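(* Let $\mathsf{k}$ be an algebraically closed field of characteristic $0$, let $D(a,\sigma)$ be a generalized Weyl algebra of rank $r$ of pure type over $\mathsf{k}$, and let $G=G(m,p,r)$, acting on $D(a,\sigma)$ by its natural action. Then $fdim\, D(a,\sigma)^G=1$.
   Context: Generalized Weyl algebras (GWA). For a commutative $\mathsf{k}$-algebra $D_1$, an automorphism $\sigma$ of $D_1$ and $a\in D_1$, the rank $1$ GWA $D_1(a,\sigma)$ is generated by $D_1,X,Y$ with relations $Xd=\sigma(d)X$, $Yd=\sigma^{-1}(d)Y$ ($d\in D_1$), $YX=a$, $XY=\sigma(a)$. It is of simple classical type if $D_1=\mathsf{k}[h]$, $\sigma(h)=h-1$, and there are no irreducible polynomial $p\in\mathsf{k}[h]$ and integer $i\ge 1$ such that both $p$ and $\sigma^i(p)$ divide $a$. It is of simple quantum type if $D_1=\mathsf{k}[h^{\pm1}]$, $\sigma(h)=\lambda h$ with $\lambda\in\mathsf{k}\setminus\{0,1\}$ not a root of unity, $a\in\mathsf{k}[h]$, and there are no irreducible polynomial $p\in\mathsf{k}[h]$ and integer $i\ge1$ such that both $p$ and $\sigma^i(p)$ divide $a$ in $\mathsf{k}[h]$. A GWA $D(a,\sigma)$ of rank $r$ of pure type is a tensor product over $\mathsf{k}$ of $r$ rank $1$ GWAs that are either all of simple classical type or all of simple quantum type; the generators of the $i$-th factor are denoted $h_i,X_i,Y_i$, so that $D=\mathsf{k}[h_1,\dots,h_r]$ or $D=\mathsf{k}[h_1^{\pm1},\dots,h_r^{\pm1}]$. The group $G(m,p,r)$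 (with $p\mid m$): let $G_m\subset\mathsf{k}^*$ be the group of $m$-th roots of unity, $A(m,p,r)=\{(g_1,\dots,g_r)\in G_m^r: (\prod g_i)^{m/p}=1\}$, and $G(m,p,r)=A(m,p,r)\rtimes S_r$. The natural action of $G(m,p,r)$ on a GWA of rank $r$ of pure type: $\xi=((g_1,\dots,g_r),\pi)$ acts by $\xi(h_i)=h_{\pi(i)}$, $\xi(X_i)=g_iX_{\pi(i)}$, $\xi(Y_i)=g_i^{-1}Y_{\pi(i)}$. $D(a,\sigma)^G$ denotes the subalgebra of $G$-invariants. Filter dimension. Let $R$ be a finitely generated infinite-dimensional $\mathsf{k}$-algebra with generators $a_1,\dots,a_s$; put $R_0=\mathsf{k}$, $R_1=\mathrm{span}\langle 1,a_1,\dots,a_s\rangle$, $R_i=R_1^i$. Let $M$ be a finitely generated left $R$-module with finite-dimensional generating subspace $M_0$, and $M_i=R_iM_0$. The return function is $f(i)=\min\{j\in\mathbb{N}\cup\{\infty\}: R_jM'\supseteq M_0$ for every finite-dimensional subspace $M'\subseteq M_i$ that generates $M$ as an $R$-module$\}$ (equal to $\infty$ if no finite $j$ works). For $f:\mathbb{N}\to\mathbb{N}\cup\{\infty\}$ put $\Gamma(f)=\inf\{r\in\mathbb{R}: f(i)\le i^r \text{ for all sufficiently large } i\}$. The filter dimension of $M$ is $\Gamma(f)$ (independent of the choice of generators and of $M_0$). For an algebra $B$, $fdim(B)$ is the filter dimension of $B$ as a left $B\otimes_{\mathsf{k}}B^{op}$-module. *)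

theory Defs
  imports
    "HOL-Algebra.Algebra"
    "HOL-Algebra.Group_Action"
    "HOL-Algebra.Product_Groups"
    "HOL-Algebra.Elementary_Groups"
    "HOL-Algebra.Algebraic_Closure_Type"
    "HOL-Library.Poly_Mapping"
    "HOL-Library.Extended_Real"
    "HOL-Computational_Algebra.Computational_Algebra"
begin

section \<open>Algebras over a field\<close>

text \<open>
  The ground field is a type \<open>'k\<close>; a \<open>'k\<close>-algebra is a (not necessarily commutative)
  unital ring record of HOL-Algebra carrying a scalar multiplication. (The locale
  \<open>algebra\<close> of HOL-Algebra covers only commutative algebras.)
\<close>

definition k_algebra :: "('k::field, 'a) module \<Rightarrow> bool" where
  "k_algebra A \<longleftrightarrow> ring A \<and> module (ring_of_type_algebra :: 'k ring) A \<and>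
     (\<forall>c. \<forall>x\<in>carrier A. \<forall>y\<in>carrier A.
        (c \<odot>\<^bsub>A\<^esub> x) \<otimes>\<^bsub>A\<^esub> y = c \<odot>\<^bsub>A\<^esub> (x \<otimes>\<^bsub>A\<^esub> y) \<and>
        x \<otimes>\<^bsub>A\<^esub> (c \<odot>\<^bsub>A\<^esub> y) = c \<odot>\<^bsub>A\<^esub> (x \<otimes>\<^bsub>A\<^esub> y))"

definition alg_hom :: "('k, 'a) module \<Rightarrow> ('k, 'b) module \<Rightarrow> ('a \<Rightarrow> 'b) set" where
  "alg_hom A B = {f \<in> ring_hom A B. \<forall>c. \<forall>x\<in>carrier A. f (c \<odot>\<^bsub>A\<^esub> x) = c \<odot>\<^bsub>B\<^esub> f x}"

definition alg_iso :: "('k, 'a) module \<Rightarrow> ('k, 'b) module \<Rightarrow> ('a \<Rightarrow> 'b) set" where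
  "alg_iso A B = {f \<in> alg_hom A B. bij_betw f (carrier A) (carrier B)}"

definition opposite_alg :: "('k, 'a) module \<Rightarrow> ('k, 'a) module" where
  "opposite_alg A = A\<lparr>monoid.mult := (\<lambda>x y. y \<otimes>\<^bsub>A\<^esub> x)\<rparr>"

definition quotient_alg :: "('k, 'a) module \<Rightarrow> 'a set \<Rightarrow> ('k, 'a set) module" where
  "quotient_alg A I =
     ring.extend (A Quot I) (module.fields (\<lambda>c C. \<Union>x\<in>C. I +>\<^bsub>A\<^esub> (c \<odot>\<^bsub>A\<^esub> x)))"

text \<open>The monoid algebra \<open>k[M]\<close>; \<open>basis s\<close> is the basis vector belonging to \<open>s \<in> M\<close>.\<close>

definition basis :: "'m \<Rightarrow> ('m \<Rightarrow>\<^sub>0 'k::zero_neq_one)" where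
  "basis s = Poly_Mapping.single s 1"

definition monoid_alg :: "('m, 'c) monoid_scheme \<Rightarrow> ('k::field, 'm \<Rightarrow>\<^sub>0 'k) module" where
  "monoid_alg M =
    \<lparr>carrier = {f. Poly_Mapping.keys f \<subseteq> carrier M},
     monoid.mult = (\<lambda>f g. \<Sum>s\<in>Poly_Mapping.keys f. \<Sum>t\<in>Poly_Mapping.keys g.
       Poly_Mapping.single (s \<otimes>\<^bsub>M\<^esub> t) (Poly_Mapping.lookup f s * Poly_Mapping.lookup g t)),
     one = basis \<one>\<^bsub>M\<^esub>,
     ring.zero = 0,
     add = (+),
     module.smult = (\<lambda>c f. Poly_Mapping.map (\<lambda>x. c * x) f)\<rparr>"

text \<open>
  The ideal of \<open>k[M]\<close> generated by all \<open>u - v\<close>, where \<open>(u, v)\<close> ranges over a set of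
  relations \<open>u = v\<close>, the quotient by it, and the class of an element in that quotient.
\<close>

definition relation_ideal ::
  "('m, 'c) monoid_scheme \<Rightarrow> (('m \<Rightarrow>\<^sub>0 'k::field) \<times> ('m \<Rightarrow>\<^sub>0 'k)) set \<Rightarrow> ('m \<Rightarrow>\<^sub>0 'k) set" where
  "relation_ideal M rels = Idl\<^bsub>monoid_alg M\<^esub> {u - v | u v. (u, v) \<in> rels}"

definition presented_alg ::
  "('m, 'c) monoid_scheme \<Rightarrow> (('m \<Rightarrow>\<^sub>0 'k::field) \<times> ('m \<Rightarrow>\<^sub>0 'k)) set
     \<Rightarrow> ('k, ('m \<Rightarrow>\<^sub>0 'k) set) module" where
  "presented_alg M rels = quotient_alg (monoid_alg M) (relation_ideal M rels)"

definition presented_class ::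
  "('m, 'c) monoid_scheme \<Rightarrow> (('m \<Rightarrow>\<^sub>0 'k::field) \<times> ('m \<Rightarrow>\<^sub>0 'k)) set
     \<Rightarrow> ('m \<Rightarrow>\<^sub>0 'k) \<Rightarrow> ('m \<Rightarrow>\<^sub>0 'k) set" where
  "presented_class M rels f = relation_ideal M rels +>\<^bsub>monoid_alg M\<^esub> f"

text \<open>The monoid algebra of the free monoid on \<open>S\<close> is the free algebra on \<open>S\<close>.\<close>

definition free_monoid :: "'g set \<Rightarrow> 'g list monoid" where
  "free_monoid S = \<lparr>carrier = lists S, monoid.mult = (@), one = []\<rparr>"


section \<open>Tensor products of algebras\<close>

text \<open>
  The tensor product is the free vector space on the product set modulo the multilinearity
  relations. The product set is a monoid under componentwise multiplication, so the free
  vector space is a monoid algebra; the span of the multilinearity relations is closed under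
  multiplication by basis vectors, hence coincides with the ideal they generate, and the
  quotient carries the usual multiplication of the tensor product of algebras.
\<close>

definition tensor_relations ::
  "('k::field, 'a) module \<Rightarrow> ('k, 'b) module
     \<Rightarrow> (('a \<times> 'b \<Rightarrow>\<^sub>0 'k) \<times> ('a \<times> 'b \<Rightarrow>\<^sub>0 'k)) set" where
  "tensor_relations A B =
     {(basis (x \<oplus>\<^bsub>A\<^esub> x', y), basis (x, y) + basis (x', y)) | x x' y.
        x \<in> carrier A \<and> x' \<in> carrier A \<and> y \<in> carrier B} \<union>
     {(basis (x, y \<oplus>\<^bsub>B\<^esub> y'), basis (x, y) + basis (x, y')) | x y y'.
        x \<in> carrier A \<and> y \<in> carrier B \<and> y' \<in> carrier B} \<union>
     {(basis (c \<odot>\<^bsub>A\<^esub> x, y), Poly_Mapping.single (x, y) c) | c x y.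
        x \<in> carrier A \<and> y \<in> carrier B} \<union>
     {(basis (x, c \<odot>\<^bsub>B\<^esub> y), Poly_Mapping.single (x, y) c) | c x y.
        x \<in> carrier A \<and> y \<in> carrier B}"

definition tensor_alg ::
  "('k::field, 'a) module \<Rightarrow> ('k, 'b) module \<Rightarrow> ('k, ('a \<times> 'b \<Rightarrow>\<^sub>0 'k) set) module" where
  "tensor_alg A B = presented_alg (A \<times>\<times> B) (tensor_relations A B)"

definition big_tensor_relations ::
  "'i set \<Rightarrow> ('i \<Rightarrow> ('k::field, 'b) module)
     \<Rightarrow> ((('i \<Rightarrow> 'b) \<Rightarrow>\<^sub>0 'k) \<times> (('i \<Rightarrow> 'b) \<Rightarrow>\<^sub>0 'k)) set" where
  "big_tensor_relations I A =
     {(basis (s(i := x \<oplus>\<^bsub>A i\<^esub> y)), basis (s(i := x)) + basis (s(i := y))) | s i x y.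
        s \<in> (\<Pi>\<^sub>E i\<in>I. carrier (A i)) \<and> i \<in> I \<and> x \<in> carrier (A i) \<and> y \<in> carrier (A i)} \<union>
     {(basis (s(i := c \<odot>\<^bsub>A i\<^esub> x)), Poly_Mapping.single (s(i := x)) c) | s i c x.
        s \<in> (\<Pi>\<^sub>E i\<in>I. carrier (A i)) \<and> i \<in> I \<and> x \<in> carrier (A i)}"

definition big_tensor ::
  "'i set \<Rightarrow> ('i \<Rightarrow> ('k::field, 'b) module) \<Rightarrow> ('k, (('i \<Rightarrow> 'b) \<Rightarrow>\<^sub>0 'k) set) module" where
  "big_tensor I A = presented_alg (product_group I A) (big_tensor_relations I A)"

text \<open>The canonical map of the \<open>i\<close>-th factor, \<open>x \<mapsto> 1 \<otimes> \<dots> \<otimes> x \<otimes> \<dots> \<otimes> 1\<close>.\<close>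

definition tensor_incl ::
  "'i set \<Rightarrow> ('i \<Rightarrow> ('k::field, 'b) module) \<Rightarrow> 'i \<Rightarrow> 'b \<Rightarrow> (('i \<Rightarrow> 'b) \<Rightarrow>\<^sub>0 'k) set" where
  "tensor_incl I A i x =
     presented_class (product_group I A) (big_tensor_relations I A)
       (basis (\<lambda>j\<in>I. if j = i then x else \<one>\<^bsub>A j\<^esub>))"


section \<open>Generalized Weyl algebras\<close>

datatype 'd gwa_generator = Coef 'd | GenX | GenY

definition gwa_monoid :: "('k, 'd) module \<Rightarrow> 'd gwa_generator list monoid" where
  "gwa_monoid D = free_monoid (Coef ` carrier D \<union> {GenX, GenY})"

text \<open>
  The first four sets of relations say that \<open>Coef\<close> is a homomorphism of unital
  \<open>k\<close>-algebras from \<open>D\<close>.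
\<close>

definition gwa_relations ::
  "('k::field, 'd) module \<Rightarrow> ('d \<Rightarrow> 'd) \<Rightarrow> 'd
     \<Rightarrow> (('d gwa_generator list \<Rightarrow>\<^sub>0 'k) \<times> ('d gwa_generator list \<Rightarrow>\<^sub>0 'k)) set" where
  "gwa_relations D \<sigma> a =
     {(basis [Coef (d \<oplus>\<^bsub>D\<^esub> e)], basis [Coef d] + basis [Coef e]) | d e.
        d \<in> carrier D \<and> e \<in> carrier D} \<union>
     {(basis [Coef (c \<odot>\<^bsub>D\<^esub> d)], Poly_Mapping.single [Coef d] c) | c d. d \<in> carrier D} \<union>
     {(basis [Coef (d \<otimes>\<^bsub>D\<^esub> e)], basis [Coef d, Coef e]) | d e.
        d \<in> carrier D \<and> e \<in> carrier D} \<union>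
     {(basis [Coef \<one>\<^bsub>D\<^esub>], basis [])} \<union>
     {(basis [GenX, Coef d], basis [Coef (\<sigma> d), GenX]) | d. d \<in> carrier D} \<union>
     {(basis [GenY, Coef d], basis [Coef (inv_into (carrier D) \<sigma> d), GenY]) | d.
        d \<in> carrier D} \<union>
     {(basis [GenY, GenX], basis [Coef a]), (basis [GenX, GenY], basis [Coef (\<sigma> a)])}"

definition gwa :: "('k::field, 'd) module \<Rightarrow> ('d \<Rightarrow> 'd) \<Rightarrow> 'd
     \<Rightarrow> ('k, ('d gwa_generator list \<Rightarrow>\<^sub>0 'k) set) module" where
  "gwa D \<sigma> a = presented_alg (gwa_monoid D) (gwa_relations D \<sigma> a)"

definition gwa_gen :: "('k::field, 'd) module \<Rightarrow> ('d \<Rightarrow> 'd) \<Rightarrow> 'd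
     \<Rightarrow> 'd gwa_generator \<Rightarrow> ('d gwa_generator list \<Rightarrow>\<^sub>0 'k) set" where
  "gwa_gen D \<sigma> a g = presented_class (gwa_monoid D) (gwa_relations D \<sigma> a) (basis [g])"

text \<open>
  \<open>A\<close> is (isomorphic to) the rank 1 GWA \<open>D(a, \<sigma>)\<close>, the elements \<open>h\<close>, \<open>x\<close>, \<open>y\<close> of \<open>A\<close> being
  the images of the distinguished element \<open>h\<^sub>0\<close> of \<open>D\<close> and of the two further generators.
\<close>

definition is_gwa :: "('k::field, 'd) module \<Rightarrow> ('d \<Rightarrow> 'd) \<Rightarrow> 'd \<Rightarrow> 'd
     \<Rightarrow> ('k, 'b) module \<Rightarrow> 'b \<Rightarrow> 'b \<Rightarrow> 'b \<Rightarrow> bool" where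
  "is_gwa D \<sigma> a h\<^sub>0 A h x y \<longleftrightarrow> k_algebra A \<and>
     (\<exists>f\<in>alg_iso (gwa D \<sigma> a) A.
        h = f (gwa_gen D \<sigma> a (Coef h\<^sub>0)) \<and>
        x = f (gwa_gen D \<sigma> a GenX) \<and>
        y = f (gwa_gen D \<sigma> a GenY))"

definition polynomial_alg :: "('k::field, 'k poly) module" where
  "polynomial_alg =
     ring.extend (ring_of_type_algebra :: 'k poly ring) (module.fields Polynomial.smult)"

definition laurent_alg :: "('k::field, int \<Rightarrow>\<^sub>0 'k) module" where
  "laurent_alg = monoid_alg integer_group"

definition poly_to_laurent :: "'k::field poly \<Rightarrow> (int \<Rightarrow>\<^sub>0 'k)" where
  "poly_to_laurent q =
     (\<Sum>i\<le>Polynomial.degree q. Poly_Mapping.single (int i) (Polynomial.coeff q i))"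

definition shift_aut :: "'k::field poly \<Rightarrow> 'k poly" where
  "shift_aut q = pcompose q [:-1, 1:]"

definition scale_aut :: "'k::field \<Rightarrow> 'k poly \<Rightarrow> 'k poly" where
  "scale_aut l q = pcompose q [:0, l:]"

definition scale_aut_laurent :: "'k::field \<Rightarrow> (int \<Rightarrow>\<^sub>0 'k) \<Rightarrow> (int \<Rightarrow>\<^sub>0 'k)" where
  "scale_aut_laurent l f = Poly_Mapping.mapp (\<lambda>n c. l powi n * c) f"

definition simple_condition :: "('k::field poly \<Rightarrow> 'k poly) \<Rightarrow> 'k poly \<Rightarrow> bool" where
  "simple_condition \<sigma> a \<longleftrightarrow>
     \<not> (\<exists>q i. Factorial_Ring.irreducible q \<and> i \<ge> 1 \<and> q dvd a \<and> (\<sigma> ^^ i) q dvd a)"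

definition simple_classical_gwa :: "('k::field, 'b) module \<Rightarrow> 'b \<Rightarrow> 'b \<Rightarrow> 'b \<Rightarrow> bool" where
  "simple_classical_gwa A h x y \<longleftrightarrow>
     (\<exists>a. simple_condition shift_aut a \<and>
        is_gwa polynomial_alg shift_aut a [:0, 1:] A h x y)"

definition simple_quantum_gwa :: "('k::field, 'b) module \<Rightarrow> 'b \<Rightarrow> 'b \<Rightarrow> 'b \<Rightarrow> bool" where
  "simple_quantum_gwa A h x y \<longleftrightarrow>
     (\<exists>l a. l \<notin> {0, 1} \<and> (\<forall>n\<ge>1. l ^ n \<noteq> 1) \<and> simple_condition (scale_aut l) a \<and>
        is_gwa laurent_alg (scale_aut_laurent l) (poly_to_laurent a) (basis 1) A h x y)"


section \<open>The group G(m,p,r), its natural action, invariants\<close>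

text \<open>
  The multiplication on \<open>A(m,p,r) \<times> S\<^sub>r\<close> is the one for which
  \<open>(g, \<pi>) X\<^sub>i = g\<^sub>i X\<^sub>\<pi>\<^sub>(\<^sub>i\<^sub>)\<close> defines a left action:
  \<open>(g, \<pi>) ((g', \<pi>') X\<^sub>i) = g'\<^sub>i g\<^sub>\<pi>\<^sub>'\<^sub>(\<^sub>i\<^sub>) X\<^sub>\<pi>\<^sub>(\<^sub>\<pi>\<^sub>'\<^sub>(\<^sub>i\<^sub>)\<^sub>)\<close>.
\<close>

definition roots_of_unity :: "nat \<Rightarrow> 'k::field set" where
  "roots_of_unity m = {z. z ^ m = 1}"

definition A_mpr :: "nat \<Rightarrow> nat \<Rightarrow> nat \<Rightarrow> (nat \<Rightarrow> 'k::field) set" where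
  "A_mpr m p r = {g \<in> {..<r} \<rightarrow>\<^sub>E roots_of_unity m. (\<Prod>i<r. g i) ^ (m div p) = 1}"

definition G_mpr :: "nat \<Rightarrow> nat \<Rightarrow> nat \<Rightarrow> ((nat \<Rightarrow> 'k::field) \<times> (nat \<Rightarrow> nat)) monoid" where
  "G_mpr m p r =
    \<lparr>carrier = A_mpr m p r \<times> {\<pi>. \<pi> permutes {..<r}},
     monoid.mult = (\<lambda>(g, \<pi>) (g', \<pi>'). (\<lambda>i\<in>{..<r}. g' i * g (\<pi>' i), \<pi> \<circ> \<pi>')),
     one = (\<lambda>i\<in>{..<r}. 1, id)\<rparr>"

definition natural_action ::
  "nat \<Rightarrow> nat \<Rightarrow> nat \<Rightarrow> ('k::field, 'a) module \<Rightarrow> (nat \<Rightarrow> 'a) \<Rightarrow> (nat \<Rightarrow> 'a) \<Rightarrow> (nat \<Rightarrow> 'a)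
     \<Rightarrow> ((nat \<Rightarrow> 'k) \<times> (nat \<Rightarrow> nat) \<Rightarrow> 'a \<Rightarrow> 'a) \<Rightarrow> bool" where
  "natural_action m p r D h x y \<rho> \<longleftrightarrow>
     group_action (G_mpr m p r :: ((nat \<Rightarrow> 'k) \<times> (nat \<Rightarrow> nat)) monoid) (carrier D) \<rho> \<and>
     (\<forall>(g, \<pi>)\<in>carrier (G_mpr m p r).
        \<rho> (g, \<pi>) \<in> alg_hom D D \<and>
        (\<forall>i<r. \<rho> (g, \<pi>) (h i) = h (\<pi> i) \<and>
               \<rho> (g, \<pi>) (x i) = g i \<odot>\<^bsub>D\<^esub> x (\<pi> i) \<and>
               \<rho> (g, \<pi>) (y i) = inverse (g i) \<odot>\<^bsub>D\<^esub> y (\<pi> i)))"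

definition invariant_alg ::
  "('k, 'a) module \<Rightarrow> ('g, 'c) monoid_scheme \<Rightarrow> ('g \<Rightarrow> 'a \<Rightarrow> 'a) \<Rightarrow> ('k, 'a) module" where
  "invariant_alg D G \<rho> =
     D\<lparr>carrier := {x. \<forall>\<xi>\<in>carrier G. x \<in> invariants (carrier D) \<rho> \<xi>}\<rparr>"


section \<open>Filter dimension\<close>

definition k_subspace :: "('k::field, 'v) module \<Rightarrow> 'v set \<Rightarrow> bool" where
  "k_subspace V W \<longleftrightarrow> W \<subseteq> carrier V \<and> \<zero>\<^bsub>V\<^esub> \<in> W \<and>
     (\<forall>x\<in>W. \<forall>y\<in>W. x \<oplus>\<^bsub>V\<^esub> y \<in> W) \<and> (\<forall>c. \<forall>x\<in>W. c \<odot>\<^bsub>V\<^esub> x \<in> W)"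

definition k_span :: "('k::field, 'v) module \<Rightarrow> 'v set \<Rightarrow> 'v set" where
  "k_span V S = \<Inter>{W. k_subspace V W \<and> S \<subseteq> W}"

definition fin_dim_subspace :: "('k::field, 'v) module \<Rightarrow> 'v set \<Rightarrow> bool" where
  "fin_dim_subspace V W \<longleftrightarrow> (\<exists>S. finite S \<and> S \<subseteq> carrier V \<and> W = k_span V S)"

definition generates_alg :: "('k::field, 'a) module \<Rightarrow> 'a set \<Rightarrow> bool" where
  "generates_alg R S \<longleftrightarrow> S \<subseteq> carrier R \<and>
     (\<forall>T. subring T R \<and> k_subspace R T \<and> S \<subseteq> T \<longrightarrow> T = carrier R)"

definition fin_gen_alg :: "('k::field, 'a) module \<Rightarrow> bool" where
  "fin_gen_alg R \<longleftrightarrow> (\<exists>S. finite S \<and> generates_alg R S)"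

text \<open>The standard filtration \<open>R\<^sub>0 = k\<close>, \<open>R\<^sub>i\<^sub>+\<^sub>1 = R\<^sub>i R\<^sub>1\<close> with \<open>R\<^sub>1\<close> the span of \<open>S \<union> {1}\<close>.\<close>

fun std_filtration :: "('k::field, 'a) module \<Rightarrow> 'a set \<Rightarrow> nat \<Rightarrow> 'a set" where
  "std_filtration R S 0 = k_span R {\<one>\<^bsub>R\<^esub>}"
| "std_filtration R S (Suc i) =
     k_span R {u \<otimes>\<^bsub>R\<^esub> v | u v. u \<in> std_filtration R S i \<and> v \<in> k_span R (insert \<one>\<^bsub>R\<^esub> S)}"

text \<open>
  A left module over a \<open>k\<close>-algebra \<open>R\<close> is a record \<open>M\<close> whose scalar multiplication is the
  action of \<open>R\<close>; only its carrier, zero, addition and scalar multiplication are used. Its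
  \<open>k\<close>-vector space structure comes from \<open>k \<rightarrow> R\<close>, \<open>c \<mapsto> c 1\<close>.
\<close>

definition restrict_to_k :: "('k::field, 'a) module \<Rightarrow> ('a, 'm) module \<Rightarrow> ('k, 'm) module" where
  "restrict_to_k R M =
     ring.extend (ring.truncate M) (module.fields (\<lambda>c x. (c \<odot>\<^bsub>R\<^esub> \<one>\<^bsub>R\<^esub>) \<odot>\<^bsub>M\<^esub> x))"

definition act_span ::
  "('k::field, 'a) module \<Rightarrow> ('a, 'm) module \<Rightarrow> 'a set \<Rightarrow> 'm set \<Rightarrow> 'm set" where
  "act_span R M U W = k_span (restrict_to_k R M) {u \<odot>\<^bsub>M\<^esub> x | u x. u \<in> U \<and> x \<in> W}"

definition fin_dim_generating :: "('k::field, 'a) module \<Rightarrow> ('a, 'm) module \<Rightarrow> 'm set \<Rightarrow> bool" where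
  "fin_dim_generating R M W \<longleftrightarrow>
     fin_dim_subspace (restrict_to_k R M) W \<and> act_span R M (carrier R) W = carrier M"

definition return_function ::
  "('k::field, 'a) module \<Rightarrow> 'a set \<Rightarrow> ('a, 'm) module \<Rightarrow> 'm set \<Rightarrow> nat \<Rightarrow> enat" where
  "return_function R S M M\<^sub>0 i =
     (INF j\<in>{j. \<forall>M'. fin_dim_generating R M M' \<and>
                      M' \<subseteq> act_span R M (std_filtration R S i) M\<^sub>0 \<longrightarrow>
                      M\<^sub>0 \<subseteq> act_span R M (std_filtration R S j) M'}. enat j)"

definition growth :: "(nat \<Rightarrow> enat) \<Rightarrow> ereal" where
  "growth f = Inf {ereal s | s :: real.
     \<forall>\<^sub>F i in sequentially. ereal_of_enat (f i) \<le> ereal (real i powr s)}"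

text \<open>
  The common value of \<open>growth\<close> over all choices of generators of \<open>R\<close> and of a
  finite-dimensional generating subspace of \<open>M\<close>. It is meaningful only if \<open>R\<close> and \<open>M\<close> are
  finitely generated (otherwise there is no such choice) and \<open>R\<close> is
  infinite-dimensional.
\<close>

definition filter_dim :: "('k::field, 'a) module \<Rightarrow> ('a, 'm) module \<Rightarrow> ereal" where
  "filter_dim R M =
     (THE d. \<forall>S M\<^sub>0. finite S \<and> generates_alg R S \<and> fin_dim_generating R M M\<^sub>0 \<longrightarrow>
                growth (return_function R S M M\<^sub>0) = d)"

definition enveloping_alg ::
  "('k::field, 'b) module \<Rightarrow> ('k, ('b \<times> 'b \<Rightarrow>\<^sub>0 'k) set) module" where
  "enveloping_alg B = tensor_alg B (opposite_alg B)"

text \<open>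
  The regular bimodule \<open>B\<close>, with \<open>b \<otimes> c\<close> acting as \<open>x \<mapsto> b x c\<close>. An element of the
  enveloping algebra is a class \<open>t\<close> of representatives
  \<open>\<Sum> f(b, c) (b, c)\<close>, all of which yield the same element of \<open>B\<close>.
\<close>

definition regular_bimodule ::
  "('k::field, 'b) module \<Rightarrow> (('b \<times> 'b \<Rightarrow>\<^sub>0 'k) set, 'b) module" where
  "regular_bimodule B = ring.extend (ring.truncate B) (module.fields (\<lambda>t x.
     the_elem ((\<lambda>f. \<Oplus>\<^bsub>B\<^esub>bc\<in>Poly_Mapping.keys f.
       Poly_Mapping.lookup f bc \<odot>\<^bsub>B\<^esub> (fst bc \<otimes>\<^bsub>B\<^esub> x \<otimes>\<^bsub>B\<^esub> snd bc)) ` t)))"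

definition fdim :: "('k::field, 'b) module \<Rightarrow> ereal" where
  "fdim B = filter_dim (enveloping_alg B) (regular_bimodule B)"

end

(*
  Let D be the tensor product, B its invariant subalgebra, and D_n the standard filtration of D
  for the obvious generators. Everything follows from two facts.

  (1) There is a constant c such that for 0 /= u in D_n some operator w |-> sum a w g(b) with a, b of degree
  at most c (n + 1) maps u to 1 for g = 1 and to 0 for every other g in G. With u = 1 this is a dual basis
  argument, which shows that B and its enveloping algebra are finitely generated; for u in B, taking
  traces gives 1 as a combination of Tr(a) u Tr(b), so that the return function grows at most linearly.

  (2) There are nonzero F in B of degree O(n) for which 1 is not in the span of D_n F D, which gives
  the lower bound. One takes the trace of a polynomial in h_1 that vanishes on a box of size n.

  A rank one factor acts on functions on the integers, h by a multiplication, X by the shift and Y by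
  the inverse shift followed by a multiplication, and elements of D are described by matrix
  coefficients. For (1), differences of the left and right multiplications by h_i first remove all
  components of g with a nontrivial permutation and all nondiagonal coefficients; those of X_i with
  suitable scalars remove the diagonal g /= 1 and then flatten the remaining coefficient to a power product
  of the X_i; simplicity of the factors, as a Bezout identity of bounded degree, lowers its exponents.
*)
theory Submission imports Defs begin

section \<open>Algebras and spans\<close>

text \<open>The obstacle is that one operator, with coefficients independent of g, must act on all
  twisted components at once: a step may destroy anything at g /= 1 but must keep the component at 1
  nonzero. Hence the coefficients are kept in spaces \<open>W N\<close> of (Laurent) polynomial
  functions on the integers. A nonzero member has infinitely many nonzero values, so the finitely
  many zeros of a factor such as \<open>a\<close> can be avoided, and f(b - 1) = \<zeta> l^\<kappa>
  f(b) with a root of unity \<zeta> /= 1 has no nonzero solution. Linearity in n comes from a fixed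
  number of stages, each using a number of multiplications affine in the current bounds; in the last
  stage it is essential that the Bezout degrees do not depend on the exponent being lowered. The
  lower bound rests on locality: an element of D_n moves lattice points by at most n, so a function
  vanishing on a box of that size produces no value at its centre. Traces cost only the factor |G|,
  invertible in characteristic 0. Finite generation and infinite dimension of the enveloping
  algebra, which give the filter dimension its meaning, come from the same two facts.\<close>

locale k_alg = ring A for A :: "('k::field, 'a) module" (structure) +
  assumes smult_closed [simp, intro]: "x \<in> carrier A \<Longrightarrow> c \<odot> x \<in> carrier A"
    and smult_l_distr: "x \<in> carrier A \<Longrightarrow> (c + d) \<odot> x = c \<odot> x \<oplus> d \<odot> x"
    and smult_r_distr:
      "\<lbrakk>x \<in> carrier A; y \<in> carrier A\<rbrakk> \<Longrightarrow> c \<odot> (x \<oplus> y) = c \<odot> x \<oplus> c \<odot> y"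
    and smult_smult: "x \<in> carrier A \<Longrightarrow> c \<odot> (d \<odot> x) = (c * d) \<odot> x"
    and smult_one [simp]: "x \<in> carrier A \<Longrightarrow> 1 \<odot> x = x"
    and smult_mult_l: "\<lbrakk>x \<in> carrier A; y \<in> carrier A\<rbrakk> \<Longrightarrow> (c \<odot> x) \<otimes> y = c \<odot> (x \<otimes> y)"
    and smult_mult_r: "\<lbrakk>x \<in> carrier A; y \<in> carrier A\<rbrakk> \<Longrightarrow> x \<otimes> (c \<odot> y) = c \<odot> (x \<otimes> y)"

text \<open>Unfolds the module axioms over \<open>ring_of_type_algebra\<close>, so that scalars
  range over the whole type and carry no membership premises.\<close>

lemma k_algebra_iff: "k_algebra (A :: ('k::field, 'a) module) \<longleftrightarrow> k_alg A"
proof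
  let ?K = "ring_of_type_algebra :: 'k ring"
  have K: "carrier ?K = UNIV" "\<And>x y. x \<oplus>\<^bsub>?K\<^esub> y = x + y" "\<And>x y. x \<otimes>\<^bsub>?K\<^esub> y = x * y"
    "\<one>\<^bsub>?K\<^esub> = 1"
    by (simp_all add: ring_of_type_algebra_def)
  {
    assume A: "k_algebra A"
    then interpret ring A by (simp add: k_algebra_def)
    have M: "module ?K A" using A by (simp add: k_algebra_def)
    show "k_alg A"
    proof
      fix c d x y assume "x \<in> carrier A" "y \<in> carrier A"
      with A show "(c \<odot>\<^bsub>A\<^esub> x) \<otimes>\<^bsub>A\<^esub> y = c \<odot>\<^bsub>A\<^esub> (x \<otimes>\<^bsub>A\<^esub> y)"
        "x \<otimes>\<^bsub>A\<^esub> (c \<odot>\<^bsub>A\<^esub> y) = c \<odot>\<^bsub>A\<^esub> (x \<otimes>\<^bsub>A\<^esub> y)"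
        by (simp_all add: k_algebra_def)
    qed (use module.smult_closed[OF M] module.smult_l_distr[OF M] module.smult_r_distr[OF M]
        module.smult_assoc1[OF M] module.smult_one[OF M] in \<open>simp_all add: K\<close>)
  next
    assume "k_alg A"
    then interpret k_alg A .
    show "k_algebra A"
      unfolding k_algebra_def
      by (intro conjI ring_axioms moduleI cring_from_type_algebra abelian_group_axioms)
        (simp_all add: K smult_l_distr smult_r_distr smult_smult smult_mult_l smult_mult_r)
  }
qed

context k_alg begin

lemma smult_zero [simp]: "c \<odot> \<zero> = \<zero>"
  using smult_r_distr[of \<zero> \<zero> c] by (metis add.l_cancel_one smult_closed zero_closed l_zero)

lemma zero_smult [simp]: assumes "x \<in> carrier A" shows "0 \<odot> x = \<zero>"
  using smult_l_distr[OF assms, of 0 0] assms by (metis add.l_cancel_one smult_closed add_0)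

text \<open>Subspaces are only required to be closed under sums and scalars; closure under negation
  comes from the scalar -1 through this identity.\<close>

lemma uminus_smult: assumes "x \<in> carrier A" shows "\<ominus> x = (- 1) \<odot> x"
proof -
  have "x \<oplus> (- 1) \<odot> x = \<zero>"
    using smult_l_distr[OF assms, of 1 "- 1"] assms by simp
  then show ?thesis using assms by (metis minus_equality smult_closed a_comm)
qed

lemma k_subspace_carrier: "k_subspace A (carrier A)"
  by (auto simp: k_subspace_def)

end

lemma k_subspace_subset: "k_subspace V W \<Longrightarrow> W \<subseteq> carrier V"
  by (simp add: k_subspace_def)

lemma k_span_incl: "S \<subseteq> k_span V S"
  by (auto simp: k_span_def)

lemma k_span_base: "x \<in> S \<Longrightarrow> x \<in> k_span V S"
  by (rule subsetD[OF k_span_incl])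

lemma k_span_minimal: "k_subspace V W \<Longrightarrow> S \<subseteq> W \<Longrightarrow> k_span V S \<subseteq> W"
  by (auto simp: k_span_def)

lemma k_span_mono: "S \<subseteq> T \<Longrightarrow> k_span V S \<subseteq> k_span V T"
  by (auto simp: k_span_def)

lemma k_span_mono_mem: "x \<in> k_span V S \<Longrightarrow> S \<subseteq> T \<Longrightarrow> x \<in> k_span V T"
  by (rule subsetD[OF k_span_mono])

context k_alg begin

lemma k_span_subspace: "S \<subseteq> carrier A \<Longrightarrow> k_subspace A (k_span A S)"
  using k_subspace_carrier unfolding k_span_def k_subspace_def by blast

lemma k_span_closed: "S \<subseteq> carrier A \<Longrightarrow> k_span A S \<subseteq> carrier A"
  by (rule k_subspace_subset[OF k_span_subspace])

lemma k_span_zero: "S \<subseteq> carrier A \<Longrightarrow> \<zero> \<in> k_span A S"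
  using k_span_subspace[of S] by (simp add: k_subspace_def)

lemma k_span_add: "S \<subseteq> carrier A \<Longrightarrow> x \<in> k_span A S \<Longrightarrow> y \<in> k_span A S \<Longrightarrow> x \<oplus> y \<in> k_span A S"
  using k_span_subspace[of S] by (simp add: k_subspace_def)

lemma k_span_smult: "S \<subseteq> carrier A \<Longrightarrow> x \<in> k_span A S \<Longrightarrow> c \<odot> x \<in> k_span A S"
  using k_span_subspace[of S] by (simp add: k_subspace_def)

lemma k_span_induct [consumes 2, case_names zero base add smult]:
  assumes "x \<in> k_span A S" "S \<subseteq> carrier A"
    and "P \<zero>" "\<And>x. x \<in> S \<Longrightarrow> P x"
    and "\<And>x y. x \<in> carrier A \<Longrightarrow> y \<in> carrier A \<Longrightarrow> P x \<Longrightarrow> P y \<Longrightarrow> P (x \<oplus> y)"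
    and "\<And>c x. x \<in> carrier A \<Longrightarrow> P x \<Longrightarrow> P (c \<odot> x)"
  shows "P x"
proof -
  have "k_subspace A {x \<in> carrier A. P x}"
    using assms by (auto simp: k_subspace_def)
  moreover have "S \<subseteq> {x \<in> carrier A. P x}" using assms by auto
  ultimately show ?thesis using k_span_minimal[of A "{x \<in> carrier A. P x}" S] assms(1) by blast
qed

text \<open>The target \<open>V\<close> is any record with a subspace \<open>W\<close>, not
  necessarily an algebra, and \<open>f\<close> is linear only on the carrier. Traces, actions of the
  enveloping algebra and single slots of a multilinear map are all handled by it.\<close>

lemma k_span_map:
  assumes "x \<in> k_span A S" "S \<subseteq> carrier A" and W: "k_subspace V W"
    and base: "\<And>x. x \<in> S \<Longrightarrow> f x \<in> W" and zero: "f \<zero> = \<zero>\<^bsub>V\<^esub>"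
    and add: "\<And>x y. x \<in> carrier A \<Longrightarrow> y \<in> carrier A \<Longrightarrow> f (x \<oplus> y) = f x \<oplus>\<^bsub>V\<^esub> f y"
    and smult: "\<And>c x. x \<in> carrier A \<Longrightarrow> f (c \<odot> x) = c \<odot>\<^bsub>V\<^esub> f x"
  shows "f x \<in> W"
  using assms(1,2)
proof (induction rule: k_span_induct)
  case zero
  then show ?case using W by (simp add: assms k_subspace_def)
next
  case (base x)
  then show ?case by (rule assms)
next
  case (add x y)
  then show ?case using W by (simp add: assms k_subspace_def)
next
  case (smult c x)
  then show ?case using W by (simp add: assms k_subspace_def)
qed

lemma k_span_mult_l:
  assumes "x \<in> k_span A S" "S \<subseteq> carrier A" "a \<in> carrier A" "k_subspace A W"
    "\<And>x. x \<in> S \<Longrightarrow> a \<otimes> x \<in> W"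
  shows "a \<otimes> x \<in> W"
  by (rule k_span_map[OF assms(1,2,4), where f = "\<lambda>x. a \<otimes> x"])
    (use assms in \<open>auto simp: r_distr smult_mult_r\<close>)

lemma k_span_mult_r:
  assumes "x \<in> k_span A S" "S \<subseteq> carrier A" "a \<in> carrier A" "k_subspace A W"
    "\<And>x. x \<in> S \<Longrightarrow> x \<otimes> a \<in> W"
  shows "x \<otimes> a \<in> W"
  by (rule k_span_map[OF assms(1,2,4), where f = "\<lambda>x. x \<otimes> a"])
    (use assms in \<open>auto simp: l_distr smult_mult_l\<close>)

end

section \<open>Monoid algebras and presented algebras\<close>

lemma poly_mapping_sum_single:
  "finite A \<Longrightarrow> Poly_Mapping.keys f \<subseteq> A \<Longrightarrow>
     f = (\<Sum>s\<in>A. Poly_Mapping.single s (Poly_Mapping.lookup f s))"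
  by (rule poly_mapping_eqI)
    (auto simp: lookup_sum lookup_single when_def in_keys_iff subset_iff)

lemma keys_add_subset:
  "Poly_Mapping.keys f \<subseteq> S \<Longrightarrow> Poly_Mapping.keys g \<subseteq> S \<Longrightarrow> Poly_Mapping.keys (f + g) \<subseteq> S"
  by (rule order_trans[OF keys_add]) simp

text \<open>Supports are carried along because the monoid laws hold only on the carrier; a single
  term comes with an arbitrary coefficient, so no scaling case arises.\<close>

lemma poly_mapping_single_induct [consumes 1, case_names single zero add]:
  fixes f :: "'m \<Rightarrow>\<^sub>0 'k::comm_monoid_add"
  assumes "Poly_Mapping.keys f \<subseteq> S"
    and "\<And>s c. s \<in> S \<Longrightarrow> P (Poly_Mapping.single s c)"
    and "P 0" "\<And>f g. Poly_Mapping.keys f \<subseteq> S \<Longrightarrow> Poly_Mapping.keys g \<subseteq> S \<Longrightarrow> P f \<Longrightarrow> P g \<Longrightarrow> P (f + g)"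
  shows "P f"
proof -
  have "P (\<Sum>s\<in>A. Poly_Mapping.single s (Poly_Mapping.lookup f s)) \<and>
      Poly_Mapping.keys (\<Sum>s\<in>A. Poly_Mapping.single s (Poly_Mapping.lookup f s)) \<subseteq> S"
    if "finite A" "A \<subseteq> S" for A
    using that
  proof (induction A)
    case (insert a A)
    let ?g = "\<Sum>s\<in>A. Poly_Mapping.single s (Poly_Mapping.lookup f s)"
    let ?h = "Poly_Mapping.single a (Poly_Mapping.lookup f a)"
    have h: "Poly_Mapping.keys ?h \<subseteq> S" "P ?h" using insert assms(2) by auto
    have g: "Poly_Mapping.keys ?g \<subseteq> S" "P ?g" using insert by auto
    have "P (?h + ?g)" by (rule assms(4)) (use h g in auto)
    moreover have "Poly_Mapping.keys (?h + ?g) \<subseteq> S"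
      by (rule keys_add_subset) (use h g in auto)
    ultimately show ?case using insert by simp
  qed (use assms(3) in simp_all)
  from this[OF finite_keys assms(1)] show ?thesis
    using poly_mapping_sum_single[of "Poly_Mapping.keys f" f] by auto
qed

definition lin_ext :: "('m \<Rightarrow> 'k::comm_ring_1) \<Rightarrow> ('m \<Rightarrow>\<^sub>0 'k) \<Rightarrow> 'k" where
  "lin_ext \<mu> f = (\<Sum>s\<in>Poly_Mapping.keys f. Poly_Mapping.lookup f s * \<mu> s)"

lemma lin_ext_superset:
  "finite A \<Longrightarrow> Poly_Mapping.keys f \<subseteq> A \<Longrightarrow> lin_ext \<mu> f = (\<Sum>s\<in>A. Poly_Mapping.lookup f s * \<mu> s)"
  unfolding lin_ext_def by (rule sum.mono_neutral_left) (auto simp: in_keys_iff)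

lemma lin_ext_zero [simp]: "lin_ext \<mu> 0 = 0"
  by (simp add: lin_ext_def)

lemma lin_ext_single [simp]: "lin_ext \<mu> (Poly_Mapping.single s c) = c * \<mu> s"
  by (subst lin_ext_superset[of "{s}"]) auto

lemma lin_ext_add [simp]: "lin_ext \<mu> (f + g) = lin_ext \<mu> f + lin_ext \<mu> g"
  using keys_add[of f g]
  by (simp add: lin_ext_superset[of "Poly_Mapping.keys f \<union> Poly_Mapping.keys g"]
      lookup_add sum.distrib distrib_right)

lemma lin_ext_uminus [simp]: "lin_ext \<mu> (- f) = - lin_ext \<mu> f"
  using lin_ext_add[of \<mu> f "- f"] by (simp add: eq_neg_iff_add_eq_0 add.commute)

lemma lin_ext_diff [simp]: "lin_ext \<mu> (f - g) = lin_ext \<mu> f - lin_ext \<mu> g"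
  using lin_ext_add[of \<mu> f "- g"] by simp

lemma lookup_map_scale [simp]:
  "Poly_Mapping.lookup (Poly_Mapping.map (\<lambda>x. (c::'k::field) * x) f) s = c * Poly_Mapping.lookup f s"
  by (simp add: Poly_Mapping.map.rep_eq when_def)

lemma keys_map_scale: "Poly_Mapping.keys (Poly_Mapping.map (\<lambda>x. (c::'k::field) * x) f) \<subseteq> Poly_Mapping.keys f"
  by (auto simp: in_keys_iff)

lemma map_scale_add: "Poly_Mapping.map (\<lambda>x. (c::'k::field) * x) (f + g) =
    Poly_Mapping.map (\<lambda>x. c * x) f + Poly_Mapping.map (\<lambda>x. c * x) g"
  by (rule poly_mapping_eqI) (simp add: lookup_add distrib_left)

lemma map_scale_sum: "Poly_Mapping.map (\<lambda>x. (c::'k::field) * x) (sum f I) =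
    (\<Sum>i\<in>I. Poly_Mapping.map (\<lambda>x. c * x) (f i))"
  by (rule poly_mapping_eqI) (simp add: lookup_sum sum_distrib_left)

lemma lin_ext_scale [simp]: "lin_ext \<mu> (Poly_Mapping.map (\<lambda>x. c * x) f) = (c::'k::field) * lin_ext \<mu> f"
  using keys_map_scale[of c f]
  by (simp add: lin_ext_superset[of "Poly_Mapping.keys f"] sum_distrib_left mult.assoc)

lemma monoid_alg_simps:
  "carrier (monoid_alg M) = {f. Poly_Mapping.keys f \<subseteq> carrier M}"
  "\<one>\<^bsub>monoid_alg M\<^esub> = basis \<one>\<^bsub>M\<^esub>" "\<zero>\<^bsub>monoid_alg M\<^esub> = 0"
  "f \<oplus>\<^bsub>monoid_alg M\<^esub> g = f + g"
  "c \<odot>\<^bsub>monoid_alg M\<^esub> f = Poly_Mapping.map (\<lambda>x. c * x) f"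
  by (simp_all add: monoid_alg_def)

text \<open>Index sets larger than the supports let the products of f, g and f + g be written over
  the same sets, where distributivity is plain manipulation of sums.\<close>

lemma monoid_alg_mult:
  "finite S \<Longrightarrow> finite T \<Longrightarrow> Poly_Mapping.keys f \<subseteq> S \<Longrightarrow> Poly_Mapping.keys g \<subseteq> T \<Longrightarrow>
   f \<otimes>\<^bsub>monoid_alg M\<^esub> g = (\<Sum>s\<in>S. \<Sum>t\<in>T.
       Poly_Mapping.single (s \<otimes>\<^bsub>M\<^esub> t) (Poly_Mapping.lookup f s * Poly_Mapping.lookup g t))"
  unfolding monoid_alg_def
  apply simp
  apply (rule sum.mono_neutral_cong_left)
     apply (auto simp: in_keys_iff intro!: sum.neutral sum.mono_neutral_left)
  done

lemma monoid_alg_mult_single [simp]: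
  "Poly_Mapping.single s c \<otimes>\<^bsub>monoid_alg M\<^esub> Poly_Mapping.single t d =
     Poly_Mapping.single (s \<otimes>\<^bsub>M\<^esub> t) (c * d)"
  by (subst monoid_alg_mult[of "{s}" "{t}"]) auto

lemma monoid_alg_mult_basis [simp]:
  "basis s \<otimes>\<^bsub>monoid_alg M\<^esub> basis t = basis (s \<otimes>\<^bsub>M\<^esub> t)"
  by (simp add: basis_def)

lemma monoid_alg_mult_zero [simp]:
  "0 \<otimes>\<^bsub>monoid_alg M\<^esub> f = 0" "f \<otimes>\<^bsub>monoid_alg M\<^esub> 0 = 0"
  by (simp_all add: monoid_alg_def)

lemma monoid_alg_distrib:
  "(f + g) \<otimes>\<^bsub>monoid_alg M\<^esub> h = f \<otimes>\<^bsub>monoid_alg M\<^esub> h + g \<otimes>\<^bsub>monoid_alg M\<^esub> h"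
  "h \<otimes>\<^bsub>monoid_alg M\<^esub> (f + g) = h \<otimes>\<^bsub>monoid_alg M\<^esub> f + h \<otimes>\<^bsub>monoid_alg M\<^esub> g"
proof -
  let ?F = "Poly_Mapping.keys f \<union> Poly_Mapping.keys g"
  have F: "finite ?F" "finite (Poly_Mapping.keys h)" by auto
  show "(f + g) \<otimes>\<^bsub>monoid_alg M\<^esub> h = f \<otimes>\<^bsub>monoid_alg M\<^esub> h + g \<otimes>\<^bsub>monoid_alg M\<^esub> h"
    using keys_add[of f g]
    by (simp add: monoid_alg_mult[OF F] lookup_add distrib_right single_add sum.distrib)
  show "h \<otimes>\<^bsub>monoid_alg M\<^esub> (f + g) = h \<otimes>\<^bsub>monoid_alg M\<^esub> f + h \<otimes>\<^bsub>monoid_alg M\<^esub> g"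
    using keys_add[of f g]
    by (simp add: monoid_alg_mult[OF F(2,1)] lookup_add distrib_left single_add sum.distrib)
qed

lemma monoid_alg_scale_mult:
  "Poly_Mapping.map (\<lambda>x. c * x) f \<otimes>\<^bsub>monoid_alg M\<^esub> g =
     Poly_Mapping.map (\<lambda>x. (c::'k::field) * x) (f \<otimes>\<^bsub>monoid_alg M\<^esub> g)"
  "f \<otimes>\<^bsub>monoid_alg M\<^esub> Poly_Mapping.map (\<lambda>x. c * x) g =
     Poly_Mapping.map (\<lambda>x. (c::'k::field) * x) (f \<otimes>\<^bsub>monoid_alg M\<^esub> g)"
  using keys_map_scale[of c f] keys_map_scale[of c g]
  by (simp_all add: monoid_alg_mult[of "Poly_Mapping.keys f" "Poly_Mapping.keys g"]
      map_scale_sum mult.assoc mult.left_commute)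

context monoid begin

lemma monoid_alg_mult_closed:
  assumes "Poly_Mapping.keys f \<subseteq> carrier G" "Poly_Mapping.keys g \<subseteq> carrier G"
  shows "Poly_Mapping.keys (f \<otimes>\<^bsub>monoid_alg G\<^esub> g) \<subseteq> carrier G"
  using assms(1)
proof (induction f rule: poly_mapping_single_induct)
  case (single s c)
  show ?case using assms(2)
    by (induction g rule: poly_mapping_single_induct)
      (simp_all add: single monoid_alg_distrib keys_add_subset)
qed (simp_all add: monoid_alg_distrib keys_add_subset)

lemma monoid_alg_assoc:
  assumes "Poly_Mapping.keys f \<subseteq> carrier G" "Poly_Mapping.keys g \<subseteq> carrier G"
    "Poly_Mapping.keys h \<subseteq> carrier G"
  shows "(f \<otimes>\<^bsub>monoid_alg G\<^esub> g) \<otimes>\<^bsub>monoid_alg G\<^esub> h = f \<otimes>\<^bsub>monoid_alg G\<^esub> (g \<otimes>\<^bsub>monoid_alg G\<^esub> h)"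
  using assms(1)
proof (induction f rule: poly_mapping_single_induct)
  case (single s a)
  show ?case using assms(2)
  proof (induction g rule: poly_mapping_single_induct)
    case (single t b)
    show ?case using assms(3)
      by (induction h rule: poly_mapping_single_induct)
        (simp_all add: single \<open>s \<in> carrier G\<close> monoid_alg_distrib m_assoc mult.assoc)
  qed (simp_all add: monoid_alg_distrib)
qed (simp_all add: monoid_alg_distrib)

lemma monoid_alg_k_alg: "k_alg (monoid_alg G :: ('k::field, 'a \<Rightarrow>\<^sub>0 'k) module)"
proof -
  let ?A = "monoid_alg G :: ('k::field, 'a \<Rightarrow>\<^sub>0 'k) module"
  have one_l: "\<one>\<^bsub>?A\<^esub> \<otimes>\<^bsub>?A\<^esub> f = f" if "Poly_Mapping.keys f \<subseteq> carrier G" for f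
    using that
  proof (induction f rule: poly_mapping_single_induct)
    case (single s c)
    then show ?case by (simp add: monoid_alg_simps(2) basis_def)
  qed (simp_all add: monoid_alg_distrib)
  have one_r: "f \<otimes>\<^bsub>?A\<^esub> \<one>\<^bsub>?A\<^esub> = f" if "Poly_Mapping.keys f \<subseteq> carrier G" for f
    using that
  proof (induction f rule: poly_mapping_single_induct)
    case (single s c)
    then show ?case by (simp add: monoid_alg_simps(2) basis_def)
  qed (simp_all add: monoid_alg_distrib)
  have "abelian_group ?A"
  proof (rule abelian_groupI)
    fix x assume "x \<in> carrier ?A"
    then show "\<exists>y\<in>carrier ?A. y \<oplus>\<^bsub>?A\<^esub> x = \<zero>\<^bsub>?A\<^esub>"
      by (intro bexI[of _ "- x"]) (auto simp: monoid_alg_simps)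
  qed (simp_all add: monoid_alg_simps add.assoc add.commute keys_add_subset)
  moreover have "Group.monoid ?A"
    by (rule monoidI)
      (simp_all add: one_l one_r monoid_alg_mult_closed monoid_alg_assoc monoid_alg_simps(1),
        simp add: monoid_alg_simps basis_def)
  ultimately have "ring ?A"
    by (intro ringI) (simp_all add: monoid_alg_simps monoid_alg_distrib)
  then interpret ring ?A .
  show ?thesis
  proof
    fix c :: 'k and x assume "x \<in> carrier ?A"
    then show "c \<odot>\<^bsub>?A\<^esub> x \<in> carrier ?A"
      using keys_map_scale[of c x] by (auto simp: monoid_alg_simps)
  next
    fix c d :: 'k and x assume "x \<in> carrier ?A"
    show "(c + d) \<odot>\<^bsub>?A\<^esub> x = c \<odot>\<^bsub>?A\<^esub> x \<oplus>\<^bsub>?A\<^esub> d \<odot>\<^bsub>?A\<^esub> x"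
      "c \<odot>\<^bsub>?A\<^esub> (d \<odot>\<^bsub>?A\<^esub> x) = (c * d) \<odot>\<^bsub>?A\<^esub> x" "1 \<odot>\<^bsub>?A\<^esub> x = x"
      unfolding monoid_alg_simps
      by (rule poly_mapping_eqI, simp add: lookup_add distrib_right)+
  qed (simp_all add: monoid_alg_simps(4,5) map_scale_add monoid_alg_scale_mult)
qed

end

text \<open>Every axiom is an identity or the existence of a negative, and passes along a surjection
  that respects the operations; \<open>Q\<close> itself need only be a record.\<close>

lemma k_alg_surj_image:
  assumes A: "k_alg A" and carrier: "carrier Q = f ` carrier A"
    and add: "\<And>x y. x \<in> carrier A \<Longrightarrow> y \<in> carrier A \<Longrightarrow> f (x \<oplus>\<^bsub>A\<^esub> y) = f x \<oplus>\<^bsub>Q\<^esub> f y"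
    and mult: "\<And>x y. x \<in> carrier A \<Longrightarrow> y \<in> carrier A \<Longrightarrow> f (x \<otimes>\<^bsub>A\<^esub> y) = f x \<otimes>\<^bsub>Q\<^esub> f y"
    and one: "f \<one>\<^bsub>A\<^esub> = \<one>\<^bsub>Q\<^esub>" and zero: "f \<zero>\<^bsub>A\<^esub> = \<zero>\<^bsub>Q\<^esub>"
    and smult: "\<And>c x. x \<in> carrier A \<Longrightarrow> f (c \<odot>\<^bsub>A\<^esub> x) = c \<odot>\<^bsub>Q\<^esub> f x"
  shows "k_alg Q"
proof -
  interpret A: k_alg A by fact
  note simps = carrier add[symmetric] mult[symmetric] one[symmetric] zero[symmetric] smult[symmetric]
  have "abelian_group Q"
  proof (rule abelian_groupI)
    fix x assume "x \<in> carrier Q"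
    then obtain a where "a \<in> carrier A" "x = f a" using carrier by auto
    then show "\<exists>y\<in>carrier Q. y \<oplus>\<^bsub>Q\<^esub> x = \<zero>\<^bsub>Q\<^esub>"
      by (intro bexI[of _ "f (\<ominus>\<^bsub>A\<^esub> a)"]) (simp_all add: simps A.l_neg)
  qed (auto simp: simps A.a_ac)
  moreover have "Group.monoid Q"
    by (rule monoidI) (auto simp: simps A.m_assoc)
  ultimately have "ring Q"
    by (intro ringI) (auto simp: simps A.l_distr A.r_distr)
  then interpret Q: ring Q .
  show ?thesis
    by unfold_locales
      (auto simp: simps A.smult_l_distr A.smult_r_distr A.smult_smult A.smult_mult_l A.smult_mult_r)
qed

context k_alg begin

lemma quotient_alg_simps:
  "carrier (quotient_alg A I) = a_rcosets I"
  "U \<otimes>\<^bsub>quotient_alg A I\<^esub> V = rcoset_mult A I U V"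
  "\<one>\<^bsub>quotient_alg A I\<^esub> = I +> \<one>" "\<zero>\<^bsub>quotient_alg A I\<^esub> = I"
  "U \<oplus>\<^bsub>quotient_alg A I\<^esub> V = set_add A U V"
  "c \<odot>\<^bsub>quotient_alg A I\<^esub> U = (\<Union>x\<in>U. I +> (c \<odot> x))"
  by (simp_all add: quotient_alg_def ring.extend_def module.fields_def FactRing_def)

text \<open>Scalar multiplication in the quotient is a union over a coset. It is well defined
  because a ring ideal of a unital algebra is closed under scalars, c acting as multiplication by c
  1.\<close>

lemma quotient_alg_hom:
  assumes "ideal I A"
  shows "carrier (quotient_alg A I) = (+>) I ` carrier A"
    "\<And>x y. x \<in> carrier A \<Longrightarrow> y \<in> carrier A \<Longrightarrow>
       I +> (x \<oplus> y) = (I +> x) \<oplus>\<^bsub>quotient_alg A I\<^esub> (I +> y)"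
    "\<And>x y. x \<in> carrier A \<Longrightarrow> y \<in> carrier A \<Longrightarrow>
       I +> (x \<otimes> y) = (I +> x) \<otimes>\<^bsub>quotient_alg A I\<^esub> (I +> y)"
    "I +> \<one> = \<one>\<^bsub>quotient_alg A I\<^esub>" "I +> \<zero> = \<zero>\<^bsub>quotient_alg A I\<^esub>"
    "\<And>c x. x \<in> carrier A \<Longrightarrow> I +> (c \<odot> x) = c \<odot>\<^bsub>quotient_alg A I\<^esub> (I +> x)"
    "\<And>x y. x \<in> carrier A \<Longrightarrow> y \<in> carrier A \<Longrightarrow> (I +> x = I +> y) \<longleftrightarrow> x \<ominus> y \<in> I"
proof -
  interpret I: ideal I A by fact
  show "carrier (quotient_alg A I) = (+>) I ` carrier A"
    by (auto simp: quotient_alg_simps A_RCOSETS_defs a_r_coset_def)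
  show eq: "(I +> x = I +> y) \<longleftrightarrow> x \<ominus> y \<in> I" if "x \<in> carrier A" "y \<in> carrier A" for x y
    using that by (metis quotient_eq_iff_same_a_r_cos I.ideal_axioms)
  show "I +> (x \<oplus> y) = (I +> x) \<oplus>\<^bsub>quotient_alg A I\<^esub> (I +> y)"
    "I +> (x \<otimes> y) = (I +> x) \<otimes>\<^bsub>quotient_alg A I\<^esub> (I +> y)"
    if "x \<in> carrier A" "y \<in> carrier A" for x y
    using that by (simp_all add: quotient_alg_simps I.a_rcos_sum I.rcoset_mult_add)
  show "I +> \<one> = \<one>\<^bsub>quotient_alg A I\<^esub>" "I +> \<zero> = \<zero>\<^bsub>quotient_alg A I\<^esub>"
    by (simp_all add: quotient_alg_simps I.a_rcos_const)
  fix c x assume x: "x \<in> carrier A"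
  have "I +> (c \<odot> x') = I +> (c \<odot> x)" if "x' \<in> I +> x" for x'
  proof -
    have x': "x' \<in> carrier A" using I.a_elemrcos_carrier[OF x that] .
    then have "x' \<ominus> x \<in> I"
      using a_repr_independence[OF that x I.a_subgroup] eq[OF x' x] by simp
    then have "(c \<odot> \<one>) \<otimes> (x' \<ominus> x) \<in> I" by (simp add: I.I_l_closed)
    also have "(c \<odot> \<one>) \<otimes> (x' \<ominus> x) = c \<odot> x' \<ominus> c \<odot> x"
      using x x' by (simp add: smult_mult_l a_minus_def uminus_smult smult_r_distr smult_smult mult.commute)
    finally show ?thesis using x x' eq by simp
  qed
  moreover have "x \<in> I +> x" using I.a_rcos_self[OF x] .
  ultimately show "I +> (c \<odot> x) = c \<odot>\<^bsub>quotient_alg A I\<^esub> (I +> x)"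
    unfolding quotient_alg_simps by blast
qed

lemma quotient_k_alg: "ideal I A \<Longrightarrow> k_alg (quotient_alg A I)"
  by (rule k_alg_surj_image[OF k_alg_axioms, where f = "(+>) I"]) (simp_all add: quotient_alg_hom)

end

locale presentation = Group.monoid M for M :: "('m, 'c) monoid_scheme" (structure) +
  fixes rels :: "(('m \<Rightarrow>\<^sub>0 'k::field) \<times> ('m \<Rightarrow>\<^sub>0 'k)) set"
  assumes rels_closed:
    "(u, v) \<in> rels \<Longrightarrow> Poly_Mapping.keys u \<subseteq> carrier M \<and> Poly_Mapping.keys v \<subseteq> carrier M"
begin

abbreviation kM :: "('k, 'm \<Rightarrow>\<^sub>0 'k) module" where "kM \<equiv> monoid_alg M"
abbreviation P where "P \<equiv> presented_alg M rels"
abbreviation cls where "cls \<equiv> presented_class M rels"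

sublocale kM: k_alg kM by (rule monoid_alg_k_alg)

text \<open>The ideal generated by the relations, built from below as sums of terms s (u - v) t, so
  that statements about it can be proved by induction; the scalar sits in the left factor.\<close>

inductive_set rel_span :: "('m \<Rightarrow>\<^sub>0 'k) set" where
  zero: "0 \<in> rel_span"
| rel: "(u, v) \<in> rels \<Longrightarrow> s \<in> carrier M \<Longrightarrow> t \<in> carrier M \<Longrightarrow>
    Poly_Mapping.single s c \<otimes>\<^bsub>kM\<^esub> (u - v) \<otimes>\<^bsub>kM\<^esub> basis t \<in> rel_span"
| add: "f \<in> rel_span \<Longrightarrow> g \<in> rel_span \<Longrightarrow> f + g \<in> rel_span"

lemma keys_diff_subset:
  "Poly_Mapping.keys f \<subseteq> S \<Longrightarrow> Poly_Mapping.keys g \<subseteq> S \<Longrightarrow> Poly_Mapping.keys (f - g) \<subseteq> S"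
  for f g :: "'m \<Rightarrow>\<^sub>0 'k"
  using keys_diff[of f g] by blast

lemma rel_closed: "(u, v) \<in> rels \<Longrightarrow> u - v \<in> carrier kM"
  using rels_closed[of u v] by (simp add: monoid_alg_simps(1) keys_diff_subset)

lemma single_closed: "s \<in> carrier M \<Longrightarrow> Poly_Mapping.single s c \<in> carrier kM"
  by (simp add: monoid_alg_simps(1))

lemma basis_closed: "s \<in> carrier M \<Longrightarrow> basis s \<in> carrier kM"
  by (simp add: basis_def single_closed)

lemma rel_span_closed: "f \<in> rel_span \<Longrightarrow> f \<in> carrier kM"
proof (induction rule: rel_span.induct)
  case (add f g)
  then show ?case by (simp add: monoid_alg_simps(1) keys_add_subset)
qed (simp_all add: rel_closed single_closed basis_closed, simp add: monoid_alg_simps(1))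

lemma rel_span_mult_l:
  assumes "f \<in> rel_span" "Poly_Mapping.keys h \<subseteq> carrier M" shows "h \<otimes>\<^bsub>kM\<^esub> f \<in> rel_span"
  using assms(1)
proof (induction rule: rel_span.induct)
  case zero
  then show ?case by (simp add: rel_span.zero)
next
  case (rel u v s t c)
  show ?case using assms(2)
  proof (induction h rule: poly_mapping_single_induct)
    case (single s' d)
    have "Poly_Mapping.single s' d \<otimes>\<^bsub>kM\<^esub> (Poly_Mapping.single s c \<otimes>\<^bsub>kM\<^esub> (u - v) \<otimes>\<^bsub>kM\<^esub> basis t) =
        Poly_Mapping.single (s' \<otimes> s) (d * c) \<otimes>\<^bsub>kM\<^esub> (u - v) \<otimes>\<^bsub>kM\<^esub> basis t"
      using rel single
      by (simp add: kM.m_assoc[symmetric] rel_closed single_closed basis_closed)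
    then show ?case using rel single by (simp add: rel_span.rel)
  qed (simp_all add: monoid_alg_distrib rel_span.zero rel_span.add)
qed (simp add: monoid_alg_distrib rel_span.add)

lemma rel_span_mult_r:
  assumes "f \<in> rel_span" "Poly_Mapping.keys h \<subseteq> carrier M" shows "f \<otimes>\<^bsub>kM\<^esub> h \<in> rel_span"
  using assms(1)
proof (induction rule: rel_span.induct)
  case zero
  then show ?case by (simp add: rel_span.zero)
next
  case (rel u v s t c)
  show ?case using assms(2)
  proof (induction h rule: poly_mapping_single_induct)
    case (single t' d)
    have [simp]: "(d::'k) \<odot>\<^bsub>kM\<^esub> basis a = Poly_Mapping.single a d" for a d
      by (rule poly_mapping_eqI) (simp add: monoid_alg_simps basis_def lookup_single when_def)
    have "Poly_Mapping.single s c \<otimes>\<^bsub>kM\<^esub> (u - v) \<otimes>\<^bsub>kM\<^esub> basis t \<otimes>\<^bsub>kM\<^esub> Poly_Mapping.single t' d =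
        Poly_Mapping.single s c \<otimes>\<^bsub>kM\<^esub> (u - v) \<otimes>\<^bsub>kM\<^esub> (d \<odot>\<^bsub>kM\<^esub> basis (t \<otimes> t'))"
      using rel single
      by (simp add: kM.m_assoc rel_closed single_closed basis_closed) (simp add: basis_def)
    also have "\<dots> = (d \<odot>\<^bsub>kM\<^esub> Poly_Mapping.single s c) \<otimes>\<^bsub>kM\<^esub> (u - v) \<otimes>\<^bsub>kM\<^esub> basis (t \<otimes> t')"
      using rel single
      by (simp only: kM.smult_mult_l kM.smult_mult_r kM.m_closed rel_closed single_closed basis_closed m_closed)
    also have "d \<odot>\<^bsub>kM\<^esub> Poly_Mapping.single s c = Poly_Mapping.single s (d * c)"
      by (rule poly_mapping_eqI) (simp add: monoid_alg_simps lookup_single when_def)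
    finally show ?case using rel single by (simp add: rel_span.rel)
  qed (simp_all add: monoid_alg_distrib rel_span.zero rel_span.add)
qed (simp add: monoid_alg_distrib rel_span.add)

lemma rel_span_ideal: "ideal rel_span kM"
proof (rule idealI)
  show "ring kM" by (rule kM.ring_axioms)
  have inv: "\<ominus>\<^bsub>kM\<^esub> f \<in> rel_span" if "f \<in> rel_span" for f
  proof -
    have "\<ominus>\<^bsub>kM\<^esub> f = (- 1) \<odot>\<^bsub>kM\<^esub> (\<one>\<^bsub>kM\<^esub> \<otimes>\<^bsub>kM\<^esub> f)"
      using rel_span_closed[OF that] by (simp add: kM.uminus_smult)
    also have "\<dots> = ((- 1) \<odot>\<^bsub>kM\<^esub> \<one>\<^bsub>kM\<^esub>) \<otimes>\<^bsub>kM\<^esub> f"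
      using rel_span_closed[OF that] by (simp only: kM.smult_mult_l kM.one_closed)
    finally show ?thesis
      using rel_span_mult_l[OF that] kM.smult_closed[OF kM.one_closed]
      by (simp add: monoid_alg_simps(1))
  qed
  show "subgroup rel_span (add_monoid kM)"
  proof (rule subgroup.intro)
    show "inv\<^bsub>add_monoid kM\<^esub> x \<in> rel_span" if "x \<in> rel_span" for x
      using inv[OF that] by (simp add: a_inv_def)
  qed (use rel_span_closed rel_span.zero rel_span.add in \<open>auto simp: monoid_alg_simps(3,4)\<close>)
qed (simp_all add: monoid_alg_simps(1) rel_span_mult_l rel_span_mult_r)

text \<open>Identifies the intersection of all ideals containing the relations with the explicit
  sums, on which equality of classes is then decided.\<close>

lemma relation_ideal_eq: "relation_ideal M rels = rel_span"
proof
  let ?S = "{u - v |u v. (u, v) \<in> rels}"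
  have S: "?S \<subseteq> carrier kM" using rel_closed by blast
  have "?S \<subseteq> rel_span"
  proof clarify
    fix u v assume uv: "(u, v) \<in> rels"
    have "\<one>\<^bsub>kM\<^esub> \<otimes>\<^bsub>kM\<^esub> (u - v) \<otimes>\<^bsub>kM\<^esub> \<one>\<^bsub>kM\<^esub> \<in> rel_span"
      using rel_span.rel[OF uv one_closed one_closed, of 1] by (simp add: monoid_alg_simps(2) basis_def)
    then show "u - v \<in> rel_span" using rel_closed[OF uv] by simp
  qed
  then show "relation_ideal M rels \<subseteq> rel_span"
    unfolding relation_ideal_def by (intro kM.genideal_minimal rel_span_ideal)
  interpret I: ideal "relation_ideal M rels" kM
    unfolding relation_ideal_def by (rule kM.genideal_ideal[OF S])
  show "rel_span \<subseteq> relation_ideal M rels"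
  proof
    fix f assume "f \<in> rel_span"
    then show "f \<in> relation_ideal M rels"
    proof (induction rule: rel_span.induct)
      case (rel u v s t c)
      then have "u - v \<in> relation_ideal M rels"
        unfolding relation_ideal_def by (intro subsetD[OF kM.genideal_self[OF S]]) blast
      then show ?case
        using rel by (simp add: I.I_l_closed I.I_r_closed single_closed basis_closed)
    next
      case zero
      then show ?case using I.zero_closed by (simp add: monoid_alg_simps(3))
    next
      case (add f g)
      then show ?case using I.a_closed by (simp add: monoid_alg_simps(4))
    qed
  qed
qed

lemma P_k_alg: "k_alg P"
  unfolding presented_alg_def relation_ideal_eq by (rule kM.quotient_k_alg[OF rel_span_ideal])

sublocale P: k_alg P by (rule P_k_alg)

lemma cls_hom:
  "f \<in> carrier kM \<Longrightarrow> cls f \<in> carrier P"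
  "f \<in> carrier kM \<Longrightarrow> g \<in> carrier kM \<Longrightarrow> cls (f + g) = cls f \<oplus>\<^bsub>P\<^esub> cls g"
  "f \<in> carrier kM \<Longrightarrow> g \<in> carrier kM \<Longrightarrow> cls (f \<otimes>\<^bsub>kM\<^esub> g) = cls f \<otimes>\<^bsub>P\<^esub> cls g"
  "cls (basis \<one>) = \<one>\<^bsub>P\<^esub>" "cls 0 = \<zero>\<^bsub>P\<^esub>"
  "f \<in> carrier kM \<Longrightarrow> cls (c \<odot>\<^bsub>kM\<^esub> f) = c \<odot>\<^bsub>P\<^esub> cls f"
  "f \<in> carrier kM \<Longrightarrow> g \<in> carrier kM \<Longrightarrow> (cls f = cls g) \<longleftrightarrow> f - g \<in> rel_span"
proof -
  note q = kM.quotient_alg_hom[OF rel_span_ideal]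
  note defs = presented_alg_def presented_class_def relation_ideal_eq
  show "f \<in> carrier kM \<Longrightarrow> cls f \<in> carrier P"
    unfolding defs q(1) by simp
  show "f \<in> carrier kM \<Longrightarrow> g \<in> carrier kM \<Longrightarrow> cls (f + g) = cls f \<oplus>\<^bsub>P\<^esub> cls g"
    unfolding defs q(2)[symmetric] by (simp add: monoid_alg_simps(4))
  show "f \<in> carrier kM \<Longrightarrow> g \<in> carrier kM \<Longrightarrow> cls (f \<otimes>\<^bsub>kM\<^esub> g) = cls f \<otimes>\<^bsub>P\<^esub> cls g"
    unfolding defs by (rule q(3))
  show "cls (basis \<one>) = \<one>\<^bsub>P\<^esub>" "cls 0 = \<zero>\<^bsub>P\<^esub>"
    unfolding defs using q(4,5) by (simp_all add: monoid_alg_simps(2,3))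
  show "f \<in> carrier kM \<Longrightarrow> cls (c \<odot>\<^bsub>kM\<^esub> f) = c \<odot>\<^bsub>P\<^esub> cls f"
    unfolding defs by (rule q(6))
  assume fg: "f \<in> carrier kM" "g \<in> carrier kM"
  have "g + (f - g) = f" "f - g \<in> carrier kM"
    using fg by (auto simp: monoid_alg_simps(1) keys_diff_subset)
  then have "f \<ominus>\<^bsub>kM\<^esub> g = f - g"
    using fg by (metis kM.add.inv_solve_right' kM.a_comm kM.minus_eq kM.minus_closed monoid_alg_simps(4))
  then show "(cls f = cls g) \<longleftrightarrow> f - g \<in> rel_span"
    unfolding defs using q(7)[OF fg] by simp
qed

lemma carrier_P: "carrier P = cls ` carrier kM"
  using kM.quotient_alg_hom(1)[OF rel_span_ideal]
  by (simp add: presented_alg_def presented_class_def[abs_def] relation_ideal_eq)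

lemma cls_rel: "(u, v) \<in> rels \<Longrightarrow> cls u = cls v"
proof -
  assume uv: "(u, v) \<in> rels"
  have "\<one>\<^bsub>kM\<^esub> \<otimes>\<^bsub>kM\<^esub> (u - v) \<otimes>\<^bsub>kM\<^esub> \<one>\<^bsub>kM\<^esub> \<in> rel_span"
    using rel_span.rel[OF uv one_closed one_closed, of 1] by (simp add: monoid_alg_simps(2) basis_def)
  then show ?thesis
    using rel_closed[OF uv] rels_closed[OF uv]
    by (subst cls_hom(7)) (simp_all add: monoid_alg_simps(1))
qed

lemma cls_basis_mult:
  "s \<in> carrier M \<Longrightarrow> t \<in> carrier M \<Longrightarrow> cls (basis s) \<otimes>\<^bsub>P\<^esub> cls (basis t) = cls (basis (s \<otimes> t))"
  by (simp add: cls_hom(3)[symmetric] basis_closed)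

lemma scale_basis: "c \<odot>\<^bsub>kM\<^esub> basis s = Poly_Mapping.single s (c::'k)"
  by (rule poly_mapping_eqI) (simp add: monoid_alg_simps basis_def lookup_single when_def)

lemma cls_single: "s \<in> carrier M \<Longrightarrow> cls (Poly_Mapping.single s c) = c \<odot>\<^bsub>P\<^esub> cls (basis s)"
  by (simp add: cls_hom(6)[symmetric] basis_closed scale_basis)

lemma P_induct [consumes 1, case_names basis add smult]:
  assumes "U \<in> carrier P" "\<And>s. s \<in> carrier M \<Longrightarrow> Q (cls (basis s))"
    "\<And>U V. U \<in> carrier P \<Longrightarrow> V \<in> carrier P \<Longrightarrow> Q U \<Longrightarrow> Q V \<Longrightarrow> Q (U \<oplus>\<^bsub>P\<^esub> V)"
    "\<And>c U. U \<in> carrier P \<Longrightarrow> Q U \<Longrightarrow> Q (c \<odot>\<^bsub>P\<^esub> U)"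
  shows "Q U"
proof -
  from assms(1) obtain f where f: "Poly_Mapping.keys f \<subseteq> carrier M" "U = cls f"
    by (auto simp: carrier_P monoid_alg_simps(1))
  have single: "Q (cls (Poly_Mapping.single s c))" if "s \<in> carrier M" for s c
    using that assms by (simp add: cls_single cls_hom basis_closed)
  have "Q (cls f)" using f(1)
  proof (induction f rule: poly_mapping_single_induct)
    case zero
    show ?case using single[OF one_closed, of 0] by simp
  next
    case (add f g)
    then show ?case using assms(3)[of "cls f" "cls g"] cls_hom by (simp add: monoid_alg_simps(1))
  qed (rule single)
  then show ?thesis using f by simp
qed

text \<open>Universal property for linear functionals: a functional descends to the presented
  algebra once it takes equal values on the two sides of every relation placed between monomials s
  and t. All matrix coefficients below are obtained in this way.\<close>

lemma lin_ext_respects: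
  assumes rel: "\<And>u v s t. (u, v) \<in> rels \<Longrightarrow> s \<in> carrier M \<Longrightarrow> t \<in> carrier M \<Longrightarrow>
       lin_ext \<mu> (basis s \<otimes>\<^bsub>kM\<^esub> u \<otimes>\<^bsub>kM\<^esub> basis t) = lin_ext \<mu> (basis s \<otimes>\<^bsub>kM\<^esub> v \<otimes>\<^bsub>kM\<^esub> basis t)"
    and "f \<in> carrier kM" "g \<in> carrier kM" "cls f = cls g"
  shows "lin_ext \<mu> f = lin_ext \<mu> g"
proof -
  have "lin_ext \<mu> h = 0" if "h \<in> rel_span" for h
    using that
  proof (induction rule: rel_span.induct)
    case (rel u v s t c)
    have d: "a \<otimes>\<^bsub>kM\<^esub> (u - v) \<otimes>\<^bsub>kM\<^esub> b = a \<otimes>\<^bsub>kM\<^esub> u \<otimes>\<^bsub>kM\<^esub> b - a \<otimes>\<^bsub>kM\<^esub> v \<otimes>\<^bsub>kM\<^esub> b" for a b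
      by (metis monoid_alg_distrib diff_add_cancel add_diff_cancel)
    have "lin_ext \<mu> (Poly_Mapping.single s c \<otimes>\<^bsub>kM\<^esub> w \<otimes>\<^bsub>kM\<^esub> basis t) =
        c * lin_ext \<mu> (basis s \<otimes>\<^bsub>kM\<^esub> w \<otimes>\<^bsub>kM\<^esub> basis t)" for w
      unfolding scale_basis[symmetric] by (simp add: monoid_alg_simps(5) monoid_alg_scale_mult)
    then show ?case using rel(1)[THEN assms(1)] rel by (simp add: d)
  qed simp_all
  from this[of "f - g"] show ?thesis using assms(2-4) cls_hom(7)[of f g] by simp
qed

end

context presentation begin

lemma cls_self: "f \<in> carrier kM \<Longrightarrow> f \<in> cls f"
proof -
  interpret I: ideal rel_span kM by (rule rel_span_ideal)
  show "f \<in> carrier kM \<Longrightarrow> f \<in> cls f"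
    unfolding presented_class_def relation_ideal_eq by (rule I.a_rcos_self)
qed

text \<open>The regular bimodule evaluates all members of a class at once; this says that every
  member is a representative of that class.\<close>

lemma cls_mem: "f \<in> carrier kM \<Longrightarrow> g \<in> cls f \<Longrightarrow> g \<in> carrier kM \<and> cls g = cls f"
proof -
  interpret I: ideal rel_span kM by (rule rel_span_ideal)
  assume f: "f \<in> carrier kM" and g: "g \<in> cls f"
  have gI: "g \<in> rel_span +>\<^bsub>kM\<^esub> f" using g by (simp add: presented_class_def relation_ideal_eq)
  have "g \<in> carrier kM" using gI f I.a_elemrcos_carrier[OF f gI] by simp
  moreover have "rel_span +>\<^bsub>kM\<^esub> f = rel_span +>\<^bsub>kM\<^esub> g"
    using kM.a_repr_independence[OF gI f I.a_subgroup] .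
  ultimately show ?thesis by (simp add: presented_class_def relation_ideal_eq)
qed

end

section \<open>The enveloping algebra\<close>

lemma opposite_alg_simps [simp]:
  "carrier (opposite_alg A) = carrier A" "\<one>\<^bsub>opposite_alg A\<^esub> = \<one>\<^bsub>A\<^esub>"
  "x \<otimes>\<^bsub>opposite_alg A\<^esub> y = y \<otimes>\<^bsub>A\<^esub> x" "x \<oplus>\<^bsub>opposite_alg A\<^esub> y = x \<oplus>\<^bsub>A\<^esub> y"
  "c \<odot>\<^bsub>opposite_alg A\<^esub> x = c \<odot>\<^bsub>A\<^esub> x"
  by (simp_all add: opposite_alg_def)

lemma keys_basis [simp]: "Poly_Mapping.keys (basis s :: 'a \<Rightarrow>\<^sub>0 'k::field) = {s}"
  by (simp add: basis_def)

lemma (in k_alg) opposite_monoid: "Group.monoid (opposite_alg A)"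
  by (rule monoidI) (auto simp: m_assoc)

lemma tensor_presentation:
  assumes "k_alg A" "k_alg B"
  shows "presentation (A \<times>\<times> opposite_alg B) (tensor_relations A (opposite_alg B))"
proof -
  interpret A: k_alg A by fact
  interpret B: k_alg B by fact
  interpret M: Group.monoid "A \<times>\<times> opposite_alg B"
    by (rule DirProd_monoid[OF A.monoid_axioms B.opposite_monoid])
  show ?thesis
  proof
    fix u v assume "(u, v) \<in> tensor_relations A (opposite_alg B)"
    then show "Poly_Mapping.keys u \<subseteq> carrier (A \<times>\<times> opposite_alg B) \<and>
        Poly_Mapping.keys v \<subseteq> carrier (A \<times>\<times> opposite_alg B)"
      unfolding tensor_relations_def
      by (elim UnE CollectE exE conjE) (simp_all add: keys_add_subset DirProd_def)
  qed
qed

context k_alg begin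

abbreviation env where "env \<equiv> enveloping_alg A"
abbreviation bimod where "bimod \<equiv> regular_bimodule A"

definition tens :: "'a \<Rightarrow> 'a \<Rightarrow> ('a \<times> 'a \<Rightarrow>\<^sub>0 'k) set" where
  "tens b c = presented_class (A \<times>\<times> opposite_alg A) (tensor_relations A (opposite_alg A)) (basis (b, c))"

interpretation T: presentation "A \<times>\<times> opposite_alg A" "tensor_relations A (opposite_alg A)"
  by (rule tensor_presentation) (rule k_alg_axioms)+

lemma env_eq: "env = T.P"
  by (simp add: enveloping_alg_def tensor_alg_def)

lemma env_k_alg: "k_alg env"
  unfolding env_eq by (rule T.P_k_alg)

lemma carr_pair: "x \<in> carrier A \<Longrightarrow> y \<in> carrier A \<Longrightarrow> (x, y) \<in> carrier (A \<times>\<times> opposite_alg A)"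
  by (simp add: DirProd_def)

lemma tens_closed: "x \<in> carrier A \<Longrightarrow> y \<in> carrier A \<Longrightarrow> tens x y \<in> carrier env"
  unfolding tens_def env_eq by (intro T.cls_hom(1) T.basis_closed carr_pair)

lemma tens_mult:
  assumes "x \<in> carrier A" "y \<in> carrier A" "x' \<in> carrier A" "y' \<in> carrier A"
  shows "tens x y \<otimes>\<^bsub>env\<^esub> tens x' y' = tens (x \<otimes> x') (y' \<otimes> y)"
  unfolding tens_def env_eq using assms by (subst T.cls_basis_mult) (simp_all add: DirProd_def)

lemma tens_one: "tens \<one> \<one> = \<one>\<^bsub>env\<^esub>"
  unfolding tens_def env_eq using T.cls_hom(4) by simp

lemma tens_add:
  assumes "x \<in> carrier A" "y \<in> carrier A" "x' \<in> carrier A" "y' \<in> carrier A"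
  shows "tens (x \<oplus> x') y = tens x y \<oplus>\<^bsub>env\<^esub> tens x' y" "tens x (y \<oplus> y') = tens x y \<oplus>\<^bsub>env\<^esub> tens x y'"
proof -
  have "(basis (x \<oplus> x', y), basis (x, y) + basis (x', y)) \<in> tensor_relations A (opposite_alg A)"
    "(basis (x, y \<oplus> y'), basis (x, y) + basis (x, y')) \<in> tensor_relations A (opposite_alg A)"
    unfolding tensor_relations_def using assms by auto
  from this[THEN T.cls_rel] show "tens (x \<oplus> x') y = tens x y \<oplus>\<^bsub>env\<^esub> tens x' y"
    "tens x (y \<oplus> y') = tens x y \<oplus>\<^bsub>env\<^esub> tens x y'"
    using assms by (simp_all add: tens_def env_eq T.cls_hom(2) T.basis_closed carr_pair)
qed

lemma tens_smult:
  assumes "x \<in> carrier A" "y \<in> carrier A"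
  shows "tens (c \<odot> x) y = c \<odot>\<^bsub>env\<^esub> tens x y" "tens x (c \<odot> y) = c \<odot>\<^bsub>env\<^esub> tens x y"
proof -
  have "(basis (c \<odot> x, y), Poly_Mapping.single (x, y) c) \<in> tensor_relations A (opposite_alg A)"
    "(basis (x, c \<odot> y), Poly_Mapping.single (x, y) c) \<in> tensor_relations A (opposite_alg A)"
    unfolding tensor_relations_def using assms by auto
  from this[THEN T.cls_rel] show "tens (c \<odot> x) y = c \<odot>\<^bsub>env\<^esub> tens x y"
    "tens x (c \<odot> y) = c \<odot>\<^bsub>env\<^esub> tens x y"
    using assms by (simp_all add: tens_def env_eq T.cls_single carr_pair)
qed

lemma env_induct [consumes 1, case_names tens add smult]:
  assumes "u \<in> carrier env" "\<And>x y. x \<in> carrier A \<Longrightarrow> y \<in> carrier A \<Longrightarrow> Q (tens x y)"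
    "\<And>u v. u \<in> carrier env \<Longrightarrow> v \<in> carrier env \<Longrightarrow> Q u \<Longrightarrow> Q v \<Longrightarrow> Q (u \<oplus>\<^bsub>env\<^esub> v)"
    "\<And>c u. u \<in> carrier env \<Longrightarrow> Q u \<Longrightarrow> Q (c \<odot>\<^bsub>env\<^esub> u)"
  shows "Q u"
  using assms(1) unfolding env_eq
  by (induction u rule: T.P_induct)
    (use assms(2-) in \<open>auto simp: tens_def env_eq DirProd_def\<close>)

text \<open>The sum inside \<open>regular_bimodule\<close> for one representative f; its
  independence of f is what gives \<open>the_elem\<close> there a meaning.\<close>

definition bim :: "('a \<times> 'a \<Rightarrow>\<^sub>0 'k) \<Rightarrow> 'a \<Rightarrow> 'a" where
  "bim f x = (\<Oplus>bc\<in>Poly_Mapping.keys f. Poly_Mapping.lookup f bc \<odot> (fst bc \<otimes> x \<otimes> snd bc))"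

lemma bim_superset:
  assumes "finite S" "Poly_Mapping.keys f \<subseteq> S" "S \<subseteq> carrier A \<times> carrier A" "x \<in> carrier A"
  shows "bim f x = (\<Oplus>bc\<in>S. Poly_Mapping.lookup f bc \<odot> (fst bc \<otimes> x \<otimes> snd bc))"
  unfolding bim_def
  by (rule add.finprod_mono_neutral_cong_left) (use assms in \<open>auto simp: in_keys_iff subset_iff\<close>)

lemma bim_zero [simp]: "bim 0 x = \<zero>"
  by (simp add: bim_def)

lemma bim_single:
  assumes "b \<in> carrier A" "c \<in> carrier A" "x \<in> carrier A"
  shows "bim (Poly_Mapping.single (b, c) d) x = d \<odot> (b \<otimes> x \<otimes> c)"
  using assms by (subst bim_superset[of "{(b, c)}"]) auto

lemma keys_pair: "f \<in> carrier T.kM \<longleftrightarrow> Poly_Mapping.keys f \<subseteq> carrier A \<times> carrier A"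
  by (simp add: monoid_alg_simps(1) DirProd_def)

lemma bim_closed: "f \<in> carrier T.kM \<Longrightarrow> x \<in> carrier A \<Longrightarrow> bim f x \<in> carrier A"
  unfolding bim_def keys_pair by (rule finsum_closed) (auto simp: subset_iff)

lemma bim_add:
  assumes "f \<in> carrier T.kM" "g \<in> carrier T.kM" "x \<in> carrier A"
  shows "bim (f + g) x = bim f x \<oplus> bim g x"
proof -
  let ?S = "Poly_Mapping.keys f \<union> Poly_Mapping.keys g"
  have S: "finite ?S" "?S \<subseteq> carrier A \<times> carrier A" using assms by (auto simp: keys_pair)
  have c: "(\<lambda>bc. Poly_Mapping.lookup h bc \<odot> (fst bc \<otimes> x \<otimes> snd bc)) \<in> ?S \<rightarrow> carrier A" for h
    using S assms by auto
  have "bim (f + g) x = (\<Oplus>bc\<in>?S. Poly_Mapping.lookup (f + g) bc \<odot> (fst bc \<otimes> x \<otimes> snd bc))"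
    by (rule bim_superset[OF S(1) _ S(2) assms(3)]) (rule keys_add)
  also have "\<dots> = (\<Oplus>bc\<in>?S. Poly_Mapping.lookup f bc \<odot> (fst bc \<otimes> x \<otimes> snd bc) \<oplus>
      Poly_Mapping.lookup g bc \<odot> (fst bc \<otimes> x \<otimes> snd bc))"
    by (rule add.finprod_cong') (use S assms in \<open>auto simp: lookup_add smult_l_distr\<close>)
  also have "\<dots> = bim f x \<oplus> bim g x"
    using assms(3) S by (simp only: finsum_addf[OF c c] bim_superset[OF S(1) _ S(2)] Un_upper1 Un_upper2)
  finally show ?thesis .
qed

text \<open>The second tensor factor multiplies in the opposite order, which is exactly how right
  multiplications nest.\<close>

lemma bim_mult:
  assumes f: "f \<in> carrier T.kM" and g: "g \<in> carrier T.kM" and x: "x \<in> carrier A"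
  shows "bim (f \<otimes>\<^bsub>T.kM\<^esub> g) x = bim f (bim g x)"
proof -
  have lin: "bim f (y \<oplus> z) = bim f y \<oplus> bim f z" if "f \<in> carrier T.kM" "y \<in> carrier A" "z \<in> carrier A" for f y z
    using that(1)[unfolded keys_pair]
  proof (induction f rule: poly_mapping_single_induct)
    case (single s c)
    then show ?case using that(2,3)
      by (cases s) (simp add: bim_single l_distr r_distr smult_r_distr)
  next
    case (add f g)
    then show ?case using that(2,3) by (simp add: bim_add bim_closed keys_pair a_ac)
  qed simp
  show ?thesis using f[unfolded keys_pair]
  proof (induction f rule: poly_mapping_single_induct)
    case (single s c)
    show ?case using g[unfolded keys_pair]
    proof (induction g rule: poly_mapping_single_induct)
      case (single t d)
      then show ?case using \<open>s \<in> _\<close> x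
        by (cases s; cases t)
          (simp add: bim_single DirProd_def smult_mult_l smult_mult_r smult_smult m_assoc)
    next
      case zero
      then show ?case using single x by (cases s) (simp add: bim_single)
    next
      case (add f g)
      then show ?case using \<open>s \<in> _\<close> x
        by (simp add: monoid_alg_distrib bim_add bim_closed keys_pair[symmetric] lin T.single_closed
            T.kM.m_closed)
    qed
  next
    case (add f g')
    then show ?case using x g
      by (simp add: monoid_alg_distrib bim_add bim_closed keys_pair[symmetric] T.kM.m_closed)
  qed simp
qed

text \<open>By \<open>bim_mult\<close> a term s (u - v) t of the ideal acts as a composition with
  \<open>bim (u - v)\<close> in the middle, and that factor is zero because b x c is linear in b and
  in c.\<close>

lemma bim_respects:
  assumes "f \<in> carrier T.kM" "g \<in> carrier T.kM" "T.cls f = T.cls g" "x \<in> carrier A"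
  shows "bim f x = bim g x"
proof -
  have rel0: "bim (u - v) x = \<zero>"
    if uv: "(u, v) \<in> tensor_relations A (opposite_alg A)" and x: "x \<in> carrier A" for u v x
  proof -
    have c: "u \<in> carrier T.kM" "v \<in> carrier T.kM" "u - v \<in> carrier T.kM"
      using T.rels_closed[OF uv] T.rel_closed[OF uv] by (auto simp: monoid_alg_simps(1))
    have eq: "bim u x = bim v x"
      using uv x unfolding tensor_relations_def basis_def
      by (auto simp: bim_single bim_add keys_pair l_distr r_distr smult_mult_l smult_mult_r)
    have "bim v x = bim (u - v) x \<oplus> bim v x"
      using bim_add[OF c(3,2) x] eq by simp
    then show ?thesis using bim_closed[OF _ x] c by (metis add.l_cancel_one' a_comm)
  qed
  have "bim h x = \<zero>" if "h \<in> T.rel_span" "x \<in> carrier A" for h x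
    using that
  proof (induction h arbitrary: x rule: T.rel_span.induct)
    case (rel u v s t c)
    have "bim (basis t) x \<in> carrier A" using rel by (simp add: bim_closed T.basis_closed)
    then show ?case using rel
      by (simp add: bim_mult T.single_closed T.basis_closed T.rel_closed rel0 bim_closed)
        (cases s, simp add: bim_single DirProd_def)
  next
    case (add f g)
    then show ?case by (simp add: bim_add T.rel_span_closed)
  qed simp
  then have "bim (f - g) x = \<zero>" using assms T.cls_hom(7) by simp
  moreover have "f - g \<in> carrier T.kM"
    using assms T.keys_diff_subset by (simp add: monoid_alg_simps(1))
  ultimately show ?thesis using bim_add[of "f - g" g x] assms by (simp add: bim_closed)
qed

definition act :: "('a \<times> 'a \<Rightarrow>\<^sub>0 'k) set \<Rightarrow> 'a \<Rightarrow> 'a" where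
  "act u x = u \<odot>\<^bsub>bimod\<^esub> x"

lemma bimod_simps [simp]:
  "carrier bimod = carrier A" "\<zero>\<^bsub>bimod\<^esub> = \<zero>" "x \<oplus>\<^bsub>bimod\<^esub> y = x \<oplus> y" "u \<odot>\<^bsub>bimod\<^esub> x = act u x"
  by (simp_all add: regular_bimodule_def ring.defs module.defs act_def)

lemma act_cls:
  assumes "f \<in> carrier T.kM" "x \<in> carrier A"
  shows "act (T.cls f) x = bim f x"
proof -
  have "act (T.cls f) x = the_elem ((\<lambda>f. bim f x) ` T.cls f)"
    by (simp add: act_def regular_bimodule_def ring.defs module.defs bim_def)
  also have "(\<lambda>f. bim f x) ` T.cls f = {bim f x}"
    using T.cls_mem[OF assms(1)] T.cls_self[OF assms(1)] bim_respects[OF _ assms(1) _ assms(2)]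
    by blast
  finally show ?thesis by simp
qed

lemma env_rep: assumes "u \<in> carrier env" obtains f where "f \<in> carrier T.kM" "u = T.cls f"
  using assms unfolding env_eq T.carrier_P by blast

lemma act_closed: "u \<in> carrier env \<Longrightarrow> x \<in> carrier A \<Longrightarrow> act u x \<in> carrier A"
  by (metis env_rep act_cls bim_closed)

lemma act_tens:
  "b \<in> carrier A \<Longrightarrow> c \<in> carrier A \<Longrightarrow> x \<in> carrier A \<Longrightarrow> act (tens b c) x = b \<otimes> x \<otimes> c"
  unfolding tens_def by (subst act_cls) (simp_all add: T.basis_closed carr_pair, simp add: basis_def bim_single)

lemma act_add:
  assumes "u \<in> carrier env" "v \<in> carrier env" "x \<in> carrier A"
  shows "act (u \<oplus>\<^bsub>env\<^esub> v) x = act u x \<oplus> act v x"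
proof -
  obtain f g where "f \<in> carrier T.kM" "u = T.cls f" "g \<in> carrier T.kM" "v = T.cls g"
    using assms env_rep by metis
  moreover have "f + g \<in> carrier T.kM" using calculation T.kM.a_closed[of f g] by (simp add: monoid_alg_simps(4))
  ultimately show ?thesis using assms(3)
    by (simp add: env_eq T.cls_hom(2)[symmetric] act_cls bim_add)
qed

lemma act_mult:
  assumes "u \<in> carrier env" "v \<in> carrier env" "x \<in> carrier A"
  shows "act (u \<otimes>\<^bsub>env\<^esub> v) x = act u (act v x)"
proof -
  obtain f g where "f \<in> carrier T.kM" "u = T.cls f" "g \<in> carrier T.kM" "v = T.cls g"
    using assms env_rep by metis
  then show ?thesis using assms(3)
    by (simp add: env_eq T.cls_hom(3)[symmetric] act_cls bim_mult bim_closed T.kM.m_closed)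
qed

lemma act_one: "x \<in> carrier A \<Longrightarrow> act \<one>\<^bsub>env\<^esub> x = x"
  unfolding tens_one[symmetric] by (simp add: act_tens)

lemma act_smult:
  assumes "u \<in> carrier env" "x \<in> carrier A"
  shows "act (c \<odot>\<^bsub>env\<^esub> u) x = c \<odot> act u x"
proof -
  interpret E: k_alg env by (rule env_k_alg)
  have "c \<odot>\<^bsub>env\<^esub> u = tens (c \<odot> \<one>) \<one> \<otimes>\<^bsub>env\<^esub> u"
    using assms by (simp add: tens_smult tens_one E.smult_mult_l)
  then show ?thesis using assms
    by (simp add: act_mult tens_closed act_tens act_closed smult_mult_l)
qed

lemma act_linear:
  assumes "u \<in> carrier env" "x \<in> carrier A" "y \<in> carrier A"
  shows "act u (x \<oplus> y) = act u x \<oplus> act u y" "act u (c \<odot> x) = c \<odot> act u x"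
  using assms(1)
proof (induction u rule: env_induct)
  case (add u v)
  { case 1 then show ?case using add assms by (simp add: act_add act_closed a_ac)
  next case 2 then show ?case using add assms by (simp add: act_add act_closed smult_r_distr) }
next
  case (smult d u)
  { case 1 then show ?case using smult assms by (simp add: act_smult act_closed smult_r_distr)
  next case 2 then show ?case using smult assms by (simp add: act_smult act_closed smult_smult mult.commute) }
qed (use assms in \<open>simp_all add: act_tens l_distr r_distr smult_mult_l smult_mult_r\<close>)

text \<open>Scalars of the bimodule act through c 1 in the enveloping algebra, and this element acts
  on \<open>A\<close> as c. Hence spans and finite dimension may be computed in
  \<open>A\<close>.\<close>

lemma k_subspace_restrict: "k_subspace (restrict_to_k env bimod) W \<longleftrightarrow> k_subspace A W"
proof -
  interpret E: k_alg env by (rule env_k_alg)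
  have [simp]: "carrier (restrict_to_k env bimod) = carrier A" "\<zero>\<^bsub>restrict_to_k env bimod\<^esub> = \<zero>"
    "x \<oplus>\<^bsub>restrict_to_k env bimod\<^esub> y = x \<oplus> y"
    "c \<odot>\<^bsub>restrict_to_k env bimod\<^esub> x = act (c \<odot>\<^bsub>env\<^esub> \<one>\<^bsub>env\<^esub>) x" for x y c
    using bimod_simps by (simp_all add: restrict_to_k_def ring.defs module.defs)
  have "act (c \<odot>\<^bsub>env\<^esub> \<one>\<^bsub>env\<^esub>) x = c \<odot> x" if "x \<in> carrier A" for c x
    using that by (simp add: act_smult act_one)
  then show ?thesis unfolding k_subspace_def by (auto simp: subset_iff)
qed

lemma k_span_restrict: "k_span (restrict_to_k env bimod) S = k_span A S"
  by (simp add: k_span_def k_subspace_restrict)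

lemma fin_dim_restrict: "fin_dim_subspace (restrict_to_k env bimod) W \<longleftrightarrow> fin_dim_subspace A W"
proof -
  have "carrier (restrict_to_k env bimod) = carrier A"
    using bimod_simps by (simp add: restrict_to_k_def ring.defs module.defs)
  then show ?thesis by (simp add: fin_dim_subspace_def k_span_restrict)
qed

lemma act_span_eq: "act_span env bimod U W = k_span A {act u x |u x. u \<in> U \<and> x \<in> W}"
  by (simp add: act_span_def k_span_restrict)

end

section \<open>Standard filtrations\<close>

context k_alg begin

lemma filt_sets_closed:
  assumes "U \<subseteq> carrier A" "V \<subseteq> carrier A"
  shows "{u \<otimes> v |u v. u \<in> U \<and> v \<in> V} \<subseteq> carrier A"
  using assms by blast

lemma filt_closed: "S \<subseteq> carrier A \<Longrightarrow> std_filtration A S n \<subseteq> carrier A"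
proof (induction n)
  case 0
  then show ?case by (simp add: k_span_closed)
next
  case (Suc n)
  then have "k_span A (insert \<one> S) \<subseteq> carrier A" by (simp add: k_span_closed)
  with Suc show ?case by (simp only: std_filtration.simps k_span_closed filt_sets_closed)
qed

lemma filt_gens_closed:
  assumes "S \<subseteq> carrier A"
  shows "{u \<otimes> v |u v. u \<in> std_filtration A S n \<and> v \<in> k_span A (insert \<one> S)} \<subseteq> carrier A"
  by (intro filt_sets_closed filt_closed k_span_closed) (use assms in auto)

lemma filt_subspace: assumes "S \<subseteq> carrier A" shows "k_subspace A (std_filtration A S n)"
  by (cases n) (use assms in \<open>simp_all only: std_filtration.simps k_span_subspace filt_gens_closed
    empty_subsetI insert_subset one_closed simp_thms\<close>)

lemma filt_step:
  "u \<in> std_filtration A S n \<Longrightarrow> v \<in> k_span A (insert \<one> S) \<Longrightarrow> u \<otimes> v \<in> std_filtration A S (Suc n)"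
  by (simp only: std_filtration.simps) (rule k_span_base, blast)

lemma filt_gen: "u \<in> std_filtration A S n \<Longrightarrow> v \<in> insert \<one> S \<Longrightarrow> u \<otimes> v \<in> std_filtration A S (Suc n)"
  by (erule filt_step) (rule k_span_base)

lemma filt_Suc: assumes "S \<subseteq> carrier A" "u \<in> std_filtration A S n" shows "u \<in> std_filtration A S (Suc n)"
  using filt_gen[OF assms(2), of \<one>] filt_closed[OF assms(1), of n] assms(2) by auto

lemma filt_mono: assumes "S \<subseteq> carrier A" "m \<le> n" shows "std_filtration A S m \<subseteq> std_filtration A S n"
  using assms(2) by (induction n rule: dec_induct) (use filt_Suc[OF assms(1)] in blast)+

lemma filt_one: "S \<subseteq> carrier A \<Longrightarrow> \<one> \<in> std_filtration A S n"
  using filt_mono[of S 0 n] k_span_base[of \<one> "{\<one>}" A] by auto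

lemma filt_zero: "S \<subseteq> carrier A \<Longrightarrow> \<zero> \<in> std_filtration A S n"
  using filt_subspace[of S n] by (simp add: k_subspace_def)

lemma filt_add: "S \<subseteq> carrier A \<Longrightarrow> u \<in> std_filtration A S n \<Longrightarrow> v \<in> std_filtration A S n \<Longrightarrow>
    u \<oplus> v \<in> std_filtration A S n"
  using filt_subspace[of S n] by (simp add: k_subspace_def)

lemma filt_smult: "S \<subseteq> carrier A \<Longrightarrow> u \<in> std_filtration A S n \<Longrightarrow> c \<odot> u \<in> std_filtration A S n"
  using filt_subspace[of S n] by (simp add: k_subspace_def)

lemma filt_base: assumes "S \<subseteq> carrier A" "v \<in> insert \<one> S" shows "v \<in> std_filtration A S 1"
proof -
  have "v \<in> carrier A" using assms by auto
  then show ?thesis using filt_gen[OF filt_one[OF assms(1), of 0] assms(2)] by simp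
qed

text \<open>The filtration is spanned by products u v with v in a span; an inner induction on that
  span reduces the step to a single generator or 1 on the right. The predicate depends on the
  degree, so that estimates can grow with it.\<close>

lemma filt_induct [consumes 2, case_names zero one gen add smult]:
  assumes "u \<in> std_filtration A S n" "S \<subseteq> carrier A"
    "\<And>n. Q n \<zero>" "\<And>n. Q n \<one>"
    "\<And>n u v. u \<in> std_filtration A S n \<Longrightarrow> Q n u \<Longrightarrow> v \<in> insert \<one> S \<Longrightarrow> Q (Suc n) (u \<otimes> v)"
    "\<And>n u v. u \<in> carrier A \<Longrightarrow> v \<in> carrier A \<Longrightarrow> Q n u \<Longrightarrow> Q n v \<Longrightarrow> Q n (u \<oplus> v)"
    "\<And>n c u. u \<in> carrier A \<Longrightarrow> Q n u \<Longrightarrow> Q n (c \<odot> u)"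
  shows "Q n u"
  using assms(1)
proof (induction n arbitrary: u)
  case 0
  then have "u \<in> k_span A {\<one>}" "{\<one>} \<subseteq> carrier A" by simp_all
  then show ?case
    by (induction rule: k_span_induct) (use assms in auto)
next
  case (Suc n)
  have S1: "insert \<one> S \<subseteq> carrier A" using assms(2) by auto
  have "u \<in> k_span A {u \<otimes> v |u v. u \<in> std_filtration A S n \<and> v \<in> k_span A (insert \<one> S)}"
    using Suc.prems by simp
  then show ?case using filt_gens_closed[OF assms(2)]
  proof (induction rule: k_span_induct)
    case (base x)
    then obtain u v where uv: "u \<in> std_filtration A S n" "v \<in> k_span A (insert \<one> S)" "x = u \<otimes> v"
      by blast
    have u: "u \<in> carrier A" using uv filt_closed[OF assms(2)] by blast
    have "Q (Suc n) (u \<otimes> v)" using uv(2) S1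
    proof (induction rule: k_span_induct)
      case zero
      then show ?case using u assms(3) by simp
    next
      case (base v)
      then show ?case using Suc.IH uv assms(5) by simp
    next
      case (add v w)
      then show ?case using u assms(6)[of "u \<otimes> v" "u \<otimes> w"] by (simp add: r_distr)
    next
      case (smult c v)
      then show ?case using u assms(7)[of "u \<otimes> v"] by (simp add: smult_mult_r)
    qed
    then show ?case using uv by simp
  qed (use assms in auto)
qed

lemma filt_mult:
  assumes S: "S \<subseteq> carrier A" and "u \<in> std_filtration A S m" "v \<in> std_filtration A S n"
  shows "u \<otimes> v \<in> std_filtration A S (m + n)"
  using assms(3,1)
proof (induction rule: filt_induct)
  have u: "u \<in> carrier A" using assms filt_closed by blast
  {
    case (zero n) then show ?case using u S by (simp add: filt_zero)
  next
    case (one n) then show ?case using u filt_mono[OF S, of m "m + n"] assms(2) by auto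
  next
    case (gen n w v)
    moreover have "w \<in> carrier A" "v \<in> carrier A" using gen S filt_closed by auto
    ultimately show ?case using filt_gen[of "u \<otimes> w" S "m + n" v] u by (simp add: m_assoc)
  next
    case (add n w v) then show ?case using u S by (simp add: r_distr filt_add)
  next
    case (smult n c w) then show ?case using u S by (simp add: smult_mult_r filt_smult)
  }
qed

text \<open>The union of the filtration is a subalgebra containing \<open>S\<close>, hence
  everything; \<open>generates_alg\<close> itself speaks only of subalgebras and knows no
  degrees.\<close>

lemma filt_generates:
  assumes "generates_alg A S" "x \<in> carrier A"
  obtains n where "x \<in> std_filtration A S n"
proof -
  have S: "S \<subseteq> carrier A" using assms(1) by (simp add: generates_alg_def)
  let ?T = "\<Union>n. std_filtration A S n"
  have add: "u \<oplus> v \<in> ?T" if "u \<in> ?T" "v \<in> ?T" for u v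
  proof -
    from that obtain m n where "u \<in> std_filtration A S m" "v \<in> std_filtration A S n" by blast
    then have "u \<in> std_filtration A S (max m n)" "v \<in> std_filtration A S (max m n)"
      using filt_mono[OF S] by (meson max.cobounded1 max.cobounded2 subsetD)+
    then show ?thesis using filt_add[OF S] by blast
  qed
  have mult: "u \<otimes> v \<in> ?T" if "u \<in> ?T" "v \<in> ?T" for u v
    using that filt_mult[OF S] by blast
  have smult: "c \<odot> u \<in> ?T" if "u \<in> ?T" for u c
    using that filt_smult[OF S] by blast
  have one: "\<one> \<in> ?T" and zero: "\<zero> \<in> ?T" and closed: "?T \<subseteq> carrier A"
    using filt_one[OF S] filt_zero[OF S] filt_closed[OF S] by blast+
  have uminus: "\<ominus> u \<in> ?T" if "u \<in> ?T" for u
    using smult[OF that, of "- 1"] that closed by (simp only: uminus_smult[OF subsetD[OF closed that]])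
  have "subring ?T A"
    by (rule subringI) (fact closed one uminus mult add)+
  moreover have "k_subspace A ?T"
    unfolding k_subspace_def by (intro conjI ballI allI closed zero add smult)
  moreover have "S \<subseteq> ?T" using filt_base[OF S] by (intro subsetI UN_I[of 1]) simp_all
  ultimately have "?T = carrier A" using assms(1) by (simp add: generates_alg_def)
  then show ?thesis using assms(2) that by blast
qed

lemma generates_algI:
  assumes S: "S \<subseteq> carrier A" and ex: "\<And>x. x \<in> carrier A \<Longrightarrow> \<exists>n. x \<in> std_filtration A S n"
  shows "generates_alg A S"
  unfolding generates_alg_def
proof (intro conjI allI impI S)
  fix T assume T: "subring T A \<and> k_subspace A T \<and> S \<subseteq> T"
  then interpret T: subring T A by simp
  have sub: "\<zero> \<in> T" "\<And>x y. x \<in> T \<Longrightarrow> y \<in> T \<Longrightarrow> x \<oplus> y \<in> T" "\<And>c x. x \<in> T \<Longrightarrow> c \<odot> x \<in> T" "T \<subseteq> carrier A"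
    using T unfolding k_subspace_def by simp_all
  have "x \<in> T" if "x \<in> std_filtration A S n" for x n
    using that S
  proof (induction rule: filt_induct)
    case (gen n u v)
    then have "v \<in> T" using T T.one_closed by auto
    then show ?case using gen by simp
  qed (simp_all add: sub)
  then show "T = carrier A" using ex sub(4) by (meson subsetI subset_antisym)
qed

lemma filt_finite:
  assumes "\<And>x. x \<in> carrier A \<Longrightarrow> \<exists>n. x \<in> std_filtration A S n" "S \<subseteq> carrier A"
    and "finite U" "U \<subseteq> carrier A"
  obtains n where "U \<subseteq> std_filtration A S n"
  using assms(3,4)
proof (induction U arbitrary: thesis)
  case (insert x U)
  obtain m where m: "U \<subseteq> std_filtration A S m" using insert by blast
  obtain n where n: "x \<in> std_filtration A S n" using assms(1)[of x] insert by blast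
  have "insert x U \<subseteq> std_filtration A S (max m n)"
    using m n filt_mono[OF assms(2), of m "max m n"] filt_mono[OF assms(2), of n "max m n"] by auto
  then show ?case using insert by blast
qed simp

end

section \<open>Growth of return functions\<close>

lemma eventually_powr_ge:
  assumes "0 < (a::real)" shows "\<forall>\<^sub>F i in sequentially. c \<le> real i powr a"
proof -
  obtain N where N: "max c 1 powr (1 / a) \<le> real N" using real_arch_simple by blast
  have "c \<le> real i powr a" if "N \<le> i" for i
  proof -
    have "max c 1 = (max c 1 powr (1 / a)) powr a" using assms by (simp add: powr_powr)
    also have "\<dots> \<le> real i powr a" using assms N that by (intro powr_mono2) auto
    finally show ?thesis by simp
  qed
  then show ?thesis by (auto simp: eventually_sequentially)
qed

text \<open>Linear bounds on both sides force the exponent 1. The lower bound is stated as a bound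
  on i by any finite j above f i, the form in which an obstruction at level i delivers it.\<close>

lemma growth_eq_one:
  assumes upper: "\<And>i. f i \<le> enat (c * (i + 1))"
    and lower: "\<And>i j. f i \<le> enat j \<Longrightarrow> i \<le> d * (j + 1)"
  shows "growth f = 1"
proof (rule antisym)
  let ?S = "{ereal s |s. \<forall>\<^sub>F i in sequentially. ereal_of_enat (f i) \<le> ereal (real i powr s)}"
  have mem: "ereal s \<in> ?S" if "1 < s" for s
  proof -
    have "\<forall>\<^sub>F i in sequentially. 2 * real c \<le> real i powr (s - 1)"
      using that by (intro eventually_powr_ge) simp
    moreover have "\<forall>\<^sub>F i in sequentially. (1::nat) \<le> i" by (rule eventually_ge_at_top)
    ultimately have "\<forall>\<^sub>F i in sequentially. ereal_of_enat (f i) \<le> ereal (real i powr s)"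
    proof eventually_elim
      case (elim i)
      have "real (c * (i + 1)) \<le> (2 * real c) * real i"
        using elim(2) mult_left_mono[of 1 "real i" "real c"] by (simp add: algebra_simps)
      also have "\<dots> \<le> real i powr (s - 1) * real i" using elim by (intro mult_right_mono) auto
      also have "\<dots> = real i powr s" using elim(2) by (simp add: powr_diff)
      finally have *: "real (c * (i + 1)) \<le> real i powr s" .
      have "ereal_of_enat (f i) \<le> ereal_of_enat (enat (c * (i + 1)))"
        using upper by (simp only: ereal_of_enat_le_iff)
      also have "\<dots> \<le> ereal (real i powr s)" using * by simp
      finally show ?case .
    qed
    then show ?thesis by blast
  qed
  show "growth f \<le> 1"
  proof (rule ereal_le_epsilon2)
    fix e :: real assume "0 < e"
    then have "Inf ?S \<le> ereal (1 + e)" by (intro Inf_lower mem) simp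
    then show "growth f \<le> 1 + ereal e" by (simp add: growth_def one_ereal_def)
  qed
  show "1 \<le> growth f" unfolding growth_def
  proof (rule Inf_greatest, clarify)
    fix s assume ev: "\<forall>\<^sub>F i in sequentially. ereal_of_enat (f i) \<le> ereal (real i powr s)"
    show "1 \<le> ereal s"
    proof (rule ccontr)
      assume "\<not> 1 \<le> ereal s"
      then have "s < 1" by (simp add: one_ereal_def)
      \<comment> \<open>A negative exponent is replaced by 0, so that i^t is at least 1 and j + 1 is
        at most 2 i^t.\<close>
      define t where "t = max s 0"
      have t: "0 \<le> t" "t < 1" "s \<le> t" using \<open>s < 1\<close> by (auto simp: t_def)
      have "\<forall>\<^sub>F i in sequentially. 2 * real d + 1 \<le> real i powr (1 - t)"
        using t by (intro eventually_powr_ge) simp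
      moreover have "\<forall>\<^sub>F i in sequentially. (1::nat) \<le> i" by (rule eventually_ge_at_top)
      ultimately have "\<forall>\<^sub>F i in sequentially. False" using ev
      proof eventually_elim
        case (elim i)
        obtain j where j: "f i = enat j" using upper[of i] by (cases "f i") auto
        have i: "1 \<le> real i" using elim by simp
        have "real j \<le> real i powr s" using elim(3) j by simp
        also have "\<dots> \<le> real i powr t" using i t by (intro powr_mono) auto
        finally have jt: "real j \<le> real i powr t" .
        have one: "1 \<le> real i powr t" using i t by (simp add: ge_one_powr_ge_zero)
        have "i \<le> d * (j + 1)" using lower[of i j] j by simp
        then have "real i \<le> real d * (real j + 1)" by (metis of_nat_1 of_nat_add of_nat_le_iff of_nat_mult)
        also have "\<dots> \<le> real d * (2 * real i powr t)" using jt one by (intro mult_left_mono) auto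
        also have "\<dots> < (2 * real d + 1) * real i powr t" using one i by (simp add: algebra_simps)
        also have "\<dots> \<le> real i powr (1 - t) * real i powr t" using elim by (intro mult_right_mono) auto
        also have "\<dots> = real i" using i by (simp add: powr_add[symmetric])
        finally show False by simp
      qed
      then show False by simp
    qed
  qed
qed

section \<open>Invariants under a finite group\<close>

context k_alg begin

lemma finsum_map:
  assumes "finite I" "\<And>i. i \<in> I \<Longrightarrow> g i \<in> carrier A"
    and "f \<zero> = \<zero>" "\<And>x. x \<in> carrier A \<Longrightarrow> f x \<in> carrier A"
    and "\<And>x y. x \<in> carrier A \<Longrightarrow> y \<in> carrier A \<Longrightarrow> f (x \<oplus> y) = f x \<oplus> f y"
  shows "f (\<Oplus>i\<in>I. g i) = (\<Oplus>i\<in>I. f (g i))"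
  using assms(1,2)
proof (induction I)
  case (insert i I)
  then have "g \<in> I \<rightarrow> carrier A" "(\<lambda>i. f (g i)) \<in> I \<rightarrow> carrier A" using assms(4) by auto
  then show ?case using insert assms(4,5) by (simp add: finsum_insert)
qed (simp add: assms)

lemma finsum_subspace:
  assumes "k_subspace A W" "finite I" "\<And>i. i \<in> I \<Longrightarrow> g i \<in> W"
  shows "(\<Oplus>i\<in>I. g i) \<in> W"
  using assms(2,3)
proof (induction I)
  case (insert i I)
  have "g \<in> I \<rightarrow> carrier A" "g i \<in> carrier A" using insert k_subspace_subset[OF assms(1)] by auto
  then show ?case using insert assms(1) by (simp add: finsum_insert k_subspace_def)
qed (use assms(1) in \<open>simp add: k_subspace_def\<close>)

lemma finsum_add_cong:
  assumes "\<And>i. i \<in> I \<Longrightarrow> f i \<in> carrier A" "\<And>i. i \<in> I \<Longrightarrow> g i \<in> carrier A"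
    and "\<And>i. i \<in> I \<Longrightarrow> h i = f i \<oplus> g i"
  shows "(\<Oplus>i\<in>I. h i) = (\<Oplus>i\<in>I. f i) \<oplus> (\<Oplus>i\<in>I. g i)"
proof -
  have "(\<Oplus>i\<in>I. h i) = (\<Oplus>i\<in>I. f i \<oplus> g i)"
    by (rule finsum_cong') (use assms in auto)
  also have "\<dots> = (\<Oplus>i\<in>I. f i) \<oplus> (\<Oplus>i\<in>I. g i)"
    by (rule finsum_addf) (use assms in auto)
  finally show ?thesis .
qed

lemma finsum_const_smult:
  assumes "finite I" "x \<in> carrier A" shows "(\<Oplus>i\<in>I. x) = of_nat (card I) \<odot> x"
  using assms by (induction I) (simp_all add: finsum_insert smult_l_distr)

end

text \<open>A finite group in characteristic 0, so the trace maps onto the invariants; the finite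
  set \<open>S\<close> fixes the filtration in which all degrees are measured.\<close>

locale galois_action = k_alg D for D :: "('k::field_char_0, 'a) module" (structure) +
  fixes G :: "('g, 'c) monoid_scheme" and \<rho> :: "'g \<Rightarrow> 'a \<Rightarrow> 'a" and S :: "'a set"
  assumes action: "group_action G (carrier D) \<rho>" and finite_G: "finite (carrier G)"
    and alg_hom: "g \<in> carrier G \<Longrightarrow> \<rho> g \<in> alg_hom D D"
    and finite_S: "finite S" and S_closed: "S \<subseteq> carrier D"
    and S_generates: "x \<in> carrier D \<Longrightarrow> \<exists>n. x \<in> std_filtration D S n"
begin

abbreviation filt where "filt \<equiv> std_filtration D S"
abbreviation B where "B \<equiv> invariant_alg D G \<rho>"

lemma group_G: "group G"
  using action by (simp add: group_action_def group_hom_def)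

lemma rho_closed: "g \<in> carrier G \<Longrightarrow> x \<in> carrier D \<Longrightarrow> \<rho> g x \<in> carrier D"
  and rho_add: "g \<in> carrier G \<Longrightarrow> x \<in> carrier D \<Longrightarrow> y \<in> carrier D \<Longrightarrow> \<rho> g (x \<oplus> y) = \<rho> g x \<oplus> \<rho> g y"
  and rho_mult: "g \<in> carrier G \<Longrightarrow> x \<in> carrier D \<Longrightarrow> y \<in> carrier D \<Longrightarrow> \<rho> g (x \<otimes> y) = \<rho> g x \<otimes> \<rho> g y"
  and rho_unit: "g \<in> carrier G \<Longrightarrow> \<rho> g \<one> = \<one>"
  and rho_smult: "g \<in> carrier G \<Longrightarrow> x \<in> carrier D \<Longrightarrow> \<rho> g (c \<odot> x) = c \<odot> \<rho> g x"
  using alg_hom[of g]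
  by (auto simp: alg_hom_def ring_hom_closed ring_hom_add ring_hom_mult ring_hom_one)

lemmas rho_hom = rho_closed rho_add rho_mult rho_unit rho_smult

lemma rho_zero: "g \<in> carrier G \<Longrightarrow> \<rho> g \<zero> = \<zero>"
  using rho_smult[of g \<zero> 0] rho_closed[of g \<zero>] by simp

lemma rho_comp: "g \<in> carrier G \<Longrightarrow> h \<in> carrier G \<Longrightarrow> x \<in> carrier D \<Longrightarrow> \<rho> (g \<otimes>\<^bsub>G\<^esub> h) x = \<rho> g (\<rho> h x)"
  using group_action.composition_rule[OF action] by simp

lemma rho_one: "x \<in> carrier D \<Longrightarrow> \<rho> \<one>\<^bsub>G\<^esub> x = x"
  using group_action.id_eq_one[OF action] by (metis restrict_apply')

definition Tr :: "'a \<Rightarrow> 'a" where "Tr x = (\<Oplus>g\<in>carrier G. \<rho> g x)"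

lemma B_simps:
  "x \<in> carrier B \<longleftrightarrow> x \<in> carrier D \<and> (\<forall>g\<in>carrier G. \<rho> g x = x)"
  "\<one>\<^bsub>B\<^esub> = \<one>" "\<zero>\<^bsub>B\<^esub> = \<zero>" "u \<otimes>\<^bsub>B\<^esub> v = u \<otimes> v" "u \<oplus>\<^bsub>B\<^esub> v = u \<oplus> v" "c \<odot>\<^bsub>B\<^esub> u = c \<odot> u"
proof -
  have "\<exists>g. g \<in> carrier G" using group.is_monoid[OF group_G] monoid.one_closed by blast
  then show "x \<in> carrier B \<longleftrightarrow> x \<in> carrier D \<and> (\<forall>g\<in>carrier G. \<rho> g x = x)"
    by (auto simp: invariant_alg_def invariants_def)
qed (simp_all add: invariant_alg_def)

lemma B_subset: "carrier B \<subseteq> carrier D" using B_simps(1) by blast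

lemma B_k_alg: "k_alg B"
proof -
  have "subring (carrier B) D"
  proof (rule subringI)
    show "\<ominus> h \<in> carrier B" if "h \<in> carrier B" for h
      using that by (auto simp: B_simps(1) uminus_smult rho_hom)
  qed (auto simp: B_simps(1) rho_hom)
  then have r: "ring (D\<lparr>carrier := carrier B\<rparr>)" by (rule subring_is_ring)
  have e: "D\<lparr>carrier := carrier B\<rparr> = B" by (simp add: invariant_alg_def)
  interpret r: ring B using r unfolding e .
  show ?thesis
    by unfold_locales (auto simp: B_simps rho_hom smult_l_distr smult_r_distr smult_smult smult_mult_l smult_mult_r)
qed

interpretation B: k_alg B by (rule B_k_alg)

lemma B_subspace: "k_subspace D (carrier B)"
  using B.k_subspace_carrier by (auto simp: k_subspace_def B_simps)

text \<open>Degree estimates are made in \<open>D\<close> while the spans of the bimodule are formed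
  in \<open>B\<close>; this lets one be read as the other.\<close>

lemma k_span_B: assumes "U \<subseteq> carrier B" shows "k_span B U = k_span D U"
proof
  have "k_subspace D (k_span B U)"
    using B.k_span_subspace[OF assms] by (auto simp: k_subspace_def B_simps)
  then show "k_span D U \<subseteq> k_span B U" by (rule k_span_minimal[OF _ k_span_incl])
  have "k_span D U \<subseteq> carrier B" by (rule k_span_minimal[OF B_subspace assms])
  then have "k_subspace B (k_span D U)"
    using k_span_subspace[of U] assms B_subset by (simp add: k_subspace_def B_simps(2-))
  then show "k_span B U \<subseteq> k_span D U" by (rule k_span_minimal[OF _ k_span_incl])
qed

lemma Tr_closed: "x \<in> carrier D \<Longrightarrow> Tr x \<in> carrier D"
  unfolding Tr_def by (rule finsum_closed) (simp add: rho_hom)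

lemma translate: "h \<in> carrier G \<Longrightarrow> bij_betw (\<lambda>g. h \<otimes>\<^bsub>G\<^esub> g) (carrier G) (carrier G)"
  using group.inj_on_cmult[OF group_G] group.surj_const_mult[OF group_G] by (auto simp: bij_betw_def)

lemma finsum_translate:
  assumes "h \<in> carrier G" "x \<in> carrier D"
  shows "(\<Oplus>g\<in>carrier G. \<rho> (h \<otimes>\<^bsub>G\<^esub> g) x) = Tr x"
proof -
  have "Tr x = (\<Oplus>g\<in>(\<lambda>g. h \<otimes>\<^bsub>G\<^esub> g) ` carrier G. \<rho> g x)"
    using translate[OF assms(1)] by (simp add: Tr_def bij_betw_def)
  also have "\<dots> = (\<Oplus>g\<in>carrier G. \<rho> (h \<otimes>\<^bsub>G\<^esub> g) x)"
    by (rule finsum_reindex) (use translate[OF assms(1)] assms in \<open>auto simp: bij_betw_def rho_hom\<close>)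
  finally show ?thesis ..
qed

lemma Tr_B: assumes x: "x \<in> carrier D" shows "Tr x \<in> carrier B"
  unfolding B_simps(1)
proof (intro conjI ballI Tr_closed x)
  fix h assume h: "h \<in> carrier G"
  have "\<rho> h (Tr x) = (\<Oplus>g\<in>carrier G. \<rho> h (\<rho> g x))"
    unfolding Tr_def by (rule finsum_map) (use finite_G h x in \<open>auto simp: rho_hom rho_zero\<close>)
  also have "\<dots> = (\<Oplus>g\<in>carrier G. \<rho> (h \<otimes>\<^bsub>G\<^esub> g) x)"
    by (rule finsum_cong') (use h x in \<open>auto simp: rho_comp rho_hom\<close>)
  finally show "\<rho> h (Tr x) = Tr x" using finsum_translate[OF h x] by simp
qed

lemma Tr_add: "x \<in> carrier D \<Longrightarrow> y \<in> carrier D \<Longrightarrow> Tr (x \<oplus> y) = Tr x \<oplus> Tr y"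
  unfolding Tr_def by (rule finsum_add_cong) (auto simp: rho_hom)

lemma Tr_smult: "x \<in> carrier D \<Longrightarrow> Tr (c \<odot> x) = c \<odot> Tr x"
  unfolding Tr_def
  by (subst finsum_map[where f = "\<lambda>x. c \<odot> x"])
    (use finite_G in \<open>auto simp: rho_hom smult_r_distr intro!: finsum_cong'\<close>)

lemma Tr_mult_r:
  assumes "x \<in> carrier D" "b \<in> carrier B" shows "Tr (x \<otimes> b) = Tr x \<otimes> b"
  unfolding Tr_def
  by (subst finsum_ldistr) (use finite_G assms in \<open>auto simp: B_simps(1) rho_hom intro!: finsum_cong'\<close>)

lemma Tr_invariant: assumes "b \<in> carrier B" shows "Tr b = of_nat (card (carrier G)) \<odot> b"
proof -
  have "Tr b = (\<Oplus>g\<in>carrier G. b)"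
    unfolding Tr_def by (rule finsum_cong') (use assms in \<open>auto simp: B_simps(1)\<close>)
  then show ?thesis using assms finite_G by (simp add: finsum_const_smult B_simps(1))
qed

text \<open>The group is nonempty and the characteristic is 0, so averaging over it is
  possible.\<close>

lemma card_G: "of_nat (card (carrier G)) \<noteq> (0 :: 'k)"
  using finite_G group.is_monoid[OF group_G] monoid.one_closed[of G] by (simp add: card_eq_0_iff) blast

text \<open>An element of D \<otimes> D^op acting on all the bimodules twisted by g at once. The
  same a and b serve every g, which is what makes summation over the group possible; scalars are
  absorbed into a.\<close>

inductive_set twisted :: "nat \<Rightarrow> ('g \<Rightarrow> 'a \<Rightarrow> 'a) set" for n where
  base: "a \<in> filt n \<Longrightarrow> b \<in> filt n \<Longrightarrow> (\<lambda>g w. a \<otimes> w \<otimes> \<rho> g b) \<in> twisted n"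
| add: "T \<in> twisted n \<Longrightarrow> U \<in> twisted n \<Longrightarrow> (\<lambda>g w. T g w \<oplus> U g w) \<in> twisted n"

lemma filt_carrier: "x \<in> filt n \<Longrightarrow> x \<in> carrier D"
  using filt_closed[OF S_closed] by blast

lemma twisted_closed: "T \<in> twisted n \<Longrightarrow> g \<in> carrier G \<Longrightarrow> w \<in> carrier D \<Longrightarrow> T g w \<in> carrier D"
  by (induction rule: twisted.induct) (auto simp: filt_carrier rho_hom)

text \<open>For invariant u one has h(a u g(b)) = h(a) u (hg)(b); summing over g and then over h
  gives Tr(a) u Tr(b). So a twisted operator turns into one with invariant coefficients.\<close>

lemma twisted_double_trace:
  assumes "T \<in> twisted n" "u \<in> carrier B"
  shows "(\<Oplus>h\<in>carrier G. \<Oplus>g\<in>carrier G. \<rho> h (T g u)) \<in>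
    k_span D {a \<otimes> u \<otimes> b |a b. a \<in> Tr ` filt n \<and> b \<in> Tr ` filt n}"
  using assms(1)
proof (induction rule: twisted.induct)
  case (base a b)
  have u: "u \<in> carrier D" "\<And>g. g \<in> carrier G \<Longrightarrow> \<rho> g u = u" using assms(2) by (auto simp: B_simps(1))
  note c = base[THEN filt_carrier]
  have inner: "(\<Oplus>g\<in>carrier G. \<rho> h (a \<otimes> u \<otimes> \<rho> g b)) = \<rho> h a \<otimes> (u \<otimes> Tr b)" if h: "h \<in> carrier G" for h
  proof -
    have "(\<Oplus>g\<in>carrier G. \<rho> h (a \<otimes> u \<otimes> \<rho> g b)) = (\<Oplus>g\<in>carrier G. \<rho> h a \<otimes> u \<otimes> \<rho> (h \<otimes>\<^bsub>G\<^esub> g) b)"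
      by (rule finsum_cong')
        (use h u c group.is_monoid[OF group_G] in \<open>auto simp: rho_hom rho_comp monoid.m_closed\<close>)
    also have "\<dots> = \<rho> h a \<otimes> u \<otimes> (\<Oplus>g\<in>carrier G. \<rho> (h \<otimes>\<^bsub>G\<^esub> g) b)"
      by (rule finsum_rdistr[symmetric])
        (use finite_G h u c group.is_monoid[OF group_G] in \<open>auto simp: rho_hom monoid.m_closed\<close>)
    finally show ?thesis using h u c by (simp add: finsum_translate rho_hom Tr_closed m_assoc)
  qed
  have "(\<Oplus>h\<in>carrier G. \<Oplus>g\<in>carrier G. \<rho> h (a \<otimes> u \<otimes> \<rho> g b)) = (\<Oplus>h\<in>carrier G. \<rho> h a \<otimes> (u \<otimes> Tr b))"
    by (rule finsum_cong') (use u c in \<open>auto simp: inner rho_hom Tr_closed\<close>)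
  also have "\<dots> = Tr a \<otimes> (u \<otimes> Tr b)"
    unfolding Tr_def[of a] by (rule finsum_ldistr[symmetric]) (use finite_G u c in \<open>auto simp: rho_hom Tr_closed\<close>)
  also have "\<dots> = Tr a \<otimes> u \<otimes> Tr b" using u c by (simp add: m_assoc Tr_closed)
  finally show ?case using base by (intro k_span_base) blast
next
  case (add T U)
  have u: "u \<in> carrier D" using assms(2) by (auto simp: B_simps(1))
  have inner: "(\<Oplus>g\<in>carrier G. \<rho> h (T g u \<oplus> U g u)) =
      (\<Oplus>g\<in>carrier G. \<rho> h (T g u)) \<oplus> (\<Oplus>g\<in>carrier G. \<rho> h (U g u))" if "h \<in> carrier G" for h
    by (rule finsum_add_cong) (use that u add twisted_closed in \<open>auto simp: rho_hom\<close>)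
  have c: "(\<Oplus>g\<in>carrier G. \<rho> h (V g u)) \<in> carrier D" if "h \<in> carrier G" "V \<in> twisted n" for h V
    by (rule finsum_closed) (use that u twisted_closed in \<open>auto simp: rho_hom\<close>)
  have "(\<Oplus>h\<in>carrier G. \<Oplus>g\<in>carrier G. \<rho> h (T g u \<oplus> U g u)) =
      (\<Oplus>h\<in>carrier G. \<Oplus>g\<in>carrier G. \<rho> h (T g u)) \<oplus> (\<Oplus>h\<in>carrier G. \<Oplus>g\<in>carrier G. \<rho> h (U g u))"
    by (rule finsum_add_cong) (use c add inner in auto)
  moreover have "{a \<otimes> u \<otimes> b |a b. a \<in> Tr ` filt n \<and> b \<in> Tr ` filt n} \<subseteq> carrier D"
    using u by (auto simp: Tr_closed filt_carrier)
  ultimately show ?case using add k_span_add by simp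
qed

text \<open>For an operator that is a delta at the unit of the group the inner sum is 1 for every h,
  so the double sum is |G| times 1, and |G| is invertible.\<close>

lemma twisted_one_in_span:
  assumes T: "T \<in> twisted n" and u: "u \<in> carrier B"
    and delta: "\<And>g. g \<in> carrier G \<Longrightarrow> T g u = (if g = \<one>\<^bsub>G\<^esub> then \<one> else \<zero>)"
  shows "\<one> \<in> k_span D {a \<otimes> u \<otimes> b |a b. a \<in> Tr ` filt n \<and> b \<in> Tr ` filt n}"
proof -
  have e: "\<one>\<^bsub>G\<^esub> \<in> carrier G" using group.is_monoid[OF group_G] monoid.one_closed by blast
  have "(\<Oplus>g\<in>carrier G. \<rho> h (T g u)) = \<one>" if h: "h \<in> carrier G" for h
  proof -
    have "(\<Oplus>g\<in>carrier G. \<rho> h (T g u)) = (\<Oplus>g\<in>carrier G. if \<one>\<^bsub>G\<^esub> = g then \<one> else \<zero>)"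
      by (rule finsum_cong') (use h delta rho_hom rho_zero in auto)
    also have "\<dots> = \<one>" using finsum_singleton[OF e finite_G, of "\<lambda>g. \<one>"] by simp
    finally show ?thesis .
  qed
  then have "(\<Oplus>h\<in>carrier G. \<Oplus>g\<in>carrier G. \<rho> h (T g u)) = (\<Oplus>h\<in>carrier G. \<one>)"
    by (intro finsum_cong') auto
  also have "\<dots> = of_nat (card (carrier G)) \<odot> \<one>" using finite_G by (simp add: finsum_const_smult)
  finally have "of_nat (card (carrier G)) \<odot> \<one> \<in>
      k_span D {a \<otimes> u \<otimes> b |a b. a \<in> Tr ` filt n \<and> b \<in> Tr ` filt n}" (is "_ \<in> k_span D ?S")
    using twisted_double_trace[OF T u] by simp
  moreover have S: "?S \<subseteq> carrier D"
    using u by (auto simp: B_simps(1) Tr_closed filt_carrier)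
  ultimately have "inverse (of_nat (card (carrier G))) \<odot> (of_nat (card (carrier G)) \<odot> \<one>) \<in> k_span D ?S"
    using k_span_smult by blast
  then show ?thesis using card_G by (simp add: smult_smult)
qed

text \<open>For a term with coefficients a and b, T_g(1) g(d) = a g(b d), whose sum over g is a Tr(b
  d). The finitely many pairs (a, b) behave like a pair of dual bases.\<close>

lemma twisted_dual_basis:
  assumes "T \<in> twisted n"
  shows "\<exists>P. finite P \<and> P \<subseteq> carrier D \<times> carrier D \<and> (\<forall>d\<in>carrier D.
    (\<Oplus>g\<in>carrier G. T g \<one> \<otimes> \<rho> g d) \<in> k_span D {x \<otimes> Tr (y \<otimes> d) |x y. (x, y) \<in> P})"
  using assms
proof (induction rule: twisted.induct)
  case (base a b)
  note c = base[THEN filt_carrier]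
  have "(\<Oplus>g\<in>carrier G. a \<otimes> \<one> \<otimes> \<rho> g b \<otimes> \<rho> g d) = a \<otimes> Tr (b \<otimes> d)" if d: "d \<in> carrier D" for d
  proof -
    have "(\<Oplus>g\<in>carrier G. a \<otimes> \<one> \<otimes> \<rho> g b \<otimes> \<rho> g d) = (\<Oplus>g\<in>carrier G. a \<otimes> \<rho> g (b \<otimes> d))"
      by (rule finsum_cong') (use c d in \<open>auto simp: rho_hom m_assoc\<close>)
    also have "\<dots> = a \<otimes> Tr (b \<otimes> d)"
      unfolding Tr_def by (rule finsum_rdistr[symmetric]) (use finite_G c d in \<open>auto simp: rho_hom\<close>)
    finally show ?thesis .
  qed
  then show ?case using c by (intro exI[of _ "{(a, b)}"]) (auto intro!: k_span_base)
next
  case (add T U)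
  let ?span = "\<lambda>V P d. (\<Oplus>g\<in>carrier G. V g \<one> \<otimes> \<rho> g d) \<in> k_span D {x \<otimes> Tr (y \<otimes> d) |x y. (x, y) \<in> P}"
  obtain P where P: "finite P \<and> P \<subseteq> carrier D \<times> carrier D \<and> (\<forall>d\<in>carrier D. ?span T P d)"
    using add.IH(1) by (rule exE)
  obtain Q where Q: "finite Q \<and> Q \<subseteq> carrier D \<times> carrier D \<and> (\<forall>d\<in>carrier D. ?span U Q d)"
    using add.IH(2) by (rule exE)
  have "(\<Oplus>g\<in>carrier G. (T g \<one> \<oplus> U g \<one>) \<otimes> \<rho> g d) \<in> k_span D {x \<otimes> Tr (y \<otimes> d) |x y. (x, y) \<in> P \<union> Q}"
    if d: "d \<in> carrier D" for d
  proof -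
    have "(\<Oplus>g\<in>carrier G. (T g \<one> \<oplus> U g \<one>) \<otimes> \<rho> g d) =
        (\<Oplus>g\<in>carrier G. T g \<one> \<otimes> \<rho> g d) \<oplus> (\<Oplus>g\<in>carrier G. U g \<one> \<otimes> \<rho> g d)"
      by (rule finsum_add_cong) (use add twisted_closed d in \<open>auto simp: rho_hom l_distr\<close>)
    moreover have "{x \<otimes> Tr (y \<otimes> d) |x y. (x, y) \<in> P \<union> Q} \<subseteq> carrier D"
      using P Q d by (auto simp: Tr_closed)
    moreover have "(\<Oplus>g\<in>carrier G. T g \<one> \<otimes> \<rho> g d) \<in> k_span D {x \<otimes> Tr (y \<otimes> d) |x y. (x, y) \<in> P \<union> Q}"
      by (rule k_span_mono_mem[where S = "{x \<otimes> Tr (y \<otimes> d) |x y. (x, y) \<in> P}"]) (use P d in auto)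
    moreover have "(\<Oplus>g\<in>carrier G. U g \<one> \<otimes> \<rho> g d) \<in> k_span D {x \<otimes> Tr (y \<otimes> d) |x y. (x, y) \<in> P \<union> Q}"
      by (rule k_span_mono_mem[where S = "{x \<otimes> Tr (y \<otimes> d) |x y. (x, y) \<in> Q}"]) (use Q d in auto)
    ultimately show ?thesis by (simp only: k_span_add)
  qed
  then show ?case using P Q by (intro exI[of _ "P \<union> Q"]) simp
qed

text \<open>The delta property singles out g = 1 in the preceding sum, which leaves d itself. In
  particular the first entries of \<open>P\<close> generate \<open>D\<close> as a right module over
  the invariants.\<close>

lemma dual_basis:
  assumes T: "T \<in> twisted n"
    and delta: "\<And>g. g \<in> carrier G \<Longrightarrow> T g \<one> = (if g = \<one>\<^bsub>G\<^esub> then \<one> else \<zero>)"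
  obtains P where "finite P" "P \<subseteq> carrier D \<times> carrier D"
    "\<forall>d\<in>carrier D. d \<in> k_span D {x \<otimes> Tr (y \<otimes> d) |x y. (x, y) \<in> P}"
proof -
  have e: "\<one>\<^bsub>G\<^esub> \<in> carrier G" using group.is_monoid[OF group_G] monoid.one_closed by blast
  have "(\<Oplus>g\<in>carrier G. T g \<one> \<otimes> \<rho> g d) = d" if d: "d \<in> carrier D" for d
  proof -
    have "(\<Oplus>g\<in>carrier G. T g \<one> \<otimes> \<rho> g d) = (\<Oplus>g\<in>carrier G. if \<one>\<^bsub>G\<^esub> = g then d else \<zero>)"
      by (rule finsum_cong') (use d delta rho_hom rho_one in auto)
    also have "\<dots> = d" using finsum_singleton[OF e finite_G, of "\<lambda>g. d"] d by simp
    finally show ?thesis .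
  qed
  moreover obtain P where "finite P \<and> P \<subseteq> carrier D \<times> carrier D \<and> (\<forall>d\<in>carrier D.
    (\<Oplus>g\<in>carrier G. T g \<one> \<otimes> \<rho> g d) \<in> k_span D {x \<otimes> Tr (y \<otimes> d) |x y. (x, y) \<in> P})"
    using twisted_dual_basis[OF T] by (rule exE)
  ultimately show ?thesis by (intro that[of P]) auto
qed

text \<open>a (a' w g(b')) g(b) = (a a') w g(b' b), so degrees add; the double induction only
  distributes this over sums.\<close>

lemma twisted_comp:
  assumes "T \<in> twisted m" "U \<in> twisted n"
  shows "\<exists>V\<in>twisted (m + n). \<forall>g\<in>carrier G. \<forall>w\<in>carrier D. V g w = U g (T g w)"
  using assms(2)
proof (induction rule: twisted.induct)
  case (base a b)
  note c = base[THEN filt_carrier]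
  show ?case using assms(1)
  proof (induction rule: twisted.induct)
    case (base a' b')
    have "a \<otimes> a' \<in> filt (m + n)" "b' \<otimes> b \<in> filt (m + n)"
      using filt_mult[OF S_closed] base \<open>a \<in> filt n\<close> \<open>b \<in> filt n\<close> by (metis add.commute)+
    then show ?case
      by (intro bexI[of _ "\<lambda>g w. (a \<otimes> a') \<otimes> w \<otimes> \<rho> g (b' \<otimes> b)"] twisted.base)
        (simp_all add: rho_hom m_assoc c base[THEN filt_carrier])
  next
    case (add T T')
    then obtain V V' where "V \<in> twisted (m + n)" "V' \<in> twisted (m + n)"
      "\<And>g w. g \<in> carrier G \<Longrightarrow> w \<in> carrier D \<Longrightarrow> V g w = a \<otimes> T g w \<otimes> \<rho> g b"
      "\<And>g w. g \<in> carrier G \<Longrightarrow> w \<in> carrier D \<Longrightarrow> V' g w = a \<otimes> T' g w \<otimes> \<rho> g b"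
      by blast
    then show ?case using add c
      by (intro bexI[of _ "\<lambda>g w. V g w \<oplus> V' g w"] twisted.add)
        (simp_all add: l_distr r_distr rho_hom twisted_closed)
  qed
next
  case (add U U')
  then obtain V V' where "V \<in> twisted (m + n)" "V' \<in> twisted (m + n)"
    "\<And>g w. g \<in> carrier G \<Longrightarrow> w \<in> carrier D \<Longrightarrow> V g w = U g (T g w)"
    "\<And>g w. g \<in> carrier G \<Longrightarrow> w \<in> carrier D \<Longrightarrow> V' g w = U' g (T g w)"
    by blast
  then show ?case
    by (intro bexI[of _ "\<lambda>g w. V g w \<oplus> V' g w"] twisted.add) simp_all
qed

lemma twisted_mono: "T \<in> twisted m \<Longrightarrow> m \<le> n \<Longrightarrow> T \<in> twisted n"
  by (induction rule: twisted.induct)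
    (use filt_mono[OF S_closed] in \<open>auto intro: twisted.intros\<close>)

end

section \<open>Effective simplicity and the filter dimension of the invariants\<close>

declare std_filtration.simps [simp del]

text \<open>The statements on the filter dimension are deduced from these two axioms alone. In
  \<open>obstruction\<close> only the left factor is bounded: left degree already keeps 1 out of
  reach, whatever stands on the right.\<close>

locale effectively_simple_action = galois_action +
  assumes effectively_simple: "\<exists>c. \<forall>n. \<forall>u\<in>filt n. u \<noteq> \<zero> \<longrightarrow>
      (\<exists>T\<in>twisted (c * (n + 1)). \<forall>g\<in>carrier G. T g u = (if g = \<one>\<^bsub>G\<^esub> then \<one> else \<zero>))"
    and obstruction: "\<exists>c. \<forall>n. \<exists>F\<in>carrier (invariant_alg D G \<rho>) \<inter> filt (c * (n + 1)). F \<noteq> \<zero> \<and>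
      \<one> \<notin> k_span D {a \<otimes> F \<otimes> b |a b. a \<in> filt n \<and> b \<in> carrier D}"
begin

interpretation B: k_alg B by (rule B_k_alg)

abbreviation Env where "Env \<equiv> enveloping_alg B"

interpretation E: k_alg Env by (rule B.env_k_alg)

abbreviation act_sp where "act_sp \<equiv> act_span Env (regular_bimodule B)"

lemma B_carrier: "x \<in> carrier B \<Longrightarrow> x \<in> carrier D"
  using B_subset by blast

lemma one_in_B: "\<one> \<in> carrier B"
  using B.one_closed by (simp add: B_simps)

text \<open>Zero lies in every span, so an element outside one of them is not zero.\<close>

lemma one_neq_zero: "\<one> \<noteq> \<zero>"
proof -
  obtain F where "F \<in> carrier B" "\<one> \<notin> k_span D {a \<otimes> F \<otimes> b |a b. a \<in> filt 0 \<and> b \<in> carrier D}"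
    using obstruction by blast
  let ?S = "{a \<otimes> F \<otimes> b |a b. a \<in> filt 0 \<and> b \<in> carrier D}"
  have "?S \<subseteq> carrier D" using \<open>F \<in> carrier B\<close> by (auto simp: B_carrier filt_carrier)
  then have "\<zero> \<in> k_span D ?S" by (rule k_span_zero)
  then show ?thesis using \<open>\<one> \<notin> k_span D ?S\<close> by auto
qed

text \<open>Finite generation of the invariants with control of degrees. The expansion of s x' into
  terms x Tr(y s x') pushes the generators s of \<open>D\<close> one at a time through the module
  generators, and each push produces one factor from the finite set \<open>Z\<close>. So an element
  of degree n becomes a combination of products x z with z of \<open>Z\<close>-degree n +
  O(1).\<close>

lemma invariant_generators:
  obtains Z c where "finite Z" "Z \<subseteq> carrier B"
    "\<forall>n x. x \<in> filt n \<longrightarrow> Tr x \<in> std_filtration B Z (n + c)"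
    "\<forall>n x. x \<in> filt n \<longrightarrow> x \<in> carrier B \<longrightarrow> x \<in> std_filtration B Z (n + c)"
proof -
  obtain c where c: "\<forall>n. \<forall>u\<in>filt n. u \<noteq> \<zero> \<longrightarrow>
      (\<exists>T\<in>twisted (c * (n + 1)). \<forall>g\<in>carrier G. T g u = (if g = \<one>\<^bsub>G\<^esub> then \<one> else \<zero>))"
    using effectively_simple by (rule exE)
  from c[rule_format, OF filt_one[OF S_closed] one_neq_zero, of 0]
  obtain T where T: "T \<in> twisted (c * (0 + 1))"
    "\<And>g. g \<in> carrier G \<Longrightarrow> T g \<one> = (if g = \<one>\<^bsub>G\<^esub> then \<one> else \<zero>)"
    by blast
  obtain P where P: "finite P" "P \<subseteq> carrier D \<times> carrier D"
    and dual0: "\<forall>d\<in>carrier D. d \<in> k_span D {x \<otimes> Tr (y \<otimes> d) |x y. (x, y) \<in> P}"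
    by (rule dual_basis[OF T])
  note dual = bspec[OF dual0]
  \<comment> \<open>The traces needed to multiply a module generator by a generator of
    \<open>D\<close> or by 1, to take the trace of x z at the end, and to expand the unit.\<close>
  define Z where "Z = (\<lambda>((x, y), s, (x', y')). Tr (y \<otimes> (s \<otimes> x'))) ` (P \<times> insert \<one> S \<times> P) \<union>
    Tr ` fst ` P \<union> Tr ` snd ` P"
  have S1: "insert \<one> S \<subseteq> carrier D" using S_closed by simp
  have Pc: "x \<in> carrier D" "y \<in> carrier D" if "(x, y) \<in> P" for x y using P(2) that by auto
  have Pfst: "x \<in> fst ` P" if "(x, y) \<in> P" for x y by (rule image_eqI[OF _ that]) simp
  have Zmem: "Tr (y \<otimes> (s \<otimes> x')) \<in> Z" if "(x, y) \<in> P" "s \<in> insert \<one> S" "(x', y') \<in> P" for x y s x' y'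
    unfolding Z_def by (intro UnI1 image_eqI[of _ _ "((x, y), s, (x', y'))"]) (use that in simp_all)
  have Zsnd: "Tr y \<in> Z" if "(x, y) \<in> P" for x y
    unfolding Z_def by (intro UnI2 imageI image_eqI[OF _ that]) simp
  have Zfst: "Tr x \<in> Z" if "x \<in> fst ` P" for x
    unfolding Z_def using that by (intro UnI1[OF UnI2] imageI)
  have ZB: "Z \<subseteq> carrier B"
    unfolding Z_def using Pc S1 by (auto intro!: Tr_B simp: subset_iff)
  have finZ: "finite Z" unfolding Z_def using P(1) finite_S by simp
  let ?Z = "std_filtration B Z"
  have Zc: "z \<in> carrier B" "z \<in> carrier D" if "z \<in> ?Z n" for z n
    using B.filt_closed[OF ZB, of n] that B_carrier by auto
  have Z1: "z \<in> ?Z (Suc n)" if "z \<in> Z" for z n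
    using B.filt_base[OF ZB, of z] B.filt_mono[OF ZB, of 1 "Suc n"] that by auto
  have Zmul: "w \<otimes> z \<in> ?Z (m + n)" if "w \<in> ?Z m" "z \<in> ?Z n" for w z m n
    using B.filt_mult[OF ZB that] by (simp add: B_simps)
  let ?U = "\<lambda>n. {x \<otimes> z |x z. x \<in> fst ` P \<and> z \<in> ?Z n}"
  have Uc: "?U n \<subseteq> carrier D" for n using Pc Zc by auto
  have Umem: "x \<otimes> z \<in> k_span D (?U n)" if "x \<in> fst ` P" "z \<in> ?Z n" for x z n
    by (rule k_span_base) (use that in blast)
  have Ustep: "v \<otimes> z \<in> k_span D (?U (Suc n))" if v: "v \<in> k_span D (?U n)" and z: "z \<in> Z" for v z n
  proof (rule k_span_mult_r[OF v Uc _ k_span_subspace[OF Uc]])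
    show "z \<in> carrier D" using z ZB B_carrier by auto
    fix w assume "w \<in> ?U n"
    then obtain x z' where "w = x \<otimes> z'" "x \<in> fst ` P" "z' \<in> ?Z n" by blast
    moreover have "z' \<otimes> z \<in> ?Z (Suc n)" using Zmul[OF \<open>z' \<in> ?Z n\<close> Z1[OF z, of 0]] by simp
    moreover have "w \<otimes> z = x \<otimes> (z' \<otimes> z)" using calculation z ZB Pc Zc by (auto simp: m_assoc B_carrier)
    ultimately show "w \<otimes> z \<in> k_span D (?U (Suc n))" by (simp only: Umem)
  qed
  \<comment> \<open>In u s with s the last generator, s x' is expanded first; then u stands again in
    front of module generators, with one degree less.\<close>
  have step: "v \<otimes> x' \<in> k_span D (?U (n + 1))" if "v \<in> filt n" "x' \<in> fst ` P" for v x' n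
    using that(1) S_closed that(2)
  proof (induction arbitrary: x' rule: filt_induct)
    case (zero n)
    then show ?case using Pc k_span_zero[OF Uc] by auto
  next
    case (one n)
    then obtain y' where x': "(x', y') \<in> P" by auto
    have "x' \<in> k_span D {x \<otimes> Tr (y \<otimes> x') |x y. (x, y) \<in> P}" using dual Pc x' by blast
    moreover have "{x \<otimes> Tr (y \<otimes> x') |x y. (x, y) \<in> P} \<subseteq> ?U (n + 1)"
    proof clarify
      fix x y assume xy: "(x, y) \<in> P"
      have "Tr (y \<otimes> (\<one> \<otimes> x')) \<in> Z" using Zmem[OF xy _ x', of \<one>] by simp
      then have "Tr (y \<otimes> x') \<in> ?Z (n + 1)" using Z1[of _ n] Pc[OF x'] by simp
      moreover have "x \<in> fst ` P" by (rule Pfst[OF xy])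
      ultimately show "\<exists>xa z. x \<otimes> Tr (y \<otimes> x') = xa \<otimes> z \<and> xa \<in> fst ` P \<and> z \<in> ?Z (n + 1)" by blast
    qed
    ultimately show ?case using Pc[OF x'] k_span_mono_mem by simp
  next
    case (gen n u s)
    then obtain y' where x': "(x', y') \<in> P" by auto
    have u: "u \<in> carrier D" and s: "s \<in> carrier D" using gen filt_carrier S1 by auto
    have "s \<otimes> x' \<in> k_span D {x \<otimes> Tr (y \<otimes> (s \<otimes> x')) |x y. (x, y) \<in> P}" (is "_ \<in> k_span D ?V")
      using dual Pc x' s by blast
    moreover have "?V \<subseteq> carrier D" using Pc x' s by (auto simp: Tr_closed)
    ultimately have "u \<otimes> (s \<otimes> x') \<in> k_span D (?U (Suc n + 1))"
    proof (rule k_span_mult_l[OF _ _ u k_span_subspace[OF Uc]])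
      fix w assume "w \<in> ?V"
      then obtain x y where xy: "w = x \<otimes> Tr (y \<otimes> (s \<otimes> x'))" "(x, y) \<in> P" by blast
      have "Tr (y \<otimes> (s \<otimes> x')) \<in> Z" by (rule Zmem[OF xy(2) gen(2) x'])
      moreover have "u \<otimes> x \<in> k_span D (?U (n + 1))" by (rule gen(3)[OF Pfst[OF xy(2)]])
      moreover have "u \<otimes> w = u \<otimes> x \<otimes> Tr (y \<otimes> (s \<otimes> x'))"
        using xy u Pc[OF xy(2)] s Pc[OF x'] by (simp add: m_assoc Tr_closed)
      ultimately show "u \<otimes> w \<in> k_span D (?U (Suc n + 1))"
        using Ustep[of "u \<otimes> x" "n + 1"] by simp
    qed
    then show ?case using u s Pc[OF x'] by (simp add: m_assoc)
  next
    case (add n u v)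
    have "x' \<in> carrier D" using add.prems P(2) by auto
    then show ?case
      using k_span_add[OF Uc add.IH(1)[OF add.prems] add.IH(2)[OF add.prems]] add.hyps by (simp only: l_distr)
  next
    case (smult n c u)
    have "x' \<in> carrier D" using smult.prems P(2) by auto
    then show ?case
      using k_span_smult[OF Uc smult.IH[OF smult.prems]] smult.hyps by (simp only: smult_mult_l)
  qed
  \<comment> \<open>Writing a = a 1 and expanding 1 into terms x Tr(y) puts a module generator to
    the right of a, where \<open>step\<close> applies.\<close>
  have all: "a \<in> k_span D (?U (n + 2))" if a: "a \<in> filt n" for a n
  proof -
    have ac: "a \<in> carrier D" using a filt_carrier by simp
    have "\<one> \<in> k_span D {x \<otimes> Tr (y \<otimes> \<one>) |x y. (x, y) \<in> P}" (is "_ \<in> k_span D ?V") by (rule dual) simp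
    moreover have "?V \<subseteq> carrier D" using Pc by (auto simp: Tr_closed)
    ultimately have "a \<otimes> \<one> \<in> k_span D (?U (n + 2))"
    proof (rule k_span_mult_l[OF _ _ ac k_span_subspace[OF Uc]])
      fix w assume "w \<in> ?V"
      then obtain x y where xy: "w = x \<otimes> Tr y" "(x, y) \<in> P" using Pc by auto
      have "Tr y \<in> Z" by (rule Zsnd[OF xy(2)])
      moreover have "a \<otimes> x \<in> k_span D (?U (n + 1))" by (rule step[OF a Pfst[OF xy(2)]])
      moreover have "a \<otimes> w = a \<otimes> x \<otimes> Tr y"
        using xy ac Pc[OF xy(2)] by (simp add: m_assoc Tr_closed)
      ultimately show "a \<otimes> w \<in> k_span D (?U (n + 2))"
        using Ustep[of "a \<otimes> x" "n + 1"] by simp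
    qed
    then show ?thesis using ac by simp
  qed
  \<comment> \<open>The 3 counts one trace for the recursion in degree 0, one from the expansion of
    1, and Tr(x).\<close>
  have trace: "Tr a \<in> ?Z (n + 3)" if a: "a \<in> filt n" for a n
  proof (rule k_span_map[OF all[OF a] Uc, where f = Tr and V = B])
    show "k_subspace B (?Z (n + 3))" by (rule B.filt_subspace[OF ZB])
    fix w assume "w \<in> ?U (n + 2)"
    then obtain x z where w: "w = x \<otimes> z" "x \<in> fst ` P" "z \<in> ?Z (n + 2)" by blast
    have "Tr x \<in> ?Z 1" using Z1[OF Zfst[OF w(2)], of 0] by simp
    then have "Tr x \<otimes> z \<in> ?Z (1 + (n + 2))" using Zmul w by blast
    then show "Tr w \<in> ?Z (n + 3)" using w Pc Zc by (auto simp: Tr_mult_r eval_nat_numeral)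
  next
    show "Tr \<zero> = \<zero>\<^bsub>B\<^esub>" using Tr_smult[of \<zero> 0] Tr_closed[of \<zero>] by (simp add: B_simps)
  qed (simp_all add: Tr_add Tr_smult B_simps)
  have inv: "x \<in> ?Z (n + 3)" if x: "x \<in> filt n" "x \<in> carrier B" for x n
  proof -
    have "inverse (of_nat (card (carrier G))) \<odot>\<^bsub>B\<^esub> Tr x \<in> ?Z (n + 3)"
      by (rule B.filt_smult[OF ZB trace[OF x(1)]])
    then show ?thesis using card_G x(2) by (simp add: Tr_invariant B_simps(2-) smult_smult B_carrier)
  qed
  show ?thesis by (rule that[OF finZ ZB]) (use trace inv in blast)+
qed

text \<open>A filtration of the enveloping algebra with degrees measured in \<open>D\<close> on both
  tensor factors. It does not refer to generators of \<open>Env\<close>, and every standard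
  filtration from a finite set lies in it up to a constant factor.\<close>

definition bounded_env :: "nat \<Rightarrow> _ set" where
  "bounded_env n = k_span Env {B.tens b c |b c. b \<in> carrier B \<inter> filt n \<and> c \<in> carrier B \<inter> filt n}"

lemma bounded_env_gens: "{B.tens b c |b c. b \<in> carrier B \<inter> filt n \<and> c \<in> carrier B \<inter> filt n} \<subseteq> carrier Env"
  by (auto intro!: B.tens_closed)

lemma bounded_env_mono: "m \<le> n \<Longrightarrow> bounded_env m \<subseteq> bounded_env n"
  unfolding bounded_env_def using filt_mono[OF S_closed, of m n] by (intro k_span_mono) blast

lemma bounded_env_subspace: "k_subspace Env (bounded_env n)"
  unfolding bounded_env_def by (rule E.k_span_subspace[OF bounded_env_gens])

lemma bounded_env_closed: "u \<in> bounded_env n \<Longrightarrow> u \<in> carrier Env"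
  using k_subspace_subset[OF bounded_env_subspace] by blast

lemma bounded_env_exhaust: assumes "u \<in> carrier Env" shows "\<exists>n. u \<in> bounded_env n"
  using assms
proof (induction u rule: B.env_induct)
  case (tens x y)
  then obtain m n where "x \<in> filt m" "y \<in> filt n" using S_generates B_carrier by meson
  then have "x \<in> filt (max m n)" "y \<in> filt (max m n)"
    using filt_mono[OF S_closed, of m "max m n"] filt_mono[OF S_closed, of n "max m n"] by auto
  then show ?case using tens unfolding bounded_env_def by (intro exI[of _ "max m n"] k_span_base) blast
next
  case (add u v)
  then obtain m n where "u \<in> bounded_env m" "v \<in> bounded_env n" by blast
  then have "u \<in> bounded_env (max m n)" "v \<in> bounded_env (max m n)"
    using bounded_env_mono[of m "max m n"] bounded_env_mono[of n "max m n"] by auto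
  then show ?case using bounded_env_subspace[of "max m n"] unfolding k_subspace_def by blast
next
  case (smult c u)
  then obtain n where "u \<in> bounded_env n" by blast
  then show ?case using bounded_env_subspace[of n] unfolding k_subspace_def by blast
qed

lemma bounded_env_finite:
  assumes "finite U" "U \<subseteq> carrier Env" shows "\<exists>n. U \<subseteq> bounded_env n"
  using assms
proof (induction U)
  case (insert u U)
  then obtain m n where "U \<subseteq> bounded_env m" "u \<in> bounded_env n" using bounded_env_exhaust by (metis insert_subset)
  then show ?case
    using bounded_env_mono[of m "max m n"] bounded_env_mono[of n "max m n"]
    by (intro exI[of _ "max m n"]) auto
qed simp

lemma bounded_env_mult:
  assumes u: "u \<in> bounded_env m" and v: "v \<in> bounded_env n"
  shows "u \<otimes>\<^bsub>Env\<^esub> v \<in> bounded_env (m + n)"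
proof -
  note uc = bounded_env_closed[OF u] and vc = bounded_env_closed[OF v]
  show ?thesis
  proof (rule E.k_span_mult_r[OF u[unfolded bounded_env_def] bounded_env_gens vc bounded_env_subspace], clarify)
    fix b c assume bc: "b \<in> carrier B" "b \<in> filt m" "c \<in> carrier B" "c \<in> filt m"
    show "B.tens b c \<otimes>\<^bsub>Env\<^esub> v \<in> bounded_env (m + n)"
    proof (rule E.k_span_mult_l[OF v[unfolded bounded_env_def] bounded_env_gens _ bounded_env_subspace], safe)
      show "B.tens b c \<in> carrier Env" using bc by (simp add: B.tens_closed)
      fix b' c' assume bc': "b' \<in> carrier B" "b' \<in> filt n" "c' \<in> carrier B" "c' \<in> filt n"
      have "b \<otimes> b' \<in> filt (m + n)" "c' \<otimes> c \<in> filt (m + n)"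
        using filt_mult[OF S_closed] bc bc' by (metis add.commute)+
      moreover have "b \<otimes> b' \<in> carrier B" "c' \<otimes> c \<in> carrier B"
        using bc bc' B.m_closed by (simp_all add: B_simps(4))
      ultimately show "B.tens b c \<otimes>\<^bsub>Env\<^esub> B.tens b' c' \<in> bounded_env (m + n)"
        using bc bc' unfolding bounded_env_def by (intro k_span_base) (auto simp: B.tens_mult B_simps(4))
    qed
  qed
qed

lemma bounded_env_one: "\<one>\<^bsub>Env\<^esub> \<in> bounded_env n"
  unfolding B.tens_one[symmetric] bounded_env_def B_simps(2)
  using one_in_B filt_one[OF S_closed, of n] by (intro k_span_base) blast

lemma bounded_env_filt:
  assumes "u \<in> std_filtration Env W i" "W \<subseteq> carrier Env" "W \<subseteq> bounded_env c"
  shows "u \<in> bounded_env (c * i)"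
  using assms(1,2)
proof (induction rule: E.filt_induct)
  case (gen n u v)
  then have "v \<in> bounded_env c" using assms(3) bounded_env_one by auto
  then show ?case using bounded_env_mult[of u "c * n" v c] gen by (simp add: add.commute)
qed (use bounded_env_subspace bounded_env_one in \<open>auto simp: k_subspace_def\<close>)

text \<open>Both tensor factors contribute their degree, hence twice n.\<close>

lemma bounded_env_act_filt:
  assumes "u \<in> bounded_env n" and w: "w \<in> carrier B" "w \<in> filt m"
  shows "B.act u w \<in> filt (2 * n + m)"
proof -
  have "k_subspace D (filt (2 * n + m))" by (rule filt_subspace[OF S_closed])
  then have W: "k_subspace B (carrier B \<inter> filt (2 * n + m))"
    using B.k_subspace_carrier unfolding k_subspace_def B_simps(2-) by auto
  have "B.act u w \<in> carrier B \<inter> filt (2 * n + m)"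
  proof (rule E.k_span_map[OF assms(1)[unfolded bounded_env_def] bounded_env_gens W])
    fix t assume "t \<in> {B.tens b c |b c. b \<in> carrier B \<inter> filt n \<and> c \<in> carrier B \<inter> filt n}"
    then obtain b c where bc: "t = B.tens b c" "b \<in> carrier B" "b \<in> filt n" "c \<in> carrier B" "c \<in> filt n"
      by blast
    have "b \<otimes> w \<otimes> c \<in> filt (n + m + n)" using bc w filt_mult[OF S_closed] by blast
    moreover have "n + m + n = 2 * n + m" by simp
    moreover have "b \<otimes> w \<otimes> c \<in> carrier B" using bc w B.m_closed unfolding B_simps(4) by blast
    ultimately show "B.act t w \<in> carrier B \<inter> filt (2 * n + m)"
      using bc w by (simp add: B.act_tens B_simps(4))
  next
    show "B.act \<zero>\<^bsub>Env\<^esub> w = \<zero>\<^bsub>B\<^esub>"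
      using B.act_smult[of "\<zero>\<^bsub>Env\<^esub>" w 0] w B.act_closed[of "\<zero>\<^bsub>Env\<^esub>" w] by simp
  qed (use w in \<open>simp_all add: B.act_add B.act_smult\<close>)
  then show ?thesis by simp
qed

text \<open>The bound on the right factor is forgotten in order to reach the form in which the
  obstruction is stated.\<close>

lemma bounded_env_act_span:
  assumes "u \<in> bounded_env n" and w: "w \<in> carrier B"
  shows "B.act u w \<in> k_span D {a \<otimes> w \<otimes> b |a b. a \<in> filt n \<and> b \<in> carrier D}"
proof -
  have gens: "{a \<otimes> w \<otimes> b |a b. a \<in> filt n \<and> b \<in> carrier D} \<subseteq> carrier D"
    using w by (auto simp: B_carrier filt_carrier)
  show ?thesis
  proof (rule E.k_span_map[OF assms(1)[unfolded bounded_env_def] bounded_env_gens k_span_subspace[OF gens]])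
    fix t assume "t \<in> {B.tens b c |b c. b \<in> carrier B \<inter> filt n \<and> c \<in> carrier B \<inter> filt n}"
    then obtain b c where bc: "t = B.tens b c" "b \<in> carrier B" "b \<in> filt n" "c \<in> carrier B" "c \<in> filt n"
      by blast
    then show "B.act t w \<in> k_span D {a \<otimes> w \<otimes> b |a b. a \<in> filt n \<and> b \<in> carrier D}"
      using w B_carrier[of c] by (intro k_span_base) (simp add: B.act_tens B_simps(4), blast)
  next
    show "B.act \<zero>\<^bsub>Env\<^esub> w = \<zero>"
      using B.act_smult[of "\<zero>\<^bsub>Env\<^esub>" w 0] w B.act_closed[of "\<zero>\<^bsub>Env\<^esub>" w] by (simp add: B_simps)
  qed (use w in \<open>simp_all add: B.act_add B.act_smult B_simps(2-)\<close>)
qed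

lemma act_gens_closed: "U \<subseteq> carrier Env \<Longrightarrow> W \<subseteq> carrier B \<Longrightarrow> {B.act u x |u x. u \<in> U \<and> x \<in> W} \<subseteq> carrier B"
  by (auto intro!: B.act_closed)

lemma act_sp_act:
  assumes W: "W \<subseteq> carrier Env" and M: "M' \<subseteq> carrier B"
    and u: "u \<in> std_filtration Env W m" and v: "v \<in> act_sp (std_filtration Env W n) M'"
  shows "B.act u v \<in> act_sp (std_filtration Env W (m + n)) M'"
proof -
  note F = E.filt_closed[OF W]
  have uc: "u \<in> carrier Env" using u F by blast
  note v = v[unfolded B.act_span_eq]
  show ?thesis unfolding B.act_span_eq
  proof (rule B.k_span_map[OF v act_gens_closed[OF F M] B.k_span_subspace[OF act_gens_closed[OF F M]], where f = "B.act u"])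
    fix w assume "w \<in> {B.act u x |u x. u \<in> std_filtration Env W n \<and> x \<in> M'}"
    then obtain u' x where "w = B.act u' x" "u' \<in> std_filtration Env W n" "x \<in> M'" by blast
    moreover from this have "B.act u w = B.act (u \<otimes>\<^bsub>Env\<^esub> u') x"
      using uc F M by (subst B.act_mult) auto
    ultimately show "B.act u w \<in> k_span B {B.act u x |u x. u \<in> std_filtration Env W (m + n) \<and> x \<in> M'}"
      using E.filt_mult[OF W u] by (intro k_span_base) blast
  next
    show "B.act u \<zero>\<^bsub>B\<^esub> = \<zero>\<^bsub>B\<^esub>"
      using B.act_linear(2)[OF uc, of "\<zero>\<^bsub>B\<^esub>" "\<zero>\<^bsub>B\<^esub>" 0] B.act_closed[OF uc, of "\<zero>\<^bsub>B\<^esub>"] by simp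
  qed (use uc B.act_linear in \<open>simp_all\<close>)
qed

lemma act_sp_mono: "U \<subseteq> U' \<Longrightarrow> W \<subseteq> W' \<Longrightarrow> act_sp U W \<subseteq> act_sp U' W'"
  unfolding B.act_span_eq by (rule k_span_mono) blast

end

section \<open>Finite generation, infinite dimension and growth for the enveloping algebra\<close>

context effectively_simple_action begin

interpretation B: k_alg B by (rule B_k_alg)
interpretation E: k_alg Env by (rule B.env_k_alg)

text \<open>x \<otimes> y = (x \<otimes> 1)(1 \<otimes> y), and each factor is built generator by
  generator. On the opposite side multiplication is reversed, so there the new generator is put on
  the left.\<close>

lemma Env_filt_tens:
  assumes W: "W \<subseteq> carrier Env" and Z: "Z \<subseteq> carrier B"
    and gens: "\<And>z. z \<in> Z \<Longrightarrow> B.tens z \<one>\<^bsub>B\<^esub> \<in> std_filtration Env W c \<and> B.tens \<one>\<^bsub>B\<^esub> z \<in> std_filtration Env W c"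
    and x: "x \<in> std_filtration B Z n" and y: "y \<in> std_filtration B Z n"
  shows "B.tens x y \<in> std_filtration Env W (c * n + c * n)"
proof -
  note F = E.filt_zero[OF W] E.filt_one[OF W] E.filt_add[OF W] E.filt_smult[OF W]
  have tens_zero: "B.tens \<zero>\<^bsub>B\<^esub> \<one>\<^bsub>B\<^esub> = \<zero>\<^bsub>Env\<^esub>" "B.tens \<one>\<^bsub>B\<^esub> \<zero>\<^bsub>B\<^esub> = \<zero>\<^bsub>Env\<^esub>"
    using B.tens_smult[of "\<zero>\<^bsub>B\<^esub>" "\<one>\<^bsub>B\<^esub>" 0] B.tens_smult[of "\<one>\<^bsub>B\<^esub>" "\<zero>\<^bsub>B\<^esub>" 0]
    by (simp_all add: B.tens_closed)
  have "B.tens x \<one>\<^bsub>B\<^esub> \<in> std_filtration Env W (c * n) \<and> B.tens \<one>\<^bsub>B\<^esub> x \<in> std_filtration Env W (c * n)"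
    if "x \<in> std_filtration B Z n" for x n
    using that Z
  proof (induction rule: B.filt_induct)
    case (zero n)
    then show ?case by (simp add: tens_zero F)
  next
    case (one n)
    then show ?case by (simp add: B.tens_one F)
  next
    case (gen n u v)
    have u: "u \<in> carrier B" and v: "v \<in> carrier B"
      using gen(1,2) B.filt_closed[OF Z] Z by auto
    have v': "B.tens v \<one>\<^bsub>B\<^esub> \<in> std_filtration Env W c" "B.tens \<one>\<^bsub>B\<^esub> v \<in> std_filtration Env W c"
      using gen(2) gens F(2) by (auto simp: B.tens_one)
    have "B.tens (u \<otimes>\<^bsub>B\<^esub> v) \<one>\<^bsub>B\<^esub> = B.tens u \<one>\<^bsub>B\<^esub> \<otimes>\<^bsub>Env\<^esub> B.tens v \<one>\<^bsub>B\<^esub>"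
      "B.tens \<one>\<^bsub>B\<^esub> (u \<otimes>\<^bsub>B\<^esub> v) = B.tens \<one>\<^bsub>B\<^esub> v \<otimes>\<^bsub>Env\<^esub> B.tens \<one>\<^bsub>B\<^esub> u"
      using u v B.tens_mult[of u "\<one>\<^bsub>B\<^esub>" v "\<one>\<^bsub>B\<^esub>"] B.tens_mult[of "\<one>\<^bsub>B\<^esub>" v "\<one>\<^bsub>B\<^esub>" u] by simp_all
    then show ?case
      using E.filt_mult[OF W _ v'(1), of _ "c * n"] E.filt_mult[OF W v'(2), of _ "c * n"] gen(3)
      by (simp add: add.commute)
  next
    case (add n u v)
    then show ?case using B.tens_add[of u "\<one>\<^bsub>B\<^esub>" v "\<one>\<^bsub>B\<^esub>"] B.tens_add(2)[of "\<one>\<^bsub>B\<^esub>" u "\<one>\<^bsub>B\<^esub>" v]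
      by (simp add: F)
  next
    case (smult n d u)
    then show ?case using B.tens_smult[of u "\<one>\<^bsub>B\<^esub>" d] B.tens_smult[of "\<one>\<^bsub>B\<^esub>" u d]
      by (simp add: F)
  qed
  from this[OF x] this[OF y]
  have "B.tens x \<one>\<^bsub>B\<^esub> \<otimes>\<^bsub>Env\<^esub> B.tens \<one>\<^bsub>B\<^esub> y \<in> std_filtration Env W (c * n + c * n)"
    using E.filt_mult[OF W] by blast
  moreover have "x \<in> carrier B" "y \<in> carrier B" using x y B.filt_closed[OF Z] by auto
  ultimately show ?thesis
    using B.tens_mult[of x "\<one>\<^bsub>B\<^esub>" "\<one>\<^bsub>B\<^esub>" y] by simp
qed

lemma Env_fin_gen: "fin_gen_alg Env"
proof -
  obtain Z c where Z: "finite Z" "Z \<subseteq> carrier B"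
    and tr: "\<forall>n x. x \<in> filt n \<longrightarrow> Tr x \<in> std_filtration B Z (n + c)"
    and inv0: "\<forall>n x. x \<in> filt n \<longrightarrow> x \<in> carrier B \<longrightarrow> x \<in> std_filtration B Z (n + c)"
    by (rule invariant_generators)
  note inv = inv0[rule_format]
  define W where "W = (\<lambda>z. B.tens z \<one>\<^bsub>B\<^esub>) ` Z \<union> (\<lambda>z. B.tens \<one>\<^bsub>B\<^esub> z) ` Z"
  have W: "W \<subseteq> carrier Env" "finite W"
    unfolding W_def using Z by (auto intro!: B.tens_closed)
  have gens: "B.tens z \<one>\<^bsub>B\<^esub> \<in> std_filtration Env W 1 \<and> B.tens \<one>\<^bsub>B\<^esub> z \<in> std_filtration Env W 1" if "z \<in> Z" for z
    using E.filt_base[OF W(1)] that by (auto simp: W_def)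
  have "\<exists>n. u \<in> std_filtration Env W n" if "u \<in> carrier Env" for u
    using that
  proof (induction u rule: B.env_induct)
    case (tens x y)
    obtain m n where mn: "x \<in> filt m" "y \<in> filt n" using tens S_generates B_carrier by meson
    have "x \<in> filt (max m n)" "y \<in> filt (max m n)"
      using filt_mono[OF S_closed, of m "max m n"] filt_mono[OF S_closed, of n "max m n"] mn by auto
    then show ?case using Env_filt_tens[OF W(1) Z(2) gens inv inv] tens by blast
  next
    case (add u v)
    then obtain m n where mn: "u \<in> std_filtration Env W m" "v \<in> std_filtration Env W n" by blast
    have "u \<in> std_filtration Env W (max m n)" "v \<in> std_filtration Env W (max m n)"
      using E.filt_mono[OF W(1), of m "max m n"] E.filt_mono[OF W(1), of n "max m n"] mn by auto
    then show ?case using E.filt_add[OF W(1)] by blast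
  next
    case (smult d u)
    then show ?case using E.filt_smult[OF W(1)] by blast
  qed
  then have "generates_alg Env W" by (rule E.generates_algI[OF W(1)])
  then show ?thesis using W(2) by (auto simp: fin_gen_alg_def)
qed

text \<open>Provides an admissible subspace; together with a generating set of \<open>Env\<close> it
  pins down the value of the definite description in \<open>filter_dim\<close>.\<close>

lemma span_one_generates: "fin_dim_generating Env (regular_bimodule B) (k_span B {\<one>\<^bsub>B\<^esub>})"
proof -
  have "x \<in> act_sp (carrier Env) (k_span B {\<one>\<^bsub>B\<^esub>})" if x: "x \<in> carrier B" for x
  proof -
    have "x = B.act (B.tens x \<one>\<^bsub>B\<^esub>) \<one>\<^bsub>B\<^esub>" using x by (simp add: B.act_tens)
    then show ?thesis unfolding B.act_span_eq
      using x k_span_base[of "\<one>\<^bsub>B\<^esub>" "{\<one>\<^bsub>B\<^esub>}" B]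
      by (intro k_span_base) (use B.tens_closed[OF x B.one_closed] in blast)
  qed
  moreover have "act_sp (carrier Env) (k_span B {\<one>\<^bsub>B\<^esub>}) \<subseteq> carrier B"
    unfolding B.act_span_eq by (intro B.k_span_closed act_gens_closed) simp_all
  ultimately have "act_sp (carrier Env) (k_span B {\<one>\<^bsub>B\<^esub>}) = carrier B" by blast
  then show ?thesis
    unfolding fin_dim_generating_def B.fin_dim_restrict B.bimod_simps(1)
    by (auto simp: fin_dim_subspace_def intro!: exI[of _ "{\<one>\<^bsub>B\<^esub>}"])
qed

lemma act_zero_right: "u \<in> carrier Env \<Longrightarrow> B.act u \<zero>\<^bsub>B\<^esub> = \<zero>\<^bsub>B\<^esub>"
  using B.act_linear(2)[of u "\<zero>\<^bsub>B\<^esub>" "\<zero>\<^bsub>B\<^esub>" 0] B.act_closed[of u "\<zero>\<^bsub>B\<^esub>"] by simp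

lemma generating_nonzero:
  assumes "fin_dim_generating Env (regular_bimodule B) M'" "M' \<subseteq> carrier B"
  obtains u where "u \<in> M'" "u \<noteq> \<zero>"
proof (rule ccontr)
  assume "\<not> thesis"
  then have M: "M' \<subseteq> {\<zero>\<^bsub>B\<^esub>}" using that by (auto simp: B_simps(3))
  have "act_sp (carrier Env) M' \<subseteq> {\<zero>\<^bsub>B\<^esub>}"
    unfolding B.act_span_eq
  proof (rule k_span_minimal)
    show "k_subspace B {\<zero>\<^bsub>B\<^esub>}" by (simp add: k_subspace_def)
    show "{B.act u x |u x. u \<in> carrier Env \<and> x \<in> M'} \<subseteq> {\<zero>\<^bsub>B\<^esub>}" using M act_zero_right by auto
  qed
  then have "carrier B \<subseteq> {\<zero>\<^bsub>B\<^esub>}" using assms(1) unfolding fin_dim_generating_def by simp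
  then show False using one_in_B one_neq_zero by (auto simp: B_simps(3))
qed

text \<open>Compares an arbitrary finite generating set \<open>W\<close> with the degrees of
  \<open>D\<close> in both directions and restates effective simplicity for \<open>B\<close>, with
  one constant for all three.\<close>

lemma filtration_constants:
  assumes W: "finite W" "generates_alg Env W"
  obtains c where "W \<subseteq> bounded_env c"
    "\<forall>n x y. x \<in> filt n \<longrightarrow> y \<in> filt n \<longrightarrow> x \<in> carrier B \<longrightarrow> y \<in> carrier B \<longrightarrow>
       B.tens x y \<in> std_filtration Env W (c * (n + 1))"
    "\<forall>n. \<forall>u\<in>filt n. u \<in> carrier B \<longrightarrow> u \<noteq> \<zero> \<longrightarrow>
       \<one> \<in> act_sp (std_filtration Env W (c * (n + 1))) {u}"
proof -
  have Wc: "W \<subseteq> carrier Env" using W(2) by (simp add: generates_alg_def)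
  note mono = E.filt_mono[OF Wc]
  obtain c1 where c1: "W \<subseteq> bounded_env c1" using bounded_env_finite[OF W(1) Wc] by blast
  obtain Z e where Z: "finite Z" "Z \<subseteq> carrier B"
    and e: "\<forall>n x. x \<in> filt n \<longrightarrow> Tr x \<in> std_filtration B Z (n + e)"
      "\<forall>n x. x \<in> filt n \<longrightarrow> x \<in> carrier B \<longrightarrow> x \<in> std_filtration B Z (n + e)"
    by (rule invariant_generators)
  let ?V = "(\<lambda>z. B.tens z \<one>\<^bsub>B\<^esub>) ` Z \<union> (\<lambda>z. B.tens \<one>\<^bsub>B\<^esub> z) ` Z"
  have V: "finite ?V" "?V \<subseteq> carrier Env" using Z by (auto intro!: B.tens_closed)
  have "\<exists>n. u \<in> std_filtration Env W n" if "u \<in> carrier Env" for u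
    by (rule E.filt_generates[OF W(2) that]) (rule exI)
  then obtain c2 where c2: "?V \<subseteq> std_filtration Env W c2"
    by (rule E.filt_finite[OF _ Wc V])
  have gens: "B.tens z \<one>\<^bsub>B\<^esub> \<in> std_filtration Env W c2 \<and> B.tens \<one>\<^bsub>B\<^esub> z \<in> std_filtration Env W c2"
    if "z \<in> Z" for z
    using c2 that by auto
  note tens = Env_filt_tens[OF Wc Z(2) gens]
  obtain c3 where c3: "\<forall>n. \<forall>u\<in>filt n. u \<noteq> \<zero> \<longrightarrow>
      (\<exists>T\<in>twisted (c3 * (n + 1)). \<forall>g\<in>carrier G. T g u = (if g = \<one>\<^bsub>G\<^esub> then \<one> else \<zero>))"
    using effectively_simple by (rule exE)
  let ?k = "\<lambda>n. c2 * (n + e) + c2 * (n + e)"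
  \<comment> \<open>A tensor of two elements of \<open>Z\<close>-degree k costs 2 \<open>c2\<close>
    k. Here k is n + e for elements of degree n, and c3 (n + 1) + e for the traces in effective
    simplicity; \<open>c1\<close> takes care of \<open>W\<close> itself.\<close>
  define c where "c = c1 + 2 * c2 * (c3 + 1) * (e + 1)"
  have kc: "?k n \<le> c * (n + 1)" for n
  proof -
    have "n + e \<le> (e + 1) * (n + 1)" by simp
    then have "2 * c2 * (n + e) \<le> 2 * c2 * ((e + 1) * (n + 1))" by (rule mult_le_mono2)
    also have "\<dots> \<le> c * (n + 1)" unfolding c_def by (simp add: algebra_simps)
    finally show ?thesis by simp
  qed
  have kc': "?k (c3 * (n + 1)) \<le> c * (n + 1)" for n
  proof -
    have "c3 * (n + 1) + e \<le> (c3 + 1) * (e + 1) * (n + 1)" by (simp add: algebra_simps)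
    then have "2 * c2 * (c3 * (n + 1) + e) \<le> 2 * c2 * ((c3 + 1) * (e + 1) * (n + 1))" by (rule mult_le_mono2)
    also have "\<dots> \<le> c * (n + 1)" unfolding c_def by (simp add: algebra_simps)
    finally show ?thesis by simp
  qed
  show ?thesis
  proof (rule that[of c])
    show "W \<subseteq> bounded_env c" using c1 bounded_env_mono[of c1 c] by (auto simp: c_def)
    show "\<forall>n x y. x \<in> filt n \<longrightarrow> y \<in> filt n \<longrightarrow> x \<in> carrier B \<longrightarrow> y \<in> carrier B \<longrightarrow>
       B.tens x y \<in> std_filtration Env W (c * (n + 1))"
      using tens[OF _ e(2)[rule_format] e(2)[rule_format]] mono[OF kc] by blast
    show "\<forall>n. \<forall>u\<in>filt n. u \<in> carrier B \<longrightarrow> u \<noteq> \<zero> \<longrightarrow>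
       \<one> \<in> act_sp (std_filtration Env W (c * (n + 1))) {u}"
    proof (intro allI ballI impI)
      fix n u assume u: "u \<in> filt n" "u \<in> carrier B" "u \<noteq> \<zero>"
      obtain T where T: "T \<in> twisted (c3 * (n + 1))"
        "\<And>g. g \<in> carrier G \<Longrightarrow> T g u = (if g = \<one>\<^bsub>G\<^esub> then \<one> else \<zero>)"
        using c3[rule_format, OF u(1,3)] by blast
      let ?S = "{a \<otimes> u \<otimes> b |a b. a \<in> Tr ` filt (c3 * (n + 1)) \<and> b \<in> Tr ` filt (c3 * (n + 1))}"
      let ?A = "{B.act v x |v x. v \<in> std_filtration Env W (c * (n + 1)) \<and> x \<in> {u}}"
      have "?S \<subseteq> ?A"
      proof clarify
        fix a b assume ab: "a \<in> filt (c3 * (n + 1))" "b \<in> filt (c3 * (n + 1))"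
        have "B.tens (Tr a) (Tr b) \<in> std_filtration Env W (?k (c3 * (n + 1)))"
          by (rule tens) (use e(1) ab in auto)
        moreover have "B.act (B.tens (Tr a) (Tr b)) u = Tr a \<otimes> u \<otimes> Tr b"
          using Tr_B filt_carrier ab u by (simp add: B.act_tens B_simps(4))
        ultimately show "\<exists>v x. Tr a \<otimes> u \<otimes> Tr b = B.act v x \<and> v \<in> std_filtration Env W (c * (n + 1)) \<and> x \<in> {u}"
          using subsetD[OF mono[OF kc']] by (intro exI[of _ "B.tens (Tr a) (Tr b)"] exI[of _ u]) simp
      qed
      then have "k_span D ?S \<subseteq> k_span D ?A" by (rule k_span_mono)
      moreover have "?A \<subseteq> carrier B" by (rule act_gens_closed) (use E.filt_closed[OF Wc] u in auto)
      ultimately show "\<one> \<in> act_sp (std_filtration Env W (c * (n + 1))) {u}"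
        using twisted_one_in_span[OF T(1) u(2) T(2)] unfolding B.act_span_eq by (simp add: k_span_B subset_iff)
    qed
  qed
qed

text \<open>If \<open>Env\<close> were finite-dimensional it would lie in a single
  \<open>bounded_env n\<close>. The obstruction F for that n would then keep 1 out of the whole
  orbit of F, contrary to effective simplicity.\<close>

lemma Env_infinite_dim: "\<not> fin_dim_subspace Env (carrier Env)"
proof
  assume "fin_dim_subspace Env (carrier Env)"
  then obtain U where U: "finite U" "U \<subseteq> carrier Env" "carrier Env = k_span Env U"
    by (auto simp: fin_dim_subspace_def)
  obtain n where "U \<subseteq> bounded_env n" using bounded_env_finite[OF U(1,2)] by blast
  then have all: "carrier Env \<subseteq> bounded_env n"
    unfolding U(3) by (intro k_span_minimal bounded_env_subspace)
  obtain W where W: "finite W" "generates_alg Env W" using Env_fin_gen by (auto simp: fin_gen_alg_def)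
  have Wc: "W \<subseteq> carrier Env" using W(2) by (simp add: generates_alg_def)
  obtain d where d: "\<forall>n. \<exists>F\<in>carrier B \<inter> filt (d * (n + 1)). F \<noteq> \<zero> \<and>
      \<one> \<notin> k_span D {a \<otimes> F \<otimes> b |a b. a \<in> filt n \<and> b \<in> carrier D}"
    using obstruction by (rule exE)
  obtain F where F: "F \<in> carrier B" "F \<in> filt (d * (n + 1))" "F \<noteq> \<zero>"
    "\<one> \<notin> k_span D {a \<otimes> F \<otimes> b |a b. a \<in> filt n \<and> b \<in> carrier D}"
    using d[rule_format, of n] by blast
  obtain c where "W \<subseteq> bounded_env c"
    "\<forall>n x y. x \<in> filt n \<longrightarrow> y \<in> filt n \<longrightarrow> x \<in> carrier B \<longrightarrow> y \<in> carrier B \<longrightarrow>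
       B.tens x y \<in> std_filtration Env W (c * (n + 1))"
    and c: "\<forall>n. \<forall>u\<in>filt n. u \<in> carrier B \<longrightarrow> u \<noteq> \<zero> \<longrightarrow>
       \<one> \<in> act_sp (std_filtration Env W (c * (n + 1))) {u}"
    by (rule filtration_constants[OF W])
  from c have "\<one> \<in> act_sp (std_filtration Env W (c * (d * (n + 1) + 1))) {F}" using F by blast
  also have "\<dots> \<subseteq> act_sp (carrier Env) {F}" by (rule act_sp_mono) (use E.filt_closed[OF Wc] in auto)
  also have "\<dots> \<subseteq> k_span D {a \<otimes> F \<otimes> b |a b. a \<in> filt n \<and> b \<in> carrier D}"
  proof -
    have g: "{a \<otimes> F \<otimes> b |a b. a \<in> filt n \<and> b \<in> carrier D} \<subseteq> carrier D"
      using F by (auto simp: B_carrier filt_carrier)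
    have "act_sp (carrier Env) {F} = k_span D {B.act u x |u x. u \<in> carrier Env \<and> x \<in> {F}}"
      unfolding B.act_span_eq by (rule k_span_B, rule act_gens_closed) (use F in auto)
    also have "\<dots> \<subseteq> k_span D {a \<otimes> F \<otimes> b |a b. a \<in> filt n \<and> b \<in> carrier D}"
      by (rule k_span_minimal[OF k_span_subspace[OF g]]) (use bounded_env_act_span all F in blast)
    finally show ?thesis .
  qed
  finally show False using F(4) by contradiction
qed

text \<open>Upper bound: a generating subspace at level i contains a nonzero element of degree O(i),
  from which 1 and then \<open>M\<^sub>0\<close> are recovered. Lower bound: the line spanned by an
  obstruction of level proportional to i is itself such a subspace, and it returns slowly.\<close>

theorem growth_return_function:
  assumes W: "finite W" "generates_alg Env W"
    and M: "fin_dim_generating Env (regular_bimodule B) M\<^sub>0"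
  shows "growth (return_function Env W (regular_bimodule B) M\<^sub>0) = 1"
proof -
  let ?F = "std_filtration Env W"
  let ?f = "return_function Env W (regular_bimodule B) M\<^sub>0"
  have Wc: "W \<subseteq> carrier Env" using W(2) by (simp add: generates_alg_def)
  note Fc = E.filt_closed[OF Wc] and mono = E.filt_mono[OF Wc]
  obtain c where c1: "W \<subseteq> bounded_env c"
    and c2: "\<forall>n x y. x \<in> filt n \<longrightarrow> y \<in> filt n \<longrightarrow> x \<in> carrier B \<longrightarrow> y \<in> carrier B \<longrightarrow>
       B.tens x y \<in> ?F (c * (n + 1))"
    and c3: "\<forall>n. \<forall>u\<in>filt n. u \<in> carrier B \<longrightarrow> u \<noteq> \<zero> \<longrightarrow> \<one> \<in> act_sp (?F (c * (n + 1))) {u}"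
    by (rule filtration_constants[OF W])
  obtain d where d: "\<forall>n. \<exists>F\<in>carrier B \<inter> filt (d * (n + 1)). F \<noteq> \<zero> \<and>
      \<one> \<notin> k_span D {a \<otimes> F \<otimes> b |a b. a \<in> filt n \<and> b \<in> carrier D}"
    using obstruction by (rule exE)
  have "fin_dim_subspace B M\<^sub>0"
    using M unfolding fin_dim_generating_def B.fin_dim_restrict by (rule conjunct1)
  then obtain U where U: "finite U" "U \<subseteq> carrier B" "M\<^sub>0 = k_span B U"
    unfolding fin_dim_subspace_def by (elim exE conjE)
  have M0B: "M\<^sub>0 \<subseteq> carrier B" using U B.k_span_closed by simp
  obtain m where "U \<subseteq> filt m"
    by (rule filt_finite[OF S_generates S_closed U(1) order_trans[OF U(2) B_subset]])
  then have M0m: "M\<^sub>0 \<subseteq> filt m"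
    unfolding U(3) k_span_B[OF U(2)] by (intro k_span_minimal filt_subspace[OF S_closed])
  \<comment> \<open>Once 1 is reached, multiplying by x \<otimes> 1 reaches x, at a price linear in
    the degree of x.\<close>
  have tens_act: "x \<in> act_sp (?F (c * (n + 1) + j)) M'"
    if "\<one> \<in> act_sp (?F j) M'" "M' \<subseteq> carrier B" "x \<in> filt n" "x \<in> carrier B" for x n j M'
  proof -
    have "B.tens x \<one> \<in> ?F (c * (n + 1))" using c2 that(3,4) one_in_B filt_one[OF S_closed] by blast
    from act_sp_act[OF Wc that(2) this that(1)]
    show ?thesis using that(4) one_in_B B_carrier by (simp add: B.act_tens B_simps)
  qed
  have filtM: "act_sp (?F i) M\<^sub>0 \<subseteq> filt (2 * (c * i) + m)" for i
  proof -
    have g: "{B.act u x |u x. u \<in> ?F i \<and> x \<in> M\<^sub>0} \<subseteq> carrier B"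
      by (rule act_gens_closed[OF Fc M0B])
    show ?thesis
      unfolding B.act_span_eq k_span_B[OF g]
    proof (rule k_span_minimal[OF filt_subspace[OF S_closed]], clarify)
      fix u x assume "u \<in> ?F i" "x \<in> M\<^sub>0"
      then show "B.act u x \<in> filt (2 * (c * i) + m)"
        using bounded_env_filt[OF _ Wc c1] M0B M0m by (intro bounded_env_act_filt) auto
    qed
  qed
  \<comment> \<open>\<open>M\<^sub>0\<close> is an arbitrary generating subspace, so 1 is obtained
    from it only in some degree e. This serves twice in the lower bound: to place the obstruction in
    level i, and to pass from \<open>M\<^sub>0\<close> back to 1.\<close>
  have one_M0: "\<exists>j. \<one> \<in> act_sp (?F j) M\<^sub>0"
  proof -
    have "\<one>\<^bsub>B\<^esub> \<in> k_span B {B.act u x |u x. u \<in> carrier Env \<and> x \<in> M\<^sub>0}"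
      using M one_in_B unfolding fin_dim_generating_def B.act_span_eq by (simp add: B_simps(2))
    moreover have "{B.act u x |u x. u \<in> carrier Env \<and> x \<in> M\<^sub>0} \<subseteq> carrier B"
      by (rule act_gens_closed[OF _ M0B]) simp
    ultimately have "\<exists>j. \<one>\<^bsub>B\<^esub> \<in> act_sp (?F j) M\<^sub>0"
    proof (induction rule: B.k_span_induct)
      case zero
      show ?case unfolding B.act_span_eq using B.k_span_zero[OF act_gens_closed[OF Fc M0B]] by blast
    next
      case (base w)
      then obtain u x where "w = B.act u x" "u \<in> carrier Env" "x \<in> M\<^sub>0" by blast
      moreover obtain j where "u \<in> ?F j" by (rule E.filt_generates[OF W(2) \<open>u \<in> carrier Env\<close>])
      ultimately show ?case unfolding B.act_span_eq by (intro exI[of _ j] k_span_base) blast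
    next
      case (add v w)
      then obtain j k where jk: "v \<in> act_sp (?F j) M\<^sub>0" "w \<in> act_sp (?F k) M\<^sub>0" by blast
      have "v \<in> act_sp (?F (max j k)) M\<^sub>0" "w \<in> act_sp (?F (max j k)) M\<^sub>0"
        using jk act_sp_mono[OF mono[of j "max j k"] subset_refl, of M\<^sub>0]
          act_sp_mono[OF mono[of k "max j k"] subset_refl, of M\<^sub>0] by auto
      then show ?case unfolding B.act_span_eq using B.k_span_add[OF act_gens_closed[OF Fc M0B]] by blast
    next
      case (smult a v)
      then show ?case unfolding B.act_span_eq using B.k_span_smult[OF act_gens_closed[OF Fc M0B]] by blast
    qed
    then show ?thesis by (simp add: B_simps(2))
  qed
  then obtain e where e: "\<one> \<in> act_sp (?F e) M\<^sub>0" by blast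
  show ?thesis
  proof (rule growth_eq_one)
    fix i
    \<comment> \<open>The second summand returns to 1 from an element of degree 2 c i + m; the first
      goes on to \<open>M\<^sub>0\<close>, whose elements have degree at most m.\<close>
    let ?j = "c * (m + 1) + c * (2 * (c * i) + m + 1)"
    have "M\<^sub>0 \<subseteq> act_sp (?F ?j) M'"
      if M': "fin_dim_generating Env (regular_bimodule B) M'" "M' \<subseteq> act_sp (?F i) M\<^sub>0" for M'
    proof -
      have "act_sp (?F i) M\<^sub>0 \<subseteq> carrier B"
        unfolding B.act_span_eq by (rule B.k_span_closed[OF act_gens_closed[OF Fc M0B]])
      then have M'B: "M' \<subseteq> carrier B" using M'(2) by blast
      obtain u where u: "u \<in> M'" "u \<noteq> \<zero>" by (rule generating_nonzero[OF M'(1) M'B])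
      have "u \<in> filt (2 * (c * i) + m)" using u M'(2) filtM by blast
      then have "\<one> \<in> act_sp (?F (c * (2 * (c * i) + m + 1))) {u}" using c3 u M'B by blast
      then have "\<one> \<in> act_sp (?F (c * (2 * (c * i) + m + 1))) M'"
        using act_sp_mono[OF subset_refl, of "{u}" M'] u(1) by blast
      then show ?thesis using tens_act[OF _ M'B] M0m M0B by blast
    qed
    then have "?f i \<le> enat ?j" unfolding return_function_def by (intro INF_lower) blast
    also have "?j \<le> (c * (m + 1) + c * (2 * c + m + 1)) * (i + 1)" by (simp add: algebra_simps)
    then have "enat ?j \<le> enat ((c * (m + 1) + c * (2 * c + m + 1)) * (i + 1))" by simp
    finally show "?f i \<le> enat ((c * (m + 1) + c * (2 * c + m + 1)) * (i + 1))" .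
  next
    fix i j assume ij: "?f i \<le> enat j"
    \<comment> \<open>The infimum is over natural numbers: if every admissible index exceeded j, it
      would be at least Suc j.\<close>
    obtain j' where j': "j' \<le> j" "\<forall>M'. fin_dim_generating Env (regular_bimodule B) M' \<and>
        M' \<subseteq> act_sp (?F i) M\<^sub>0 \<longrightarrow> M\<^sub>0 \<subseteq> act_sp (?F j') M'"
    proof (rule ccontr)
      assume "\<not> thesis"
      with that have "enat (Suc j) \<le> ?f i"
        unfolding return_function_def by (intro INF_greatest) (auto simp: not_less_eq_eq[symmetric])
      then show False using ij by (metis enat_ord_simps(1) not_less_eq_eq order.refl order_trans)
    qed
    \<comment> \<open>From level K (n + 1) on, the obstruction of index n lies in the span reached
      from \<open>M\<^sub>0\<close>. Below, n is taken as the largest index with K (n + 1) \<le>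
      i.\<close>
    define K where "K = c * (d + 1) + e + 1"
    have K: "c * (d * (n + 1) + 1) + e \<le> K * (n + 1)" for n unfolding K_def by (simp add: algebra_simps)
    show "i \<le> K * (c * (e + 1) + 2) * (j + 1)"
    proof (cases "i < K")
      case True
      have "K * 1 \<le> K * ((c * (e + 1) + 2) * (j + 1))" by (intro mult_le_mono2) simp
      then show ?thesis using True by (simp only: mult.assoc mult_1_right)
    next
      case False
      have "K > 0" by (simp add: K_def)
      define n where "n = i div K - 1"
      have n: "K * (n + 1) \<le> i" "i < K * (n + 2)"
      proof -
        have "1 \<le> i div K" using False \<open>K > 0\<close> by (simp add: div_greater_zero_iff Suc_le_eq)
        then have "n + 1 = i div K" by (simp add: n_def)
        then show "K * (n + 1) \<le> i" by simp
        have "i < K * (i div K) + K" using \<open>K > 0\<close> by (metis add_strict_left_mono mod_less_divisor mult_div_mod_eq)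
        also have "\<dots> = K * (n + 2)" using \<open>n + 1 = i div K\<close>[symmetric] by (simp add: algebra_simps)
        finally show "i < K * (n + 2)" .
      qed
      obtain F where F: "F \<in> carrier B" "F \<in> filt (d * (n + 1))" "F \<noteq> \<zero>"
        "\<one> \<notin> k_span D {a \<otimes> F \<otimes> b |a b. a \<in> filt n \<and> b \<in> carrier D}"
        using d[rule_format, of n] by blast
      let ?M = "k_span B {F}"
      have MB: "?M \<subseteq> carrier B" by (rule B.k_span_closed) (use F in simp)
      have oneM: "\<one> \<in> act_sp (?F (c * (d * (n + 1) + 1))) ?M"
      proof -
        have "\<one> \<in> act_sp (?F (c * (d * (n + 1) + 1))) {F}" using c3 F by blast
        then show ?thesis using act_sp_mono[OF subset_refl, of "{F}" ?M] k_span_incl[of "{F}" B] by blast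
      qed
      have "fin_dim_generating Env (regular_bimodule B) ?M"
        unfolding fin_dim_generating_def B.fin_dim_restrict B.bimod_simps(1)
      proof
        show "fin_dim_subspace B ?M" using F by (auto simp: fin_dim_subspace_def intro!: exI[of _ "{F}"])
        show "act_sp (carrier Env) ?M = carrier B"
        proof
          show "act_sp (carrier Env) ?M \<subseteq> carrier B"
            unfolding B.act_span_eq by (rule B.k_span_closed[OF act_gens_closed[OF subset_refl MB]])
          show "carrier B \<subseteq> act_sp (carrier Env) ?M"
          proof
            fix x assume x: "x \<in> carrier B"
            then obtain k where "x \<in> filt k" using S_generates B_carrier by blast
            from tens_act[OF oneM MB this x] show "x \<in> act_sp (carrier Env) ?M"
              using act_sp_mono[OF Fc subset_refl] by blast
          qed
        qed
      qed
      moreover have "F \<in> act_sp (?F i) M\<^sub>0"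
      proof -
        have "F \<in> act_sp (?F (c * (d * (n + 1) + 1) + e)) M\<^sub>0" by (rule tens_act[OF e M0B F(2,1)])
        moreover have "c * (d * (n + 1) + 1) + e \<le> i" using K n(1) by (rule order_trans)
        ultimately show ?thesis using act_sp_mono[OF mono subset_refl] by blast
      qed
      then have "?M \<subseteq> act_sp (?F i) M\<^sub>0"
        unfolding B.act_span_eq by (intro k_span_minimal B.k_span_subspace act_gens_closed[OF Fc M0B]) simp
      ultimately have M0M: "M\<^sub>0 \<subseteq> act_sp (?F j') ?M" using j'(2) by blast
      have "\<one> \<in> act_sp (?F (e + j')) ?M"
      proof -
        have "act_sp (?F e) M\<^sub>0 \<subseteq> act_sp (?F (e + j')) ?M"
          unfolding B.act_span_eq[of "?F e"]
          by (rule k_span_minimal, unfold B.act_span_eq[of "?F (e + j')"],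
              rule B.k_span_subspace[OF act_gens_closed[OF Fc MB]],
              unfold B.act_span_eq[of "?F (e + j')", symmetric])
            (use act_sp_act[OF Wc MB] M0M in blast)
        then show ?thesis using e by blast
      qed
      also have "act_sp (?F (e + j')) ?M \<subseteq> k_span D {a \<otimes> F \<otimes> b |a b. a \<in> filt (c * (e + j')) \<and> b \<in> carrier D}"
        (is "_ \<subseteq> k_span D ?R")
      proof -
        have R: "?R \<subseteq> carrier D" using F by (auto simp: B_carrier filt_carrier)
        have "B.act u x \<in> k_span D ?R" if u: "u \<in> ?F (e + j')" and x: "x \<in> ?M" for u x
        proof (rule B.k_span_map[OF x _ k_span_subspace[OF R]])
          have uc: "u \<in> carrier Env" using u Fc by blast
          show "{F} \<subseteq> carrier B" using F by simp
          show "B.act u \<zero>\<^bsub>B\<^esub> = \<zero>" using act_zero_right[OF uc] by (simp add: B_simps(3))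
          show "B.act u w \<in> k_span D ?R" if "w \<in> {F}" for w
            using bounded_env_act_span[OF bounded_env_filt[OF u Wc c1] F(1)] that by simp
          show "B.act u (v \<oplus>\<^bsub>B\<^esub> w) = B.act u v \<oplus> B.act u w" if "v \<in> carrier B" "w \<in> carrier B" for v w
            using B.act_linear(1)[OF uc that] by (simp add: B_simps(5))
          show "B.act u (a \<odot>\<^bsub>B\<^esub> w) = a \<odot> B.act u w" if "w \<in> carrier B" for a w
            using B.act_linear(2)[OF uc that that] by (simp add: B_simps(6))
        qed
        then show ?thesis
          unfolding B.act_span_eq k_span_B[OF act_gens_closed[OF Fc MB]]
          by (intro k_span_minimal[OF k_span_subspace[OF R]]) blast
      qed
      finally have in_span: "\<one> \<in> k_span D ?R" .
      \<comment> \<open>Reaching 1 from F with left degree at most n is forbidden by the choice of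
        F.\<close>
      have "n < c * (e + j')"
      proof (rule ccontr)
        assume "\<not> n < c * (e + j')"
        then have "filt (c * (e + j')) \<subseteq> filt n" by (intro filt_mono[OF S_closed]) simp
        then have "k_span D ?R \<subseteq> k_span D {a \<otimes> F \<otimes> b |a b. a \<in> filt n \<and> b \<in> carrier D}"
          by (intro k_span_mono) blast
        then show False using in_span F(4) by blast
      qed
      also have "\<dots> \<le> c * (e + j)" using j'(1) by simp
      finally have "n + 2 \<le> c * (e + j) + 2" by simp
      also have "\<dots> \<le> (c * (e + 1) + 2) * (j + 1)" by (simp add: algebra_simps)
      finally have "K * (n + 2) \<le> K * ((c * (e + 1) + 2) * (j + 1))" by (rule mult_le_mono2)
      then show ?thesis using n(2) by (simp only: mult.assoc)
    qed
  qed
qed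

theorem fdim_invariants_eq_one: "fdim B = 1"
  unfolding fdim_def filter_dim_def
proof (rule the_equality)
  show "\<forall>W M\<^sub>0. finite W \<and> generates_alg Env W \<and> fin_dim_generating Env (regular_bimodule B) M\<^sub>0 \<longrightarrow>
      growth (return_function Env W (regular_bimodule B) M\<^sub>0) = 1"
    using growth_return_function by blast
  obtain W where W: "finite W" "generates_alg Env W" using Env_fin_gen by (auto simp: fin_gen_alg_def)
  show "d = 1" if "\<forall>W M\<^sub>0. finite W \<and> generates_alg Env W \<and> fin_dim_generating Env (regular_bimodule B) M\<^sub>0 \<longrightarrow>
      growth (return_function Env W (regular_bimodule B) M\<^sub>0) = d" for d
    using that[rule_format, OF conjI[OF W(1) conjI[OF W(2) span_one_generates]]]
      growth_return_function[OF W span_one_generates] by simp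
qed

end

section \<open>Matrix coefficients of rank one algebras\<close>

text \<open>
  The algebra \<open>A\<close> acts on functions on \<open>\<int>\<close>: \<open>h\<close> multiplies by \<open>\<theta>\<close>, \<open>x\<close> shifts, and \<open>y\<close> shifts back
  and multiplies by \<open>a\<close>. The scalar \<open>m u n b\<close> is the coefficient at \<open>b\<close> of the image under \<open>u\<close>
  of the delta function at \<open>b - n\<close>. The unit \<open>g\<close> with inverse \<open>g'\<close> is \<open>h\<close> in the quantum case and
  \<open>1\<close> in the classical case, where also \<open>l = 1\<close>. The spaces \<open>W N\<close> consist of the (Laurent)
  polynomials in \<open>\<theta>\<close> of degree at most \<open>N\<close>.
\<close>

locale coefficient_functions =
  fixes \<theta> a :: "int \<Rightarrow> 'k::field_char_0" and l :: 'k
    and W :: "nat \<Rightarrow> (int \<Rightarrow> 'k) set" and da :: nat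
  assumes \<theta>_inj: "inj \<theta>" and l_nonzero: "l \<noteq> 0"
    and \<theta>_affine: "\<exists>p q. \<forall>b. \<theta> (b + j) = p * \<theta> b + q"
    and W_mono: "N \<le> N' \<Longrightarrow> W N \<subseteq> W N'"
    and W_zero: "(\<lambda>_. 0) \<in> W N"
    and W_const: "(\<lambda>_. c) \<in> W N"
    and W_add: "f \<in> W N \<Longrightarrow> f' \<in> W N \<Longrightarrow> (\<lambda>b. f b + f' b) \<in> W N"
    and W_scale: "f \<in> W N \<Longrightarrow> (\<lambda>b. c * f b) \<in> W N"
    and W_shift: "f \<in> W N \<Longrightarrow> (\<lambda>b. f (b + j)) \<in> W N"
    and W_\<theta>: "f \<in> W N \<Longrightarrow> (\<lambda>b. \<theta> b * f b) \<in> W (N + da)"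
    and W_a: "f \<in> W N \<Longrightarrow> (\<lambda>b. a b * f b) \<in> W (N + da)"
    and W_l: "f \<in> W N \<Longrightarrow> (\<lambda>b. l powi (- b) * f b) \<in> W (N + da)"
      "f \<in> W N \<Longrightarrow> (\<lambda>b. l powi b * f b) \<in> W (N + da)"
    and W_finite: "f \<in> W N \<Longrightarrow> finite {b. f b \<noteq> 0} \<Longrightarrow> f = (\<lambda>_. 0)"
    and W_annihilated: "f \<in> W N \<Longrightarrow>
        fold (\<lambda>\<kappa> f b. f (b - 1) - l powi \<kappa> * f b) [- int N..int N] f = (\<lambda>_. 0)"
    and W_twist: "f \<in> W N \<Longrightarrow> (\<zeta>::'k) ^ k = 1 \<Longrightarrow> 0 < k \<Longrightarrow> \<zeta> \<noteq> 1 \<Longrightarrow>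
        (\<And>b. f (b - 1) = \<zeta> * l powi \<kappa> * f b) \<Longrightarrow> f = (\<lambda>_. 0)"
    and a_finite: "finite {b. a b = 0}"
    and bezout: "\<exists>K. \<forall>d>0. \<exists>p q. degree p \<le> K \<and> degree q \<le> K \<and>
        (\<forall>b. poly p (\<theta> b) * a b + poly q (\<theta> b) * a (b - int d) = 1)"

text \<open>\<open>m_basis\<close> is faithfulness of the coefficients in the form that survives
  tensoring: a spanning set with linearly independent coefficient functions. The paired formulas say
  that left and right multiplication by a generator only translate arguments and multiply by known
  functions.\<close>

locale rank_one = k_alg A + coefficient_functions \<theta> a l W da
  for A :: "('k::field_char_0, 'b) module" (structure) and h g g' x y :: 'b
    and \<theta> a :: "int \<Rightarrow> 'k" and l :: 'k and W and da +
  fixes m :: "'b \<Rightarrow> int \<Rightarrow> int \<Rightarrow> 'k"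
  assumes gens_closed: "h \<in> carrier A" "g \<in> carrier A" "g' \<in> carrier A" "x \<in> carrier A" "y \<in> carrier A"
    and m_add: "u \<in> carrier A \<Longrightarrow> v \<in> carrier A \<Longrightarrow> m (u \<oplus> v) n b = m u n b + m v n b"
    and m_smult: "u \<in> carrier A \<Longrightarrow> m (c \<odot> u) n b = c * m u n b"
    and m_one: "m \<one> n b = (if n = 0 then 1 else 0)"
    and m_h: "u \<in> carrier A \<Longrightarrow> m (h \<otimes> u) n b = \<theta> b * m u n b"
      "u \<in> carrier A \<Longrightarrow> m (u \<otimes> h) n b = \<theta> (b - n) * m u n b"
    and m_g: "u \<in> carrier A \<Longrightarrow> m (g \<otimes> u) n b = l powi (- b) * m u n b"
      "u \<in> carrier A \<Longrightarrow> m (u \<otimes> g) n b = l powi (- (b - n)) * m u n b"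
    and m_g': "u \<in> carrier A \<Longrightarrow> m (g' \<otimes> u) n b = l powi b * m u n b"
      "u \<in> carrier A \<Longrightarrow> m (u \<otimes> g') n b = l powi (b - n) * m u n b"
    and m_x: "u \<in> carrier A \<Longrightarrow> m (x \<otimes> u) n b = m u (n - 1) (b - 1)"
      "u \<in> carrier A \<Longrightarrow> m (u \<otimes> x) n b = m u (n - 1) b"
    and m_y: "u \<in> carrier A \<Longrightarrow> m (y \<otimes> u) n b = a b * m u (n + 1) (b + 1)"
      "u \<in> carrier A \<Longrightarrow> m (u \<otimes> y) n b = a (b - n - 1) * m u (n + 1) b"
    and m_basis: "\<exists>E\<subseteq>carrier A. k_span A E = carrier A \<and> (\<forall>F c. finite F \<longrightarrow> F \<subseteq> E \<longrightarrow>
        (\<forall>n b. (\<Sum>e\<in>F. c e * m e n b) = 0) \<longrightarrow> (\<forall>e\<in>F. c e = 0))"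
    and gens_generate: "generates_alg A {h, g, g', x, y}"

section \<open>Tensor products of rank one algebras\<close>

lemma big_tensor_presentation:
  assumes "\<And>i. i \<in> I \<Longrightarrow> k_alg (A i)"
  shows "presentation (product_group I A) (big_tensor_relations I A)"
proof -
  have ring: "ring (A i)" if "i \<in> I" for i using assms[OF that] k_alg_def by blast
  have mon: "Group.monoid (A i)" if "i \<in> I" for i using ring.is_monoid[OF ring[OF that]] .
  interpret M: Group.monoid "product_group I A"
    by (rule monoidI) (auto simp: product_group_def monoid.m_closed[OF mon] monoid.m_assoc[OF mon]
      monoid.one_closed[OF mon] monoid.l_one[OF mon] monoid.r_one[OF mon] PiE_iff extensional_def restrict_def
      intro!: ext)
  have upd: "s(i := x) \<in> carrier (product_group I A)"
    if "s \<in> (\<Pi>\<^sub>E i\<in>I. carrier (A i))" "i \<in> I" "x \<in> carrier (A i)" for s i x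
    using that by (auto simp: product_group_def PiE_iff extensional_def)
  show ?thesis
  proof
    fix u v assume "(u, v) \<in> big_tensor_relations I A"
    then show "Poly_Mapping.keys u \<subseteq> carrier (product_group I A) \<and>
        Poly_Mapping.keys v \<subseteq> carrier (product_group I A)"
      unfolding big_tensor_relations_def
    proof (elim UnE CollectE exE conjE)
      fix s i y z
      assume a: "(u, v) = (basis (s(i := y \<oplus>\<^bsub>A i\<^esub> z)), basis (s(i := y)) + basis (s(i := z)))"
        "s \<in> (\<Pi>\<^sub>E i\<in>I. carrier (A i))" "i \<in> I" "y \<in> carrier (A i)" "z \<in> carrier (A i)"
      then have "y \<oplus>\<^bsub>A i\<^esub> z \<in> carrier (A i)" using ring[OF a(3)] by (simp add: ring.ring_simprules(1))
      then show ?thesis using a upd by (simp add: keys_add_subset)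
    next
      fix s i c z
      assume a: "(u, v) = (basis (s(i := c \<odot>\<^bsub>A i\<^esub> z)), Poly_Mapping.single (s(i := z)) c)"
        "s \<in> (\<Pi>\<^sub>E i\<in>I. carrier (A i))" "i \<in> I" "z \<in> carrier (A i)"
      then have "c \<odot>\<^bsub>A i\<^esub> z \<in> carrier (A i)" using assms[OF a(3)] by (simp add: k_alg.smult_closed)
      then show ?thesis using a upd by simp
    qed
  qed
qed

text \<open>Products of independent functions of separate variables are independent. Coordinates are
  frozen one at a time from the last down: with the other variables fixed, the sum is a combination
  of the functions of coordinate k, and its coefficients must vanish.\<close>

lemma product_independent:
  fixes \<phi> :: "nat \<Rightarrow> 'e \<Rightarrow> 'x \<Rightarrow> 'k::field"
  assumes ind: "\<And>i F c. i < r \<Longrightarrow> finite F \<Longrightarrow> F \<subseteq> E i \<Longrightarrow>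
      (\<And>z. (\<Sum>e\<in>F. c e * \<phi> i e z) = 0) \<Longrightarrow> (\<forall>e\<in>F. c e = 0)"
    and F: "finite F" "F \<subseteq> (\<Pi>\<^sub>E i\<in>{..<r}. E i)"
    and zero: "\<And>z. (\<Sum>s\<in>F. c s * (\<Prod>i<r. \<phi> i (s i) (z i))) = 0"
    and t: "t \<in> F"
  shows "c t = 0"
proof -
  have "(\<Sum>s\<in>{s\<in>F. \<forall>i\<in>{k..<r}. s i = t i}. c s * (\<Prod>i<k. \<phi> i (s i) (z i))) = 0"
    if "k \<le> r" for k z
    using that
  proof (induction k arbitrary: z t rule: inc_induct)
    case base
    have "{s\<in>F. \<forall>i\<in>{r..<r}. s i = t i} = F" by auto
    then show ?case using zero by simp
  next
    case (step k)
    let ?S = "{s\<in>F. \<forall>i\<in>{Suc k..<r}. s i = t i}"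
    let ?T = "\<lambda>e. {s\<in>?S. s k = e}"
    let ?c = "\<lambda>e. \<Sum>s\<in>?T e. c s * (\<Prod>i<k. \<phi> i (s i) (z i))"
    have finS: "finite ?S" using F by simp
    have "\<forall>e\<in>(\<lambda>s. s k) ` ?S. ?c e = 0"
    proof (rule ind)
      show "k < r" "finite ((\<lambda>s. s k) ` ?S)" using step finS by auto
      show "(\<lambda>s. s k) ` ?S \<subseteq> E k" using F(2) step(2) by (auto simp: PiE_iff)
      fix w
      have "0 = (\<Sum>s\<in>?S. c s * (\<Prod>i<Suc k. \<phi> i (s i) ((z(k := w)) i)))"
        by (rule step.IH[symmetric])
      also have "\<dots> = (\<Sum>s\<in>?S. c s * (\<Prod>i<k. \<phi> i (s i) (z i)) * \<phi> k (s k) w)"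
        by (intro sum.cong refl) simp
      also have "\<dots> = (\<Sum>e\<in>(\<lambda>s. s k) ` ?S. \<Sum>s\<in>?T e. c s * (\<Prod>i<k. \<phi> i (s i) (z i)) * \<phi> k (s k) w)"
        by (rule sum.image_gen[OF finS])
      also have "\<dots> = (\<Sum>e\<in>(\<lambda>s. s k) ` ?S. ?c e * \<phi> k e w)"
        by (intro sum.cong refl) (simp add: sum_distrib_right)
      finally show "(\<Sum>e\<in>(\<lambda>s. s k) ` ?S. ?c e * \<phi> k e w) = 0" by simp
    qed
    then have zero_coeff: "?c e = 0" if "e \<in> (\<lambda>s. s k) ` ?S" for e using that by (rule bspec)
    have eq: "{s\<in>F. \<forall>i\<in>{k..<r}. s i = t i} = ?T (t k)"
      using step(2) by (auto simp: Ball_def) (metis le_neq_implies_less Suc_leI)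
    show ?case
    proof (cases "t k \<in> (\<lambda>s. s k) ` ?S")
      case True
      then show ?thesis unfolding eq by (rule zero_coeff)
    next
      case False
      then have "?T (t k) = {}" by (auto simp del: image_iff intro: rev_image_eqI)
      then show ?thesis unfolding eq by (simp only: sum.empty)
    qed
  qed
  from this[of 0] have "(\<Sum>s\<in>{s\<in>F. \<forall>i\<in>{0..<r}. s i = t i}. c s) = 0" by simp
  moreover have "{s\<in>F. \<forall>i\<in>{0..<r}. s i = t i} = {t}"
  proof -
    have "s = t" if "s \<in> F" "\<forall>i\<in>{0..<r}. s i = t i" for s
      by (rule PiE_ext[where k = "{..<r}" and s = E]) (use that t F in auto)
    then show ?thesis using t by auto
  qed
  ultimately show ?thesis by simp
qed

declare carrier_product_group [simp del]

locale tensor_gwa =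
  fixes r :: nat and A :: "nat \<Rightarrow> ('k::field_char_0, 'b) module"
    and h g g' x y :: "nat \<Rightarrow> 'b" and \<theta> a :: "nat \<Rightarrow> int \<Rightarrow> 'k" and l :: "nat \<Rightarrow> 'k"
    and W :: "nat \<Rightarrow> nat \<Rightarrow> (int \<Rightarrow> 'k) set" and da :: "nat \<Rightarrow> nat"
    and m :: "nat \<Rightarrow> 'b \<Rightarrow> int \<Rightarrow> int \<Rightarrow> 'k"
  assumes r_pos: "0 < r"
    and rank_one: "i < r \<Longrightarrow> rank_one (A i) (h i) (g i) (g' i) (x i) (y i) (\<theta> i) (a i) (l i) (W i) (da i) (m i)"
begin

lemma A_k_alg: "i < r \<Longrightarrow> k_alg (A i)"
  by (rule rank_one.axioms(1)[OF rank_one])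

lemma coefficients: "i < r \<Longrightarrow> coefficient_functions (\<theta> i) (a i) (l i) (W i) (da i)"
  by (rule rank_one.axioms(2)[OF rank_one])

abbreviation D where "D \<equiv> big_tensor {..<r} A"
abbreviation incl where "incl \<equiv> tensor_incl {..<r} A"

interpretation T: presentation "product_group {..<r} A" "big_tensor_relations {..<r} A"
  by (rule big_tensor_presentation) (simp add: A_k_alg)

lemma D_eq: "D = T.P" by (simp add: big_tensor_def)

lemma D_k_alg: "k_alg D" unfolding D_eq by (rule T.P_k_alg)

interpretation D: k_alg D by (rule D_k_alg)

definition pure_tensors :: "(nat \<Rightarrow> 'b) set" where
  "pure_tensors = (\<Pi>\<^sub>E i\<in>{..<r}. carrier (A i))"

definition ten :: "(nat \<Rightarrow> 'b) \<Rightarrow> ((nat \<Rightarrow> 'b) \<Rightarrow>\<^sub>0 'k) set" where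
  "ten s = T.cls (basis s)"

lemma carrier_M: "carrier (product_group {..<r} A) = pure_tensors"
  by (simp add: product_group_def pure_tensors_def)

lemma pure_upd: "s \<in> pure_tensors \<Longrightarrow> i < r \<Longrightarrow> z \<in> carrier (A i) \<Longrightarrow> s(i := z) \<in> pure_tensors"
  by (auto simp: pure_tensors_def PiE_iff extensional_def)

lemma pure_mem: "s \<in> pure_tensors \<Longrightarrow> i < r \<Longrightarrow> s i \<in> carrier (A i)"
  by (auto simp: pure_tensors_def)

lemma ten_closed: "s \<in> pure_tensors \<Longrightarrow> ten s \<in> carrier D"
  unfolding ten_def D_eq by (intro T.cls_hom(1) T.basis_closed) (simp add: carrier_M)

lemma ten_add:
  assumes "s \<in> pure_tensors" "i < r" "z \<in> carrier (A i)" "w \<in> carrier (A i)"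
  shows "ten (s(i := z \<oplus>\<^bsub>A i\<^esub> w)) = ten (s(i := z)) \<oplus>\<^bsub>D\<^esub> ten (s(i := w))"
proof -
  have "(basis (s(i := z \<oplus>\<^bsub>A i\<^esub> w)), basis (s(i := z)) + basis (s(i := w))) \<in> big_tensor_relations {..<r} A"
    unfolding big_tensor_relations_def using assms by (auto simp: pure_tensors_def)
  note rel = T.cls_rel[OF this]
  have c: "basis (s(i := v)) \<in> carrier T.kM" if "v \<in> carrier (A i)" for v
    by (rule T.basis_closed) (simp only: carrier_M pure_upd[OF assms(1,2) that])
  show ?thesis
    unfolding ten_def D_eq rel by (rule T.cls_hom(2)[OF c[OF assms(3)] c[OF assms(4)]])
qed

lemma ten_smult:
  assumes "s \<in> pure_tensors" "i < r" "z \<in> carrier (A i)"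
  shows "ten (s(i := c \<odot>\<^bsub>A i\<^esub> z)) = c \<odot>\<^bsub>D\<^esub> ten (s(i := z))"
proof -
  have "(basis (s(i := c \<odot>\<^bsub>A i\<^esub> z)), Poly_Mapping.single (s(i := z)) c) \<in> big_tensor_relations {..<r} A"
    unfolding big_tensor_relations_def using assms unfolding pure_tensors_def
    by (intro UnI2 CollectI exI[of _ s] exI[of _ i] exI[of _ c] exI[of _ z]) simp
  note rel = T.cls_rel[OF this]
  show ?thesis
    unfolding ten_def D_eq rel by (rule T.cls_single) (simp only: carrier_M pure_upd[OF assms])
qed

lemma ten_mult:
  assumes "s \<in> pure_tensors" "t \<in> pure_tensors"
  shows "ten s \<otimes>\<^bsub>D\<^esub> ten t = ten (\<lambda>i\<in>{..<r}. s i \<otimes>\<^bsub>A i\<^esub> t i)"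
  unfolding ten_def D_eq using assms by (subst T.cls_basis_mult) (simp_all add: carrier_M)

lemma ten_one: "\<one>\<^bsub>D\<^esub> = ten (\<lambda>i\<in>{..<r}. \<one>\<^bsub>A i\<^esub>)"
  unfolding ten_def D_eq using T.cls_hom(4) by simp

lemma one_pure: "(\<lambda>i\<in>{..<r}. \<one>\<^bsub>A i\<^esub>) \<in> pure_tensors"
  unfolding pure_tensors_def using A_k_alg
  by (auto simp: k_alg_def ring.ring_simprules(6))

lemma incl_eq: "i < r \<Longrightarrow> incl i z = ten ((\<lambda>j\<in>{..<r}. \<one>\<^bsub>A j\<^esub>)(i := z))"
  unfolding tensor_incl_def ten_def by (intro arg_cong[of _ _ T.cls] arg_cong[of _ _ basis]) auto

lemma incl_closed: "i < r \<Longrightarrow> z \<in> carrier (A i) \<Longrightarrow> incl i z \<in> carrier D"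
  by (simp add: incl_eq ten_closed pure_upd one_pure)

lemma incl_ten:
  assumes "i < r" "z \<in> carrier (A i)" "s \<in> pure_tensors"
  shows "incl i z \<otimes>\<^bsub>D\<^esub> ten s = ten (s(i := z \<otimes>\<^bsub>A i\<^esub> s i))"
    "ten s \<otimes>\<^bsub>D\<^esub> incl i z = ten (s(i := s i \<otimes>\<^bsub>A i\<^esub> z))"
proof -
  let ?o = "(\<lambda>j\<in>{..<r}. \<one>\<^bsub>A j\<^esub>)(i := z)"
  have o: "?o \<in> pure_tensors" using assms by (simp add: pure_upd one_pure)
  have mon: "Group.monoid (A j)" if "j < r" for j using A_k_alg[OF that] by (simp add: k_alg_def ring.is_monoid)
  have ext: "s \<in> extensional {..<r}" using assms(3) by (auto simp: pure_tensors_def PiE_iff)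
  have "(\<lambda>j\<in>{..<r}. ?o j \<otimes>\<^bsub>A j\<^esub> s j) = s(i := z \<otimes>\<^bsub>A i\<^esub> s i)"
    "(\<lambda>j\<in>{..<r}. s j \<otimes>\<^bsub>A j\<^esub> ?o j) = s(i := s i \<otimes>\<^bsub>A i\<^esub> z)"
    using assms(1) ext pure_mem[OF assms(3)]
    by (auto simp: fun_eq_iff restrict_def extensional_def monoid.l_one[OF mon] monoid.r_one[OF mon])
  then show "incl i z \<otimes>\<^bsub>D\<^esub> ten s = ten (s(i := z \<otimes>\<^bsub>A i\<^esub> s i))"
    "ten s \<otimes>\<^bsub>D\<^esub> incl i z = ten (s(i := s i \<otimes>\<^bsub>A i\<^esub> z))"
    by (simp_all only: incl_eq[OF assms(1)] ten_mult[OF o assms(3)] ten_mult[OF assms(3) o])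
qed

lemma D_induct [consumes 1, case_names ten add smult]:
  assumes "u \<in> carrier D" "\<And>s. s \<in> pure_tensors \<Longrightarrow> Q (ten s)"
    "\<And>u v. u \<in> carrier D \<Longrightarrow> v \<in> carrier D \<Longrightarrow> Q u \<Longrightarrow> Q v \<Longrightarrow> Q (u \<oplus>\<^bsub>D\<^esub> v)"
    "\<And>c u. u \<in> carrier D \<Longrightarrow> Q u \<Longrightarrow> Q (c \<odot>\<^bsub>D\<^esub> u)"
  shows "Q u"
  using assms(1) unfolding D_eq
  by (induction u rule: T.P_induct) (use assms(2-) in \<open>auto simp: ten_def D_eq carrier_M\<close>)

definition prod_m :: "(nat \<Rightarrow> int) \<Rightarrow> (nat \<Rightarrow> int) \<Rightarrow> (nat \<Rightarrow> 'b) \<Rightarrow> 'k" where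
  "prod_m \<alpha> \<beta> s = (\<Prod>i<r. m i (s i) (\<alpha> i) (\<beta> i))"

lemma prod_m_upd:
  assumes "i < r"
  shows "prod_m \<alpha> \<beta> (s(i := z)) = m i z (\<alpha> i) (\<beta> i) * (\<Prod>j\<in>{..<r} - {i}. m j (s j) (\<alpha> j) (\<beta> j))"
proof -
  have "prod_m \<alpha> \<beta> (s(i := z)) = m i z (\<alpha> i) (\<beta> i) * (\<Prod>j\<in>{..<r} - {i}. m j ((s(i := z)) j) (\<alpha> j) (\<beta> j))"
    unfolding prod_m_def using assms by (subst prod.remove[of _ i]) auto
  then show ?thesis by (simp cong: prod.cong_simp)
qed

text \<open>Between monomials s and t a coordinate p_j turns into s_j p_j t_j, in which the
  coefficient \<open>m j\<close> is still linear.\<close>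

lemma prod_m_respects:
  assumes uv: "(u, v) \<in> big_tensor_relations {..<r} A" and s: "s \<in> pure_tensors" and t: "t \<in> pure_tensors"
  shows "lin_ext (prod_m \<alpha> \<beta>) (basis s \<otimes>\<^bsub>T.kM\<^esub> u \<otimes>\<^bsub>T.kM\<^esub> basis t) =
    lin_ext (prod_m \<alpha> \<beta>) (basis s \<otimes>\<^bsub>T.kM\<^esub> v \<otimes>\<^bsub>T.kM\<^esub> basis t)"
proof -
  define q where "q p = (\<lambda>j\<in>{..<r}. s j \<otimes>\<^bsub>A j\<^esub> p j \<otimes>\<^bsub>A j\<^esub> t j)" for p
  have sand: "basis s \<otimes>\<^bsub>T.kM\<^esub> Poly_Mapping.single p c \<otimes>\<^bsub>T.kM\<^esub> basis t = Poly_Mapping.single (q p) c" for p and c :: 'k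
    by (simp add: basis_def product_group_def q_def cong: restrict_cong)
  have q_upd: "q (p(i := z)) = (q p)(i := s i \<otimes>\<^bsub>A i\<^esub> z \<otimes>\<^bsub>A i\<^esub> t i)" if "i < r" for p i z
    using that by (auto simp: q_def fun_eq_iff)
  from uv show ?thesis
    unfolding big_tensor_relations_def
  proof (elim UnE CollectE exE conjE)
    fix p i z w
    assume e: "(u, v) = (basis (p(i := z \<oplus>\<^bsub>A i\<^esub> w)), basis (p(i := z)) + basis (p(i := w)))"
      "i \<in> {..<r}" "z \<in> carrier (A i)" "w \<in> carrier (A i)"
    then have i: "i < r" by simp
    interpret R: rank_one "A i" "h i" "g i" "g' i" "x i" "y i" "\<theta> i" "a i" "l i" "W i" "da i" "m i"
      by (rule rank_one[OF i])
    show ?thesis using e pure_mem[OF s i] pure_mem[OF t i]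
      by (simp add: monoid_alg_distrib basis_def[of "p(_ := _)"] sand q_upd[OF i] prod_m_upd[OF i]
          R.r_distr R.l_distr R.m_add distrib_right)
  next
    fix p i c z
    assume e: "(u, v) = (basis (p(i := c \<odot>\<^bsub>A i\<^esub> z)), Poly_Mapping.single (p(i := z)) c)"
      "i \<in> {..<r}" "z \<in> carrier (A i)"
    then have i: "i < r" by simp
    interpret R: rank_one "A i" "h i" "g i" "g' i" "x i" "y i" "\<theta> i" "a i" "l i" "W i" "da i" "m i"
      by (rule rank_one[OF i])
    show ?thesis using e pure_mem[OF s i] pure_mem[OF t i]
      by (simp add: basis_def[of "p(_ := _)"] sand q_upd[OF i] prod_m_upd[OF i]
          R.smult_mult_l R.smult_mult_r R.m_smult)
  qed
qed

text \<open>The matrix coefficient of the tensor product, which on a pure tensor is the product of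
  the rank one coefficients. A representative is chosen; \<open>mh_cls\<close> shows that the choice
  is immaterial.\<close>

definition mh :: "((nat \<Rightarrow> 'b) \<Rightarrow>\<^sub>0 'k) set \<Rightarrow> (nat \<Rightarrow> int) \<Rightarrow> (nat \<Rightarrow> int) \<Rightarrow> 'k" where
  "mh u \<alpha> \<beta> = lin_ext (prod_m \<alpha> \<beta>) (SOME f. f \<in> carrier T.kM \<and> T.cls f = u)"

lemma mh_cls: assumes "f \<in> carrier T.kM" shows "mh (T.cls f) \<alpha> \<beta> = lin_ext (prod_m \<alpha> \<beta>) f"
proof -
  let ?f = "SOME f'. f' \<in> carrier T.kM \<and> T.cls f' = T.cls f"
  have "?f \<in> carrier T.kM \<and> T.cls ?f = T.cls f" by (rule someI[of _ f]) (use assms in simp)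
  note f = conjunct1[OF this] conjunct2[OF this]
  show ?thesis unfolding mh_def
  proof (rule T.lin_ext_respects[OF _ f(1) assms f(2)])
    fix u v s t
    assume "(u, v) \<in> big_tensor_relations {..<r} A" "s \<in> carrier (product_group {..<r} A)"
      "t \<in> carrier (product_group {..<r} A)"
    then show "lin_ext (prod_m \<alpha> \<beta>) (basis s \<otimes>\<^bsub>T.kM\<^esub> u \<otimes>\<^bsub>T.kM\<^esub> basis t) =
        lin_ext (prod_m \<alpha> \<beta>) (basis s \<otimes>\<^bsub>T.kM\<^esub> v \<otimes>\<^bsub>T.kM\<^esub> basis t)"
      unfolding carrier_M by (rule prod_m_respects)
  qed
qed

lemma D_rep: assumes "u \<in> carrier D" obtains f where "f \<in> carrier T.kM" "u = T.cls f"
  using assms unfolding D_eq T.carrier_P by blast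

lemma mh_ten: "s \<in> pure_tensors \<Longrightarrow> mh (ten s) \<alpha> \<beta> = prod_m \<alpha> \<beta> s"
  unfolding ten_def by (subst mh_cls) (simp_all add: T.basis_closed carrier_M, simp add: basis_def)

lemma mh_add:
  assumes "u \<in> carrier D" "v \<in> carrier D" shows "mh (u \<oplus>\<^bsub>D\<^esub> v) \<alpha> \<beta> = mh u \<alpha> \<beta> + mh v \<alpha> \<beta>"
proof -
  obtain f f' where f: "f \<in> carrier T.kM" "u = T.cls f" "f' \<in> carrier T.kM" "v = T.cls f'"
    using assms D_rep by metis
  moreover have "f + f' \<in> carrier T.kM" using f T.kM.a_closed by (simp add: monoid_alg_simps(4))
  ultimately show ?thesis by (simp add: D_eq T.cls_hom(2)[symmetric] mh_cls)
qed

lemma mh_smult: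
  assumes "u \<in> carrier D" shows "mh (c \<odot>\<^bsub>D\<^esub> u) \<alpha> \<beta> = c * mh u \<alpha> \<beta>"
proof -
  obtain f where f: "f \<in> carrier T.kM" "u = T.cls f" using assms D_rep by metis
  then show ?thesis
    using mh_cls[OF T.kM.smult_closed[OF f(1), of c]]
    by (simp add: D_eq T.cls_hom(6)[symmetric] mh_cls) (simp add: monoid_alg_simps(5))
qed

lemma prod_m_shift:
  assumes "i < r"
  shows "prod_m (\<alpha>(i := n)) (\<beta>(i := b)) s =
    m i (s i) n b * (\<Prod>j\<in>{..<r} - {i}. m j (s j) (\<alpha> j) (\<beta> j))"
  using prod_m_upd[OF assms, of "\<alpha>(i := n)" "\<beta>(i := b)" s "s i"] by (simp cong: prod.cong_simp)

text \<open>One scheme for all generators: in coordinate i such an element multiplies by c and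
  translates the two arguments by p and q, and the other coordinates are left alone.\<close>

lemma mh_incl_l:
  assumes i: "i < r" and z: "z \<in> carrier (A i)" and u: "u \<in> carrier D"
    and formula: "\<And>w n b. w \<in> carrier (A i) \<Longrightarrow> m i (z \<otimes>\<^bsub>A i\<^esub> w) n b = c n b * m i w (n + p) (b + q)"
  shows "mh (incl i z \<otimes>\<^bsub>D\<^esub> u) \<alpha> \<beta> = c (\<alpha> i) (\<beta> i) * mh u (\<alpha>(i := \<alpha> i + p)) (\<beta>(i := \<beta> i + q))"
  using u
proof (induction u rule: D_induct)
  case (ten s)
  interpret R: k_alg "A i" by (rule A_k_alg[OF i])
  have "z \<otimes>\<^bsub>A i\<^esub> s i \<in> carrier (A i)" using z pure_mem[OF ten i] by simp
  then show ?case
    by (simp only: incl_ten(1)[OF i z ten] mh_ten[OF pure_upd[OF ten i]] mh_ten[OF ten] prod_m_upd[OF i]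
      formula[OF pure_mem[OF ten i]] prod_m_shift[OF i] mult.assoc)
next
  case (add u v)
  then show ?case using incl_closed[OF i z] by (simp add: D.r_distr mh_add distrib_left)
next
  case (smult d u)
  then show ?case using incl_closed[OF i z] by (simp add: D.smult_mult_r mh_smult)
qed

lemma mh_incl_r:
  assumes i: "i < r" and z: "z \<in> carrier (A i)" and u: "u \<in> carrier D"
    and formula: "\<And>w n b. w \<in> carrier (A i) \<Longrightarrow> m i (w \<otimes>\<^bsub>A i\<^esub> z) n b = c n b * m i w (n + p) (b + q)"
  shows "mh (u \<otimes>\<^bsub>D\<^esub> incl i z) \<alpha> \<beta> = c (\<alpha> i) (\<beta> i) * mh u (\<alpha>(i := \<alpha> i + p)) (\<beta>(i := \<beta> i + q))"
  using u
proof (induction u rule: D_induct)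
  case (ten s)
  interpret R: k_alg "A i" by (rule A_k_alg[OF i])
  have "s i \<otimes>\<^bsub>A i\<^esub> z \<in> carrier (A i)" using z pure_mem[OF ten i] by simp
  then show ?case
    by (simp only: incl_ten(2)[OF i z ten] mh_ten[OF pure_upd[OF ten i]] mh_ten[OF ten] prod_m_upd[OF i]
      formula[OF pure_mem[OF ten i]] prod_m_shift[OF i] mult.assoc)
next
  case (add u v)
  then show ?case using incl_closed[OF i z] by (simp add: D.l_distr mh_add distrib_left)
next
  case (smult d u)
  then show ?case using incl_closed[OF i z] by (simp add: D.smult_mult_l mh_smult)
qed

lemma mh_gens:
  assumes i: "i < r" and u: "u \<in> carrier D"
  shows "mh (incl i (h i) \<otimes>\<^bsub>D\<^esub> u) \<alpha> \<beta> = \<theta> i (\<beta> i) * mh u \<alpha> \<beta>"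
    "mh (u \<otimes>\<^bsub>D\<^esub> incl i (h i)) \<alpha> \<beta> = \<theta> i (\<beta> i - \<alpha> i) * mh u \<alpha> \<beta>"
    "mh (incl i (g i) \<otimes>\<^bsub>D\<^esub> u) \<alpha> \<beta> = l i powi (- \<beta> i) * mh u \<alpha> \<beta>"
    "mh (u \<otimes>\<^bsub>D\<^esub> incl i (g i)) \<alpha> \<beta> = l i powi (- (\<beta> i - \<alpha> i)) * mh u \<alpha> \<beta>"
    "mh (incl i (g' i) \<otimes>\<^bsub>D\<^esub> u) \<alpha> \<beta> = l i powi \<beta> i * mh u \<alpha> \<beta>"
    "mh (u \<otimes>\<^bsub>D\<^esub> incl i (g' i)) \<alpha> \<beta> = l i powi (\<beta> i - \<alpha> i) * mh u \<alpha> \<beta>"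
    "mh (incl i (x i) \<otimes>\<^bsub>D\<^esub> u) \<alpha> \<beta> = mh u (\<alpha>(i := \<alpha> i - 1)) (\<beta>(i := \<beta> i - 1))"
    "mh (u \<otimes>\<^bsub>D\<^esub> incl i (x i)) \<alpha> \<beta> = mh u (\<alpha>(i := \<alpha> i - 1)) \<beta>"
    "mh (incl i (y i) \<otimes>\<^bsub>D\<^esub> u) \<alpha> \<beta> = a i (\<beta> i) * mh u (\<alpha>(i := \<alpha> i + 1)) (\<beta>(i := \<beta> i + 1))"
    "mh (u \<otimes>\<^bsub>D\<^esub> incl i (y i)) \<alpha> \<beta> = a i (\<beta> i - \<alpha> i - 1) * mh u (\<alpha>(i := \<alpha> i + 1)) \<beta>"
proof -
  interpret R: rank_one "A i" "h i" "g i" "g' i" "x i" "y i" "\<theta> i" "a i" "l i" "W i" "da i" "m i"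
    by (rule rank_one[OF i])
  show "mh (incl i (h i) \<otimes>\<^bsub>D\<^esub> u) \<alpha> \<beta> = \<theta> i (\<beta> i) * mh u \<alpha> \<beta>"
    using mh_incl_l[OF i R.gens_closed(1) u, of "\<lambda>n b. \<theta> i b" 0 0] by (simp add: R.m_h)
  show "mh (u \<otimes>\<^bsub>D\<^esub> incl i (h i)) \<alpha> \<beta> = \<theta> i (\<beta> i - \<alpha> i) * mh u \<alpha> \<beta>"
    using mh_incl_r[OF i R.gens_closed(1) u, of "\<lambda>n b. \<theta> i (b - n)" 0 0] by (simp add: R.m_h)
  show "mh (incl i (g i) \<otimes>\<^bsub>D\<^esub> u) \<alpha> \<beta> = l i powi (- \<beta> i) * mh u \<alpha> \<beta>"
    using mh_incl_l[OF i R.gens_closed(2) u, of "\<lambda>n b. l i powi (- b)" 0 0] by (simp add: R.m_g)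
  show "mh (u \<otimes>\<^bsub>D\<^esub> incl i (g i)) \<alpha> \<beta> = l i powi (- (\<beta> i - \<alpha> i)) * mh u \<alpha> \<beta>"
    using mh_incl_r[OF i R.gens_closed(2) u, of "\<lambda>n b. l i powi (- (b - n))" 0 0] by (simp add: R.m_g)
  show "mh (incl i (g' i) \<otimes>\<^bsub>D\<^esub> u) \<alpha> \<beta> = l i powi \<beta> i * mh u \<alpha> \<beta>"
    using mh_incl_l[OF i R.gens_closed(3) u, of "\<lambda>n b. l i powi b" 0 0] by (simp add: R.m_g')
  show "mh (u \<otimes>\<^bsub>D\<^esub> incl i (g' i)) \<alpha> \<beta> = l i powi (\<beta> i - \<alpha> i) * mh u \<alpha> \<beta>"
    using mh_incl_r[OF i R.gens_closed(3) u, of "\<lambda>n b. l i powi (b - n)" 0 0] by (simp add: R.m_g')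
  show "mh (incl i (x i) \<otimes>\<^bsub>D\<^esub> u) \<alpha> \<beta> = mh u (\<alpha>(i := \<alpha> i - 1)) (\<beta>(i := \<beta> i - 1))"
    using mh_incl_l[OF i R.gens_closed(4) u, of "\<lambda>n b. 1" "- 1" "- 1"] by (simp add: R.m_x)
  show "mh (u \<otimes>\<^bsub>D\<^esub> incl i (x i)) \<alpha> \<beta> = mh u (\<alpha>(i := \<alpha> i - 1)) \<beta>"
    using mh_incl_r[OF i R.gens_closed(4) u, of "\<lambda>n b. 1" "- 1" 0] by (simp add: R.m_x)
  show "mh (incl i (y i) \<otimes>\<^bsub>D\<^esub> u) \<alpha> \<beta> = a i (\<beta> i) * mh u (\<alpha>(i := \<alpha> i + 1)) (\<beta>(i := \<beta> i + 1))"
    using mh_incl_l[OF i R.gens_closed(5) u, of "\<lambda>n b. a i b" 1 1] by (simp add: R.m_y)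
  show "mh (u \<otimes>\<^bsub>D\<^esub> incl i (y i)) \<alpha> \<beta> = a i (\<beta> i - \<alpha> i - 1) * mh u (\<alpha>(i := \<alpha> i + 1)) \<beta>"
    using mh_incl_r[OF i R.gens_closed(5) u, of "\<lambda>n b. a i (b - n - 1)" 1 0] by (simp add: R.m_y)
qed

lemma mh_one: "mh \<one>\<^bsub>D\<^esub> \<alpha> \<beta> = (if \<forall>i<r. \<alpha> i = 0 then 1 else 0)"
proof -
  have m1: "m i \<one>\<^bsub>A i\<^esub> (\<alpha> i) (\<beta> i) = (if \<alpha> i = 0 then 1 else 0)" if "i < r" for i
    by (rule rank_one.m_one[OF rank_one[OF that]])
  have "mh \<one>\<^bsub>D\<^esub> \<alpha> \<beta> = (\<Prod>i<r. if \<alpha> i = 0 then 1 else 0)"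
    unfolding ten_one mh_ten[OF one_pure] prod_m_def by (intro prod.cong) (simp_all add: m1)
  then show ?thesis by (auto simp: prod_zero_iff) 
qed

lemma mh_zero: "mh \<zero>\<^bsub>D\<^esub> \<alpha> \<beta> = 0"
  using mh_smult[of "\<zero>\<^bsub>D\<^esub>" 0] by simp

text \<open>An element is a combination of pure tensors of basis elements, and
  \<open>product_independent\<close>, with the pair (n, b) as variable of each factor, forces its
  coefficients to vanish.\<close>

lemma mh_injective:
  assumes u: "u \<in> carrier D" and zero: "\<And>\<alpha> \<beta>. mh u \<alpha> \<beta> = 0"
  shows "u = \<zero>\<^bsub>D\<^esub>"
proof -
  have "\<forall>i. \<exists>E. i < r \<longrightarrow> E \<subseteq> carrier (A i) \<and> k_span (A i) E = carrier (A i) \<and> (\<forall>F c. finite F \<longrightarrow> F \<subseteq> E \<longrightarrow>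
        (\<forall>n b. (\<Sum>e\<in>F. c e * m i e n b) = 0) \<longrightarrow> (\<forall>e\<in>F. c e = 0))"
  proof
    fix i
    show "\<exists>E. i < r \<longrightarrow> E \<subseteq> carrier (A i) \<and> k_span (A i) E = carrier (A i) \<and> (\<forall>F c. finite F \<longrightarrow> F \<subseteq> E \<longrightarrow>
        (\<forall>n b. (\<Sum>e\<in>F. c e * m i e n b) = 0) \<longrightarrow> (\<forall>e\<in>F. c e = 0))"
    proof (cases "i < r")
      case True
      then show ?thesis using rank_one.m_basis[OF rank_one[OF True]] by auto
    qed simp
  qed
  from choice[OF this] obtain E where E0: "\<forall>i. i < r \<longrightarrow> E i \<subseteq> carrier (A i) \<and> k_span (A i) (E i) = carrier (A i) \<and>
      (\<forall>F c. finite F \<longrightarrow> F \<subseteq> E i \<longrightarrow> (\<forall>n b. (\<Sum>e\<in>F. c e * m i e n b) = 0) \<longrightarrow> (\<forall>e\<in>F. c e = 0))"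
    by (rule exE)
  have E: "E i \<subseteq> carrier (A i)" "k_span (A i) (E i) = carrier (A i)" if "i < r" for i
    using E0 that by auto
  define Sp where "Sp = {T.cls f |f. Poly_Mapping.keys f \<subseteq> (\<Pi>\<^sub>E i\<in>{..<r}. E i)}"
  have PE: "(\<Pi>\<^sub>E i\<in>{..<r}. E i) \<subseteq> pure_tensors"
    unfolding pure_tensors_def by (rule PiE_mono) (use E in auto)
  have kc: "f \<in> carrier T.kM" if "Poly_Mapping.keys f \<subseteq> (\<Pi>\<^sub>E i\<in>{..<r}. E i)" for f :: "_ \<Rightarrow>\<^sub>0 'k"
    using that PE by (auto simp: monoid_alg_simps(1) carrier_M)
  have Sp: "k_subspace D Sp"
    unfolding k_subspace_def
  proof (intro conjI ballI allI)
    show "Sp \<subseteq> carrier D" unfolding Sp_def D_eq using T.cls_hom(1)[OF kc] by auto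
    have "T.cls 0 \<in> Sp" unfolding Sp_def by (intro CollectI exI[of _ 0]) simp
    then show "\<zero>\<^bsub>D\<^esub> \<in> Sp" using T.cls_hom(5) by (simp add: D_eq)
  next
    fix u v assume "u \<in> Sp" "v \<in> Sp"
    then obtain f f' where f: "u = T.cls f" "v = T.cls f'" "Poly_Mapping.keys f \<subseteq> (\<Pi>\<^sub>E i\<in>{..<r}. E i)"
      "Poly_Mapping.keys f' \<subseteq> (\<Pi>\<^sub>E i\<in>{..<r}. E i)" unfolding Sp_def by auto
    then show "u \<oplus>\<^bsub>D\<^esub> v \<in> Sp" unfolding Sp_def D_eq
      using T.cls_hom(2)[OF kc[OF f(3)] kc[OF f(4)]] keys_add_subset[OF f(3,4)] by auto
  next
    fix c u assume "u \<in> Sp"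
    then obtain f where f: "u = T.cls f" "Poly_Mapping.keys f \<subseteq> (\<Pi>\<^sub>E i\<in>{..<r}. E i)"
      unfolding Sp_def by auto
    have "c \<odot>\<^bsub>D\<^esub> u = T.cls (Poly_Mapping.map (\<lambda>x. c * x) f)"
      using T.cls_hom(6)[OF kc[OF f(2)]] f(1) by (simp add: D_eq monoid_alg_simps(5))
    then show "c \<odot>\<^bsub>D\<^esub> u \<in> Sp" unfolding Sp_def using order_trans[OF keys_map_scale f(2), of c] by (intro CollectI exI conjI) auto
  qed
  \<comment> \<open>Coordinates below k may still be arbitrary; they are expanded into basis
    elements one at a time.\<close>
  have ten_Sp: "ten s \<in> Sp" if "s \<in> pure_tensors" "\<forall>i. k \<le> i \<and> i < r \<longrightarrow> s i \<in> E i" "k \<le> r" for s k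
    using that
  proof (induction k arbitrary: s)
    case 0
    then have "s \<in> (\<Pi>\<^sub>E i\<in>{..<r}. E i)" by (auto simp: pure_tensors_def PiE_iff)
    then show ?case unfolding Sp_def ten_def by (intro CollectI exI[of _ "basis s"]) simp
  next
    case (Suc k)
    then have k: "k < r" by simp
    interpret R: k_alg "A k" by (rule A_k_alg[OF k])
    have "s k \<in> k_span (A k) (E k)" using pure_mem[OF Suc.prems(1) k] E(2)[OF k] by simp
    then have "ten (s(k := s k)) \<in> Sp"
    proof (rule R.k_span_map[OF _ E(1)[OF k] Sp])
      fix z assume z: "z \<in> E k"
      show "ten (s(k := z)) \<in> Sp"
      proof (rule Suc.IH[OF pure_upd[OF Suc.prems(1) k]])
        show "z \<in> carrier (A k)" using z E(1)[OF k] by blast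
        show "\<forall>i. k \<le> i \<and> i < r \<longrightarrow> (s(k := z)) i \<in> E i"
          using Suc.prems(2) z by (metis Suc_leI fun_upd_apply le_neq_implies_less)
        show "k \<le> r" using k by simp
      qed
    next
      show "ten (s(k := \<zero>\<^bsub>A k\<^esub>)) = \<zero>\<^bsub>D\<^esub>"
        using ten_smult[OF Suc.prems(1) k R.zero_closed, of 0]
          D.zero_smult[OF ten_closed[OF pure_upd[OF Suc.prems(1) k R.zero_closed]]]
        by (simp only: R.smult_zero)
    qed (simp_all only: ten_add[OF Suc.prems(1) k] ten_smult[OF Suc.prems(1) k])
    then show ?case by simp
  qed
  have "u \<in> Sp" using u
  proof (induction u rule: D_induct)
    case (ten s)
    then show ?case by (rule ten_Sp[of s r]) auto
  qed (use Sp in \<open>simp_all add: k_subspace_def\<close>)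
  then obtain f where f: "u = T.cls f" "Poly_Mapping.keys f \<subseteq> (\<Pi>\<^sub>E i\<in>{..<r}. E i)" unfolding Sp_def by auto
  have "Poly_Mapping.lookup f s = 0" if s: "s \<in> Poly_Mapping.keys f" for s
  proof (rule product_independent[where \<phi> = "\<lambda>i e (n, b). m i e n b" and F = "Poly_Mapping.keys f" and E = E and r = r])
    fix z :: "nat \<Rightarrow> int \<times> int"
    have "0 = mh u (\<lambda>i. fst (z i)) (\<lambda>i. snd (z i))" by (simp add: zero)
    also have "\<dots> = (\<Sum>s\<in>Poly_Mapping.keys f. Poly_Mapping.lookup f s * (\<Prod>i<r. case z i of (n, b) \<Rightarrow> m i (s i) n b))"
      unfolding f(1) mh_cls[OF kc[OF f(2)]] lin_ext_def prod_m_def by (simp add: case_prod_beta)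
    finally show "(\<Sum>s\<in>Poly_Mapping.keys f. Poly_Mapping.lookup f s * (\<Prod>i<r. case z i of (n, b) \<Rightarrow> m i (s i) n b)) = 0"
      by simp
  next
    fix i F and c :: "'b \<Rightarrow> 'k"
    assume iF: "i < r" "finite F" "F \<subseteq> E i" and z: "\<And>z. (\<Sum>e\<in>F. c e * (case z of (n, b) \<Rightarrow> m i e n b)) = 0"
    have "\<forall>n b. (\<Sum>e\<in>F. c e * m i e n b) = 0" using z[of "(_, _)"] by simp
    then show "\<forall>e\<in>F. c e = 0" using E0 iF by blast
  qed (use f s in auto)
  then have "f = 0" by (metis in_keys_iff keys_eq_empty all_not_in_conv)
  then show ?thesis using f(1) T.cls_hom(5) by (simp add: D_eq)
qed

end

section \<open>Degrees, supports and locality of matrix coefficients\<close>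

context tensor_gwa begin

interpretation D: k_alg D by (rule D_k_alg)

definition gens :: "((nat \<Rightarrow> 'b) \<Rightarrow>\<^sub>0 'k) set set" where
  "gens = (\<Union>i<r. incl i ` {h i, g i, g' i, x i, y i})"

abbreviation filt where "filt \<equiv> std_filtration D gens"

lemma local_gens: "i < r \<Longrightarrow> {h i, g i, g' i, x i, y i} \<subseteq> carrier (A i)"
  using rank_one.gens_closed[OF rank_one] by blast

lemma gens_closed: "gens \<subseteq> carrier D"
  unfolding gens_def
proof (rule UN_least)
  fix i assume "i \<in> {..<r}"
  then have i: "i < r" by simp
  show "incl i ` {h i, g i, g' i, x i, y i} \<subseteq> carrier D"
    by (rule image_subsetI) (rule incl_closed[OF i subsetD[OF local_gens[OF i]]])
qed

lemma finite_gens: "finite gens" by (simp add: gens_def)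

lemma gens_mem: "i < r \<Longrightarrow> z \<in> {h i, g i, g' i, x i, y i} \<Longrightarrow> incl i z \<in> gens"
  unfolding gens_def by blast

lemma gens_cases [consumes 1]:
  assumes "v \<in> gens"
  obtains i where "i < r" "v = incl i (h i)" | i where "i < r" "v = incl i (g i)"
    | i where "i < r" "v = incl i (g' i)" | i where "i < r" "v = incl i (x i)"
    | i where "i < r" "v = incl i (y i)"
  using assms unfolding gens_def by auto

lemma incl_hom:
  assumes i: "i < r" and z: "z \<in> carrier (A i)" and w: "w \<in> carrier (A i)"
  shows "incl i (z \<oplus>\<^bsub>A i\<^esub> w) = incl i z \<oplus>\<^bsub>D\<^esub> incl i w"
    "incl i (z \<otimes>\<^bsub>A i\<^esub> w) = incl i z \<otimes>\<^bsub>D\<^esub> incl i w"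
    "incl i (c \<odot>\<^bsub>A i\<^esub> z) = c \<odot>\<^bsub>D\<^esub> incl i z" "incl i \<one>\<^bsub>A i\<^esub> = \<one>\<^bsub>D\<^esub>"
proof -
  show "incl i (z \<oplus>\<^bsub>A i\<^esub> w) = incl i z \<oplus>\<^bsub>D\<^esub> incl i w"
    unfolding incl_eq[OF i] by (rule ten_add[OF one_pure i z w])
  show "incl i (c \<odot>\<^bsub>A i\<^esub> z) = c \<odot>\<^bsub>D\<^esub> incl i z"
    unfolding incl_eq[OF i] by (rule ten_smult[OF one_pure i z])
  let ?o = "\<lambda>j\<in>{..<r}. \<one>\<^bsub>A j\<^esub>"
  have "incl i z \<otimes>\<^bsub>D\<^esub> incl i w = incl i z \<otimes>\<^bsub>D\<^esub> ten (?o(i := w))" by (simp only: incl_eq[OF i])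
  also have "\<dots> = ten ((?o(i := w))(i := z \<otimes>\<^bsub>A i\<^esub> (?o(i := w)) i))"
    by (rule incl_ten(1)[OF i z pure_upd[OF one_pure i w]])
  also have "\<dots> = incl i (z \<otimes>\<^bsub>A i\<^esub> w)" by (simp only: incl_eq[OF i] fun_upd_upd fun_upd_same)
  finally show "incl i (z \<otimes>\<^bsub>A i\<^esub> w) = incl i z \<otimes>\<^bsub>D\<^esub> incl i w" ..
  have "?o(i := \<one>\<^bsub>A i\<^esub>) = ?o" using i by auto
  then show "incl i \<one>\<^bsub>A i\<^esub> = \<one>\<^bsub>D\<^esub>" by (simp only: incl_eq[OF i] ten_one)
qed

lemma filt_exhaust_closed:
  assumes "\<exists>n. u \<in> filt n" "\<exists>n. v \<in> filt n"
  shows "\<exists>n. u \<oplus>\<^bsub>D\<^esub> v \<in> filt n" "\<exists>n. u \<otimes>\<^bsub>D\<^esub> v \<in> filt n" "\<exists>n. c \<odot>\<^bsub>D\<^esub> u \<in> filt n"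
proof -
  obtain j k where jk: "u \<in> filt j" "v \<in> filt k" using assms by auto
  then have "u \<in> filt (max j k)" "v \<in> filt (max j k)"
    using D.filt_mono[OF gens_closed, of j "max j k"] D.filt_mono[OF gens_closed, of k "max j k"] by auto
  then show "\<exists>n. u \<oplus>\<^bsub>D\<^esub> v \<in> filt n" using D.filt_add[OF gens_closed] by blast
  show "\<exists>n. u \<otimes>\<^bsub>D\<^esub> v \<in> filt n" using D.filt_mult[OF gens_closed jk] by blast
  show "\<exists>n. c \<odot>\<^bsub>D\<^esub> u \<in> filt n" using D.filt_smult[OF gens_closed jk(1)] by blast
qed

lemma incl_filt:
  assumes i: "i < r" and z: "z \<in> carrier (A i)" shows "\<exists>n. incl i z \<in> filt n"
proof -
  interpret R: rank_one "A i" "h i" "g i" "g' i" "x i" "y i" "\<theta> i" "a i" "l i" "W i" "da i" "m i"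
    by (rule rank_one[OF i])
  obtain n where "z \<in> std_filtration (A i) {h i, g i, g' i, x i, y i} n"
    by (rule R.filt_generates[OF R.gens_generate z])
  then have "incl i z \<in> filt n" using local_gens[OF i]
  proof (induction rule: R.filt_induct)
    case (zero n)
    have "incl i \<zero>\<^bsub>A i\<^esub> = \<zero>\<^bsub>D\<^esub>"
      using incl_hom(3)[OF i R.zero_closed R.zero_closed, of 0] incl_closed[OF i R.zero_closed] by simp
    then show ?case by (simp only: D.filt_zero[OF gens_closed])
  next
    case (one n)
    show ?case using incl_hom(4)[OF i R.zero_closed R.zero_closed] by (simp only: D.filt_one[OF gens_closed])
  next
    case (gen n u v)
    have u: "u \<in> carrier (A i)" using gen(1) R.filt_closed[OF local_gens[OF i]] by blast
    have v: "v \<in> carrier (A i)" using gen(2) local_gens[OF i] by blast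
    have "incl i v \<in> insert \<one>\<^bsub>D\<^esub> gens"
    proof (cases "v = \<one>\<^bsub>A i\<^esub>")
      case True
      then show ?thesis using incl_hom(4)[OF i v v] by simp
    next
      case False
      then show ?thesis using gen(2) gens_mem[OF i] by blast
    qed
    then show ?case unfolding incl_hom(2)[OF i u v] by (rule D.filt_gen[OF gen(3)])
  next
    case (add n u v)
    then show ?case by (simp only: incl_hom(1)[OF i add(1,2)] D.filt_add[OF gens_closed])
  next
    case (smult n c u)
    then show ?case by (simp only: incl_hom(3)[OF i smult(1,1)] D.filt_smult[OF gens_closed])
  qed
  then show ?thesis by blast
qed

lemma gens_generate:
  assumes "u \<in> carrier D" shows "\<exists>n. u \<in> filt n"
  using assms
proof (induction u rule: D_induct)
  case (ten s)
  have "\<exists>n. ten (\<lambda>i\<in>{..<r}. if i < k then s i else \<one>\<^bsub>A i\<^esub>) \<in> filt n" if "k \<le> r" for k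
    using that
  proof (induction k)
    case 0
    have "(\<lambda>i\<in>{..<r}. if i < 0 then s i else \<one>\<^bsub>A i\<^esub>) = (\<lambda>i\<in>{..<r}. \<one>\<^bsub>A i\<^esub>)" by (rule restrict_ext) simp
    then show ?case using D.filt_one[OF gens_closed] ten_one by metis
  next
    case (Suc k)
    let ?s = "\<lambda>i\<in>{..<r}. if i < k then s i else \<one>\<^bsub>A i\<^esub>"
    have k: "k < r" using Suc by simp
    interpret R: k_alg "A k" by (rule A_k_alg[OF k])
    have sp: "?s \<in> pure_tensors"
      unfolding pure_tensors_def using pure_mem[OF ten] A_k_alg
      by (auto simp: k_alg_def ring.ring_simprules(6))
    have "(\<lambda>i\<in>{..<r}. if i < Suc k then s i else \<one>\<^bsub>A i\<^esub>) = ?s(k := s k \<otimes>\<^bsub>A k\<^esub> ?s k)"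
      using k pure_mem[OF ten k] by (auto simp: fun_eq_iff less_Suc_eq)
    then have "ten (\<lambda>i\<in>{..<r}. if i < Suc k then s i else \<one>\<^bsub>A i\<^esub>) = incl k (s k) \<otimes>\<^bsub>D\<^esub> ten ?s"
      by (simp only: incl_ten(1)[OF k pure_mem[OF ten k] sp])
    moreover have "\<exists>n. ten ?s \<in> filt n" by (rule Suc.IH) (use Suc.prems in simp)
    ultimately show ?case by (simp only: filt_exhaust_closed(2)[OF incl_filt[OF k pure_mem[OF ten k]]])
  qed
  from this[of r] have "\<exists>n. ten (\<lambda>i\<in>{..<r}. if i < r then s i else \<one>\<^bsub>A i\<^esub>) \<in> filt n" by simp
  moreover have "(\<lambda>i\<in>{..<r}. if i < r then s i else \<one>\<^bsub>A i\<^esub>) = s"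
    using ten by (auto simp: pure_tensors_def PiE_iff extensional_def fun_eq_iff)
  ultimately show ?case by simp
qed (use filt_exhaust_closed in blast)+

lemma mh_cong:
  assumes "\<And>i. i < r \<Longrightarrow> \<alpha> i = \<alpha>' i" "\<And>i. i < r \<Longrightarrow> \<beta> i = \<beta>' i"
  shows "mh u \<alpha> \<beta> = mh u \<alpha>' \<beta>'"
proof -
  have "prod_m \<alpha> \<beta> = prod_m \<alpha>' \<beta>'"
    unfolding prod_m_def by (intro ext prod.cong refl) (simp add: assms)
  then show ?thesis by (simp add: mh_def)
qed

text \<open>A common increment: multiplying by any generator raises the degree of a coefficient in
  each of its variables by at most this much.\<close>

definition dd :: nat where "dd = (\<Sum>i<r. da i)"

lemma W_mono: "i < r \<Longrightarrow> f \<in> W i N \<Longrightarrow> N \<le> N' \<Longrightarrow> f \<in> W i N'"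
  using coefficient_functions.W_mono[OF coefficients] by blast

text \<open>Seen as a function of the i-th coordinate alone, the factor is a multiplier of the
  spaces \<open>W i\<close> if j = i and a constant otherwise.\<close>

lemma W_coefficient:
  assumes i: "i < r" and f: "f \<in> W i N"
    and c: "\<And>N f. f \<in> W i N \<Longrightarrow> (\<lambda>b. c i b * f b) \<in> W i (N + da i)"
  shows "(\<lambda>b. c j ((\<beta>(i := b)) j - k) * f b) \<in> W i (N + dd)"
proof (cases "j = i")
  case True
  \<comment> \<open>Only the unshifted multiplier is known to act on the spaces, so f is shifted by
    k first and the product is shifted back.\<close>
  have "(\<lambda>b. c i b * f (b + k)) \<in> W i (N + da i)"
    by (rule c[OF coefficient_functions.W_shift[OF coefficients[OF i] f]])
  from coefficient_functions.W_shift[OF coefficients[OF i] this, of "- k"]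
  have "(\<lambda>b. c i (b - k) * f b) \<in> W i (N + da i)" by simp
  moreover have "da i \<le> dd" unfolding dd_def using i by (intro member_le_sum) auto
  ultimately show ?thesis using True i W_mono by simp
next
  case False
  then show ?thesis
    using coefficient_functions.W_scale[OF coefficients[OF i] f, of "c j (\<beta> j - k)"] i W_mono by simp
qed

lemmas W_coefficients =
  W_coefficient[where c = \<theta>, OF _ _ coefficient_functions.W_\<theta>[OF coefficients]]
  W_coefficient[where c = a, OF _ _ coefficient_functions.W_a[OF coefficients]]
  W_coefficient[where c = "\<lambda>j b. l j powi (- b)", OF _ _ coefficient_functions.W_l(1)[OF coefficients]]
  W_coefficient[where c = "\<lambda>j b. l j powi b", OF _ _ coefficient_functions.W_l(2)[OF coefficients]]

text \<open>N bounds the width of the band of nonzero coefficients and M, in units of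
  \<open>dd\<close>, their degrees. They are tracked separately because differences of
  multiplications by h raise only the second.\<close>

definition bounded :: "nat \<Rightarrow> nat \<Rightarrow> ((nat \<Rightarrow> 'b) \<Rightarrow>\<^sub>0 'k) set \<Rightarrow> bool" where
  "bounded N M u \<longleftrightarrow> u \<in> carrier D \<and> (\<forall>\<alpha> \<beta> i. i < r \<longrightarrow> mh u \<alpha> \<beta> \<noteq> 0 \<longrightarrow> \<bar>\<alpha> i\<bar> \<le> int N) \<and>
     (\<forall>\<alpha> \<beta> i. i < r \<longrightarrow> (\<lambda>b. mh u \<alpha> (\<beta>(i := b))) \<in> W i (dd * M))"

lemma bounded_right:
  assumes "bounded N M u" "j < r"
  shows "bounded N (M + 1) (u \<otimes>\<^bsub>D\<^esub> incl j (h j))" "bounded N (M + 1) (u \<otimes>\<^bsub>D\<^esub> incl j (g j))"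
    "bounded N (M + 1) (u \<otimes>\<^bsub>D\<^esub> incl j (g' j))" "bounded (N + 1) (M + 1) (u \<otimes>\<^bsub>D\<^esub> incl j (x j))"
    "bounded (N + 1) (M + 1) (u \<otimes>\<^bsub>D\<^esub> incl j (y j))"
proof -
  have u: "u \<in> carrier D" and supp: "\<And>\<alpha> \<beta> i. i < r \<Longrightarrow> mh u \<alpha> \<beta> \<noteq> 0 \<Longrightarrow> \<bar>\<alpha> i\<bar> \<le> int N"
    and sl: "\<And>\<alpha> \<beta> i. i < r \<Longrightarrow> (\<lambda>b. mh u \<alpha> (\<beta>(i := b))) \<in> W i (dd * M)"
    using assms by (auto simp: bounded_def)
  have c: "z \<in> {h j, g j, g' j, x j, y j} \<Longrightarrow> u \<otimes>\<^bsub>D\<^esub> incl j z \<in> carrier D" for z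
    using u incl_closed[OF assms(2)] local_gens[OF assms(2)] by blast
  have M: "dd * M + dd = dd * (M + 1)" by simp
  note W = W_coefficients[unfolded M]
  have shift: "\<bar>\<alpha> i\<bar> \<le> int (N + 1)" if "i < r" "mh u (\<alpha>(j := \<alpha> j + e)) \<beta> \<noteq> 0" "e = 1 \<or> e = - 1" for \<alpha> \<beta> i e
    using supp[OF that(1,2)] that(3) by (cases "i = j") auto
  show "bounded N (M + 1) (u \<otimes>\<^bsub>D\<^esub> incl j (h j))"
    unfolding bounded_def mh_gens[OF assms(2) u]
    using c supp W(1)[OF _ sl[of _ _]] by (auto simp: M)
  show "bounded N (M + 1) (u \<otimes>\<^bsub>D\<^esub> incl j (g j))"
    unfolding bounded_def mh_gens[OF assms(2) u]
    using c supp W(3)[OF _ sl[of _ _]] by (auto simp: M)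
  show "bounded N (M + 1) (u \<otimes>\<^bsub>D\<^esub> incl j (g' j))"
    unfolding bounded_def mh_gens[OF assms(2) u]
    using c supp W(4)[OF _ sl[of _ _]] by (auto simp: M)
  show "bounded (N + 1) (M + 1) (u \<otimes>\<^bsub>D\<^esub> incl j (x j))"
    unfolding bounded_def mh_gens[OF assms(2) u]
    using c shift[of _ _ "- 1"] W_mono[OF _ sl, of _ "dd * (M + 1)"] by auto
  have y: "a j ((\<beta>(i := b)) j - \<alpha> j - 1) = a j ((\<beta>(i := b)) j - (\<alpha> j + 1))" for \<beta> \<alpha> i b
    by (rule arg_cong[of _ _ "a j"]) simp
  show "bounded (N + 1) (M + 1) (u \<otimes>\<^bsub>D\<^esub> incl j (y j))"
    unfolding bounded_def mh_gens[OF assms(2) u] y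
    using c shift[of _ _ 1] W(2)[OF _ sl[of _ _]] by (auto simp: M)
qed

lemma bounded_mono: assumes "bounded N M u" "N \<le> N'" "M \<le> M'" shows "bounded N' M' u"
proof -
  have "dd * M \<le> dd * M'" using assms(3) by simp
  then show ?thesis using assms(1,2) W_mono unfolding bounded_def by (meson of_nat_mono order_trans)
qed

lemma bounded_add: assumes "bounded N M u" "bounded N M v" shows "bounded N M (u \<oplus>\<^bsub>D\<^esub> v)"
proof -
  have c: "u \<in> carrier D" "v \<in> carrier D" using assms by (simp_all add: bounded_def)
  show ?thesis
    unfolding bounded_def mh_add[OF c]
  proof (intro conjI allI impI)
    fix \<alpha> \<beta> i assume "i < r" "mh u \<alpha> \<beta> + mh v \<alpha> \<beta> \<noteq> 0"
    moreover then have "mh u \<alpha> \<beta> \<noteq> 0 \<or> mh v \<alpha> \<beta> \<noteq> 0" by auto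
    ultimately show "\<bar>\<alpha> i\<bar> \<le> int N" using assms by (auto simp: bounded_def)
  qed (use assms c in \<open>auto simp: bounded_def intro!: coefficient_functions.W_add[OF coefficients]\<close>)
qed

lemma bounded_smult: assumes "bounded N M u" shows "bounded N M (c \<odot>\<^bsub>D\<^esub> u)"
proof -
  have "u \<in> carrier D" using assms by (simp add: bounded_def)
  then show ?thesis using assms
    by (auto simp: bounded_def mh_smult intro!: coefficient_functions.W_scale[OF coefficients])
qed

lemma filt_bounded: assumes "u \<in> filt n" shows "bounded n n u"
  using assms gens_closed
proof (induction rule: D.filt_induct)
  case (zero n)
  then show ?case by (auto simp: bounded_def mh_zero intro: coefficient_functions.W_zero[OF coefficients])
next
  case (one n)
  then show ?case
    by (auto simp: bounded_def mh_one intro: coefficient_functions.W_zero[OF coefficients] coefficient_functions.W_const[OF coefficients] split: if_splits)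
next
  case (gen n u v)
  have "bounded (Suc n) (Suc n) u" by (rule bounded_mono[OF gen(3)]) auto
  moreover have "u \<in> carrier D" using gen(3) by (simp add: bounded_def)
  moreover have "bounded (Suc n) (Suc n) (u \<otimes>\<^bsub>D\<^esub> v)" if "v \<in> gens"
    using that
  proof (cases rule: gens_cases)
    case (1 i)
    then show ?thesis using bounded_mono[OF bounded_right(1)[OF gen(3)]] by simp
  next
    case (2 i)
    then show ?thesis using bounded_mono[OF bounded_right(2)[OF gen(3)]] by simp
  next
    case (3 i)
    then show ?thesis using bounded_mono[OF bounded_right(3)[OF gen(3)]] by simp
  next
    case (4 i)
    then show ?thesis using bounded_right(4)[OF gen(3)] by simp
  next
    case (5 i)
    then show ?thesis using bounded_right(5)[OF gen(3)] by simp
  qed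
  ultimately show ?case using gen(2) by auto
next
  case (add n u v)
  then show ?case by (simp add: bounded_add)
next
  case (smult n c u)
  then show ?case by (simp add: bounded_smult)
qed

text \<open>Locality: left multiplication by a generator moves the base point \<beta> by at most one
  step in one coordinate, so v w on the box of radius n depends only on w on the box of radius n +
  k.\<close>

lemma filt_zero_box:
  assumes "v \<in> filt k" "w \<in> carrier D"
    "\<And>\<alpha> \<beta>. (\<And>i. i < r \<Longrightarrow> \<bar>\<beta> i\<bar> \<le> int (n + k)) \<Longrightarrow> mh w \<alpha> \<beta> = 0"
    "\<And>i. i < r \<Longrightarrow> \<bar>\<beta> i\<bar> \<le> int n"
  shows "mh (v \<otimes>\<^bsub>D\<^esub> w) \<alpha> \<beta> = 0"
  using assms(1) gens_closed assms(2-)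
proof (induction arbitrary: w n \<alpha> \<beta> rule: D.filt_induct)
  case (zero k)
  then show ?case by (simp add: mh_zero)
next
  case (one k)
  have "mh w \<alpha> \<beta> = 0" by (rule one(2)) (use one(3) in fastforce)
  then show ?case using one(1) by simp
next
  case (gen k u v)
  have u: "u \<in> carrier D" using gen(1) D.filt_closed[OF gens_closed] by blast
  have v: "v \<in> carrier D" using gen(2) gens_closed by auto
  have upd: "mh w \<alpha>' (\<beta>'(j := \<beta>' j + e)) = 0"
    if "\<And>i. i < r \<Longrightarrow> \<bar>\<beta>' i\<bar> \<le> int (n + k)" "j < r" "e \<in> {-1, 0, 1}" for \<alpha>' \<beta>' e j
    by (rule gen.prems(2)) (use that(1)[of j] that in \<open>fastforce simp: algebra_simps\<close>)
  have same: "mh w \<alpha>' \<beta>' = 0" if "\<And>i. i < r \<Longrightarrow> \<bar>\<beta>' i\<bar> \<le> int (n + k)" for \<alpha>' \<beta>'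
    by (rule gen.prems(2)) (use that in \<open>fastforce simp: algebra_simps\<close>)
  have box: "mh (v \<otimes>\<^bsub>D\<^esub> w) \<alpha>' \<beta>' = 0" if b: "\<And>i. i < r \<Longrightarrow> \<bar>\<beta>' i\<bar> \<le> int (n + k)" for \<alpha>' \<beta>'
  proof (cases "v = \<one>\<^bsub>D\<^esub>")
    case True
    then show ?thesis using gen.prems(1) same[OF b] by simp
  next
    case False
    then have "v \<in> gens" using gen(2) by simp
    then show ?thesis
    proof (cases rule: gens_cases)
      case (4 i)
      have "mh w (\<alpha>'(i := \<alpha>' i - 1)) (\<beta>'(i := \<beta>' i + (- 1))) = 0"
        by (rule upd) (use b 4(1) in auto)
      then show ?thesis using mh_gens(7)[OF 4(1) gen.prems(1)] 4(2) by simp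
    next
      case (5 i)
      have "mh w (\<alpha>'(i := \<alpha>' i + 1)) (\<beta>'(i := \<beta>' i + 1)) = 0"
        by (rule upd) (use b 5(1) in auto)
      then show ?thesis using mh_gens(9)[OF 5(1) gen.prems(1)] 5(2) by simp
    qed (use mh_gens[OF _ gen.prems(1)] same[OF b] in auto)
  qed
  have "mh (u \<otimes>\<^bsub>D\<^esub> (v \<otimes>\<^bsub>D\<^esub> w)) \<alpha> \<beta> = 0"
    by (rule gen.IH[OF D.m_closed[OF v gen.prems(1)] box gen.prems(3)])
  then show ?case using u v gen.prems by (simp add: D.m_assoc)
next
  case (add k u v)
  have "mh (u \<otimes>\<^bsub>D\<^esub> w) \<alpha> \<beta> = 0" "mh (v \<otimes>\<^bsub>D\<^esub> w) \<alpha> \<beta> = 0"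
    by (rule add.IH[OF add.prems(1) add.prems(2,3)], assumption+)+
  then show ?case using add.hyps add.prems(1) by (simp add: D.l_distr mh_add)
next
  case (smult k c u)
  have "mh (u \<otimes>\<^bsub>D\<^esub> w) \<alpha> \<beta> = 0"
    by (rule smult.IH[OF smult.prems(1) smult.prems(2,3)], assumption+)
  then show ?case using smult.hyps smult.prems(1) by (simp add: D.smult_mult_l mh_smult)
qed

end

section \<open>Effective simplicity of the tensor product\<close>

lemma G_mpr_simps:
  "(\<xi>, \<pi>) \<in> carrier (G_mpr e p r) \<longleftrightarrow> \<xi> \<in> A_mpr e p r \<and> \<pi> permutes {..<r}"
  "\<one>\<^bsub>G_mpr e p r\<^esub> = (\<lambda>i\<in>{..<r}. 1, id)"
  by (simp_all add: G_mpr_def)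

lemma A_mpr_root: "\<xi> \<in> A_mpr e p r \<Longrightarrow> i < r \<Longrightarrow> \<xi> i ^ e = 1"
  by (auto simp: A_mpr_def roots_of_unity_def PiE_iff)

lemma finite_roots: assumes "0 < e" shows "finite (roots_of_unity e :: 'k::field set)"
proof -
  have "monom 1 e - 1 \<noteq> (0 :: 'k poly)"
  proof
    assume "monom 1 e - 1 = (0 :: 'k poly)"
    then have "coeff (monom 1 e - 1 :: 'k poly) e = 0" by simp
    then show False using assms by simp
  qed
  then have "finite {z::'k. poly (monom 1 e - 1) z = 0}" by (rule poly_roots_finite)
  moreover have "roots_of_unity e = {z::'k. poly (monom 1 e - 1) z = 0}"
    by (auto simp: roots_of_unity_def poly_monom)
  ultimately show ?thesis by (simp only:)
qed

lemma finite_G_mpr: assumes "0 < e" shows "finite (carrier (G_mpr e p r :: ((nat \<Rightarrow> 'k::field) \<times> (nat \<Rightarrow> nat)) monoid))"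
proof -
  have "finite (A_mpr e p r :: (nat \<Rightarrow> 'k) set)"
    by (rule finite_subset[of _ "{..<r} \<rightarrow>\<^sub>E roots_of_unity e"])
      (auto simp: A_mpr_def finite_roots[OF assms] intro!: finite_PiE)
  then show ?thesis by (simp add: G_mpr_def finite_permutations)
qed

text \<open>What left minus c times right multiplication by x_i does to a coefficient. A function
  killed by it is an eigenfunction of the shift with eigenvalue c.\<close>

definition dop :: "nat \<Rightarrow> 'k::field \<Rightarrow> ((nat \<Rightarrow> int) \<Rightarrow> 'k) \<Rightarrow> (nat \<Rightarrow> int) \<Rightarrow> 'k" where
  "dop i c P = (\<lambda>\<beta>. P (\<beta>(i := \<beta> i - 1)) - c * P \<beta>)"

lemma fold_dop_slice:
  "fold (\<lambda>c. dop i (d c)) cs P (\<beta>(i := b)) =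
   fold (\<lambda>c f b. f (b - 1) - d c * f b) cs (\<lambda>b. P (\<beta>(i := b))) b"
proof (induction cs arbitrary: P)
  case (Cons c cs)
  have "(\<lambda>b. dop i (d c) P (\<beta>(i := b))) = (\<lambda>b. P (\<beta>(i := b - 1)) - d c * P (\<beta>(i := b)))"
    by (simp only: dop_def fun_upd_upd fun_upd_same)
  then show ?case by (simp only: fold_Cons comp_apply Cons.IH)
qed simp

lemma fold_dop_zero: "fold (\<lambda>c. dop i (d c)) cs (\<lambda>_. 0) = (\<lambda>_. 0)"
  by (induction cs) (simp_all add: dop_def)

text \<open>If a product of operators kills P, the last nonzero intermediate value is killed by a
  single factor. For difference operators this produces an eigenfunction of the shift.\<close>

lemma fold_first_zero:
  assumes "fold F cs P = z" "P \<noteq> z"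
  shows "\<exists>cs1 c cs2. cs = cs1 @ c # cs2 \<and> fold F cs1 P \<noteq> z \<and> F c (fold F cs1 P) = z"
  using assms
proof (induction cs arbitrary: P)
  case (Cons c cs)
  show ?case
  proof (cases "F c P = z")
    case True
    then show ?thesis using Cons.prems by (intro exI[of _ "[]"] exI[of _ c] exI[of _ cs]) simp
  next
    case False
    from Cons.IH[OF _ this] Cons.prems obtain cs1 c' cs2 where
      "cs = cs1 @ c' # cs2" "fold F cs1 (F c P) \<noteq> z" "F c' (fold F cs1 (F c P)) = z" by auto
    then show ?thesis by (intro exI[of _ "c # cs1"] exI[of _ c'] exI[of _ cs2]) simp
  qed
qed simp

locale tensor_action = tensor_gwa r A h g g' x y \<theta> a l W da m
  for r :: nat and A :: "nat \<Rightarrow> ('k::field_char_0, 'b) module"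
    and h g g' x y and \<theta> a and l and W and da and m +
  fixes e p :: nat
    and \<rho> :: "(nat \<Rightarrow> 'k) \<times> (nat \<Rightarrow> nat) \<Rightarrow> ((nat \<Rightarrow> 'b) \<Rightarrow>\<^sub>0 'k) set \<Rightarrow> ((nat \<Rightarrow> 'b) \<Rightarrow>\<^sub>0 'k) set"
  assumes e_pos: "0 < e"
    and action: "natural_action e p r D (\<lambda>i. incl i (h i)) (\<lambda>i. incl i (x i)) (\<lambda>i. incl i (y i)) \<rho>"
begin

abbreviation Grp :: "((nat \<Rightarrow> 'k) \<times> (nat \<Rightarrow> nat)) monoid" where "Grp \<equiv> G_mpr e p r"

lemma galois: "galois_action D Grp \<rho> gens"
proof (rule galois_action.intro[OF D_k_alg], rule galois_action_axioms.intro)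
  show "group_action Grp (carrier D) \<rho>" using action by (simp add: natural_action_def)
  show "finite (carrier Grp)" by (rule finite_G_mpr[OF e_pos])
  show "\<rho> f \<in> alg_hom D D" if "f \<in> carrier Grp" for f
    using action that unfolding natural_action_def by fast
qed (simp_all add: finite_gens gens_closed gens_generate)

sublocale gal: galois_action D Grp \<rho> gens
  by (rule galois)

lemma rho_gens:
  assumes "(\<xi>, \<pi>) \<in> carrier Grp" "i < r"
  shows "\<rho> (\<xi>, \<pi>) (incl i (h i)) = incl (\<pi> i) (h (\<pi> i))"
    "\<rho> (\<xi>, \<pi>) (incl i (x i)) = \<xi> i \<odot>\<^bsub>D\<^esub> incl (\<pi> i) (x (\<pi> i))"
    "\<rho> (\<xi>, \<pi>) (incl i (y i)) = inverse (\<xi> i) \<odot>\<^bsub>D\<^esub> incl (\<pi> i) (y (\<pi> i))"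
  using action assms unfolding natural_action_def by fast+

lemma perm_less: "(\<xi>, \<pi>) \<in> carrier Grp \<Longrightarrow> i < r \<Longrightarrow> \<pi> i < r"
  using permutes_in_image[of \<pi> "{..<r}" i] by (simp add: G_mpr_simps)

lemma gens_in_D:
  assumes "i < r"
  shows "incl i (h i) \<in> carrier D" "incl i (g i) \<in> carrier D" "incl i (g' i) \<in> carrier D"
    "incl i (x i) \<in> carrier D" "incl i (y i) \<in> carrier D"
  using gens_mem[OF assms] by (auto intro!: subsetD[OF gens_closed])

lemma gens_filt: "v \<in> gens \<Longrightarrow> v \<in> filt 1"
  by (rule gal.filt_base[OF gens_closed]) simp

lemma gen_filt: "i < r \<Longrightarrow> z \<in> {h i, g i, g' i, x i, y i} \<Longrightarrow> incl i z \<in> filt 1"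
  by (rule gens_filt[OF gens_mem])

lemma one_Grp: "\<one>\<^bsub>Grp\<^esub> \<in> carrier Grp"
  using group.is_monoid[OF gal.group_G] by (rule monoid.one_closed)

abbreviation scal where "scal c \<equiv> c \<odot>\<^bsub>D\<^esub> \<one>\<^bsub>D\<^esub>"

lemma scal_filt: "scal c \<in> filt n"
  by (rule gal.filt_smult[OF gens_closed gal.filt_one[OF gens_closed]])

lemma scal_mult: "v \<in> carrier D \<Longrightarrow> scal c \<otimes>\<^bsub>D\<^esub> v = c \<odot>\<^bsub>D\<^esub> v"
  by (simp add: gal.smult_mult_l)

text \<open>A family indexed by the group is transformed by one twisted operator of degree N, the
  same at all components. Degrees add under composition, so effective simplicity can be proved as a
  chain of such steps with a running cost.\<close>

definition reach where
  "reach N w w' \<longleftrightarrow> (\<forall>f\<in>carrier Grp. w f \<in> carrier D) \<and> (\<exists>T\<in>gal.twisted N. \<forall>f\<in>carrier Grp. T f (w f) = w' f)"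

lemma reach_source: "reach N w w' \<Longrightarrow> f \<in> carrier Grp \<Longrightarrow> w f \<in> carrier D"
  by (simp add: reach_def)

lemma reach_closed: assumes "reach N w w'" "f \<in> carrier Grp" shows "w' f \<in> carrier D"
proof -
  obtain T where T: "T \<in> gal.twisted N" "\<forall>f\<in>carrier Grp. T f (w f) = w' f"
    using assms(1) by (auto simp: reach_def)
  then show ?thesis using gal.twisted_closed[OF T(1) assms(2) reach_source[OF assms]] assms(2) by simp
qed

lemma reach_trans: assumes "reach N w w'" "reach N' w' w''" shows "reach (N + N') w w''"
proof -
  obtain T where T: "T \<in> gal.twisted N" "\<forall>f\<in>carrier Grp. T f (w f) = w' f"
    using assms(1) by (auto simp: reach_def)
  obtain U where U: "U \<in> gal.twisted N'" "\<forall>f\<in>carrier Grp. U f (w' f) = w'' f"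
    using assms(2) by (auto simp: reach_def)
  obtain V where V: "V \<in> gal.twisted (N + N')" "\<forall>f\<in>carrier Grp. \<forall>v\<in>carrier D. V f v = U f (T f v)"
    using gal.twisted_comp[OF T(1) U(1)] by auto
  show ?thesis unfolding reach_def
  proof (intro conjI ballI bexI)
    fix f assume f: "f \<in> carrier Grp"
    show "w f \<in> carrier D" by (rule reach_source[OF assms(1) f])
    then show "V f (w f) = w'' f" using T(2) U(2) V(2) f by simp
  qed (rule V)
qed

lemma reach_mono: assumes "reach N w w'" "N \<le> N'" shows "reach N' w w'"
  using assms(1) gal.twisted_mono[OF _ assms(2)] unfolding reach_def by blast

text \<open>The two-term shape covers every step below: differences of left and right
  multiplications and, with entries 0 or 1, multiplications from one side.\<close>

lemma reach_op:
  assumes w: "\<And>f. f \<in> carrier Grp \<Longrightarrow> w f \<in> carrier D" and "u \<in> filt n" "v \<in> filt n" "b \<in> filt n"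
  shows "reach n w (\<lambda>f. u \<otimes>\<^bsub>D\<^esub> w f \<oplus>\<^bsub>D\<^esub> v \<otimes>\<^bsub>D\<^esub> (w f \<otimes>\<^bsub>D\<^esub> \<rho> f b))"
  unfolding reach_def
proof (intro conjI ballI bexI)
  let ?T = "\<lambda>f w. (u \<otimes>\<^bsub>D\<^esub> w \<otimes>\<^bsub>D\<^esub> \<rho> f \<one>\<^bsub>D\<^esub>) \<oplus>\<^bsub>D\<^esub> (v \<otimes>\<^bsub>D\<^esub> w \<otimes>\<^bsub>D\<^esub> \<rho> f b)"
  show "?T \<in> gal.twisted n"
    by (intro gal.twisted.add gal.twisted.base assms gal.filt_one[OF gens_closed])
  fix f assume f: "f \<in> carrier Grp"
  show "w f \<in> carrier D" by (rule w[OF f])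
  show "?T f (w f) = u \<otimes>\<^bsub>D\<^esub> w f \<oplus>\<^bsub>D\<^esub> v \<otimes>\<^bsub>D\<^esub> (w f \<otimes>\<^bsub>D\<^esub> \<rho> f b)"
    using w[OF f] f assms(2-4)[THEN gal.filt_carrier] by (simp add: gal.rho_hom gal.m_assoc)
qed

lemma reach_left:
  assumes w: "\<And>f. f \<in> carrier Grp \<Longrightarrow> w f \<in> carrier D" and u: "u \<in> filt n"
  obtains w' where "reach n w w'" "\<forall>f\<in>carrier Grp. w' f = u \<otimes>\<^bsub>D\<^esub> w f"
proof (rule that)
  have z: "\<zero>\<^bsub>D\<^esub> \<in> filt n" by (rule gal.filt_zero[OF gens_closed])
  show "reach n w (\<lambda>f. u \<otimes>\<^bsub>D\<^esub> w f \<oplus>\<^bsub>D\<^esub> \<zero>\<^bsub>D\<^esub> \<otimes>\<^bsub>D\<^esub> (w f \<otimes>\<^bsub>D\<^esub> \<rho> f \<zero>\<^bsub>D\<^esub>))"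
    by (rule reach_op[OF w u z z])
  show "\<forall>f\<in>carrier Grp. u \<otimes>\<^bsub>D\<^esub> w f \<oplus>\<^bsub>D\<^esub> \<zero>\<^bsub>D\<^esub> \<otimes>\<^bsub>D\<^esub> (w f \<otimes>\<^bsub>D\<^esub> \<rho> f \<zero>\<^bsub>D\<^esub>) = u \<otimes>\<^bsub>D\<^esub> w f"
    using w gal.filt_carrier[OF u] by (simp add: gal.rho_zero)
qed

lemma reach_right:
  assumes w: "\<And>f. f \<in> carrier Grp \<Longrightarrow> w f \<in> carrier D" and b: "b \<in> filt n"
  obtains w' where "reach n w w'" "\<forall>f\<in>carrier Grp. w' f = w f \<otimes>\<^bsub>D\<^esub> \<rho> f b"
proof (rule that)
  have z: "\<zero>\<^bsub>D\<^esub> \<in> filt n" by (rule gal.filt_zero[OF gens_closed])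
  have o: "\<one>\<^bsub>D\<^esub> \<in> filt n" by (rule gal.filt_one[OF gens_closed])
  show "reach n w (\<lambda>f. \<zero>\<^bsub>D\<^esub> \<otimes>\<^bsub>D\<^esub> w f \<oplus>\<^bsub>D\<^esub> \<one>\<^bsub>D\<^esub> \<otimes>\<^bsub>D\<^esub> (w f \<otimes>\<^bsub>D\<^esub> \<rho> f b))"
    by (rule reach_op[OF w z o b])
  show "\<forall>f\<in>carrier Grp. \<zero>\<^bsub>D\<^esub> \<otimes>\<^bsub>D\<^esub> w f \<oplus>\<^bsub>D\<^esub> \<one>\<^bsub>D\<^esub> \<otimes>\<^bsub>D\<^esub> (w f \<otimes>\<^bsub>D\<^esub> \<rho> f b) = w f \<otimes>\<^bsub>D\<^esub> \<rho> f b"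
    using w gal.filt_carrier[OF b] by (simp add: gal.rho_hom)
qed

lemma reach_refl: assumes "\<And>f. f \<in> carrier Grp \<Longrightarrow> w f \<in> carrier D"
  obtains w' where "reach 0 w w'" "\<forall>f\<in>carrier Grp. w' f = w f"
proof (rule reach_left[OF assms gal.filt_one[OF gens_closed]])
  fix w' assume w': "reach 0 w w'" "\<forall>f\<in>carrier Grp. w' f = \<one>\<^bsub>D\<^esub> \<otimes>\<^bsub>D\<^esub> w f"
  have "\<forall>f\<in>carrier Grp. w' f = w f" using w'(2) assms by simp
  then show thesis by (rule that[OF w'(1)])
qed

text \<open>If the slice vanished wherever f is nonzero, it would have finite support and hence be
  zero by \<open>W_finite\<close>.\<close>

lemma slice_nonzero:
  assumes sl: "(\<lambda>b. P (\<beta>(i := b))) \<in> W i N" and i: "i < r" and nz: "P \<beta> \<noteq> (0::'k)"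
    and fin: "finite {b. f b = (0::'k)}"
  shows "\<exists>b. f b \<noteq> 0 \<and> P (\<beta>(i := b)) \<noteq> 0"
proof (rule ccontr)
  assume neg: "\<not> (\<exists>b. f b \<noteq> 0 \<and> P (\<beta>(i := b)) \<noteq> 0)"
  have "finite {b. P (\<beta>(i := b)) \<noteq> 0}"
    by (rule finite_subset[OF _ fin]) (use neg in blast)
  from coefficient_functions.W_finite[OF coefficients[OF i] sl this] have "P (\<beta>(i := \<beta> i)) = 0" by (rule fun_cong)
  then show False using nz by (simp only: fun_upd_triv)
qed

text \<open>Right multiplication by y_i or x_i moves the support one step towards \<alpha> = 0, so K
  is the sum of the |\<alpha>_i|. With x_i the coefficient is only relabelled; with y_i a value of
  \<open>a\<close> appears as a factor, whose finitely many zeros are avoided by changing one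
  coordinate of \<beta>.\<close>

lemma step0:
  assumes "\<forall>f\<in>carrier Grp. bounded N M (w f)" and "mh (w \<one>\<^bsub>Grp\<^esub>) \<alpha> \<beta> \<noteq> 0"
    and "K = (\<Sum>i<r. nat \<bar>\<alpha> i\<bar>)"
  shows "\<exists>w'. reach K w w' \<and> (\<forall>f\<in>carrier Grp. bounded (N + K) (M + K) (w' f)) \<and>
    (\<exists>\<beta>. mh (w' \<one>\<^bsub>Grp\<^esub>) (\<lambda>_. 0) \<beta> \<noteq> 0)"
  using assms
proof (induction K arbitrary: w N M \<alpha> \<beta>)
  case 0
  then have z: "\<alpha> i = 0" if "i < r" for i using that by simp
  have w: "w f \<in> carrier D" if "f \<in> carrier Grp" for f using 0(1) that by (simp add: bounded_def)
  obtain w' where w': "reach 0 w w'" "\<forall>f\<in>carrier Grp. w' f = w f"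
    by (rule reach_refl[OF w])
  have "mh (w \<one>\<^bsub>Grp\<^esub>) (\<lambda>_. 0) \<beta> \<noteq> 0" using 0(2) mh_cong[of \<alpha> "\<lambda>_. 0" \<beta> \<beta>] z by simp
  then show ?case using w' 0(1) one_Grp by (intro exI[of _ w']) auto
next
  case (Suc K)
  have w: "w f \<in> carrier D" if "f \<in> carrier Grp" for f using Suc.prems(1) that by (simp add: bounded_def)
  obtain i where i: "i < r" "\<alpha> i \<noteq> 0"
  proof (rule ccontr)
    assume "\<not> thesis"
    with that have "(\<Sum>i<r. nat \<bar>\<alpha> i\<bar>) = 0" by (intro sum.neutral) auto
    then show False using Suc.prems(3) by simp
  qed
  define s :: int where "s = (if \<alpha> i > 0 then - 1 else 1)"
  let ?\<alpha> = "\<alpha>(i := \<alpha> i + s)"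
  have "(\<Sum>j<r. nat \<bar>\<alpha> j\<bar>) = nat \<bar>\<alpha> i\<bar> + (\<Sum>j\<in>{..<r} - {i}. nat \<bar>\<alpha> j\<bar>)"
    using i by (subst sum.remove[of _ i]) auto
  moreover have "(\<Sum>j<r. nat \<bar>?\<alpha> j\<bar>) = nat \<bar>?\<alpha> i\<bar> + (\<Sum>j\<in>{..<r} - {i}. nat \<bar>?\<alpha> j\<bar>)"
    using i by (subst sum.remove[of _ i]) auto
  moreover have "(\<Sum>j\<in>{..<r} - {i}. nat \<bar>?\<alpha> j\<bar>) = (\<Sum>j\<in>{..<r} - {i}. nat \<bar>\<alpha> j\<bar>)"
    by (intro sum.cong) auto
  moreover have "nat \<bar>\<alpha> i\<bar> = Suc (nat \<bar>?\<alpha> i\<bar>)" using i(2) by (auto simp: s_def)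
  ultimately have K: "K = (\<Sum>j<r. nat \<bar>?\<alpha> j\<bar>)" using Suc.prems(3) by linarith
  have "\<exists>w'. reach 1 w w' \<and> (\<forall>f\<in>carrier Grp. bounded (N + 1) (M + 1) (w' f)) \<and>
      (\<exists>\<beta>'. mh (w' \<one>\<^bsub>Grp\<^esub>) ?\<alpha> \<beta>' \<noteq> 0)"
  proof (cases "\<alpha> i > 0")
    case True
    obtain w' where w': "reach 1 w w'" "\<forall>f\<in>carrier Grp. w' f = w f \<otimes>\<^bsub>D\<^esub> \<rho> f (incl i (y i))"
      by (rule reach_right[OF w gen_filt[OF i(1), of "y i"]]) simp_all
    have "bounded (N + 1) (M + 1) (w' f)" if f: "f \<in> carrier Grp" for f
    proof (cases f)
      case (Pair \<xi> \<pi>)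
      have \<pi>: "\<pi> i < r" using perm_less[of \<xi> \<pi> i] f i(1) Pair by simp
      have "w' f = inverse (\<xi> i) \<odot>\<^bsub>D\<^esub> (w f \<otimes>\<^bsub>D\<^esub> incl (\<pi> i) (y (\<pi> i)))"
        using w'(2) rho_gens(3)[of \<xi> \<pi> i] f Pair i(1) w[OF f] gens_in_D(5)[OF \<pi>]
        by (simp add: gal.smult_mult_r)
      then show ?thesis
        using bounded_smult[OF bounded_right(5)[OF bspec[OF Suc.prems(1) f] \<pi>]] by simp
    qed
    moreover have "\<exists>\<beta>'. mh (w' \<one>\<^bsub>Grp\<^esub>) ?\<alpha> \<beta>' \<noteq> 0"
    proof -
      have "bounded N M (w \<one>\<^bsub>Grp\<^esub>)" by (rule bspec[OF Suc.prems(1) one_Grp])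
      then have sl: "(\<lambda>b. mh (w \<one>\<^bsub>Grp\<^esub>) \<alpha> (\<beta>(i := b))) \<in> W i (dd * M)" using i(1) by (simp add: bounded_def)
      have "{b. a i (b - \<alpha> i) = 0} \<subseteq> (\<lambda>b. b + \<alpha> i) ` {b. a i b = 0}"
      proof
        fix b assume "b \<in> {b. a i (b - \<alpha> i) = 0}"
        then show "b \<in> (\<lambda>b. b + \<alpha> i) ` {b. a i b = 0}" by (intro image_eqI[of _ _ "b - \<alpha> i"]) auto
      qed
      then have "finite {b. a i (b - \<alpha> i) = 0}"
        by (rule finite_subset) (simp add: coefficient_functions.a_finite[OF coefficients[OF i(1)]])
      from slice_nonzero[where P = "mh (w \<one>\<^bsub>Grp\<^esub>) \<alpha>", OF sl i(1) Suc.prems(2) this] obtain b where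
        b: "a i (b - \<alpha> i) \<noteq> 0" "mh (w \<one>\<^bsub>Grp\<^esub>) \<alpha> (\<beta>(i := b)) \<noteq> 0" by blast
      have "mh (w' \<one>\<^bsub>Grp\<^esub>) ?\<alpha> (\<beta>(i := b)) = mh (w \<one>\<^bsub>Grp\<^esub> \<otimes>\<^bsub>D\<^esub> incl i (y i)) ?\<alpha> (\<beta>(i := b))"
        using bspec[OF w'(2) one_Grp] by (simp only: gal.rho_one[OF gens_in_D(5)[OF i(1)]])
      also have "\<dots> = a i (b - \<alpha> i) * mh (w \<one>\<^bsub>Grp\<^esub>) \<alpha> (\<beta>(i := b))"
        unfolding mh_gens(10)[OF i(1) w[OF one_Grp]] using True by (simp add: s_def)
      finally show ?thesis using b by (intro exI[of _ "\<beta>(i := b)"]) simp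
    qed
    ultimately show ?thesis using w'(1) by blast
  next
    case False
    obtain w' where w': "reach 1 w w'" "\<forall>f\<in>carrier Grp. w' f = w f \<otimes>\<^bsub>D\<^esub> \<rho> f (incl i (x i))"
      by (rule reach_right[OF w gen_filt[OF i(1), of "x i"]]) simp_all
    have "bounded (N + 1) (M + 1) (w' f)" if f: "f \<in> carrier Grp" for f
    proof (cases f)
      case (Pair \<xi> \<pi>)
      have \<pi>: "\<pi> i < r" using perm_less[of \<xi> \<pi> i] f i(1) Pair by simp
      have "w' f = \<xi> i \<odot>\<^bsub>D\<^esub> (w f \<otimes>\<^bsub>D\<^esub> incl (\<pi> i) (x (\<pi> i)))"
        using w'(2) rho_gens(2)[of \<xi> \<pi> i] f Pair i(1) w[OF f] gens_in_D(4)[OF \<pi>]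
        by (simp add: gal.smult_mult_r)
      then show ?thesis
        using bounded_smult[OF bounded_right(4)[OF bspec[OF Suc.prems(1) f] \<pi>]] by simp
    qed
    moreover have "mh (w' \<one>\<^bsub>Grp\<^esub>) ?\<alpha> \<beta> = mh (w \<one>\<^bsub>Grp\<^esub> \<otimes>\<^bsub>D\<^esub> incl i (x i)) ?\<alpha> \<beta>"
      using bspec[OF w'(2) one_Grp] by (simp only: gal.rho_one[OF gens_in_D(4)[OF i(1)]])
    then have "mh (w' \<one>\<^bsub>Grp\<^esub>) ?\<alpha> \<beta> = mh (w \<one>\<^bsub>Grp\<^esub>) \<alpha> \<beta>"
      unfolding mh_gens(8)[OF i(1) w[OF one_Grp]] using False by (simp add: s_def)
    then have "mh (w' \<one>\<^bsub>Grp\<^esub>) ?\<alpha> \<beta> \<noteq> 0" using Suc.prems(2) by simp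
    ultimately show ?thesis using w'(1) by blast
  qed
  then obtain w' \<beta>' where w': "reach 1 w w'" "\<forall>f\<in>carrier Grp. bounded (N + 1) (M + 1) (w' f)"
    "mh (w' \<one>\<^bsub>Grp\<^esub>) ?\<alpha> \<beta>' \<noteq> 0" by blast
  from Suc.IH[OF w'(2,3) K] obtain w'' where w'': "reach K w' w''"
    "\<forall>f\<in>carrier Grp. bounded (N + 1 + K) (M + 1 + K) (w'' f)" "\<exists>\<beta>. mh (w'' \<one>\<^bsub>Grp\<^esub>) (\<lambda>_. 0) \<beta> \<noteq> 0"
    by blast
  then show ?case using reach_trans[OF w'(1) w''(1)] by (intro exI[of _ w'']) simp
qed

end

section \<open>Removing permutations, nondiagonal coefficients and diagonal group elements\<close>

context tensor_action begin

text \<open>The operator is h_i w - q w - c w g(h_k), where \<theta>_i(b + j) = c \<theta>_i(b) + q.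
  If the permutation of g sends k to i it multiplies by \<theta>_i(\<beta>_i) - q - c
  \<theta>_i(\<beta>_i - \<alpha>_i), which is zero for \<alpha>_i = j. At the unit of the group and
  \<alpha> = 0 the factor is \<theta>_i(\<beta>_i) - q - c \<theta>_k(\<beta>_k): nonzero by
  injectivity if i = k and j /= 0, and after a change of \<beta>_i if i /= k.\<close>

lemma diag_step:
  assumes B: "\<forall>f\<in>carrier Grp. bounded N M (w f)" and nz: "mh (w \<one>\<^bsub>Grp\<^esub>) (\<lambda>_. 0) \<beta> \<noteq> 0"
    and i: "i < r" and k: "k < r" and ikj: "i \<noteq> k \<or> j \<noteq> 0"
  shows "\<exists>w'. reach 1 w w' \<and> (\<forall>f\<in>carrier Grp. bounded N (M + 1) (w' f)) \<and>
    (\<exists>\<beta>. mh (w' \<one>\<^bsub>Grp\<^esub>) (\<lambda>_. 0) \<beta> \<noteq> 0) \<and>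
    (\<forall>f\<in>carrier Grp. \<forall>\<alpha> \<beta>. mh (w f) \<alpha> \<beta> = 0 \<longrightarrow> mh (w' f) \<alpha> \<beta> = 0) \<and>
    (\<forall>f\<in>carrier Grp. snd f k = i \<longrightarrow> (\<forall>\<alpha> \<beta>. \<alpha> i = j \<longrightarrow> mh (w' f) \<alpha> \<beta> = 0))"
proof -
  have w: "w f \<in> carrier D" if "f \<in> carrier Grp" for f using B that by (simp add: bounded_def)
  obtain c q where cq: "\<forall>b. \<theta> i (b + j) = c * \<theta> i b + q"
    using coefficient_functions.\<theta>_affine[OF coefficients[OF i]] by blast
  let ?u = "incl i (h i) \<oplus>\<^bsub>D\<^esub> scal (- q)"
  have hi: "incl i (h i) \<in> filt 1" and hk: "incl k (h k) \<in> filt 1"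
    by (rule gen_filt[OF i], simp, rule gen_filt[OF k], simp)
  have u: "?u \<in> filt 1" by (rule gal.filt_add[OF gens_closed hi scal_filt])
  define w' where "w' = (\<lambda>f. ?u \<otimes>\<^bsub>D\<^esub> w f \<oplus>\<^bsub>D\<^esub> scal (- c) \<otimes>\<^bsub>D\<^esub> (w f \<otimes>\<^bsub>D\<^esub> \<rho> f (incl k (h k))))"
  have r: "reach 1 w w'" unfolding w'_def by (rule reach_op[OF w u scal_filt hk])
  have formula: "mh (w' f) \<alpha> \<beta> = \<theta> i (\<beta> i) * mh (w f) \<alpha> \<beta> +
      ((- q) * mh (w f) \<alpha> \<beta> + (- c) * (\<theta> (snd f k) (\<beta> (snd f k) - \<alpha> (snd f k)) * mh (w f) \<alpha> \<beta>))"
    if f: "f \<in> carrier Grp" for f \<alpha> \<beta>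
  proof (cases f)
    case (Pair \<xi> \<pi>)
    have \<pi>: "\<pi> k < r" using perm_less[of \<xi> \<pi> k] f k Pair by simp
    have eq: "w' f = (incl i (h i) \<otimes>\<^bsub>D\<^esub> w f \<oplus>\<^bsub>D\<^esub> (- q) \<odot>\<^bsub>D\<^esub> w f) \<oplus>\<^bsub>D\<^esub>
        (- c) \<odot>\<^bsub>D\<^esub> (w f \<otimes>\<^bsub>D\<^esub> incl (\<pi> k) (h (\<pi> k)))"
      using rho_gens(1)[of \<xi> \<pi> k] f Pair k w[OF f] gens_in_D(1)[OF \<pi>] gens_in_D(1)[OF i]
      by (simp add: w'_def gal.l_distr scal_mult)
    show ?thesis
      unfolding eq using w[OF f] gens_in_D(1)[OF \<pi>] gens_in_D(1)[OF i] Pair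
      by (simp add: mh_add mh_smult mh_gens(1)[OF i] mh_gens(2)[OF \<pi>])
  qed
  have "bounded N (M + 1) (w' f)" if f: "f \<in> carrier Grp" for f
    unfolding bounded_def
  proof (intro conjI allI impI)
    have Bf: "bounded N M (w f)" using B f by blast
    show "w' f \<in> carrier D" by (rule reach_closed[OF r f])
    fix \<alpha> \<beta> i' assume i': "i' < r"
    show "\<bar>\<alpha> i'\<bar> \<le> int N" if "mh (w' f) \<alpha> \<beta> \<noteq> 0"
    proof -
      have "mh (w f) \<alpha> \<beta> \<noteq> 0" using that unfolding formula[OF f] by auto
      then show ?thesis using Bf i' by (simp add: bounded_def)
    qed
    have sl: "(\<lambda>b. mh (w f) \<alpha> (\<beta>(i' := b))) \<in> W i' (dd * M)" using Bf i' by (simp add: bounded_def)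
    have M: "dd * M + dd = dd * (M + 1)" by simp
    note WW = coefficient_functions.W_add[OF coefficients[OF i']] coefficient_functions.W_scale[OF coefficients[OF i']]
    have 1: "(\<lambda>b. \<theta> i ((\<beta>(i' := b)) i) * mh (w f) \<alpha> (\<beta>(i' := b))) \<in> W i' (dd * (M + 1))"
      using W_coefficients(1)[OF i' sl i', of i \<beta> 0] unfolding M by simp
    have 2: "(\<lambda>b. \<theta> (snd f k) ((\<beta>(i' := b)) (snd f k) - \<alpha> (snd f k)) * mh (w f) \<alpha> (\<beta>(i' := b))) \<in> W i' (dd * (M + 1))"
      using W_coefficients(1)[OF i' sl i', of "snd f k" \<beta> "\<alpha> (snd f k)"] unfolding M .
    have 3: "(\<lambda>b. mh (w f) \<alpha> (\<beta>(i' := b))) \<in> W i' (dd * (M + 1))" by (rule W_mono[OF i' sl]) simp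
    show "(\<lambda>b. mh (w' f) \<alpha> (\<beta>(i' := b))) \<in> W i' (dd * (M + 1))"
      unfolding formula[OF f] by (intro WW 1 2 3)
  qed
  moreover have "\<exists>\<beta>. mh (w' \<one>\<^bsub>Grp\<^esub>) (\<lambda>_. 0) \<beta> \<noteq> 0"
  proof -
    have f1: "mh (w' \<one>\<^bsub>Grp\<^esub>) (\<lambda>_. 0) \<beta> = (\<theta> i (\<beta> i) - (c * \<theta> k (\<beta> k) + q)) * mh (w \<one>\<^bsub>Grp\<^esub>) (\<lambda>_. 0) \<beta>" for \<beta>
      unfolding formula[OF one_Grp] by (simp add: G_mpr_simps algebra_simps)
    note inj = injD[OF coefficient_functions.\<theta>_inj[OF coefficients[OF i]]]
    show ?thesis
    proof (cases "i = k")
      case True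
      then have "\<theta> i (\<beta> i) - (c * \<theta> k (\<beta> k) + q) = \<theta> i (\<beta> i) - \<theta> i (\<beta> i + j)" using cq by simp
      also have "\<dots> \<noteq> 0" using inj[of "\<beta> i" "\<beta> i + j"] ikj True by auto
      finally show ?thesis using f1[of \<beta>] nz by (intro exI[of _ \<beta>]) simp
    next
      case False
      have "{b. \<theta> i b - (c * \<theta> k (\<beta> k) + q) = 0} \<subseteq> \<theta> i -` {c * \<theta> k (\<beta> k) + q}" by auto
      then have fin: "finite {b. \<theta> i b - (c * \<theta> k (\<beta> k) + q) = 0}"
        by (rule finite_subset) (simp add: finite_vimageI coefficient_functions.\<theta>_inj[OF coefficients[OF i]])
      have sl: "(\<lambda>b. mh (w \<one>\<^bsub>Grp\<^esub>) (\<lambda>_. 0) (\<beta>(i := b))) \<in> W i (dd * M)"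
        using B one_Grp i by (simp add: bounded_def)
      from slice_nonzero[where P = "mh (w \<one>\<^bsub>Grp\<^esub>) (\<lambda>_. 0)", OF sl i nz fin] obtain b where
        b: "\<theta> i b - (c * \<theta> k (\<beta> k) + q) \<noteq> 0" "mh (w \<one>\<^bsub>Grp\<^esub>) (\<lambda>_. 0) (\<beta>(i := b)) \<noteq> 0" by blast
      show ?thesis
        by (rule exI[of _ "\<beta>(i := b)"]) (use f1[of "\<beta>(i := b)"] False b in auto)
    qed
  qed
  moreover have "mh (w' f) \<alpha> \<beta> = 0" if "f \<in> carrier Grp" "mh (w f) \<alpha> \<beta> = 0" for f \<alpha> \<beta>
    unfolding formula[OF that(1)] that(2) by simp
  moreover have "mh (w' f) \<alpha> \<beta> = 0" if "f \<in> carrier Grp" "snd f k = i" "\<alpha> i = j" for f \<alpha> \<beta>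
  proof -
    have "\<theta> i (\<beta> i) = c * \<theta> i (\<beta> i - j) + q" using cq[rule_format, of "\<beta> i - j"] by simp
    then show ?thesis unfolding formula[OF that(1)] that(2,3) by (simp add: algebra_simps)
  qed
  ultimately show ?thesis using r by (intro exI[of _ w'] conjI) blast+
qed

lemma diag_list:
  assumes "\<forall>f\<in>carrier Grp. bounded N M (w f)" and "mh (w \<one>\<^bsub>Grp\<^esub>) (\<lambda>_. 0) \<beta> \<noteq> 0"
    and "\<forall>(i, k, j)\<in>set ts. i < r \<and> k < r \<and> (i \<noteq> k \<or> j \<noteq> 0)"
  shows "\<exists>w'. reach (length ts) w w' \<and> (\<forall>f\<in>carrier Grp. bounded N (M + length ts) (w' f)) \<and>
    (\<exists>\<beta>. mh (w' \<one>\<^bsub>Grp\<^esub>) (\<lambda>_. 0) \<beta> \<noteq> 0) \<and>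
    (\<forall>f\<in>carrier Grp. \<forall>\<alpha> \<beta>. mh (w f) \<alpha> \<beta> = 0 \<longrightarrow> mh (w' f) \<alpha> \<beta> = 0) \<and>
    (\<forall>(i, k, j)\<in>set ts.
      (\<forall>f\<in>carrier Grp. snd f k = i \<longrightarrow> (\<forall>\<alpha> \<beta>. \<alpha> i = j \<longrightarrow> mh (w' f) \<alpha> \<beta> = 0)))"
  using assms
proof (induction ts arbitrary: w M \<beta>)
  case Nil
  have w: "w f \<in> carrier D" if "f \<in> carrier Grp" for f using Nil(1) that by (simp add: bounded_def)
  obtain w' where w': "reach 0 w w'" "\<forall>f\<in>carrier Grp. w' f = w f"
    by (rule reach_refl[OF w])
  show ?case using w' Nil(1,2) one_Grp by (intro exI[of _ w']) auto
next
  case (Cons t ts)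
  obtain i k j where t: "t = (i, k, j)" by (cases t) auto
  then have ikj: "i < r" "k < r" "i \<noteq> k \<or> j \<noteq> 0" using Cons.prems(3) by auto
  from diag_step[OF Cons.prems(1,2) ikj] obtain w1 \<beta>1 where w1: "reach 1 w w1"
    "\<forall>f\<in>carrier Grp. bounded N (M + 1) (w1 f)" "mh (w1 \<one>\<^bsub>Grp\<^esub>) (\<lambda>_. 0) \<beta>1 \<noteq> 0"
    "\<forall>f\<in>carrier Grp. \<forall>\<alpha> \<beta>. mh (w f) \<alpha> \<beta> = 0 \<longrightarrow> mh (w1 f) \<alpha> \<beta> = 0"
    "\<forall>f\<in>carrier Grp. snd f k = i \<longrightarrow> (\<forall>\<alpha> \<beta>. \<alpha> i = j \<longrightarrow> mh (w1 f) \<alpha> \<beta> = 0)"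
    by (elim exE conjE)
  have prem: "\<forall>(i, k, j)\<in>set ts. i < r \<and> k < r \<and> (i \<noteq> k \<or> j \<noteq> 0)" using Cons.prems(3) by simp
  from Cons.IH[OF w1(2,3) prem] obtain w2 \<beta>2 where w2: "reach (length ts) w1 w2"
    "\<forall>f\<in>carrier Grp. bounded N (M + 1 + length ts) (w2 f)" "mh (w2 \<one>\<^bsub>Grp\<^esub>) (\<lambda>_. 0) \<beta>2 \<noteq> 0"
    "\<forall>f\<in>carrier Grp. \<forall>\<alpha> \<beta>. mh (w1 f) \<alpha> \<beta> = 0 \<longrightarrow> mh (w2 f) \<alpha> \<beta> = 0"
    "\<forall>(i, k, j)\<in>set ts.
      (\<forall>f\<in>carrier Grp. snd f k = i \<longrightarrow> (\<forall>\<alpha> \<beta>. \<alpha> i = j \<longrightarrow> mh (w2 f) \<alpha> \<beta> = 0))"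
    by (elim exE conjE)
  show ?case
  proof (intro exI[of _ w2] conjI)
    show "reach (length (t # ts)) w w2" using reach_trans[OF w1(1) w2(1)] by simp
    show "\<forall>f\<in>carrier Grp. bounded N (M + length (t # ts)) (w2 f)" using w2(2) by simp
    show "\<exists>\<beta>. mh (w2 \<one>\<^bsub>Grp\<^esub>) (\<lambda>_. 0) \<beta> \<noteq> 0" by (rule exI[of _ \<beta>2]) (rule w2(3))
    show "\<forall>f\<in>carrier Grp. \<forall>\<alpha> \<beta>. mh (w f) \<alpha> \<beta> = 0 \<longrightarrow> mh (w2 f) \<alpha> \<beta> = 0"
      using w1(4) w2(4) by simp
    show "\<forall>(i, k, j)\<in>set (t # ts).
      (\<forall>f\<in>carrier Grp. snd f k = i \<longrightarrow> (\<forall>\<alpha> \<beta>. \<alpha> i = j \<longrightarrow> mh (w2 f) \<alpha> \<beta> = 0))"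
      using w1(5) w2(4,5) unfolding t by simp
  qed
qed

text \<open>
  The component of \<open>w\<close> at \<open>(\<xi>, \<pi>)\<close> vanishes unless \<open>\<pi>\<close> is the identity, in which case it is
  \<open>P \<xi>\<close> (a function of the \<open>h\<^sub>i\<close>) times the monomial \<open>x\<^sup>\<gamma>\<close>.
\<close>

definition monomial_state where
  "monomial_state N J w \<gamma> P \<longleftrightarrow> (\<forall>(\<xi>, \<pi>)\<in>carrier Grp. w (\<xi>, \<pi>) \<in> carrier D \<and>
     (\<pi> \<noteq> id \<longrightarrow> w (\<xi>, \<pi>) = \<zero>\<^bsub>D\<^esub>) \<and>
     (\<pi> = id \<longrightarrow> (\<forall>\<alpha> \<beta>. mh (w (\<xi>, \<pi>)) \<alpha> \<beta> = (if \<forall>i<r. \<alpha> i = int (\<gamma> i) then P \<xi> \<beta> else 0)) \<and>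
        (\<forall>i\<in>J. \<forall>\<beta>. (\<lambda>b. P \<xi> (\<beta>(i := b))) \<in> W i N)))"

lemma monomial_stateD:
  assumes "monomial_state N J w \<gamma> P" "(\<xi>, \<pi>) \<in> carrier Grp"
  shows "w (\<xi>, \<pi>) \<in> carrier D" "\<pi> \<noteq> id \<Longrightarrow> w (\<xi>, \<pi>) = \<zero>\<^bsub>D\<^esub>"
    "\<pi> = id \<Longrightarrow> mh (w (\<xi>, \<pi>)) \<alpha> \<beta> = (if \<forall>i<r. \<alpha> i = int (\<gamma> i) then P \<xi> \<beta> else 0)"
    "\<pi> = id \<Longrightarrow> i \<in> J \<Longrightarrow> (\<lambda>b. P \<xi> (\<beta>(i := b))) \<in> W i N"
  using bspec[OF assms(1)[unfolded monomial_state_def] assms(2)] by auto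

lemma state_closed: "monomial_state N J w \<gamma> P \<Longrightarrow> f \<in> carrier Grp \<Longrightarrow> w f \<in> carrier D"
  by (cases f) (simp add: monomial_stateD(1))

lemma state_subset: "monomial_state N J w \<gamma> P \<Longrightarrow> J' \<subseteq> J \<Longrightarrow> monomial_state N J' w \<gamma> P"
  unfolding monomial_state_def by fastforce

abbreviation ident :: "nat \<Rightarrow> 'k" where "ident \<equiv> (\<lambda>i\<in>{..<r}. 1)"

lemma ident_Grp: "(ident, id) \<in> carrier Grp" using one_Grp by (simp add: G_mpr_simps(2))

text \<open>If \<pi> moves k, the triples with i = \<pi>(k) and all |j| \<le> N remove the component
  entirely, since its \<alpha>_i stays within N. If \<pi> is the identity, the triples with i = k
  and j /= 0 leave only \<alpha> = 0.\<close>

lemma diagonal_state: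
  assumes B: "\<forall>f\<in>carrier Grp. bounded N M (w f)" and nz: "mh (w \<one>\<^bsub>Grp\<^esub>) (\<lambda>_. 0) \<beta> \<noteq> 0"
  shows "\<exists>w' P. reach (r * r * (2 * N + 1)) w w' \<and>
    monomial_state (dd * (M + r * r * (2 * N + 1))) {..<r} w' (\<lambda>_. 0) P \<and> P ident \<noteq> (\<lambda>_. 0)"
proof -
  \<comment> \<open>Triples with i = k and j = 0 are left out: they would kill the very coefficient
    that has to survive.\<close>
  define us where "us = filter (\<lambda>(i, k, j). i \<noteq> k \<or> j \<noteq> 0) (List.product [0..<r] (List.product [0..<r] [- int N..int N]))"
  have len: "length us \<le> r * r * (2 * N + 1)"
  proof -
    have "length us \<le> length (List.product [0..<r] (List.product [0..<r] [- int N..int N]))"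
      unfolding us_def by (rule length_filter_le)
    also have "\<dots> = r * (r * (2 * N + 1))" by (simp only: length_product length_upt length_upto) (simp add: nat_add_distrib nat_mult_distrib)
    finally show ?thesis by (simp only: mult.assoc)
  qed
  have us: "(i, k, j) \<in> set us \<longleftrightarrow> i < r \<and> k < r \<and> \<bar>j\<bar> \<le> int N \<and> (i \<noteq> k \<or> j \<noteq> 0)" for i k j
    unfolding us_def by auto
  then have "\<forall>(i, k, j)\<in>set us. i < r \<and> k < r \<and> (i \<noteq> k \<or> j \<noteq> 0)" by auto
  from diag_list[OF B nz this] obtain w' \<beta>' where w': "reach (length us) w w'"
    "\<forall>f\<in>carrier Grp. bounded N (M + length us) (w' f)" "mh (w' \<one>\<^bsub>Grp\<^esub>) (\<lambda>_. 0) \<beta>' \<noteq> 0"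
    "\<forall>f\<in>carrier Grp. \<forall>\<alpha> \<beta>. mh (w f) \<alpha> \<beta> = 0 \<longrightarrow> mh (w' f) \<alpha> \<beta> = 0"
    "\<forall>(i, k, j)\<in>set us. (\<forall>f\<in>carrier Grp. snd f k = i \<longrightarrow> (\<forall>\<alpha> \<beta>. \<alpha> i = j \<longrightarrow> mh (w' f) \<alpha> \<beta> = 0))"
    by (elim exE conjE)
  have w'b: "bounded N (M + length us) (w' f)" if "f \<in> carrier Grp" for f using w'(2) that by blast
  have kill: "mh (w' f) \<alpha> \<beta> = 0" if f: "f \<in> carrier Grp" and "k < r" "snd f k = i" "i \<noteq> k \<or> \<alpha> i \<noteq> 0" for f k i \<alpha> \<beta>
  proof (rule ccontr)
    assume n: "mh (w' f) \<alpha> \<beta> \<noteq> 0"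
    have i: "i < r" using perm_less[of "fst f" "snd f" k] that by simp
    have "\<bar>\<alpha> i\<bar> \<le> int N" using w'b[OF f] n i by (simp add: bounded_def)
    then have "(i, k, \<alpha> i) \<in> set us" using us i that by simp
    then have "mh (w' f) \<alpha> \<beta> = 0" using w'(5) f that(3) by fastforce
    then show False using n by simp
  qed
  define P where "P \<xi> = mh (w' (\<xi>, id)) (\<lambda>_. 0)" for \<xi>
  have "monomial_state (dd * (M + r * r * (2 * N + 1))) {..<r} w' (\<lambda>_. 0) P"
    unfolding monomial_state_def
  proof (clarify, intro conjI impI allI ballI)
    fix \<xi> \<pi> assume f: "(\<xi>, \<pi>) \<in> carrier Grp"
    show wc: "w' (\<xi>, \<pi>) \<in> carrier D" using w'b[OF f] by (simp add: bounded_def)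
    show "w' (\<xi>, \<pi>) = \<zero>\<^bsub>D\<^esub>" if "\<pi> \<noteq> id"
    proof (rule mh_injective[OF wc])
      fix \<alpha> \<beta>
      have "\<exists>k. \<pi> k \<noteq> id k" using that unfolding fun_eq_iff by blast
      then obtain k where k: "\<pi> k \<noteq> k" unfolding id_apply by (elim exE)
      then have "k < r" using f permutes_not_in[of \<pi> "{..<r}" k] by (auto simp: G_mpr_simps)
      then show "mh (w' (\<xi>, \<pi>)) \<alpha> \<beta> = 0" using kill[OF f, of k "\<pi> k"] k by simp
    qed
    assume pi: "\<pi> = id"
    show "mh (w' (\<xi>, \<pi>)) \<alpha> \<beta> = (if \<forall>i<r. \<alpha> i = int 0 then P \<xi> \<beta> else 0)" for \<alpha> \<beta>
    proof (cases "\<forall>i<r. \<alpha> i = 0")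
      case True
      then show ?thesis unfolding P_def pi using mh_cong[of \<alpha> "\<lambda>_. 0" \<beta> \<beta>] by simp
    next
      case False
      then obtain i where "i < r" "\<alpha> i \<noteq> 0" by blast
      then show ?thesis using kill[OF f, of i i] pi False by auto
    qed
    fix i \<beta> assume "i \<in> {..<r}"
    then have "(\<lambda>b. P \<xi> (\<beta>(i := b))) \<in> W i (dd * (M + length us))"
      using w'b[OF f] pi by (simp add: bounded_def P_def)
    then show "(\<lambda>b. P \<xi> (\<beta>(i := b))) \<in> W i (dd * (M + r * r * (2 * N + 1)))"
      by (rule W_mono[rotated]) (use \<open>i \<in> {..<r}\<close> len in auto)
  qed
  moreover have "P ident \<noteq> (\<lambda>_. 0)"
    using w'(3) unfolding P_def G_mpr_simps(2) by auto
  ultimately show ?thesis using reach_mono[OF w'(1) len] by blast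
qed

text \<open>A diagonal group element sends x_i to \<xi>_i x_i, so the scalar c shows up as c
  \<xi>_i: one operator is a different difference operator at each component, and this is what tells
  the components apart.\<close>

lemma x_step:
  assumes St: "monomial_state N J w \<gamma> P" and i: "i \<in> J" and J: "J \<subseteq> {..<r}"
  shows "\<exists>w'. reach 1 w w' \<and> monomial_state N J w' (\<gamma>(i := \<gamma> i + 1)) (\<lambda>\<xi>. dop i (c * \<xi> i) (P \<xi>))"
proof -
  have ir: "i < r" using i J by auto
  have w: "w f \<in> carrier D" if "f \<in> carrier Grp" for f by (rule state_closed[OF St that])
  have xi: "incl i (x i) \<in> filt 1" by (rule gen_filt[OF ir]) simp
  define w' where "w' = (\<lambda>f. incl i (x i) \<otimes>\<^bsub>D\<^esub> w f \<oplus>\<^bsub>D\<^esub> scal (- c) \<otimes>\<^bsub>D\<^esub> (w f \<otimes>\<^bsub>D\<^esub> \<rho> f (incl i (x i))))"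
  have r: "reach 1 w w'" unfolding w'_def by (rule reach_op[OF w xi scal_filt xi])
  have "monomial_state N J w' (\<gamma>(i := \<gamma> i + 1)) (\<lambda>\<xi>. dop i (c * \<xi> i) (P \<xi>))"
    unfolding monomial_state_def
  proof (clarify, intro conjI impI allI ballI)
    fix \<xi> \<pi> assume f: "(\<xi>, \<pi>) \<in> carrier Grp"
    note D = monomial_stateD[OF St f]
    show "w' (\<xi>, \<pi>) \<in> carrier D" by (rule reach_closed[OF r f])
    show "w' (\<xi>, \<pi>) = \<zero>\<^bsub>D\<^esub>" if "\<pi> \<noteq> id"
      using D(2)[OF that] gens_in_D(4)[OF ir] gal.rho_closed[OF f gens_in_D(4)[OF ir]] by (simp add: w'_def)
    assume pi: "\<pi> = id"
    show "mh (w' (\<xi>, \<pi>)) \<alpha> \<beta> = (if \<forall>j<r. \<alpha> j = int ((\<gamma>(i := \<gamma> i + 1)) j) then dop i (c * \<xi> i) (P \<xi>) \<beta> else 0)" for \<alpha> \<beta>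
    proof -
      have eq: "w' (\<xi>, \<pi>) = incl i (x i) \<otimes>\<^bsub>D\<^esub> w (\<xi>, \<pi>) \<oplus>\<^bsub>D\<^esub> (- c * \<xi> i) \<odot>\<^bsub>D\<^esub> (w (\<xi>, \<pi>) \<otimes>\<^bsub>D\<^esub> incl i (x i))"
        using rho_gens(2)[OF f ir] pi D(1) gens_in_D(4)[OF ir]
        by (simp add: w'_def scal_mult gal.smult_mult_r gal.smult_smult mult.commute)
      have cond: "(\<forall>j<r. (\<alpha>(i := \<alpha> i - 1)) j = int (\<gamma> j)) \<longleftrightarrow> (\<forall>j<r. \<alpha> j = int ((\<gamma>(i := \<gamma> i + 1)) j))"
        by (intro all_cong1 imp_cong refl) auto
      have "mh (w' (\<xi>, \<pi>)) \<alpha> \<beta> = mh (w (\<xi>, \<pi>)) (\<alpha>(i := \<alpha> i - 1)) (\<beta>(i := \<beta> i - 1)) +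
          (- c * \<xi> i) * mh (w (\<xi>, \<pi>)) (\<alpha>(i := \<alpha> i - 1)) \<beta>"
        unfolding eq using D(1) gens_in_D(4)[OF ir]
        by (simp only: mh_add mh_smult mh_gens(7)[OF ir] mh_gens(8)[OF ir] gal.m_closed gal.smult_closed)
      then show ?thesis unfolding D(3)[OF pi] cond dop_def
        by (cases "\<forall>j<r. \<alpha> j = int ((\<gamma>(i := \<gamma> i + 1)) j)") (simp_all only: if_True if_False mult_zero_right add_0_right add_0, simp)
    qed
    fix j \<beta> assume j: "j \<in> J"
    have jr: "j < r" using j J by auto
    have 1: "(\<lambda>b. P \<xi> (\<beta>(j := b))) \<in> W j N" by (rule D(4)[OF pi j])
    have 2: "(\<lambda>b. P \<xi> ((\<beta>(j := b))(i := (\<beta>(j := b)) i - 1))) \<in> W j N"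
    proof (cases "j = i")
      case True
      have "(\<lambda>b. P \<xi> (\<beta>(j := b + (- 1)))) \<in> W j N" by (rule coefficient_functions.W_shift[OF coefficients[OF jr] 1])
      then show ?thesis using True by simp
    next
      case False
      have "(\<lambda>b. P \<xi> ((\<beta>(i := \<beta> i - 1))(j := b))) \<in> W j N" by (rule D(4)[OF pi j])
      then show ?thesis using False by (simp add: fun_upd_twist)
    qed
    have 3: "(\<lambda>b. (- (c * \<xi> i)) * P \<xi> (\<beta>(j := b))) \<in> W j N"
      by (rule coefficient_functions.W_scale[OF coefficients[OF jr] 1])
    from coefficient_functions.W_add[OF coefficients[OF jr] 2 3]
    show "(\<lambda>b. dop i (c * \<xi> i) (P \<xi>) (\<beta>(j := b))) \<in> W j N" by (simp add: dop_def)
  qed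
  then show ?thesis using r by blast
qed

lemma x_list:
  assumes St: "monomial_state N J w \<gamma> P" and i: "i \<in> J" and J: "J \<subseteq> {..<r}"
  shows "\<exists>w'. reach (length cs) w w' \<and> monomial_state N J w' (\<gamma>(i := \<gamma> i + length cs))
    (\<lambda>\<xi>. fold (\<lambda>c. dop i (c * \<xi> i)) cs (P \<xi>))"
  using St
proof (induction cs arbitrary: w \<gamma> P)
  case Nil
  obtain w' where w': "reach 0 w w'" "\<forall>f\<in>carrier Grp. w' f = w f"
    by (rule reach_refl[OF state_closed[OF Nil]])
  have "monomial_state N J w' \<gamma> P" using Nil w'(2) unfolding monomial_state_def by fastforce
  then show ?case using w'(1) by auto
next
  case (Cons c cs)
  from x_step[OF Cons.prems i J, of c] obtain w1 where w1: "reach 1 w w1"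
    "monomial_state N J w1 (\<gamma>(i := \<gamma> i + 1)) (\<lambda>\<xi>. dop i (c * \<xi> i) (P \<xi>))" by (elim exE conjE)
  from Cons.IH[OF w1(2)] obtain w2 where w2: "reach (length cs) w1 w2"
    "monomial_state N J w2 ((\<gamma>(i := \<gamma> i + 1))(i := (\<gamma>(i := \<gamma> i + 1)) i + length cs))
      (\<lambda>\<xi>. fold (\<lambda>c. dop i (c * \<xi> i)) cs (dop i (c * \<xi> i) (P \<xi>)))" by (elim exE conjE)
  have g: "(\<gamma>(i := \<gamma> i + 1))(i := (\<gamma>(i := \<gamma> i + 1)) i + length cs) = \<gamma>(i := \<gamma> i + length (c # cs))"
    by simp
  show ?case
  proof (intro exI[of _ w2] conjI)
    show "reach (length (c # cs)) w w2" using reach_trans[OF w1(1) w2(1)] by simp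
    show "monomial_state N J w2 (\<gamma>(i := \<gamma> i + length (c # cs))) (\<lambda>\<xi>. fold (\<lambda>c. dop i (c * \<xi> i)) (c # cs) (P \<xi>))"
      using w2(2) unfolding g by simp
  qed
qed

text \<open>The scalars are \<zeta> l^\<kappa> with |\<kappa>| \<le> N. Where \<zeta> \<xi>_i = 1
  they become l^\<kappa>, and the product of the differences annihilates all of
  \<open>W i N\<close>. At the unit they retain \<zeta> /= 1; if the result were zero there, some
  intermediate nonzero function would satisfy the equation excluded by
  \<open>W_twist\<close>.\<close>

lemma kill_diagonal:
  assumes St: "monomial_state N {..<r} w \<gamma> P" and i: "i < r" and nz: "P ident \<noteq> (\<lambda>_. 0)"
    and zeta: "\<zeta> ^ e = 1" "\<zeta> \<noteq> 1"
  shows "\<exists>w' \<gamma>' P'. reach (2 * N + 1) w w' \<and> monomial_state N {..<r} w' \<gamma>' P' \<and> P' ident \<noteq> (\<lambda>_. 0) \<and>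
    (\<Sum>j<r. \<gamma>' j) = (\<Sum>j<r. \<gamma> j) + (2 * N + 1) \<and>
    (\<forall>\<xi>. P \<xi> = (\<lambda>_. 0) \<longrightarrow> P' \<xi> = (\<lambda>_. 0)) \<and>
    (\<forall>\<xi>. (\<xi>, id) \<in> carrier Grp \<longrightarrow> \<zeta> * \<xi> i = 1 \<longrightarrow> P' \<xi> = (\<lambda>_. 0))"
proof -
  define \<kappa>s where "\<kappa>s = [- int N..int N]"
  define cs where "cs = map (\<lambda>\<kappa>. \<zeta> * l i powi \<kappa>) \<kappa>s"
  have len: "length cs = 2 * N + 1" by (simp add: cs_def \<kappa>s_def)
  have iJ: "i \<in> {..<r}" using i by simp
  from x_list[OF St iJ subset_refl, of cs] obtain w' where w': "reach (length cs) w w'"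
    "monomial_state N {..<r} w' (\<gamma>(i := \<gamma> i + length cs)) (\<lambda>\<xi>. fold (\<lambda>c. dop i (c * \<xi> i)) cs (P \<xi>))"
    by (elim exE conjE)
  let ?P = "\<lambda>\<xi>. fold (\<lambda>c. dop i (c * \<xi> i)) cs (P \<xi>)"
  have "(\<Sum>j<r. (\<gamma>(i := \<gamma> i + length cs)) j) = (\<gamma> i + length cs) + (\<Sum>j\<in>{..<r} - {i}. (\<gamma>(i := \<gamma> i + length cs)) j)"
    using i by (subst sum.remove[of _ i]) auto
  also have "(\<Sum>j\<in>{..<r} - {i}. (\<gamma>(i := \<gamma> i + length cs)) j) = (\<Sum>j\<in>{..<r} - {i}. \<gamma> j)"
    by (intro sum.cong) auto
  also have "\<gamma> i + length cs + (\<Sum>j\<in>{..<r} - {i}. \<gamma> j) = (\<Sum>j<r. \<gamma> j) + length cs"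
    using i by (subst (2) sum.remove[of _ i]) auto
  finally have sum: "(\<Sum>j<r. (\<gamma>(i := \<gamma> i + length cs)) j) = (\<Sum>j<r. \<gamma> j) + (2 * N + 1)" by (simp add: len)
  have zero: "?P \<xi> = (\<lambda>_. 0)" if "P \<xi> = (\<lambda>_. 0)" for \<xi>
    unfolding that by (rule fold_dop_zero)
  have kill: "?P \<xi> = (\<lambda>_. 0)" if f: "(\<xi>, id) \<in> carrier Grp" and z: "\<zeta> * \<xi> i = 1" for \<xi>
  proof
    fix \<beta>
    have sl: "(\<lambda>b. P \<xi> (\<beta>(i := b))) \<in> W i N" by (rule monomial_stateD(4)[OF St f refl iJ])
    have z': "\<zeta> * l i powi \<kappa> * \<xi> i = l i powi \<kappa>" for \<kappa> using z by (simp add: mult.commute mult.left_commute)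
    have "?P \<xi> (\<beta>(i := \<beta> i)) = fold (\<lambda>c f b. f (b - 1) - (c * \<xi> i) * f b) cs (\<lambda>b. P \<xi> (\<beta>(i := b))) (\<beta> i)"
      by (rule fold_dop_slice)
    also have "\<dots> = fold (\<lambda>\<kappa> f b. f (b - 1) - l i powi \<kappa> * f b) \<kappa>s (\<lambda>b. P \<xi> (\<beta>(i := b))) (\<beta> i)"
      unfolding cs_def fold_map comp_def z' ..
    also have "\<dots> = 0" unfolding \<kappa>s_def coefficient_functions.W_annihilated[OF coefficients[OF i] sl] ..
    finally show "?P \<xi> \<beta> = 0" by (simp only: fun_upd_triv)
  qed
  have "?P ident \<noteq> (\<lambda>_. 0)"
  proof
    assume z: "?P ident = (\<lambda>_. 0)"
    from fold_first_zero[OF z nz] obtain cs1 c cs2 where cs: "cs = cs1 @ c # cs2"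
      "fold (\<lambda>c. dop i (c * ident i)) cs1 (P ident) \<noteq> (\<lambda>_. 0)"
      "dop i (c * ident i) (fold (\<lambda>c. dop i (c * ident i)) cs1 (P ident)) = (\<lambda>_. 0)" by (elim exE conjE)
    let ?Q = "fold (\<lambda>c. dop i (c * ident i)) cs1 (P ident)"
    have "c \<in> set cs" using cs(1) by simp
    then obtain \<kappa> where c: "c = \<zeta> * l i powi \<kappa>" by (auto simp: cs_def)
    from x_list[OF St iJ subset_refl, of cs1] obtain w1 where
      "monomial_state N {..<r} w1 (\<gamma>(i := \<gamma> i + length cs1)) (\<lambda>\<xi>. fold (\<lambda>c. dop i (c * \<xi> i)) cs1 (P \<xi>))"
      by (elim exE conjE)
    note sl = monomial_stateD(4)[OF this ident_Grp refl iJ]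
    have "?Q = (\<lambda>_. 0)"
    proof
      fix \<beta>
      have "(\<lambda>b. ?Q (\<beta>(i := b))) = (\<lambda>_. 0)"
      proof (rule coefficient_functions.W_twist[OF coefficients[OF i] sl zeta(1) e_pos zeta(2)])
        fix b
        have "dop i (c * ident i) ?Q (\<beta>(i := b)) = 0" using fun_cong[OF cs(3)] .
        then show "?Q (\<beta>(i := b - 1)) = \<zeta> * l i powi \<kappa> * ?Q (\<beta>(i := b))"
          using i c by (simp add: dop_def)
      qed
      then have "?Q (\<beta>(i := \<beta> i)) = 0" by (rule fun_cong)
      then show "?Q \<beta> = 0" by (simp only: fun_upd_triv)
    qed
    then show False using cs(2) by contradiction
  qed
  then show ?thesis using w' sum zero kill unfolding len
    by (intro exI[of _ w'] exI[of _ "\<gamma>(i := \<gamma> i + (2 * N + 1))"] exI[of _ ?P] conjI) blast+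
qed

lemma kill_diagonal_list:
  assumes "monomial_state N {..<r} w \<gamma> P" and "P ident \<noteq> (\<lambda>_. 0)"
    and "\<forall>(i, \<zeta>)\<in>set ps. i < r \<and> \<zeta> ^ e = 1 \<and> \<zeta> \<noteq> 1"
  shows "\<exists>w' \<gamma>' P'. reach (length ps * (2 * N + 1)) w w' \<and> monomial_state N {..<r} w' \<gamma>' P' \<and>
    P' ident \<noteq> (\<lambda>_. 0) \<and> (\<Sum>j<r. \<gamma>' j) = (\<Sum>j<r. \<gamma> j) + length ps * (2 * N + 1) \<and>
    (\<forall>\<xi>. P \<xi> = (\<lambda>_. 0) \<longrightarrow> P' \<xi> = (\<lambda>_. 0)) \<and>
    (\<forall>(i, \<zeta>)\<in>set ps. \<forall>\<xi>. (\<xi>, id) \<in> carrier Grp \<longrightarrow> \<zeta> * \<xi> i = 1 \<longrightarrow> P' \<xi> = (\<lambda>_. 0))"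
  using assms
proof (induction ps arbitrary: w \<gamma> P)
  case Nil
  obtain w' where w': "reach 0 w w'" "\<forall>f\<in>carrier Grp. w' f = w f"
    by (rule reach_refl[OF state_closed[OF Nil(1)]])
  have "monomial_state N {..<r} w' \<gamma> P" using Nil(1) w'(2) unfolding monomial_state_def by fastforce
  then show ?case using w'(1) Nil(2) by (intro exI[of _ w'] exI[of _ \<gamma>] exI[of _ P]) simp
next
  case (Cons q ps)
  obtain i \<zeta> where q: "q = (i, \<zeta>)" by (cases q)
  have i: "i < r" and z: "\<zeta> ^ e = 1" "\<zeta> \<noteq> 1" using Cons.prems(3) q by auto
  from kill_diagonal[OF Cons.prems(1) i Cons.prems(2) z] obtain w1 \<gamma>1 P1 where 1: "reach (2 * N + 1) w w1"
    "monomial_state N {..<r} w1 \<gamma>1 P1" "P1 ident \<noteq> (\<lambda>_. 0)"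
    "(\<Sum>j<r. \<gamma>1 j) = (\<Sum>j<r. \<gamma> j) + (2 * N + 1)" "\<forall>\<xi>. P \<xi> = (\<lambda>_. 0) \<longrightarrow> P1 \<xi> = (\<lambda>_. 0)"
    "\<forall>\<xi>. (\<xi>, id) \<in> carrier Grp \<longrightarrow> \<zeta> * \<xi> i = 1 \<longrightarrow> P1 \<xi> = (\<lambda>_. 0)" by (elim exE conjE)
  have prem: "\<forall>(i, \<zeta>)\<in>set ps. i < r \<and> \<zeta> ^ e = 1 \<and> \<zeta> \<noteq> 1" using Cons.prems(3) by simp
  from Cons.IH[OF 1(2,3) prem] obtain w2 \<gamma>2 P2 where 2: "reach (length ps * (2 * N + 1)) w1 w2"
    "monomial_state N {..<r} w2 \<gamma>2 P2" "P2 ident \<noteq> (\<lambda>_. 0)"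
    "(\<Sum>j<r. \<gamma>2 j) = (\<Sum>j<r. \<gamma>1 j) + length ps * (2 * N + 1)" "\<forall>\<xi>. P1 \<xi> = (\<lambda>_. 0) \<longrightarrow> P2 \<xi> = (\<lambda>_. 0)"
    "\<forall>(i, \<zeta>)\<in>set ps. \<forall>\<xi>. (\<xi>, id) \<in> carrier Grp \<longrightarrow> \<zeta> * \<xi> i = 1 \<longrightarrow> P2 \<xi> = (\<lambda>_. 0)" by (elim exE conjE)
  show ?case
  proof (intro exI[of _ w2] exI[of _ \<gamma>2] exI[of _ P2] conjI)
    have "length (q # ps) * (2 * N + 1) = 2 * N + 1 + length ps * (2 * N + 1)" by simp
    then show "reach (length (q # ps) * (2 * N + 1)) w w2" by (simp only: reach_trans[OF 1(1) 2(1)])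
    show "(\<Sum>j<r. \<gamma>2 j) = (\<Sum>j<r. \<gamma> j) + length (q # ps) * (2 * N + 1)" using 1(4) 2(4) by simp
    show "\<forall>\<xi>. P \<xi> = (\<lambda>_. 0) \<longrightarrow> P2 \<xi> = (\<lambda>_. 0)" using 1(5) 2(5) by simp
    show "\<forall>(i, \<zeta>)\<in>set (q # ps). \<forall>\<xi>. (\<xi>, id) \<in> carrier Grp \<longrightarrow> \<zeta> * \<xi> i = 1 \<longrightarrow> P2 \<xi> = (\<lambda>_. 0)"
      using 1(6) 2(5,6) unfolding q by simp
  qed (rule 2)+
qed

end

section \<open>Flattening the remaining coefficient and normalising it\<close>

lemma shift_invariant:
  fixes P :: "(nat \<Rightarrow> int) \<Rightarrow> 'c"
  assumes "\<forall>\<beta>. P (\<beta>(j := \<beta> j - 1)) = P \<beta>" shows "P (\<beta>(j := b)) = P \<beta>"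
proof -
  have s: "P (\<beta>(j := b - 1)) = P (\<beta>(j := b))" for b
    using assms[rule_format, of "\<beta>(j := b)"] by (simp only: fun_upd_upd fun_upd_same)
  have "P (\<beta>(j := b)) = P (\<beta>(j := \<beta> j))"
  proof (induction b rule: int_induct[where k = "\<beta> j"])
    case (step1 i)
    have "P (\<beta>(j := i + 1 - 1)) = P (\<beta>(j := i + 1))" by (rule s)
    then have "P (\<beta>(j := i + 1)) = P (\<beta>(j := i))" by (simp only: add_diff_cancel_right')
    then show ?case using step1.IH by (rule trans)
  next
    case (step2 i)
    show ?case using s[of i] step2.IH by (rule trans)
  qed simp
  then show ?thesis by (simp only: fun_upd_triv)
qed

text \<open>Difference operators commute with translations, so a coordinate on which the coefficient
  no longer depends stays so while others are treated.\<close>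

lemma dop_shift_invariant:
  assumes "\<forall>\<beta>. P (\<beta>(j := \<beta> j - 1)) = P \<beta>"
  shows "\<forall>\<beta>. dop i c P (\<beta>(j := \<beta> j - 1)) = dop i c P \<beta>"
proof
  fix \<beta>
  show "dop i c P (\<beta>(j := \<beta> j - 1)) = dop i c P \<beta>"
  proof (cases "j = i")
    case True
    have "P ((\<beta>(i := \<beta> i - 1))(i := (\<beta>(i := \<beta> i - 1)) i - 1)) = P (\<beta>(i := \<beta> i - 1))"
      using assms True by blast
    moreover have "P (\<beta>(i := \<beta> i - 1)) = P \<beta>" using assms True by blast
    ultimately show ?thesis unfolding dop_def True by (simp only:)
  next
    case False
    have "(\<beta>(j := \<beta> j - 1))(i := (\<beta>(j := \<beta> j - 1)) i - 1) = (\<beta>(i := \<beta> i - 1))(j := (\<beta>(i := \<beta> i - 1)) j - 1)"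
      using False by (auto simp: fun_eq_iff)
    then show ?thesis unfolding dop_def by (simp only: assms)
  qed
qed

lemma fold_dop_shift_invariant:
  "\<forall>\<beta>. P (\<beta>(j := \<beta> j - 1)) = P \<beta> \<Longrightarrow>
    \<forall>\<beta>. fold (\<lambda>c. dop i (d c)) cs P (\<beta>(j := \<beta> j - 1)) = fold (\<lambda>c. dop i (d c)) cs P \<beta>"
proof (induction cs arbitrary: P)
  case (Cons c cs)
  show ?case using Cons.IH[OF dop_shift_invariant[OF Cons.prems, of i "d c"]] by simp
qed simp

context tensor_action begin

text \<open>The multiplier l^(s \<beta>_i) may raise the degree in \<beta>_i only, so the degree
  bounds are kept for the coordinates in \<open>J\<close>, away from i.\<close>

lemma scale_step:
  assumes St: "monomial_state N J w \<gamma> P" and i: "i < r" "i \<notin> J" and J: "J \<subseteq> {..<r}"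
    and s: "s = 1 \<or> s = - 1"
  shows "\<exists>w'. reach 1 w w' \<and> monomial_state N J w' \<gamma> (\<lambda>\<xi> \<beta>. l i powi (s * \<beta> i) * P \<xi> \<beta>)"
proof -
  have w: "w f \<in> carrier D" if "f \<in> carrier Grp" for f by (rule state_closed[OF St that])
  define z where "z = (if s = 1 then g' i else g i)"
  have zf: "incl i z \<in> filt 1" by (rule gen_filt[OF i(1)]) (simp add: z_def)
  have zc: "incl i z \<in> carrier D" by (rule gal.filt_carrier[OF zf])
  have mz: "mh (incl i z \<otimes>\<^bsub>D\<^esub> u) \<alpha> \<beta> = l i powi (s * \<beta> i) * mh u \<alpha> \<beta>" if "u \<in> carrier D" for u \<alpha> \<beta>
    using s mh_gens(3,5)[OF i(1) that] by (auto simp: z_def)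
  obtain w' where w': "reach 1 w w'" "\<forall>f\<in>carrier Grp. w' f = incl i z \<otimes>\<^bsub>D\<^esub> w f"
    by (rule reach_left[OF w zf])
  have "monomial_state N J w' \<gamma> (\<lambda>\<xi> \<beta>. l i powi (s * \<beta> i) * P \<xi> \<beta>)"
    unfolding monomial_state_def
  proof (clarify, intro conjI impI allI ballI)
    fix \<xi> \<pi> assume f: "(\<xi>, \<pi>) \<in> carrier Grp"
    note D = monomial_stateD[OF St f]
    have eq: "w' (\<xi>, \<pi>) = incl i z \<otimes>\<^bsub>D\<^esub> w (\<xi>, \<pi>)" using w'(2) f by blast
    show "w' (\<xi>, \<pi>) \<in> carrier D" by (rule reach_closed[OF w'(1) f])
    show "w' (\<xi>, \<pi>) = \<zero>\<^bsub>D\<^esub>" if "\<pi> \<noteq> id" using D(2)[OF that] zc eq by simp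
    assume pi: "\<pi> = id"
    show "mh (w' (\<xi>, \<pi>)) \<alpha> \<beta> = (if \<forall>j<r. \<alpha> j = int (\<gamma> j) then l i powi (s * \<beta> i) * P \<xi> \<beta> else 0)" for \<alpha> \<beta>
      unfolding eq mz[OF D(1)] D(3)[OF pi] by (simp only: if_distrib[of "\<lambda>t. l i powi (s * \<beta> i) * t"] mult_zero_right)
    fix j \<beta> assume j: "j \<in> J"
    then have ji: "j < r" "i \<noteq> j" using J i by auto
    have "(\<lambda>b. l i powi (s * \<beta> i) * P \<xi> (\<beta>(j := b))) \<in> W j N"
      by (rule coefficient_functions.W_scale[OF coefficients[OF ji(1)] D(4)[OF pi j]])
    then show "(\<lambda>b. l i powi (s * (\<beta>(j := b)) i) * P \<xi> (\<beta>(j := b))) \<in> W j N"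
      by (simp only: fun_upd_other[OF ji(2)])
  qed
  then show ?thesis using w'(1) by blast
qed

lemma scale_power:
  assumes St: "monomial_state N J w \<gamma> P" and i: "i < r" "i \<notin> J" and J: "J \<subseteq> {..<r}"
    and s: "s = 1 \<or> s = - 1"
  shows "\<exists>w'. reach n w w' \<and> monomial_state N J w' \<gamma> (\<lambda>\<xi> \<beta>. l i powi (int n * s * \<beta> i) * P \<xi> \<beta>)"
  using St
proof (induction n arbitrary: w P)
  case 0
  obtain w' where w': "reach 0 w w'" "\<forall>f\<in>carrier Grp. w' f = w f"
    by (rule reach_refl[OF state_closed[OF 0]])
  have "monomial_state N J w' \<gamma> P" using 0 w'(2) unfolding monomial_state_def by fastforce
  then show ?case using w'(1) by auto
next
  case (Suc n)
  have l: "l i \<noteq> 0" by (rule coefficient_functions.l_nonzero[OF coefficients[OF i(1)]])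
  from scale_step[OF Suc.prems i J s] obtain w1 where w1: "reach 1 w w1"
    "monomial_state N J w1 \<gamma> (\<lambda>\<xi> \<beta>. l i powi (s * \<beta> i) * P \<xi> \<beta>)" by (elim exE conjE)
  from Suc.IH[OF w1(2)] obtain w2 where w2: "reach n w1 w2"
    "monomial_state N J w2 \<gamma> (\<lambda>\<xi> \<beta>. l i powi (int n * s * \<beta> i) * (l i powi (s * \<beta> i) * P \<xi> \<beta>))" by (elim exE conjE)
  have eq: "(\<lambda>\<xi> \<beta>. l i powi (int n * s * \<beta> i) * (l i powi (s * \<beta> i) * P \<xi> \<beta>)) =
      (\<lambda>\<xi> \<beta>. l i powi (int (Suc n) * s * \<beta> i) * P \<xi> \<beta>)"
    using l by (intro ext) (simp add: power_int_add algebra_simps)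
  show ?case
  proof (intro exI[of _ w2] conjI)
    show "reach (Suc n) w w2" using reach_trans[OF w1(1) w2(1)] by simp
    show "monomial_state N J w2 \<gamma> (\<lambda>\<xi> \<beta>. l i powi (int (Suc n) * s * \<beta> i) * P \<xi> \<beta>)"
      using w2(2) unfolding eq .
  qed
qed

text \<open>At the unit the differences for l^\<kappa> with |\<kappa>| \<le> N kill the coefficient.
  Stopping just before it vanishes leaves a nonzero Q with Q(\<beta> - e_i) = l^\<kappa> Q(\<beta>),
  and multiplying by l^(\<kappa> \<beta>_i) makes it independent of \<beta>_i.\<close>

lemma flatten_coordinate:
  assumes St: "monomial_state N J w \<gamma> P" and i: "i \<in> J" and J: "J \<subseteq> {..<r}" and nz: "P ident \<noteq> (\<lambda>_. 0)"
  shows "\<exists>w' \<gamma>' P'. reach (3 * N + 1) w w' \<and> monomial_state N (J - {i}) w' \<gamma>' P' \<and> P' ident \<noteq> (\<lambda>_. 0) \<and>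
    (\<Sum>j<r. \<gamma>' j) \<le> (\<Sum>j<r. \<gamma> j) + (2 * N + 1) \<and>
    (\<forall>\<xi>. P \<xi> = (\<lambda>_. 0) \<longrightarrow> P' \<xi> = (\<lambda>_. 0)) \<and>
    (\<forall>\<beta>. P' ident (\<beta>(i := \<beta> i - 1)) = P' ident \<beta>) \<and>
    (\<forall>j. (\<forall>\<beta>. P ident (\<beta>(j := \<beta> j - 1)) = P ident \<beta>) \<longrightarrow> (\<forall>\<beta>. P' ident (\<beta>(j := \<beta> j - 1)) = P' ident \<beta>))"
proof -
  have ir: "i < r" using i J by auto
  have l: "l i \<noteq> 0" by (rule coefficient_functions.l_nonzero[OF coefficients[OF ir]])
  define cs where "cs = map (\<lambda>\<kappa>. l i powi \<kappa>) [- int N..int N]"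
  let ?F = "\<lambda>cs \<xi>. fold (\<lambda>c. dop i (c * \<xi> i)) cs (P \<xi>)"
  have id1: "c * ident i = c" for c using ir by simp
  have "?F cs ident = (\<lambda>_. 0)"
  proof
    fix \<beta>
    have sl: "(\<lambda>b. P ident (\<beta>(i := b))) \<in> W i N" by (rule monomial_stateD(4)[OF St ident_Grp refl i])
    have "?F cs ident (\<beta>(i := \<beta> i)) = fold (\<lambda>c f b. f (b - 1) - (c * ident i) * f b) cs (\<lambda>b. P ident (\<beta>(i := b))) (\<beta> i)"
      by (rule fold_dop_slice)
    also have "\<dots> = fold (\<lambda>\<kappa> f b. f (b - 1) - l i powi \<kappa> * f b) [- int N..int N] (\<lambda>b. P ident (\<beta>(i := b))) (\<beta> i)"
      unfolding cs_def fold_map comp_def id1 ..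
    also have "\<dots> = 0" unfolding coefficient_functions.W_annihilated[OF coefficients[OF ir] sl] ..
    finally show "?F cs ident \<beta> = 0" by (simp only: fun_upd_triv)
  qed
  from fold_first_zero[OF this nz] obtain cs1 c cs2 where cs: "cs = cs1 @ c # cs2"
    "?F cs1 ident \<noteq> (\<lambda>_. 0)" "dop i (c * ident i) (?F cs1 ident) = (\<lambda>_. 0)" by (elim exE conjE)
  have "length cs = 2 * N + 1" by (simp add: cs_def)
  then have len: "length cs1 \<le> 2 * N" using cs(1) by simp
  have "c \<in> set cs" using cs(1) by simp
  then obtain \<kappa> where \<kappa>: "c = l i powi \<kappa>" "\<bar>\<kappa>\<bar> \<le> int N" by (auto simp: cs_def)
  have shift: "?F cs1 ident (\<beta>(i := \<beta> i - 1)) = l i powi \<kappa> * ?F cs1 ident \<beta>" for \<beta>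
    using fun_cong[OF cs(3), of \<beta>] unfolding dop_def id1 \<kappa>(1) by simp
  from x_list[OF St i J, of cs1] obtain w1 where w1: "reach (length cs1) w w1"
    "monomial_state N J w1 (\<gamma>(i := \<gamma> i + length cs1)) (?F cs1)" by (elim exE conjE)
  have "monomial_state N (J - {i}) w1 (\<gamma>(i := \<gamma> i + length cs1)) (?F cs1)"
    by (rule state_subset[OF w1(2)]) blast
  note St1 = this
  define s :: int where "s = (if 0 \<le> \<kappa> then 1 else - 1)"
  have s: "s = 1 \<or> s = - 1" by (simp add: s_def)
  have iJ: "i \<notin> J - {i}" "J - {i} \<subseteq> {..<r}" using J by auto
  from scale_power[OF St1 ir iJ s, of "nat \<bar>\<kappa>\<bar>"] obtain w2 where
    w2: "reach (nat \<bar>\<kappa>\<bar>) w1 w2" "monomial_state N (J - {i}) w2 (\<gamma>(i := \<gamma> i + length cs1))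
      (\<lambda>\<xi> \<beta>. l i powi (int (nat \<bar>\<kappa>\<bar>) * s * \<beta> i) * ?F cs1 \<xi> \<beta>)"
    by (elim exE conjE)
  define P' where "P' = (\<lambda>\<xi> \<beta>. l i powi (\<kappa> * \<beta> i) * ?F cs1 \<xi> \<beta>)"
  have "int (nat \<bar>\<kappa>\<bar>) * s = \<kappa>" by (simp add: s_def)
  then have St2: "monomial_state N (J - {i}) w2 (\<gamma>(i := \<gamma> i + length cs1)) P'"
    using w2(2) unfolding P'_def by (simp only:)
  have sum: "(\<Sum>j<r. (\<gamma>(i := \<gamma> i + length cs1)) j) \<le> (\<Sum>j<r. \<gamma> j) + (2 * N + 1)"
  proof -
    have "(\<Sum>j<r. (\<gamma>(i := \<gamma> i + length cs1)) j) = (\<gamma> i + length cs1) + (\<Sum>j\<in>{..<r} - {i}. (\<gamma>(i := \<gamma> i + length cs1)) j)"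
      using ir by (subst sum.remove[of _ i]) auto
    also have "(\<Sum>j\<in>{..<r} - {i}. (\<gamma>(i := \<gamma> i + length cs1)) j) = (\<Sum>j\<in>{..<r} - {i}. \<gamma> j)"
      by (intro sum.cong) auto
    also have "\<gamma> i + length cs1 + (\<Sum>j\<in>{..<r} - {i}. \<gamma> j) = (\<Sum>j<r. \<gamma> j) + length cs1"
      using ir by (subst (2) sum.remove[of _ i]) auto
    finally show ?thesis using len by simp
  qed
  have inv_i: "P' ident (\<beta>(i := \<beta> i - 1)) = P' ident \<beta>" for \<beta>
  proof -
    have "l i powi (\<kappa> * (\<beta> i - 1)) * (l i powi \<kappa> * t) = l i powi (\<kappa> * \<beta> i) * t" for t
    proof -
      have "l i powi (\<kappa> * (\<beta> i - 1)) * l i powi \<kappa> = l i powi (\<kappa> * (\<beta> i - 1) + \<kappa>)"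
        using l by (simp only: power_int_add[of "l i"] simp_thms)
      then show ?thesis by (simp add: mult.assoc[symmetric] right_diff_distrib)
    qed
    then show ?thesis unfolding P'_def shift by (simp only: fun_upd_same)
  qed
  have inv_j: "P' ident (\<beta>(j := \<beta> j - 1)) = P' ident \<beta>"
    if "\<forall>\<beta>. P ident (\<beta>(j := \<beta> j - 1)) = P ident \<beta>" for j \<beta>
  proof (cases "j = i")
    case False
    have "?F cs1 ident (\<beta>(j := \<beta> j - 1)) = ?F cs1 ident \<beta>"
      by (rule spec[OF fold_dop_shift_invariant[OF that]])
    then show ?thesis unfolding P'_def by (simp only: fun_upd_other[OF False[symmetric]])
  qed (use inv_i in simp)
  have nz': "P' ident \<noteq> (\<lambda>_. 0)"
  proof
    assume z: "P' ident = (\<lambda>_. 0)"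
    have "?F cs1 ident \<beta> = 0" for \<beta>
      using fun_cong[OF z, of \<beta>] l unfolding P'_def by (simp add: power_int_eq_0_iff)
    then show False using cs(2) by blast
  qed
  have zero: "P' \<xi> = (\<lambda>_. 0)" if "P \<xi> = (\<lambda>_. 0)" for \<xi>
    unfolding P'_def that fold_dop_zero by simp
  \<comment> \<open>At most 2 N differences precede the factor that kills, then at most N scalings
    follow.\<close>
  have "length cs1 + nat \<bar>\<kappa>\<bar> \<le> 3 * N + 1" using len \<kappa>(2) by linarith
  from reach_mono[OF reach_trans[OF w1(1) w2(1)] this] have r: "reach (3 * N + 1) w w2" .
  show ?thesis
  proof (intro exI[of _ w2] exI[of _ "\<gamma>(i := \<gamma> i + length cs1)"] exI[of _ P'] conjI)
    show "\<forall>\<xi>. P \<xi> = (\<lambda>_. 0) \<longrightarrow> P' \<xi> = (\<lambda>_. 0)" by (intro allI impI zero)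
    show "\<forall>\<beta>. P' ident (\<beta>(i := \<beta> i - 1)) = P' ident \<beta>" by (intro allI inv_i)
    show "\<forall>j. (\<forall>\<beta>. P ident (\<beta>(j := \<beta> j - 1)) = P ident \<beta>) \<longrightarrow> (\<forall>\<beta>. P' ident (\<beta>(j := \<beta> j - 1)) = P' ident \<beta>)"
    proof (intro allI impI)
      fix j \<beta> assume "\<forall>\<beta>. P ident (\<beta>(j := \<beta> j - 1)) = P ident \<beta>"
      then show "P' ident (\<beta>(j := \<beta> j - 1)) = P' ident \<beta>" by (rule inv_j)
    qed
  qed (rule r St2 nz' sum)+
qed

lemma flatten:
  assumes "monomial_state N {..<r} w \<gamma> P" and "P ident \<noteq> (\<lambda>_. 0)" and "k \<le> r"
  shows "\<exists>w' \<gamma>' P'. reach (k * (3 * N + 1)) w w' \<and> monomial_state N {k..<r} w' \<gamma>' P' \<and> P' ident \<noteq> (\<lambda>_. 0) \<and>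
    (\<Sum>j<r. \<gamma>' j) \<le> (\<Sum>j<r. \<gamma> j) + k * (2 * N + 1) \<and>
    (\<forall>\<xi>. P \<xi> = (\<lambda>_. 0) \<longrightarrow> P' \<xi> = (\<lambda>_. 0)) \<and>
    (\<forall>j<k. \<forall>\<beta>. P' ident (\<beta>(j := \<beta> j - 1)) = P' ident \<beta>)"
  using assms(3)
proof (induction k)
  case 0
  obtain w' where w': "reach 0 w w'" "\<forall>f\<in>carrier Grp. w' f = w f"
    by (rule reach_refl[OF state_closed[OF assms(1)]])
  have "monomial_state N {..<r} w' \<gamma> P" using assms(1) w'(2) unfolding monomial_state_def by fastforce
  then have "monomial_state N {0..<r} w' \<gamma> P" by (simp only: lessThan_atLeast0)
  moreover have "reach (0 * (3 * N + 1)) w w'" using w'(1) by simp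
  ultimately show ?case using assms(2)
    by (intro exI[of _ w'] exI[of _ \<gamma>] exI[of _ P] conjI allI impI) (assumption | simp only: mult_0 add_0_right order_refl not_less_zero)+
next
  case (Suc k)
  have "k \<le> r" using Suc.prems by simp
  from Suc.IH[OF this] obtain w1 \<gamma>1 P1 where 1: "reach (k * (3 * N + 1)) w w1"
    "monomial_state N {k..<r} w1 \<gamma>1 P1" "P1 ident \<noteq> (\<lambda>_. 0)"
    "(\<Sum>j<r. \<gamma>1 j) \<le> (\<Sum>j<r. \<gamma> j) + k * (2 * N + 1)" "\<forall>\<xi>. P \<xi> = (\<lambda>_. 0) \<longrightarrow> P1 \<xi> = (\<lambda>_. 0)"
    "\<forall>j<k. \<forall>\<beta>. P1 ident (\<beta>(j := \<beta> j - 1)) = P1 ident \<beta>" by (elim exE conjE)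
  have kk: "k \<in> {k..<r}" "{k..<r} \<subseteq> {..<r}" using Suc.prems by auto
  from flatten_coordinate[OF 1(2) kk 1(3)] obtain w2 \<gamma>2 P2 where 2: "reach (3 * N + 1) w1 w2"
    "monomial_state N ({k..<r} - {k}) w2 \<gamma>2 P2" "P2 ident \<noteq> (\<lambda>_. 0)"
    "(\<Sum>j<r. \<gamma>2 j) \<le> (\<Sum>j<r. \<gamma>1 j) + (2 * N + 1)" "\<forall>\<xi>. P1 \<xi> = (\<lambda>_. 0) \<longrightarrow> P2 \<xi> = (\<lambda>_. 0)"
    "\<forall>\<beta>. P2 ident (\<beta>(k := \<beta> k - 1)) = P2 ident \<beta>"
    "\<forall>j. (\<forall>\<beta>. P1 ident (\<beta>(j := \<beta> j - 1)) = P1 ident \<beta>) \<longrightarrow> (\<forall>\<beta>. P2 ident (\<beta>(j := \<beta> j - 1)) = P2 ident \<beta>)"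
    by (elim exE conjE)
  have J: "{k..<r} - {k} = {Suc k..<r}" by auto
  show ?case
  proof (intro exI[of _ w2] exI[of _ \<gamma>2] exI[of _ P2] conjI)
    have "Suc k * (3 * N + 1) = k * (3 * N + 1) + (3 * N + 1)" by simp
    then show "reach (Suc k * (3 * N + 1)) w w2" by (simp only: reach_trans[OF 1(1) 2(1)])
    show "monomial_state N {Suc k..<r} w2 \<gamma>2 P2" using 2(2) unfolding J .
    show "(\<Sum>j<r. \<gamma>2 j) \<le> (\<Sum>j<r. \<gamma> j) + Suc k * (2 * N + 1)" using 1(4) 2(4) by simp
    show "\<forall>\<xi>. P \<xi> = (\<lambda>_. 0) \<longrightarrow> P2 \<xi> = (\<lambda>_. 0)" using 1(5) 2(5) by simp
    show "\<forall>j<Suc k. \<forall>\<beta>. P2 ident (\<beta>(j := \<beta> j - 1)) = P2 ident \<beta>"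
    proof (intro allI impI)
      fix j \<beta> assume "j < Suc k"
      then show "P2 ident (\<beta>(j := \<beta> j - 1)) = P2 ident \<beta>"
      proof (cases "j = k")
        case False
        then have "j < k" using \<open>j < Suc k\<close> by simp
        then show ?thesis by (rule 2(7)[rule_format, OF 1(6)[rule_format]])
      qed (simp only: 2(6)[rule_format])
    qed
  qed (rule 2)
qed

text \<open>The unit component is the power product of the x_i with exponents \<gamma>, described
  through its coefficients because these determine the element.\<close>

definition monomial_at_one where
  "monomial_at_one w \<gamma> \<longleftrightarrow> w \<one>\<^bsub>Grp\<^esub> \<in> carrier D \<and>
    (\<forall>\<alpha> \<beta>. mh (w \<one>\<^bsub>Grp\<^esub>) \<alpha> \<beta> = (if \<forall>i<r. \<alpha> i = int (\<gamma> i) then 1 else 0)) \<and>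
    (\<forall>f\<in>carrier Grp. f \<noteq> \<one>\<^bsub>Grp\<^esub> \<longrightarrow> w f = \<zero>\<^bsub>D\<^esub>)"

lemma monomial_at_oneD:
  assumes "monomial_at_one w \<gamma>"
  shows "w \<one>\<^bsub>Grp\<^esub> \<in> carrier D"
    "mh (w \<one>\<^bsub>Grp\<^esub>) \<alpha> \<beta> = (if \<forall>i<r. \<alpha> i = int (\<gamma> i) then 1 else 0)"
    "f \<in> carrier Grp \<Longrightarrow> f \<noteq> \<one>\<^bsub>Grp\<^esub> \<Longrightarrow> w f = \<zero>\<^bsub>D\<^esub>"
    "f \<in> carrier Grp \<Longrightarrow> w f \<in> carrier D"
  using assms gal.zero_closed unfolding monomial_at_one_def by metis+

text \<open>Being independent of every coordinate, the coefficient at the unit is a nonzero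
  constant, and a scalar normalises it to 1.\<close>

lemma monomial_reached:
  assumes St: "monomial_state N {..<r} w \<gamma> P" and nz: "P ident \<noteq> (\<lambda>_. 0)"
    and diag: "\<forall>\<xi>. (\<xi>, id) \<in> carrier Grp \<longrightarrow> \<xi> \<noteq> ident \<longrightarrow> P \<xi> = (\<lambda>_. 0)"
  shows "\<exists>w' \<gamma>'. reach (r * (3 * N + 1)) w w' \<and> monomial_at_one w' \<gamma>' \<and>
    (\<Sum>j<r. \<gamma>' j) \<le> (\<Sum>j<r. \<gamma> j) + r * (2 * N + 1)"
proof -
  from flatten[OF St nz order_refl] obtain w1 \<gamma>1 P1 where 1: "reach (r * (3 * N + 1)) w w1"
    "monomial_state N {r..<r} w1 \<gamma>1 P1" "P1 ident \<noteq> (\<lambda>_. 0)"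
    "(\<Sum>j<r. \<gamma>1 j) \<le> (\<Sum>j<r. \<gamma> j) + r * (2 * N + 1)" "\<forall>\<xi>. P \<xi> = (\<lambda>_. 0) \<longrightarrow> P1 \<xi> = (\<lambda>_. 0)"
    "\<forall>j<r. \<forall>\<beta>. P1 ident (\<beta>(j := \<beta> j - 1)) = P1 ident \<beta>" by (elim exE conjE)
  have P1mh: "P1 ident \<beta> = mh (w1 (ident, id)) (\<lambda>i. int (\<gamma>1 i)) \<beta>" for \<beta>
    using monomial_stateD(3)[OF 1(2) ident_Grp refl] by simp
  have const: "P1 ident \<beta> = P1 ident (\<lambda>_. 0)" for \<beta>
  proof -
    \<comment> \<open>Coordinates below k are set to 0 one after another; those from r on do not
      influence \<open>mh\<close>.\<close>
    have "P1 ident (\<lambda>i. if i < k then 0 else \<beta> i) = P1 ident \<beta>" if "k \<le> r" for k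
      using that
    proof (induction k)
      case (Suc k)
      have eq: "(\<lambda>i. if i < Suc k then 0 else \<beta> i) = (\<lambda>i. if i < k then 0 else \<beta> i)(k := 0)"
        by (auto simp: fun_eq_iff less_Suc_eq)
      have "P1 ident ((\<lambda>i. if i < k then 0 else \<beta> i)(k := 0)) = P1 ident (\<lambda>i. if i < k then 0 else \<beta> i)"
        by (rule shift_invariant) (rule 1(6)[rule_format, OF Suc_le_lessD[OF Suc.prems], THEN allI])
      moreover have "P1 ident (\<lambda>i. if i < k then 0 else \<beta> i) = P1 ident \<beta>"
        by (rule Suc.IH) (use Suc.prems in simp)
      ultimately show ?case unfolding eq by (rule trans)
    qed simp
    from this[of r] have "P1 ident (\<lambda>i. if i < r then 0 else \<beta> i) = P1 ident \<beta>" by simp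
    moreover have "P1 ident (\<lambda>i. if i < r then 0 else \<beta> i) = P1 ident (\<lambda>_. 0)"
      unfolding P1mh by (rule mh_cong) auto
    ultimately show ?thesis by simp
  qed
  define c where "c = P1 ident (\<lambda>_. 0)"
  have c0: "c \<noteq> 0" using 1(3) const unfolding c_def by metis
  obtain w2 where w2: "reach 0 w1 w2" "\<forall>f\<in>carrier Grp. w2 f = scal (inverse c) \<otimes>\<^bsub>D\<^esub> w1 f"
    by (rule reach_left[OF state_closed[OF 1(2)] scal_filt])
  have w2': "w2 f = inverse c \<odot>\<^bsub>D\<^esub> w1 f" if "f \<in> carrier Grp" for f
    using w2(2) that scal_mult[OF state_closed[OF 1(2) that]] by simp
  have one: "\<one>\<^bsub>Grp\<^esub> = (ident, id)" by (rule G_mpr_simps(2))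
  have "monomial_at_one w2 \<gamma>1"
    unfolding monomial_at_one_def
  proof (intro conjI allI ballI impI)
    show "w2 \<one>\<^bsub>Grp\<^esub> \<in> carrier D" by (rule reach_closed[OF w2(1) one_Grp])
    show "mh (w2 \<one>\<^bsub>Grp\<^esub>) \<alpha> \<beta> = (if \<forall>i<r. \<alpha> i = int (\<gamma>1 i) then 1 else 0)" for \<alpha> \<beta>
      unfolding one w2'[OF ident_Grp] mh_smult[OF state_closed[OF 1(2) ident_Grp]]
        monomial_stateD(3)[OF 1(2) ident_Grp refl] const[of \<beta>] c_def[symmetric]
      using c0 by (cases "\<forall>i<r. \<alpha> i = int (\<gamma>1 i)") (simp_all only: if_True if_False mult_zero_right, simp)
  next
    fix f assume f: "f \<in> carrier Grp" "f \<noteq> \<one>\<^bsub>Grp\<^esub>"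
    obtain \<xi> \<pi> where f': "f = (\<xi>, \<pi>)" by (cases f)
    have "w1 f = \<zero>\<^bsub>D\<^esub>"
    proof (cases "\<pi> = id")
      case True
      have "\<xi> \<noteq> ident" using f(2) True f' one by simp
      then have "P1 \<xi> = (\<lambda>_. 0)" using diag 1(5) f(1) f' True by blast
      then have "mh (w1 f) \<alpha> \<beta> = 0" for \<alpha> \<beta>
        using monomial_stateD(3)[OF 1(2) f(1)[unfolded f'] True] f' by simp
      then show ?thesis by (rule mh_injective[OF state_closed[OF 1(2) f(1)]])
    next
      case False
      then show ?thesis using monomial_stateD(2)[OF 1(2) f(1)[unfolded f'] False] f' by simp
    qed
    then show "w2 f = \<zero>\<^bsub>D\<^esub>" using w2'[OF f(1)] by simp
  qed
  moreover have "reach (r * (3 * N + 1)) w w2" using reach_trans[OF 1(1) w2(1)] by simp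
  ultimately show ?thesis using 1(4) by blast
qed

end

text \<open>Closed under the sums and constant multiples from which the total cost is assembled, so
  a linear bound for it exists without writing out its constants.\<close>

definition affine_growth :: "(nat \<Rightarrow> nat) \<Rightarrow> bool" where
  "affine_growth f \<longleftrightarrow> (\<exists>p q. \<forall>n. f n = p * n + q)"

lemma affine_growth_intros:
  "affine_growth (\<lambda>n. n)" "affine_growth (\<lambda>_. c)"
  "affine_growth f \<Longrightarrow> affine_growth g \<Longrightarrow> affine_growth (\<lambda>n. f n + g n)"
  "affine_growth f \<Longrightarrow> affine_growth (\<lambda>n. c * f n)"
proof -
  show "affine_growth (\<lambda>n. n)" unfolding affine_growth_def by (intro exI[of _ 1] exI[of _ 0]) simp
  show "affine_growth (\<lambda>_. c)" unfolding affine_growth_def by (intro exI[of _ 0] exI[of _ c]) simp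
  show "affine_growth (\<lambda>n. c * f n)" if f: "affine_growth f"
  proof -
    obtain p q where "\<forall>n. f n = p * n + q" using f by (auto simp: affine_growth_def)
    then show ?thesis unfolding affine_growth_def by (intro exI[of _ "c * p"] exI[of _ "c * q"]) (simp add: algebra_simps)
  qed
  show "affine_growth (\<lambda>n. f n + g n)" if f: "affine_growth f" "affine_growth g"
  proof -
    obtain p q p' q' where "\<forall>n. f n = p * n + q" "\<forall>n. g n = p' * n + q'" using f by (auto simp: affine_growth_def)
    then show ?thesis unfolding affine_growth_def by (intro exI[of _ "p + p'"] exI[of _ "q + q'"]) (simp add: algebra_simps)
  qed
qed

lemma affine_growth_linear: assumes "affine_growth f" obtains c where "\<forall>n. f n \<le> c * (n + 1)"
proof -
  obtain p q where "\<forall>n. f n = p * n + q" using assms by (auto simp: affine_growth_def)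
  then have "\<forall>n. f n \<le> (p + q) * (n + 1)" by (simp add: algebra_simps)
  then show ?thesis by (rule that)
qed

section \<open>Lowering exponents, effective simplicity and the obstruction\<close>

context tensor_action begin

text \<open>Horner's scheme builds q(h_i). Its image under each group element is described as well,
  because the obstruction is the trace of such an element.\<close>

lemma polynomial_in_h:
  assumes i: "i < r" and deg: "degree q \<le> K"
  shows "\<exists>u\<in>filt K. \<forall>f\<in>carrier Grp. \<rho> f u \<in> filt K \<and>
    (\<forall>v\<in>carrier D. \<forall>\<alpha> \<beta>. mh (\<rho> f u \<otimes>\<^bsub>D\<^esub> v) \<alpha> \<beta> = poly q (\<theta> (snd f i) (\<beta> (snd f i))) * mh v \<alpha> \<beta>)"
  using deg
proof (induction q arbitrary: K)
  case 0
  show ?case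
  proof (intro bexI[of _ "\<zero>\<^bsub>D\<^esub>"] ballI conjI allI)
    fix f assume f: "f \<in> carrier Grp"
    show "\<rho> f \<zero>\<^bsub>D\<^esub> \<in> filt K" by (simp only: gal.rho_zero[OF f] gal.filt_zero[OF gens_closed])
    fix v \<alpha> \<beta> assume "v \<in> carrier D"
    then show "mh (\<rho> f \<zero>\<^bsub>D\<^esub> \<otimes>\<^bsub>D\<^esub> v) \<alpha> \<beta> = poly 0 (\<theta> (snd f i) (\<beta> (snd f i))) * mh v \<alpha> \<beta>"
      by (simp add: gal.rho_zero[OF f] mh_zero)
  qed (rule gal.filt_zero[OF gens_closed])
next
  case (pCons c q)
  show ?case
  proof (cases "q = 0")
    case True
    show ?thesis
    proof (intro bexI[of _ "scal c"] ballI conjI allI)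
      fix f assume f: "f \<in> carrier Grp"
      have e: "\<rho> f (scal c) = scal c" by (simp add: gal.rho_hom[OF f])
      show "\<rho> f (scal c) \<in> filt K" unfolding e by (rule scal_filt)
      fix v \<alpha> \<beta> assume "v \<in> carrier D"
      then show "mh (\<rho> f (scal c) \<otimes>\<^bsub>D\<^esub> v) \<alpha> \<beta> = poly (pCons c q) (\<theta> (snd f i) (\<beta> (snd f i))) * mh v \<alpha> \<beta>"
        using True by (simp add: e scal_mult mh_smult)
    qed (rule scal_filt)
  next
    case False
    then obtain K' where K: "K = 1 + K'" "degree q \<le> K'" using pCons.prems by (cases K) auto
    from pCons.IH[OF K(2)] obtain u where u: "u \<in> filt K'"
      "\<forall>f\<in>carrier Grp. \<rho> f u \<in> filt K' \<and>
        (\<forall>v\<in>carrier D. \<forall>\<alpha> \<beta>. mh (\<rho> f u \<otimes>\<^bsub>D\<^esub> v) \<alpha> \<beta> = poly q (\<theta> (snd f i) (\<beta> (snd f i))) * mh v \<alpha> \<beta>)"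
      by blast
    let ?u = "scal c \<oplus>\<^bsub>D\<^esub> incl i (h i) \<otimes>\<^bsub>D\<^esub> u"
    have uc: "u \<in> carrier D" by (rule gal.filt_carrier[OF u(1)])
    have hf: "j < r \<Longrightarrow> incl j (h j) \<in> filt 1" for j by (rule gen_filt) simp_all
    show ?thesis
    proof (intro bexI[of _ ?u] ballI conjI allI)
      show "?u \<in> filt K" unfolding K(1)
        by (intro gal.filt_add[OF gens_closed] scal_filt gal.filt_mult[OF gens_closed] hf i u(1))
      fix f assume f: "f \<in> carrier Grp"
      have fi: "snd f i < r" using perm_less[of "fst f" "snd f" i] f i by simp
      have ruc: "\<rho> f u \<in> carrier D" by (rule gal.rho_closed[OF f uc])
      have "\<rho> f (incl i (h i)) = incl (snd f i) (h (snd f i))"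
        using rho_gens(1)[of "fst f" "snd f" i] f i by simp
      then have e: "\<rho> f ?u = scal c \<oplus>\<^bsub>D\<^esub> incl (snd f i) (h (snd f i)) \<otimes>\<^bsub>D\<^esub> \<rho> f u"
        using uc gens_in_D(1)[OF i] by (simp add: gal.rho_hom[OF f])
      show "\<rho> f ?u \<in> filt K" unfolding e K(1)
        by (intro gal.filt_add[OF gens_closed] scal_filt gal.filt_mult[OF gens_closed] hf fi) (use u(2) f in blast)
      fix v \<alpha> \<beta> assume v: "v \<in> carrier D"
      have "\<rho> f ?u \<otimes>\<^bsub>D\<^esub> v = c \<odot>\<^bsub>D\<^esub> v \<oplus>\<^bsub>D\<^esub> incl (snd f i) (h (snd f i)) \<otimes>\<^bsub>D\<^esub> (\<rho> f u \<otimes>\<^bsub>D\<^esub> v)"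
        using v ruc gens_in_D(1)[OF fi] by (simp add: e gal.l_distr gal.m_assoc scal_mult)
      then show "mh (\<rho> f ?u \<otimes>\<^bsub>D\<^esub> v) \<alpha> \<beta> = poly (pCons c q) (\<theta> (snd f i) (\<beta> (snd f i))) * mh v \<alpha> \<beta>"
        using v ruc gens_in_D(1)[OF fi] u(2) f
        by (simp add: mh_add mh_smult mh_gens(1)[OF fi] distrib_right mult.assoc)
    qed
  qed
qed

lemma polynomial_in_h_one:
  assumes "i < r" "degree q \<le> K"
  shows "\<exists>u\<in>filt K. \<forall>v\<in>carrier D. \<forall>\<alpha> \<beta>. mh (u \<otimes>\<^bsub>D\<^esub> v) \<alpha> \<beta> = poly q (\<theta> i (\<beta> i)) * mh v \<alpha> \<beta>"
proof -
  from polynomial_in_h[OF assms] obtain u where u: "u \<in> filt K" "\<forall>f\<in>carrier Grp. \<rho> f u \<in> filt K \<and>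
    (\<forall>v\<in>carrier D. \<forall>\<alpha> \<beta>. mh (\<rho> f u \<otimes>\<^bsub>D\<^esub> v) \<alpha> \<beta> = poly q (\<theta> (snd f i) (\<beta> (snd f i))) * mh v \<alpha> \<beta>)"
    by blast
  show ?thesis
    using bspec[OF u(2) one_Grp] gal.rho_one[OF gal.filt_carrier[OF u(1)]]
    by (intro bexI[OF _ u(1)]) (simp add: G_mpr_simps(2))
qed

lemma bezout_uniform: obtains K where
  "\<forall>i<r. \<forall>d>0. \<exists>p q. degree p \<le> K \<and> degree q \<le> K \<and>
        (\<forall>b. poly p (\<theta> i b) * a i b + poly q (\<theta> i b) * a i (b - int d) = 1)"
proof -
  have "\<forall>i. \<exists>K. i < r \<longrightarrow> (\<forall>d>0. \<exists>p q. degree p \<le> K \<and> degree q \<le> K \<and>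
        (\<forall>b. poly p (\<theta> i b) * a i b + poly q (\<theta> i b) * a i (b - int d) = 1))"
    using coefficient_functions.bezout[OF coefficients] by blast
  from choice[OF this] obtain K where K: "\<forall>i. i < r \<longrightarrow> (\<forall>d>0. \<exists>p q. degree p \<le> K i \<and> degree q \<le> K i \<and>
        (\<forall>b. poly p (\<theta> i b) * a i b + poly q (\<theta> i b) * a i (b - int d) = 1))" by (rule exE)
  show ?thesis
  proof (rule that[of "\<Sum>i<r. K i"], intro allI impI)
    fix i d :: nat assume i: "i < r" and d: "0 < d"
    have "K i \<le> (\<Sum>i<r. K i)" using i by (intro member_le_sum) auto
    then show "\<exists>p q. degree p \<le> (\<Sum>i<r. K i) \<and> degree q \<le> (\<Sum>i<r. K i) \<and>
        (\<forall>b. poly p (\<theta> i b) * a i b + poly q (\<theta> i b) * a i (b - int d) = 1)"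
      using K i d by (meson order_trans)
  qed
qed

text \<open>Multiplying by y_i from the left or from the right lowers the exponent of x_i by one and
  produces the factor a(b) or a(b - \<gamma>_i). A Bezout combination with coefficients in h_i
  restores the coefficient 1. Its degree bound K is the same for all exponents, so a step costs a
  constant.\<close>

lemma lower_monomial:
  assumes K: "\<forall>i<r. \<forall>d>0. \<exists>p q. degree p \<le> K \<and> degree q \<le> K \<and>
        (\<forall>b. poly p (\<theta> i b) * a i b + poly q (\<theta> i b) * a i (b - int d) = 1)"
    and w: "monomial_at_one w \<gamma>" and i: "i < r" "0 < \<gamma> i"
  shows "\<exists>w'. reach (K + 1) w w' \<and> monomial_at_one w' (\<gamma>(i := \<gamma> i - 1))"
proof -
  note D = monomial_at_oneD[OF w]
  from K[rule_format, OF i] obtain p q where pq: "degree p \<le> K" "degree q \<le> K"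
    "\<forall>b. poly p (\<theta> i b) * a i b + poly q (\<theta> i b) * a i (b - int (\<gamma> i)) = 1" by (elim exE conjE)
  from polynomial_in_h_one[OF i(1) pq(1)] obtain up where up: "up \<in> filt K"
    "\<forall>v\<in>carrier D. \<forall>\<alpha> \<beta>. mh (up \<otimes>\<^bsub>D\<^esub> v) \<alpha> \<beta> = poly p (\<theta> i (\<beta> i)) * mh v \<alpha> \<beta>" by blast
  from polynomial_in_h_one[OF i(1) pq(2)] obtain uq where uq: "uq \<in> filt K"
    "\<forall>v\<in>carrier D. \<forall>\<alpha> \<beta>. mh (uq \<otimes>\<^bsub>D\<^esub> v) \<alpha> \<beta> = poly q (\<theta> i (\<beta> i)) * mh v \<alpha> \<beta>" by blast
  let ?y = "incl i (y i)"
  have yf: "?y \<in> filt 1" by (rule gen_filt[OF i(1)]) simp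
  have mono: "N \<le> K + 1 \<Longrightarrow> v \<in> filt N \<Longrightarrow> v \<in> filt (K + 1)" for N v
    using gal.filt_mono[OF gens_closed] by blast
  have f1: "up \<otimes>\<^bsub>D\<^esub> ?y \<in> filt (K + 1)" by (rule gal.filt_mult[OF gens_closed up(1) yf])
  have f2: "uq \<in> filt (K + 1)" by (rule mono[OF _ uq(1)]) simp
  have f3: "?y \<in> filt (K + 1)" by (rule mono[OF _ yf]) simp
  note cl = gal.filt_carrier[OF up(1)] gal.filt_carrier[OF uq(1)] gens_in_D(5)[OF i(1)]
  define w' where "w' = (\<lambda>f. up \<otimes>\<^bsub>D\<^esub> ?y \<otimes>\<^bsub>D\<^esub> w f \<oplus>\<^bsub>D\<^esub> uq \<otimes>\<^bsub>D\<^esub> (w f \<otimes>\<^bsub>D\<^esub> \<rho> f ?y))"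
  have r: "reach (K + 1) w w'" unfolding w'_def by (rule reach_op[OF D(4) f1 f2 f3])
  have "monomial_at_one w' (\<gamma>(i := \<gamma> i - 1))"
    unfolding monomial_at_one_def
  proof (intro conjI allI ballI impI)
    show "w' \<one>\<^bsub>Grp\<^esub> \<in> carrier D" by (rule reach_closed[OF r one_Grp])
    show "w' f = \<zero>\<^bsub>D\<^esub>" if "f \<in> carrier Grp" "f \<noteq> \<one>\<^bsub>Grp\<^esub>" for f
      unfolding w'_def D(3)[OF that] using cl gal.rho_closed[OF that(1) cl(3)] by simp
    fix \<alpha> \<beta>
    let ?e = "\<lambda>\<alpha>. if \<forall>j<r. \<alpha> j = int (\<gamma> j) then 1 else 0 :: 'k"
    have cond: "(\<forall>j<r. (\<alpha>(i := \<alpha> i + 1)) j = int (\<gamma> j)) \<longleftrightarrow> (\<forall>j<r. \<alpha> j = int ((\<gamma>(i := \<gamma> i - 1)) j))"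
      by (intro all_cong1 imp_cong refl) (use i(2) in auto)
    have yw: "?y \<otimes>\<^bsub>D\<^esub> w \<one>\<^bsub>Grp\<^esub> \<in> carrier D" "w \<one>\<^bsub>Grp\<^esub> \<otimes>\<^bsub>D\<^esub> ?y \<in> carrier D" using cl D(1) by simp_all
    have "w' \<one>\<^bsub>Grp\<^esub> = up \<otimes>\<^bsub>D\<^esub> (?y \<otimes>\<^bsub>D\<^esub> w \<one>\<^bsub>Grp\<^esub>) \<oplus>\<^bsub>D\<^esub> uq \<otimes>\<^bsub>D\<^esub> (w \<one>\<^bsub>Grp\<^esub> \<otimes>\<^bsub>D\<^esub> ?y)"
      using cl D(1) by (simp add: w'_def gal.rho_one gal.m_assoc)
    also have "mh \<dots> \<alpha> \<beta> = poly p (\<theta> i (\<beta> i)) * mh (?y \<otimes>\<^bsub>D\<^esub> w \<one>\<^bsub>Grp\<^esub>) \<alpha> \<beta> + poly q (\<theta> i (\<beta> i)) * mh (w \<one>\<^bsub>Grp\<^esub> \<otimes>\<^bsub>D\<^esub> ?y) \<alpha> \<beta>"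
      using cl yw up(2) uq(2) by (simp add: mh_add)
    also have "\<dots> = poly p (\<theta> i (\<beta> i)) * (a i (\<beta> i) * ?e (\<alpha>(i := \<alpha> i + 1))) +
        poly q (\<theta> i (\<beta> i)) * (a i (\<beta> i - \<alpha> i - 1) * ?e (\<alpha>(i := \<alpha> i + 1)))"
      by (simp only: mh_gens(9)[OF i(1) D(1)] mh_gens(10)[OF i(1) D(1)] D(2))
    also have "\<dots> = (if \<forall>j<r. \<alpha> j = int ((\<gamma>(i := \<gamma> i - 1)) j) then 1 else 0)"
    proof (cases "\<forall>j<r. \<alpha> j = int ((\<gamma>(i := \<gamma> i - 1)) j)")
      case True
      then have "\<alpha> i = int (\<gamma> i - 1)" using i(1) by (simp only: fun_upd_same)
      then have "\<beta> i - \<alpha> i - 1 = \<beta> i - int (\<gamma> i)" using i(2) by simp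
      then show ?thesis using pq(3) unfolding cond if_P[OF True] by (simp only: mult_1_right)
    next
      case False
      show ?thesis unfolding cond if_not_P[OF False] by simp
    qed
    finally show "mh (w' \<one>\<^bsub>Grp\<^esub>) \<alpha> \<beta> = (if \<forall>j<r. \<alpha> j = int ((\<gamma>(i := \<gamma> i - 1)) j) then 1 else 0)" .
  qed
  then show ?thesis using r by blast
qed

lemma lower_to_one:
  assumes K: "\<forall>i<r. \<forall>d>0. \<exists>p q. degree p \<le> K \<and> degree q \<le> K \<and>
        (\<forall>b. poly p (\<theta> i b) * a i b + poly q (\<theta> i b) * a i (b - int d) = 1)"
    and "monomial_at_one w \<gamma>" and "(\<Sum>i<r. \<gamma> i) = n"
  shows "\<exists>w'. reach (n * (K + 1)) w w' \<and> (\<forall>f\<in>carrier Grp. w' f = (if f = \<one>\<^bsub>Grp\<^esub> then \<one>\<^bsub>D\<^esub> else \<zero>\<^bsub>D\<^esub>))"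
  using assms(2,3)
proof (induction n arbitrary: w \<gamma>)
  case 0
  note D = monomial_at_oneD[OF 0(1)]
  have g0: "\<gamma> i = 0" if "i < r" for i using 0(2) that by simp
  obtain w' where w': "reach 0 w w'" "\<forall>f\<in>carrier Grp. w' f = w f"
    by (rule reach_refl[OF D(4)])
  have "w \<one>\<^bsub>Grp\<^esub> \<oplus>\<^bsub>D\<^esub> (- 1) \<odot>\<^bsub>D\<^esub> \<one>\<^bsub>D\<^esub> = \<zero>\<^bsub>D\<^esub>"
  proof (rule mh_injective)
    fix \<alpha> \<beta>
    have "(\<forall>i<r. \<alpha> i = int (\<gamma> i)) \<longleftrightarrow> (\<forall>i<r. \<alpha> i = 0)" using g0 by auto
    then show "mh (w \<one>\<^bsub>Grp\<^esub> \<oplus>\<^bsub>D\<^esub> (- 1) \<odot>\<^bsub>D\<^esub> \<one>\<^bsub>D\<^esub>) \<alpha> \<beta> = 0"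
      using D(1) by (simp add: mh_add mh_smult mh_one D(2))
  qed (use D(1) in simp)
  then have "w \<one>\<^bsub>Grp\<^esub> = \<one>\<^bsub>D\<^esub>"
    using D(1) gal.minus_unique gal.uminus_smult[of "\<one>\<^bsub>D\<^esub>"] gal.r_neg gal.add.inv_equality
    by (metis gal.add.inv_inv gal.minus_equality gal.one_closed gal.smult_closed)
  then have "\<forall>f\<in>carrier Grp. w' f = (if f = \<one>\<^bsub>Grp\<^esub> then \<one>\<^bsub>D\<^esub> else \<zero>\<^bsub>D\<^esub>)" using w'(2) D(3) by simp
  then show ?case using w'(1) by (intro exI[of _ w']) simp
next
  case (Suc n)
  obtain i where i: "i < r" "0 < \<gamma> i"
  proof (rule ccontr)
    assume "\<not> thesis"
    with that have "(\<Sum>i<r. \<gamma> i) = 0" by (intro sum.neutral) auto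
    then show False using Suc.prems by simp
  qed
  from lower_monomial[OF K Suc.prems(1) i] obtain w1 where w1: "reach (K + 1) w w1"
    "monomial_at_one w1 (\<gamma>(i := \<gamma> i - 1))" by (elim exE conjE)
  have "(\<Sum>j<r. (\<gamma>(i := \<gamma> i - 1)) j) = (\<gamma> i - 1) + (\<Sum>j\<in>{..<r} - {i}. (\<gamma>(i := \<gamma> i - 1)) j)"
    using i by (subst sum.remove[of _ i]) auto
  also have "(\<Sum>j\<in>{..<r} - {i}. (\<gamma>(i := \<gamma> i - 1)) j) = (\<Sum>j\<in>{..<r} - {i}. \<gamma> j)"
    by (intro sum.cong) auto
  also have "\<gamma> i - 1 + (\<Sum>j\<in>{..<r} - {i}. \<gamma> j) = (\<Sum>j<r. \<gamma> j) - 1"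
    using i by (subst (2) sum.remove[of _ i]) auto
  finally have "(\<Sum>j<r. (\<gamma>(i := \<gamma> i - 1)) j) = n" using Suc.prems by simp
  from Suc.IH[OF w1(2) this] obtain w2 where w2: "reach (n * (K + 1)) w1 w2"
    "\<forall>f\<in>carrier Grp. w2 f = (if f = \<one>\<^bsub>Grp\<^esub> then \<one>\<^bsub>D\<^esub> else \<zero>\<^bsub>D\<^esub>)" by (elim exE conjE)
  have "Suc n * (K + 1) = (K + 1) + n * (K + 1)" by simp
  then show ?case using reach_trans[OF w1(1) w2(1)] w2(2) by (intro exI[of _ w2] conjI) (simp only:)
qed

lemma effectively_simple: "\<exists>c. \<forall>n. \<forall>u\<in>filt n. u \<noteq> \<zero>\<^bsub>D\<^esub> \<longrightarrow>
    (\<exists>T\<in>gal.twisted (c * (n + 1)). \<forall>f\<in>carrier Grp. T f u = (if f = \<one>\<^bsub>Grp\<^esub> then \<one>\<^bsub>D\<^esub> else \<zero>\<^bsub>D\<^esub>))"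
proof -
  obtain K where K: "\<forall>i<r. \<forall>d>0. \<exists>p q. degree p \<le> K \<and> degree q \<le> K \<and>
        (\<forall>b. poly p (\<theta> i b) * a i b + poly q (\<theta> i b) * a i (b - int d) = 1)" by (rule bezout_uniform)
  have fin: "finite (roots_of_unity e :: 'k set)" by (rule finite_roots[OF e_pos])
  obtain zs where zs: "set zs = roots_of_unity e - {1 :: 'k}" using finite_list[of "roots_of_unity e - {1}"] fin by blast
  define ps where "ps = List.product [0..<r] zs"
  have ps: "(i, \<zeta>) \<in> set ps \<longleftrightarrow> i < r \<and> \<zeta> ^ e = 1 \<and> \<zeta> \<noteq> 1" for i \<zeta>
    unfolding ps_def using zs by (auto simp: roots_of_unity_def)
  \<comment> \<open>\<open>N1\<close> bounds supports and degrees after the move to \<alpha> = 0,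
    \<open>N3\<close> the degrees after the diagonal stage, and \<open>Q\<close> the sum of the
    exponents created later; \<open>R\<close> adds up the costs of all stages.\<close>
  define N1 where "N1 n = n + r * n" for n
  define N3 where "N3 n = dd * (N1 n + r * r * (2 * N1 n + 1))" for n
  define Q where "Q n = length ps * (2 * N3 n + 1) + r * (2 * N3 n + 1)" for n
  define R where "R n = r * n + r * r * (2 * N1 n + 1) + length ps * (2 * N3 n + 1) + r * (3 * N3 n + 1) + (K + 1) * Q n" for n
  have "affine_growth R"
    unfolding R_def Q_def N3_def N1_def by (intro affine_growth_intros)
  then obtain c where c: "\<forall>n. R n \<le> c * (n + 1)" by (rule affine_growth_linear)
  show ?thesis
  proof (intro exI[of _ c] allI ballI impI)
    fix n u assume u: "u \<in> filt n" "u \<noteq> \<zero>\<^bsub>D\<^esub>"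
    have uc: "u \<in> carrier D" by (rule gal.filt_carrier[OF u(1)])
    have "\<exists>\<alpha> \<beta>. mh u \<alpha> \<beta> \<noteq> 0" using mh_injective[OF uc] u(2) by blast
    then obtain \<alpha> \<beta> where nz: "mh u \<alpha> \<beta> \<noteq> 0" by (elim exE)
    have bnd: "bounded n n u" by (rule filt_bounded[OF u(1)])
    define k where "k = (\<Sum>i<r. nat \<bar>\<alpha> i\<bar>)"
    have "k \<le> (\<Sum>i<r. n)" unfolding k_def
    proof (rule sum_mono)
      fix i assume "i \<in> {..<r}"
      then have "\<bar>\<alpha> i\<bar> \<le> int n" using bnd nz by (simp add: bounded_def)
      then show "nat \<bar>\<alpha> i\<bar> \<le> n" by simp
    qed
    then have k: "k \<le> r * n" by simp
    have "\<forall>f\<in>carrier Grp. bounded n n ((\<lambda>_. u) f)" using bnd by simp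
    from step0[OF this nz k_def] obtain w0 \<beta>0 where w0: "reach k (\<lambda>_. u) w0"
      "\<forall>f\<in>carrier Grp. bounded (n + k) (n + k) (w0 f)" "mh (w0 \<one>\<^bsub>Grp\<^esub>) (\<lambda>_. 0) \<beta>0 \<noteq> 0" by (elim exE conjE)
    have "\<forall>f\<in>carrier Grp. bounded (N1 n) (N1 n) (w0 f)"
    proof
      fix f assume "f \<in> carrier Grp"
      then have "bounded (n + k) (n + k) (w0 f)" using w0(2) by blast
      then show "bounded (N1 n) (N1 n) (w0 f)" by (rule bounded_mono) (use k in \<open>simp_all add: N1_def\<close>)
    qed
    from diagonal_state[OF this w0(3)] obtain w1 P1 where w1: "reach (r * r * (2 * N1 n + 1)) w0 w1"
      "monomial_state (N3 n) {..<r} w1 (\<lambda>_. 0) P1" "P1 ident \<noteq> (\<lambda>_. 0)" unfolding N3_def by (elim exE conjE)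
    have "\<forall>(i, \<zeta>)\<in>set ps. i < r \<and> \<zeta> ^ e = 1 \<and> \<zeta> \<noteq> 1" using ps by auto
    from kill_diagonal_list[OF w1(2,3) this] obtain w2 \<gamma>2 P2 where
      w2: "reach (length ps * (2 * N3 n + 1)) w1 w2" "monomial_state (N3 n) {..<r} w2 \<gamma>2 P2" "P2 ident \<noteq> (\<lambda>_. 0)"
      "(\<Sum>j<r. \<gamma>2 j) = (\<Sum>j<r. 0) + length ps * (2 * N3 n + 1)"
      "\<forall>(i, \<zeta>)\<in>set ps. \<forall>\<xi>. (\<xi>, id) \<in> carrier Grp \<longrightarrow> \<zeta> * \<xi> i = 1 \<longrightarrow> P2 \<xi> = (\<lambda>_. 0)"
      by (elim exE conjE)
    have diag: "\<forall>\<xi>. (\<xi>, id) \<in> carrier Grp \<longrightarrow> \<xi> \<noteq> ident \<longrightarrow> P2 \<xi> = (\<lambda>_. 0)"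
    proof (intro allI impI)
      fix \<xi> assume f: "(\<xi>, id) \<in> carrier Grp" and ne: "\<xi> \<noteq> ident"
      have A: "\<xi> \<in> A_mpr e p r" using f by (simp only: G_mpr_simps)
      obtain i where i: "i < r" "\<xi> i \<noteq> 1"
      proof (rule ccontr)
        assume "\<not> thesis"
        with that have "\<xi> i = 1" if "i < r" for i using \<open>i < r\<close> by blast
        then have "\<xi> = ident" using A by (auto simp: A_mpr_def PiE_iff extensional_def fun_eq_iff)
        then show False using ne by contradiction
      qed
      have root: "\<xi> i ^ e = 1" by (rule A_mpr_root[OF A i(1)])
      then have nz: "\<xi> i \<noteq> 0" using e_pos by (auto simp: zero_power)
      \<comment> \<open>A diagonal element other than the unit is removed by \<zeta> = 1 / \<xi>_i
        at a coordinate where \<xi>_i /= 1.\<close>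
      have "(i, inverse (\<xi> i)) \<in> set ps" unfolding ps using i root by (simp add: power_inverse)
      moreover have "inverse (\<xi> i) * \<xi> i = 1" using nz by simp
      ultimately show "P2 \<xi> = (\<lambda>_. 0)" using w2(5) f by fast
    qed
    from monomial_reached[OF w2(2,3) diag] obtain w3 \<gamma>3 where w3: "reach (r * (3 * N3 n + 1)) w2 w3"
      "monomial_at_one w3 \<gamma>3" "(\<Sum>j<r. \<gamma>3 j) \<le> (\<Sum>j<r. \<gamma>2 j) + r * (2 * N3 n + 1)" by (elim exE conjE)
    from lower_to_one[OF K w3(2) refl] obtain w4 where
      w4: "reach ((\<Sum>i<r. \<gamma>3 i) * (K + 1)) w3 w4"
        "\<forall>f\<in>carrier Grp. w4 f = (if f = \<one>\<^bsub>Grp\<^esub> then \<one>\<^bsub>D\<^esub> else \<zero>\<^bsub>D\<^esub>)" by (elim exE conjE)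
    have Q: "(\<Sum>i<r. \<gamma>3 i) \<le> Q n" using w3(3) w2(4) by (simp add: Q_def)
    have "reach (k + r * r * (2 * N1 n + 1) + length ps * (2 * N3 n + 1) + r * (3 * N3 n + 1) + (\<Sum>i<r. \<gamma>3 i) * (K + 1)) (\<lambda>_. u) w4"
      by (rule reach_trans[OF reach_trans[OF reach_trans[OF reach_trans[OF w0(1) w1(1)] w2(1)] w3(1)] w4(1)])
    moreover have "(\<Sum>i<r. \<gamma>3 i) * (K + 1) \<le> (K + 1) * Q n" using mult_le_mono1[OF Q, of "K + 1"] by (simp only: mult.commute)
    then have "k + r * r * (2 * N1 n + 1) + length ps * (2 * N3 n + 1) + r * (3 * N3 n + 1) + (\<Sum>i<r. \<gamma>3 i) * (K + 1) \<le> R n"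
      unfolding R_def using k by (intro add_mono order_refl)
    then have "k + r * r * (2 * N1 n + 1) + length ps * (2 * N3 n + 1) + r * (3 * N3 n + 1) + (\<Sum>i<r. \<gamma>3 i) * (K + 1) \<le> c * (n + 1)"
      using c by (meson order_trans)
    ultimately have "reach (c * (n + 1)) (\<lambda>_. u) w4" by (rule reach_mono)
    then obtain T where "T \<in> gal.twisted (c * (n + 1))" "\<forall>f\<in>carrier Grp. T f u = w4 f"
      unfolding reach_def by blast
    then show "\<exists>T\<in>gal.twisted (c * (n + 1)). \<forall>f\<in>carrier Grp. T f u = (if f = \<one>\<^bsub>Grp\<^esub> then \<one>\<^bsub>D\<^esub> else \<zero>\<^bsub>D\<^esub>)"
      using w4(2) by (intro bexI[of _ T]) simp_all
  qed
qed

lemma mh_finsum: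
  assumes "finite I" "\<And>i. i \<in> I \<Longrightarrow> u i \<in> carrier D"
  shows "mh (\<Oplus>\<^bsub>D\<^esub>i\<in>I. u i) \<alpha> \<beta> = (\<Sum>i\<in>I. mh (u i) \<alpha> \<beta>)"
  using assms
proof (induction I)
  case (insert i I)
  have "u \<in> I \<rightarrow> carrier D" "u i \<in> carrier D" using insert.prems by auto
  then show ?case using insert by (simp add: gal.finsum_insert mh_add gal.finsum_closed)
qed (simp add: mh_zero)

text \<open>F is the trace of a polynomial in h_0 whose roots include all \<theta>_i(b) with |b|
  \<le> n. The coefficients of F v vanish on the box of radius n, so by locality those of u F v
  vanish at \<beta> = 0 when u has degree at most n, whereas 1 has the coefficient 1 there. The
  constant 2 r comes from counting the r (2 n + 1) listed roots.\<close>

lemma obstruction: "\<exists>c. \<forall>n. \<exists>F\<in>carrier (invariant_alg D Grp \<rho>) \<inter> filt (c * (n + 1)). F \<noteq> \<zero>\<^bsub>D\<^esub> \<and>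
    \<one>\<^bsub>D\<^esub> \<notin> k_span D {u \<otimes>\<^bsub>D\<^esub> F \<otimes>\<^bsub>D\<^esub> v |u v. u \<in> filt n \<and> v \<in> carrier D}"
proof (intro exI[of _ "2 * r"] allI)
  fix n
  \<comment> \<open>Values for all coordinates are included: a permutation may carry h_0 to any h_i,
    and the functions \<theta>_i may differ.\<close>
  define zs where "zs = concat (map (\<lambda>i. map (\<theta> i) [- int n..int n]) [0..<r])"
  have zs: "\<theta> i b \<in> set zs" if "i < r" "\<bar>b\<bar> \<le> int n" for i b
    unfolding zs_def using that by (auto intro!: bexI[of _ i] imageI)
  have len: "length zs = r * (2 * n + 1)"
    unfolding zs_def by (simp add: length_concat comp_def sum_list_triv nat_add_distrib nat_mult_distrib)
  define q where "q = (\<Prod>z\<leftarrow>zs. [:- z, 1:])"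
  have deg: "degree q \<le> length zs" unfolding q_def
  proof (induction zs)
    case (Cons z zs)
    have "degree ([:- z, 1:] * (\<Prod>z\<leftarrow>zs. [:- z, 1:])) \<le> degree [:- z, 1:] + degree (\<Prod>z\<leftarrow>zs. [:- z, 1:])"
      by (rule degree_mult_le)
    then show ?case using Cons by simp
  qed simp
  have q0: "poly q t = 0 \<longleftrightarrow> t \<in> set zs" for t
    unfolding q_def by (induction zs) auto
  from polynomial_in_h[OF r_pos deg] obtain u where u: "u \<in> filt (length zs)"
    "\<forall>f\<in>carrier Grp. \<rho> f u \<in> filt (length zs) \<and>
      (\<forall>v\<in>carrier D. \<forall>\<alpha> \<beta>. mh (\<rho> f u \<otimes>\<^bsub>D\<^esub> v) \<alpha> \<beta> = poly q (\<theta> (snd f 0) (\<beta> (snd f 0))) * mh v \<alpha> \<beta>)"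
    by blast
  have uc: "u \<in> carrier D" by (rule gal.filt_carrier[OF u(1)])
  have rc: "\<rho> f u \<in> carrier D" if "f \<in> carrier Grp" for f by (rule gal.rho_closed[OF that uc])
  let ?F = "gal.Tr u"
  have Fc: "?F \<in> carrier D" by (rule gal.Tr_closed[OF uc])
  have mhF: "mh (?F \<otimes>\<^bsub>D\<^esub> v) \<alpha> \<beta> = (\<Sum>f\<in>carrier Grp. poly q (\<theta> (snd f 0) (\<beta> (snd f 0)))) * mh v \<alpha> \<beta>"
    if v: "v \<in> carrier D" for v \<alpha> \<beta>
  proof -
    have "?F \<otimes>\<^bsub>D\<^esub> v = (\<Oplus>\<^bsub>D\<^esub>f\<in>carrier Grp. \<rho> f u \<otimes>\<^bsub>D\<^esub> v)"
      unfolding gal.Tr_def by (rule gal.finsum_ldistr) (use gal.finite_G v rc in auto)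
    also have "mh \<dots> \<alpha> \<beta> = (\<Sum>f\<in>carrier Grp. mh (\<rho> f u \<otimes>\<^bsub>D\<^esub> v) \<alpha> \<beta>)"
      by (rule mh_finsum[OF gal.finite_G]) (use rc v in simp)
    also have "\<dots> = (\<Sum>f\<in>carrier Grp. poly q (\<theta> (snd f 0) (\<beta> (snd f 0))) * mh v \<alpha> \<beta>)"
      by (rule sum.cong[OF refl]) (use u(2) v in blast)
    finally show ?thesis by (simp only: sum_distrib_right)
  qed
  have perm: "snd f 0 < r" if "f \<in> carrier Grp" for f using perm_less[of "fst f" "snd f" 0] that r_pos by simp
  show "\<exists>F\<in>carrier (invariant_alg D Grp \<rho>) \<inter> filt (2 * r * (n + 1)). F \<noteq> \<zero>\<^bsub>D\<^esub> \<and>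
    \<one>\<^bsub>D\<^esub> \<notin> k_span D {u \<otimes>\<^bsub>D\<^esub> F \<otimes>\<^bsub>D\<^esub> v |u v. u \<in> filt n \<and> v \<in> carrier D}"
  proof (intro bexI[of _ ?F] conjI IntI)
    show "?F \<in> carrier (invariant_alg D Grp \<rho>)" by (rule gal.Tr_B[OF uc])
    have "?F \<in> filt (length zs)"
      unfolding gal.Tr_def
      by (rule gal.finsum_subspace[OF gal.filt_subspace[OF gens_closed] gal.finite_G]) (use u(2) in blast)
    moreover have "length zs \<le> 2 * r * (n + 1)" unfolding len by (simp add: algebra_simps)
    ultimately show "?F \<in> filt (2 * r * (n + 1))" using gal.filt_mono[OF gens_closed] by blast
    show "?F \<noteq> \<zero>\<^bsub>D\<^esub>"
    proof
      assume F0: "?F = \<zero>\<^bsub>D\<^esub>"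
      have "finite (\<theta> 0 -` set zs)" by (simp add: finite_vimageI coefficient_functions.\<theta>_inj[OF coefficients[OF r_pos]])
      then have "\<theta> 0 -` set zs \<noteq> UNIV" using infinite_UNIV_int by metis
      then obtain b where b: "\<theta> 0 b \<notin> set zs" by blast
      \<comment> \<open>Coordinate 0 is placed off the roots and the others at 0. Summands whose
        permutation moves 0 then vanish and the remaining ones are equal, so nothing cancels in
        characteristic 0.\<close>
      define \<beta> where "\<beta> = (\<lambda>_::nat. 0)(0 := b)"
      have "(\<Sum>f\<in>carrier Grp. poly q (\<theta> (snd f 0) (\<beta> (snd f 0)))) =
          (\<Sum>f\<in>carrier Grp. if snd f 0 = 0 then poly q (\<theta> 0 b) else 0)"
      proof (rule sum.cong[OF refl])
        fix f assume f: "f \<in> carrier Grp"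
        have "\<theta> (snd f 0) 0 \<in> set zs" by (rule zs[OF perm[OF f]]) simp
        then show "poly q (\<theta> (snd f 0) (\<beta> (snd f 0))) = (if snd f 0 = 0 then poly q (\<theta> 0 b) else 0)"
          by (simp add: \<beta>_def q0)
      qed
      also have "\<dots> = of_nat (card {f \<in> carrier Grp. snd f 0 = 0}) * poly q (\<theta> 0 b)"
        using gal.finite_G by (simp add: sum.inter_filter[symmetric])
      also have "\<dots> \<noteq> 0"
      proof -
        have "\<one>\<^bsub>Grp\<^esub> \<in> {f \<in> carrier Grp. snd f 0 = 0}" using one_Grp by (simp add: G_mpr_simps(2))
        then have "{f \<in> carrier Grp. snd f 0 = 0} \<noteq> {}" by blast
        then have "card {f \<in> carrier Grp. snd f 0 = 0} \<noteq> 0" using gal.finite_G by simp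
        then show ?thesis using b by (simp add: q0)
      qed
      finally have "mh (?F \<otimes>\<^bsub>D\<^esub> \<one>\<^bsub>D\<^esub>) (\<lambda>_. 0) \<beta> \<noteq> 0" unfolding mhF[OF gal.one_closed] mh_one by simp
      then show False unfolding F0 by (simp add: mh_zero)
    qed
    let ?W = "{v \<in> carrier D. \<forall>\<alpha>. mh v \<alpha> (\<lambda>_. 0) = 0}"
    have W: "k_subspace D ?W"
      unfolding k_subspace_def by (auto simp: mh_zero mh_add mh_smult)
    have "k_span D {u \<otimes>\<^bsub>D\<^esub> ?F \<otimes>\<^bsub>D\<^esub> v |u v. u \<in> filt n \<and> v \<in> carrier D} \<subseteq> ?W"
    proof (rule k_span_minimal[OF W], clarify, intro conjI allI)
      fix u v \<alpha> assume u: "u \<in> filt n" and v: "v \<in> carrier D"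
      have uc: "u \<in> carrier D" by (rule gal.filt_carrier[OF u])
      show "u \<otimes>\<^bsub>D\<^esub> ?F \<otimes>\<^bsub>D\<^esub> v \<in> carrier D" using uc v Fc by simp
      have "mh (u \<otimes>\<^bsub>D\<^esub> (?F \<otimes>\<^bsub>D\<^esub> v)) \<alpha> (\<lambda>_. 0) = 0"
      proof (rule filt_zero_box[where n = 0 and k = n, OF u])
        show "?F \<otimes>\<^bsub>D\<^esub> v \<in> carrier D" using Fc v by simp
        fix \<alpha> \<beta> assume box: "\<And>i. i < r \<Longrightarrow> \<bar>\<beta> i\<bar> \<le> int (0 + n)"
        have "(\<Sum>f\<in>carrier Grp. poly q (\<theta> (snd f 0) (\<beta> (snd f 0)))) = 0"
        proof (rule sum.neutral, rule ballI)
          fix f assume f: "f \<in> carrier Grp"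
          show "poly q (\<theta> (snd f 0) (\<beta> (snd f 0))) = 0"
            unfolding q0 by (rule zs[OF perm[OF f]]) (use box[OF perm[OF f]] in simp)
        qed
        then show "mh (?F \<otimes>\<^bsub>D\<^esub> v) \<alpha> \<beta> = 0" unfolding mhF[OF v] by simp
      qed simp
      then show "mh (u \<otimes>\<^bsub>D\<^esub> ?F \<otimes>\<^bsub>D\<^esub> v) \<alpha> (\<lambda>_. 0) = 0" using uc v Fc by (simp add: gal.m_assoc)
    qed
    moreover have "\<one>\<^bsub>D\<^esub> \<notin> ?W"
    proof
      assume "\<one>\<^bsub>D\<^esub> \<in> ?W"
      then have "mh \<one>\<^bsub>D\<^esub> (\<lambda>_. 0) (\<lambda>_. 0) = 0" by blast
      then show False unfolding mh_one by simp
    qed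
    ultimately show "\<one>\<^bsub>D\<^esub> \<notin> k_span D {u \<otimes>\<^bsub>D\<^esub> ?F \<otimes>\<^bsub>D\<^esub> v |u v. u \<in> filt n \<and> v \<in> carrier D}" by blast
  qed
qed

lemma simple_action: "effectively_simple_action D Grp \<rho> gens"
  by (intro effectively_simple_action.intro galois effectively_simple_action_axioms.intro
    effectively_simple obstruction)

end

section \<open>Generalized Weyl algebras of rank one\<close>

text \<open>
  The presentation of a generalized Weyl algebra is realized by operators on functions on \<open>\<int>\<close>,
  where \<open>d\<close> in the coefficient ring multiplies by \<open>ev d\<close>; this yields the matrix coefficients.
\<close>

locale gwa_coefficients = D0: k_alg D0 + A: k_alg A + coefficient_functions \<theta> a l W da
  for D0 :: "('k::field_char_0, 'd) module" and A :: "('k, 'b) module"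
    and \<theta> a :: "int \<Rightarrow> 'k" and l :: 'k and W and da +
  fixes \<sigma> :: "'d \<Rightarrow> 'd" and ev :: "'d \<Rightarrow> int \<Rightarrow> 'k" and a0 h0 g0 g0' :: 'd
    and f :: "('d gwa_generator list \<Rightarrow>\<^sub>0 'k) set \<Rightarrow> 'b"
  assumes \<sigma>: "bij_betw \<sigma> (carrier D0) (carrier D0)"
    and ev_add: "d \<in> carrier D0 \<Longrightarrow> d' \<in> carrier D0 \<Longrightarrow> ev (d \<oplus>\<^bsub>D0\<^esub> d') b = ev d b + ev d' b"
    and ev_mult: "d \<in> carrier D0 \<Longrightarrow> d' \<in> carrier D0 \<Longrightarrow> ev (d \<otimes>\<^bsub>D0\<^esub> d') b = ev d b * ev d' b"
    and ev_smult: "d \<in> carrier D0 \<Longrightarrow> ev (c \<odot>\<^bsub>D0\<^esub> d) b = c * ev d b"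
    and ev_one: "ev \<one>\<^bsub>D0\<^esub> b = 1"
    and ev_\<sigma>: "d \<in> carrier D0 \<Longrightarrow> ev (\<sigma> d) b = ev d (b - 1)"
    and D0_gens_closed: "a0 \<in> carrier D0" "h0 \<in> carrier D0" "g0 \<in> carrier D0" "g0' \<in> carrier D0"
    and ev_gens: "ev a0 b = a b" "ev h0 b = \<theta> b" "ev g0 b = l powi (- b)" "ev g0' b = l powi b"
    and D0_generate: "generates_alg D0 {h0, g0, g0'}"
    and D0_basis: "\<exists>E\<subseteq>carrier D0. k_span D0 E = carrier D0 \<and> (\<forall>F c. finite F \<longrightarrow> F \<subseteq> E \<longrightarrow>
        finite {b. (\<Sum>e\<in>F. c e * ev e b) \<noteq> 0} \<longrightarrow> (\<forall>e\<in>F. c e = 0))"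
    and iso: "f \<in> alg_iso (gwa D0 \<sigma> a0) A"
begin

abbreviation letters where "letters \<equiv> Coef ` carrier D0 \<union> {GenX, GenY}"
abbreviation inv_\<sigma> where "inv_\<sigma> \<equiv> inv_into (carrier D0) \<sigma>"

lemma monoid_simps: "carrier (gwa_monoid D0) = lists letters" "s \<otimes>\<^bsub>gwa_monoid D0\<^esub> t = s @ t"
    "\<one>\<^bsub>gwa_monoid D0\<^esub> = []"
  by (simp_all add: gwa_monoid_def free_monoid_def)

lemma \<sigma>_closed: "d \<in> carrier D0 \<Longrightarrow> \<sigma> d \<in> carrier D0"
  using \<sigma> by (auto simp: bij_betw_def)

lemma inv_\<sigma>_closed: "d \<in> carrier D0 \<Longrightarrow> inv_\<sigma> d \<in> carrier D0"
  using \<sigma> by (metis bij_betw_imp_surj_on inv_into_into)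

lemma ev_inv_\<sigma>: assumes "d \<in> carrier D0" shows "ev (inv_\<sigma> d) b = ev d (b + 1)"
proof -
  have "\<sigma> (inv_\<sigma> d) = d" using \<sigma> assms by (simp add: bij_betw_def f_inv_into_f)
  then show ?thesis using ev_\<sigma>[OF inv_\<sigma>_closed[OF assms], of "b + 1"] by simp
qed

lemma gwa_presentation: "presentation (gwa_monoid D0) (gwa_relations D0 \<sigma> a0)"
proof -
  interpret M: Group.monoid "gwa_monoid D0"
    by (rule monoidI) (auto simp: monoid_simps)
  show ?thesis
  proof
    fix u v assume "(u, v) \<in> gwa_relations D0 \<sigma> a0"
    then show "Poly_Mapping.keys u \<subseteq> carrier (gwa_monoid D0) \<and> Poly_Mapping.keys v \<subseteq> carrier (gwa_monoid D0)"
      unfolding gwa_relations_def monoid_simps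
      by (elim UnE CollectE exE conjE insertE)
        (auto simp: D0_gens_closed \<sigma>_closed inv_\<sigma>_closed dest!: subsetD[OF keys_add])
  qed
qed

interpretation T: presentation "gwa_monoid D0" "gwa_relations D0 \<sigma> a0"
  by (rule gwa_presentation)

definition F where "F w = f (T.cls w)"
abbreviation Fb where "Fb s \<equiv> F (basis s)"

lemma f_hom:
  "u \<in> carrier T.P \<Longrightarrow> f u \<in> carrier A"
  "u \<in> carrier T.P \<Longrightarrow> v \<in> carrier T.P \<Longrightarrow> f (u \<oplus>\<^bsub>T.P\<^esub> v) = f u \<oplus>\<^bsub>A\<^esub> f v"
  "u \<in> carrier T.P \<Longrightarrow> v \<in> carrier T.P \<Longrightarrow> f (u \<otimes>\<^bsub>T.P\<^esub> v) = f u \<otimes>\<^bsub>A\<^esub> f v"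
  "u \<in> carrier T.P \<Longrightarrow> f (c \<odot>\<^bsub>T.P\<^esub> u) = c \<odot>\<^bsub>A\<^esub> f u"
  "f \<one>\<^bsub>T.P\<^esub> = \<one>\<^bsub>A\<^esub>" "bij_betw f (carrier T.P) (carrier A)"
  using iso by (auto simp: alg_iso_def alg_hom_def gwa_def ring_hom_def)

lemma F_hom:
  assumes "w \<in> carrier T.kM" "w' \<in> carrier T.kM"
  shows "F w \<in> carrier A" "F (w + w') = F w \<oplus>\<^bsub>A\<^esub> F w'" "F (w \<otimes>\<^bsub>T.kM\<^esub> w') = F w \<otimes>\<^bsub>A\<^esub> F w'"
    "F (Poly_Mapping.map (\<lambda>x. c * x) w) = c \<odot>\<^bsub>A\<^esub> F w"
    "F w = F w' \<longleftrightarrow> T.cls w = T.cls w'"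
proof -
  note c = T.cls_hom(1)[OF assms(1)] T.cls_hom(1)[OF assms(2)]
  show "F w \<in> carrier A" unfolding F_def by (rule f_hom(1)[OF c(1)])
  show "F (w + w') = F w \<oplus>\<^bsub>A\<^esub> F w'"
    using T.cls_hom(2)[OF assms] f_hom(2)[OF c] by (simp add: F_def monoid_alg_simps(4))
  show "F (w \<otimes>\<^bsub>T.kM\<^esub> w') = F w \<otimes>\<^bsub>A\<^esub> F w'"
    using T.cls_hom(3)[OF assms] f_hom(3)[OF c] by (simp add: F_def)
  show "F (Poly_Mapping.map (\<lambda>x. c * x) w) = c \<odot>\<^bsub>A\<^esub> F w"
    using T.cls_hom(6)[OF assms(1), of c] f_hom(4)[OF c(1), of c] by (simp add: F_def monoid_alg_simps(5))
  show "F w = F w' \<longleftrightarrow> T.cls w = T.cls w'"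
    using f_hom(6) c by (auto simp: F_def bij_betw_def dest: inj_onD)
qed

lemma F_rep: assumes "u \<in> carrier A" obtains w where "w \<in> carrier T.kM" "u = F w"
proof -
  have "u \<in> f ` carrier T.P" using assms f_hom(6) by (simp add: bij_betw_def)
  then show ?thesis using that unfolding T.carrier_P F_def by blast
qed

lemma Fb_closed: "s \<in> lists letters \<Longrightarrow> Fb s \<in> carrier A"
  using F_hom(1)[OF T.basis_closed T.basis_closed] by (simp add: monoid_simps)

lemma Fb_append: "s \<in> lists letters \<Longrightarrow> t \<in> lists letters \<Longrightarrow> Fb (s @ t) = Fb s \<otimes>\<^bsub>A\<^esub> Fb t"
  using F_hom(3)[OF T.basis_closed T.basis_closed, of s t] by (simp add: monoid_simps)

lemma Fb_Nil: "Fb [] = \<one>\<^bsub>A\<^esub>"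
  using T.cls_hom(4) f_hom(5) by (simp add: F_def monoid_simps)

lemma F_single: "s \<in> lists letters \<Longrightarrow> F (Poly_Mapping.single s c) = c \<odot>\<^bsub>A\<^esub> Fb s"
  using F_hom(4)[OF T.basis_closed T.basis_closed, of s s c] T.scale_basis[of c s]
  by (simp add: monoid_simps monoid_alg_simps(5))

lemma A_induct [consumes 1, case_names word add smult]:
  assumes "u \<in> carrier A" "\<And>s. s \<in> lists letters \<Longrightarrow> Q (Fb s)"
    "\<And>u v. u \<in> carrier A \<Longrightarrow> v \<in> carrier A \<Longrightarrow> Q u \<Longrightarrow> Q v \<Longrightarrow> Q (u \<oplus>\<^bsub>A\<^esub> v)"
    "\<And>c u. u \<in> carrier A \<Longrightarrow> Q u \<Longrightarrow> Q (c \<odot>\<^bsub>A\<^esub> u)"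
  shows "Q u"
proof -
  obtain w where w: "w \<in> carrier T.kM" "u = F w" using F_rep[OF assms(1)] .
  have k: "Poly_Mapping.keys w' \<subseteq> lists letters \<longleftrightarrow> w' \<in> carrier T.kM" for w' by (simp add: monoid_alg_simps(1) monoid_simps)
  have "Poly_Mapping.keys w \<subseteq> lists letters" using w(1) k by simp
  then have "Q (F w)"
  proof (induction w rule: poly_mapping_single_induct)
    case (single s c)
    then show ?case by (simp add: F_single assms(2,4) Fb_closed)
  next
    case zero
    have "Q (0 \<odot>\<^bsub>A\<^esub> Fb [])" by (rule assms(4)) (simp_all add: Fb_closed assms(2))
    then show ?case using F_single[of "[]" 0] by simp
  next
    case (add w w')
    then show ?case using F_hom(1,2) k assms(3) by simp
  qed
  then show ?thesis using w by simp
qed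

fun act :: "'d gwa_generator \<Rightarrow> (int \<Rightarrow> 'k) \<Rightarrow> int \<Rightarrow> 'k" where
  "act (Coef d) \<phi> = (\<lambda>b. ev d b * \<phi> b)"
| "act GenX \<phi> = (\<lambda>b. \<phi> (b - 1))"
| "act GenY \<phi> = (\<lambda>b. a b * \<phi> (b + 1))"

abbreviation opw where "opw \<equiv> foldr act"

lemma opw_add: "opw s (\<lambda>b. \<phi> b + \<psi> b) = (\<lambda>b. opw s \<phi> b + opw s \<psi> b)"
proof (induction s)
  case (Cons q s)
  then show ?case by (cases q) (simp_all add: distrib_left)
qed simp

lemma opw_scale: "opw s (\<lambda>b. c * \<phi> b) = (\<lambda>b. c * opw s \<phi> b)"
proof (induction s)
  case (Cons q s)
  then show ?case by (cases q) (simp_all add: mult.left_commute)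
qed simp

abbreviation delta :: "int \<Rightarrow> int \<Rightarrow> 'k" where "delta k \<equiv> (\<lambda>t. if t = k then 1 else 0)"

definition \<mu> where "\<mu> n b s = opw s (delta (b - n)) b"

lemma lin_ext_basis: "lin_ext \<nu> (basis s) = \<nu> s"
  by (simp add: basis_def)

text \<open>The operators satisfy the defining relations: y x multiplies by a(b), and x y by a(b -
  1), the value of \<sigma>(a) at b. Linearity of the word s reduces the check to the relation
  itself.\<close>

lemma \<mu>_respects:
  assumes uv: "(u, v) \<in> gwa_relations D0 \<sigma> a0"
  shows "lin_ext (\<mu> n b) (basis s \<otimes>\<^bsub>T.kM\<^esub> u \<otimes>\<^bsub>T.kM\<^esub> basis t) =
    lin_ext (\<mu> n b) (basis s \<otimes>\<^bsub>T.kM\<^esub> v \<otimes>\<^bsub>T.kM\<^esub> basis t)"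
proof -
  have word: "lin_ext (\<mu> n b) (basis s \<otimes>\<^bsub>T.kM\<^esub> basis q \<otimes>\<^bsub>T.kM\<^esub> basis t) = opw s (opw q (opw t (delta (b - n)))) b" for q
    by (simp add: monoid_simps lin_ext_basis \<mu>_def)
  have scaled: "lin_ext (\<mu> n b) (basis s \<otimes>\<^bsub>T.kM\<^esub> Poly_Mapping.single q c \<otimes>\<^bsub>T.kM\<^esub> basis t) =
      c * opw s (opw q (opw t (delta (b - n)))) b" for q c
    by (simp add: basis_def monoid_simps \<mu>_def)
  from uv show ?thesis
    unfolding gwa_relations_def
    by (elim UnE CollectE exE conjE insertE)
      (auto simp: word scaled monoid_alg_distrib ev_add ev_mult ev_smult ev_one ev_\<sigma> ev_inv_\<sigma>
        D0_gens_closed \<sigma>_closed inv_\<sigma>_closed ev_gens distrib_right mult.assoc opw_add opw_scale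
        mult.left_commute[of "a _"]
        simp del: monoid_alg_mult_basis)
qed

definition m where "m u n b = lin_ext (\<mu> n b) (SOME w. w \<in> carrier T.kM \<and> F w = u)"

lemma m_F: assumes "w \<in> carrier T.kM" shows "m (F w) n b = lin_ext (\<mu> n b) w"
proof -
  let ?w = "SOME w'. w' \<in> carrier T.kM \<and> F w' = F w"
  have "?w \<in> carrier T.kM \<and> F ?w = F w" by (rule someI[of _ w]) (use assms in simp)
  then have w: "?w \<in> carrier T.kM" "T.cls ?w = T.cls w" using F_hom(5)[OF _ assms] by auto
  show ?thesis unfolding m_def
    by (rule T.lin_ext_respects[OF _ w(1) assms w(2)]) (rule \<mu>_respects)
qed

lemma m_word: "s \<in> lists letters \<Longrightarrow> m (Fb s) n b = opw s (delta (b - n)) b"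
  using m_F[OF T.basis_closed] by (simp add: monoid_simps lin_ext_basis \<mu>_def)

lemma m_add: assumes "u \<in> carrier A" "v \<in> carrier A" shows "m (u \<oplus>\<^bsub>A\<^esub> v) n b = m u n b + m v n b"
proof -
  obtain w w' where w: "w \<in> carrier T.kM" "u = F w" "w' \<in> carrier T.kM" "v = F w'"
    using F_rep assms by metis
  moreover have "w + w' \<in> carrier T.kM" using w T.kM.a_closed by (simp add: monoid_alg_simps(4))
  ultimately show ?thesis using F_hom(2)[OF w(1,3)] m_F by (metis lin_ext_add)
qed

lemma m_smult: assumes "u \<in> carrier A" shows "m (c \<odot>\<^bsub>A\<^esub> u) n b = c * m u n b"
proof -
  obtain w where w: "w \<in> carrier T.kM" "u = F w" using F_rep[OF assms] .
  moreover have "Poly_Mapping.map (\<lambda>x. c * x) w \<in> carrier T.kM"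
    using T.kM.smult_closed[OF w(1), of c] by (simp add: monoid_alg_simps(5))
  ultimately show ?thesis using F_hom(4)[OF w(1,1), of c] m_F by (metis lin_ext_scale)
qed

lemma m_one: "m \<one>\<^bsub>A\<^esub> n b = (if n = 0 then 1 else 0)"
  using m_word[of "[]"] by (simp add: Fb_Nil)

text \<open>A letter on the left acts last, so its value at b involves the remaining word only at b
  + k; n moves along because the delta function stays where it is.\<close>

lemma m_left:
  assumes q: "q \<in> letters" and u: "u \<in> carrier A"
    and formula: "\<And>\<phi>. act q \<phi> b = c * \<phi> (b + k)"
  shows "m (Fb [q] \<otimes>\<^bsub>A\<^esub> u) n b = c * m u (n + k) (b + k)"
  using u
proof (induction u rule: A_induct)
  case (word s)
  have qs: "[q] \<in> lists letters" "[q] @ s \<in> lists letters" using q word by auto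
  have "Fb [q] \<otimes>\<^bsub>A\<^esub> Fb s = Fb ([q] @ s)" by (rule Fb_append[OF qs(1) word, symmetric])
  then show ?case using m_word[OF qs(2)] m_word[OF word] by (simp add: formula)
next
  case (add u v)
  then show ?case using Fb_closed[of "[q]"] q by (simp add: A.r_distr m_add distrib_left)
next
  case (smult d u)
  then show ?case using Fb_closed[of "[q]"] q by (simp add: A.smult_mult_r m_smult)
qed

text \<open>A letter on the right acts first, on the delta function, and sends the one at b - n to a
  multiple of the one at b - (n + k).\<close>

lemma m_right:
  assumes q: "q \<in> letters" and u: "u \<in> carrier A"
    and formula: "act q (delta (b - n)) = (\<lambda>t. c * delta (b - (n + k)) t)"
  shows "m (u \<otimes>\<^bsub>A\<^esub> Fb [q]) n b = c * m u (n + k) b"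
  using u
proof (induction u rule: A_induct)
  case (word s)
  have qs: "[q] \<in> lists letters" "s @ [q] \<in> lists letters" using q word by auto
  have "Fb s \<otimes>\<^bsub>A\<^esub> Fb [q] = Fb (s @ [q])" by (rule Fb_append[OF word qs(1), symmetric])
  then show ?case using m_word[OF qs(2)] m_word[OF word] by (simp only: foldr_append foldr.simps comp_apply id_apply formula opw_scale)
next
  case (add u v)
  then show ?case using Fb_closed[of "[q]"] q by (simp add: A.l_distr m_add distrib_left)
next
  case (smult d u)
  then show ?case using Fb_closed[of "[q]"] q by (simp add: A.smult_mult_l m_smult)
qed

lemma m_Coef:
  assumes d: "d \<in> carrier D0" and u: "u \<in> carrier A"
  shows "m (Fb [Coef d] \<otimes>\<^bsub>A\<^esub> u) n b = ev d b * m u n b"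
    "m (u \<otimes>\<^bsub>A\<^esub> Fb [Coef d]) n b = ev d (b - n) * m u n b"
proof -
  show "m (Fb [Coef d] \<otimes>\<^bsub>A\<^esub> u) n b = ev d b * m u n b"
    using m_left[OF _ u, of "Coef d" b "ev d b" 0 n] d by simp
  show "m (u \<otimes>\<^bsub>A\<^esub> Fb [Coef d]) n b = ev d (b - n) * m u n b"
    using m_right[OF _ u, of "Coef d" b n "ev d (b - n)" 0] d by (simp add: fun_eq_iff)
qed

lemma Fb_context:
  assumes "Fb u = Fb v" "s \<in> lists letters" "u \<in> lists letters" "v \<in> lists letters" "t \<in> lists letters"
  shows "Fb (s @ u @ t) = Fb (s @ v @ t)"
  using assms by (simp add: Fb_append)

lemma Fb_rel: "(basis u, basis v) \<in> gwa_relations D0 \<sigma> a0 \<Longrightarrow> Fb u = Fb v"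
  unfolding F_def by (simp only: T.cls_rel)

lemma Fb_relations:
  assumes "d \<in> carrier D0" "d' \<in> carrier D0"
  shows "Fb [Coef (d \<otimes>\<^bsub>D0\<^esub> d')] = Fb [Coef d, Coef d']" "Fb [Coef \<one>\<^bsub>D0\<^esub>] = Fb []"
    "Fb [GenX, Coef d] = Fb [Coef (\<sigma> d), GenX]" "Fb [GenY, Coef d] = Fb [Coef (inv_\<sigma> d), GenY]"
    "Fb [GenY, GenX] = Fb [Coef a0]" "Fb [GenX, GenY] = Fb [Coef (\<sigma> a0)]"
  by (rule Fb_rel, unfold gwa_relations_def, use assms in blast)+

lemma Fb_Coef_hom:
  "d \<in> carrier D0 \<Longrightarrow> d' \<in> carrier D0 \<Longrightarrow> Fb [Coef (d \<oplus>\<^bsub>D0\<^esub> d')] = Fb [Coef d] \<oplus>\<^bsub>A\<^esub> Fb [Coef d']"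
  "d \<in> carrier D0 \<Longrightarrow> Fb [Coef (c \<odot>\<^bsub>D0\<^esub> d)] = c \<odot>\<^bsub>A\<^esub> Fb [Coef d]"
  "d \<in> carrier D0 \<Longrightarrow> d' \<in> carrier D0 \<Longrightarrow> Fb [Coef (d \<otimes>\<^bsub>D0\<^esub> d')] = Fb [Coef d] \<otimes>\<^bsub>A\<^esub> Fb [Coef d']"
  "Fb [Coef \<one>\<^bsub>D0\<^esub>] = \<one>\<^bsub>A\<^esub>" "Fb [Coef \<zero>\<^bsub>D0\<^esub>] = \<zero>\<^bsub>A\<^esub>"
proof -
  show "Fb [Coef (d \<oplus>\<^bsub>D0\<^esub> d')] = Fb [Coef d] \<oplus>\<^bsub>A\<^esub> Fb [Coef d']" if "d \<in> carrier D0" "d' \<in> carrier D0"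
  proof -
    have "(basis [Coef (d \<oplus>\<^bsub>D0\<^esub> d')], basis [Coef d] + basis [Coef d']) \<in> gwa_relations D0 \<sigma> a0"
      unfolding gwa_relations_def using that by blast
    then have "Fb [Coef (d \<oplus>\<^bsub>D0\<^esub> d')] = F (basis [Coef d] + basis [Coef d'])"
      unfolding F_def by (simp only: T.cls_rel)
    also have "\<dots> = Fb [Coef d] \<oplus>\<^bsub>A\<^esub> Fb [Coef d']"
      by (rule F_hom(2)) (use that in \<open>simp_all add: T.basis_closed monoid_simps\<close>)
    finally show ?thesis .
  qed
  show smult: "Fb [Coef (c \<odot>\<^bsub>D0\<^esub> d)] = c \<odot>\<^bsub>A\<^esub> Fb [Coef d]" if "d \<in> carrier D0" for c d
  proof -
    have "(basis [Coef (c \<odot>\<^bsub>D0\<^esub> d)], Poly_Mapping.single [Coef d] c) \<in> gwa_relations D0 \<sigma> a0"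
      unfolding gwa_relations_def using that by blast
    then have "Fb [Coef (c \<odot>\<^bsub>D0\<^esub> d)] = F (Poly_Mapping.single [Coef d] c)"
      unfolding F_def by (simp only: T.cls_rel)
    then show ?thesis using that by (simp add: F_single)
  qed
  show "Fb [Coef (d \<otimes>\<^bsub>D0\<^esub> d')] = Fb [Coef d] \<otimes>\<^bsub>A\<^esub> Fb [Coef d']" if "d \<in> carrier D0" "d' \<in> carrier D0"
    using Fb_relations(1)[OF that] Fb_append[of "[Coef d]" "[Coef d']"] that by simp
  show "Fb [Coef \<one>\<^bsub>D0\<^esub>] = \<one>\<^bsub>A\<^esub>" using Fb_relations(2)[OF D0.one_closed D0.one_closed] Fb_Nil by simp
  have "Fb [Coef (0 \<odot>\<^bsub>D0\<^esub> \<zero>\<^bsub>D0\<^esub>)] = 0 \<odot>\<^bsub>A\<^esub> Fb [Coef \<zero>\<^bsub>D0\<^esub>]" by (rule smult) simp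
  also have "\<dots> = \<zero>\<^bsub>A\<^esub>" by (rule A.zero_smult[OF Fb_closed]) simp
  finally show "Fb [Coef \<zero>\<^bsub>D0\<^esub>] = \<zero>\<^bsub>A\<^esub>" by simp
qed

text \<open>The power x^k, read as y^(-k) for negative k; every word reduces to a coefficient times
  such a power.\<close>

definition pw :: "int \<Rightarrow> 'd gwa_generator list" where
  "pw k = (if 0 \<le> k then replicate (nat k) GenX else replicate (nat (- k)) GenY)"

lemma pw_letters: "pw k \<in> lists letters"
  by (auto simp: pw_def)

text \<open>A new letter x or y passes the coefficient by \<sigma> or its inverse. If it then meets
  a power of the opposite letter the two cancel, since x y and y x are coefficients.\<close>

lemma normal_form_step:
  assumes q: "q \<in> letters" and d: "d \<in> carrier D0"
  shows "\<exists>d'\<in>carrier D0. \<exists>k'. Fb (q # Coef d # pw k) = Fb (Coef d' # pw k')"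
proof -
  consider d' where "q = Coef d'" "d' \<in> carrier D0" | "q = GenX" | "q = GenY" using q by auto
  then show ?thesis
  proof cases
    case (1 d')
    have "Fb ([] @ [Coef (d' \<otimes>\<^bsub>D0\<^esub> d)] @ pw k) = Fb ([] @ [Coef d', Coef d] @ pw k)"
      by (rule Fb_context[OF Fb_relations(1)]) (use 1 d pw_letters in auto)
    then show ?thesis using 1 d by (intro bexI[of _ "d' \<otimes>\<^bsub>D0\<^esub> d"] exI[of _ k]) auto
  next
    case 2
    have 1: "Fb ([] @ [GenX, Coef d] @ pw k) = Fb ([] @ [Coef (\<sigma> d), GenX] @ pw k)"
      by (rule Fb_context[OF Fb_relations(3)]) (use d \<sigma>_closed pw_letters in auto)
    show ?thesis
    proof (cases "0 \<le> k")
      case True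
      then have "GenX # pw k = pw (k + 1)" by (simp add: pw_def nat_add_distrib)
      then show ?thesis using 1 2 d \<sigma>_closed by (intro bexI[of _ "\<sigma> d"] exI[of _ "k + 1"]) auto
    next
      case False
      then have "nat (- k) = Suc (nat (- (k + 1)))" by simp
      then have pw: "pw k = GenY # pw (k + 1)" using False by (auto simp: pw_def)
      have 3: "Fb ([Coef (\<sigma> d)] @ [GenX, GenY] @ pw (k + 1)) = Fb ([Coef (\<sigma> d)] @ [Coef (\<sigma> a0)] @ pw (k + 1))"
        by (rule Fb_context[OF Fb_relations(6)]) (use d \<sigma>_closed D0_gens_closed pw_letters in auto)
      have 4: "Fb ([] @ [Coef (\<sigma> d \<otimes>\<^bsub>D0\<^esub> \<sigma> a0)] @ pw (k + 1)) = Fb ([] @ [Coef (\<sigma> d), Coef (\<sigma> a0)] @ pw (k + 1))"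
        by (rule Fb_context[OF Fb_relations(1)]) (use d \<sigma>_closed D0_gens_closed pw_letters in auto)
      show ?thesis using 1 3 4 2 d \<sigma>_closed D0_gens_closed unfolding pw
        by (intro bexI[of _ "\<sigma> d \<otimes>\<^bsub>D0\<^esub> \<sigma> a0"] exI[of _ "k + 1"]) auto
    qed
  next
    case 3
    have 1: "Fb ([] @ [GenY, Coef d] @ pw k) = Fb ([] @ [Coef (inv_\<sigma> d), GenY] @ pw k)"
      by (rule Fb_context[OF Fb_relations(4)]) (use d inv_\<sigma>_closed pw_letters in auto)
    show ?thesis
    proof (cases "k \<le> 0")
      case True
      then have "nat (- (k - 1)) = Suc (nat (- k))" by simp
      then have "GenY # pw k = pw (k - 1)" using True by (cases "k = 0") (auto simp: pw_def)
      then show ?thesis using 1 3 d inv_\<sigma>_closed by (intro bexI[of _ "inv_\<sigma> d"] exI[of _ "k - 1"]) auto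
    next
      case False
      then have "nat k = Suc (nat (k - 1))" by simp
      then have pw: "pw k = GenX # pw (k - 1)" using False by (auto simp: pw_def)
      have 5: "Fb ([Coef (inv_\<sigma> d)] @ [GenY, GenX] @ pw (k - 1)) = Fb ([Coef (inv_\<sigma> d)] @ [Coef a0] @ pw (k - 1))"
        by (rule Fb_context[OF Fb_relations(5)]) (use d inv_\<sigma>_closed D0_gens_closed pw_letters in auto)
      have 4: "Fb ([] @ [Coef (inv_\<sigma> d \<otimes>\<^bsub>D0\<^esub> a0)] @ pw (k - 1)) = Fb ([] @ [Coef (inv_\<sigma> d), Coef a0] @ pw (k - 1))"
        by (rule Fb_context[OF Fb_relations(1)]) (use d inv_\<sigma>_closed D0_gens_closed pw_letters in auto)
      show ?thesis using 1 5 4 3 d inv_\<sigma>_closed D0_gens_closed unfolding pw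
        by (intro bexI[of _ "inv_\<sigma> d \<otimes>\<^bsub>D0\<^esub> a0"] exI[of _ "k - 1"]) auto
    qed
  qed
qed

lemma normal_form:
  assumes "s \<in> lists letters"
  shows "\<exists>d\<in>carrier D0. \<exists>k. Fb s = Fb (Coef d # pw k)"
  using assms
proof (induction s)
  case Nil
  have "Fb [] = Fb (Coef \<one>\<^bsub>D0\<^esub> # pw 0)" using Fb_relations(2)[OF D0.one_closed D0.one_closed] by (simp add: pw_def)
  then show ?case by blast
next
  case (Cons q s)
  then obtain d k where d: "d \<in> carrier D0" "Fb s = Fb (Coef d # pw k)" by blast
  have l: "[q] \<in> lists letters" "Coef d # pw k \<in> lists letters" using Cons d pw_letters by auto
  have "Fb (q # s) = Fb (q # Coef d # pw k)"
    using Fb_append[OF l(1) Cons(2)] Fb_append[OF l] d(2) by simp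
  then show ?case using normal_form_step[OF Cons(1) d(1), of k] by simp
qed

text \<open>Only the diagonal n = k is occupied. For y^j the weight is a(b) a(b + 1) ... a(b + j -
  1), which has finitely many zeros because \<open>a\<close> has.\<close>

lemma pw_coefficient: "\<exists>w. finite {b. w b = (0::'k)} \<and> (\<forall>d\<in>carrier D0. \<forall>n b. m (Fb (Coef d # pw k)) n b = (if n = k then ev d b * w b else 0))"
proof -
  have X: "(act GenX ^^ j) \<phi> b = \<phi> (b - int j)" for j \<phi> b
    by (induction j arbitrary: b) (simp_all add: algebra_simps)
  have Y: "(act GenY ^^ j) \<phi> b = (\<Prod>i<j. a (b + int i)) * \<phi> (b + int j)" for j \<phi> b
  proof (induction j arbitrary: b)
    case (Suc j)
    have "(\<Prod>i<Suc j. a (b + int i)) = a b * (\<Prod>i<j. a (b + 1 + int i))"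
      by (subst prod.lessThan_Suc_shift) (simp add: algebra_simps)
    then show ?case using Suc by (simp add: algebra_simps)
  qed simp
  have l: "Coef d # pw k \<in> lists letters" if "d \<in> carrier D0" for d using that pw_letters by auto
  show ?thesis
  proof (cases "0 \<le> k")
    case True
    then show ?thesis using m_word[OF l]
      by (intro exI[of _ "\<lambda>_. 1"]) (auto simp: pw_def X)
  next
    case False
    define j where "j = nat (- k)"
    have fin: "finite {b. (\<Prod>i<j. a (b + int i)) = 0}"
    proof -
      have "{b. (\<Prod>i<j. a (b + int i)) = 0} \<subseteq> (\<Union>i<j. (\<lambda>b. b - int i) ` {b. a b = 0})"
      proof
        fix b assume "b \<in> {b. (\<Prod>i<j. a (b + int i)) = 0}"
        then obtain i where i: "i < j" "a (b + int i) = 0" by auto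
        then have "b \<in> (\<lambda>b. b - int i) ` {b. a b = 0}" by (intro image_eqI[of _ _ "b + int i"]) auto
        then show "b \<in> (\<Union>i<j. (\<lambda>b. b - int i) ` {b. a b = 0})" using i by blast
      qed
      then show ?thesis by (rule finite_subset) (simp add: a_finite)
    qed
    have "m (Fb (Coef d # pw k)) n b = (if n = k then ev d b * (\<Prod>i<j. a (b + int i)) else 0)"
      if "d \<in> carrier D0" for d n b
    proof -
      have pj: "pw k = replicate j GenY" and k: "k = - int j" using False by (simp_all add: pw_def j_def)
      show ?thesis unfolding m_word[OF l[OF that]] unfolding pj by (auto simp: Y k)
    qed
    then show ?thesis by (intro exI[of _ "\<lambda>b. \<Prod>i<j. a (b + int i)"] conjI fin ballI allI)
  qed
qed

text \<open>Diagonals separate the powers. On one diagonal the weight is nonzero outside a finite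
  set, so the combination of the functions \<open>ev e\<close> has finite support; this is why
  \<open>D0_basis\<close> assumes finite support rather than vanishing.\<close>

lemma basis: "\<exists>E\<subseteq>carrier A. k_span A E = carrier A \<and> (\<forall>F c. finite F \<longrightarrow> F \<subseteq> E \<longrightarrow>
    (\<forall>n b. (\<Sum>e\<in>F. c e * m e n b) = 0) \<longrightarrow> (\<forall>e\<in>F. c e = 0))"
proof -
  from D0_basis obtain E0 where E0: "E0 \<subseteq> carrier D0" "k_span D0 E0 = carrier D0"
    "\<forall>F c. finite F \<longrightarrow> F \<subseteq> E0 \<longrightarrow> finite {b. (\<Sum>e\<in>F. c e * ev e b) \<noteq> 0} \<longrightarrow> (\<forall>e\<in>F. c e = 0)"
    by (elim exE conjE)
  define N where "N = (\<lambda>(e, k). Fb (Coef e # pw k))"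
  define E where "E = N ` (E0 \<times> UNIV)"
  have l: "Coef d # pw k \<in> lists letters" if "d \<in> carrier D0" for d k using that pw_letters by auto
  have Ec: "E \<subseteq> carrier A"
  proof
    fix u assume "u \<in> E"
    then obtain e k where "e \<in> E0" "u = Fb (Coef e # pw k)" by (auto simp: E_def N_def)
    then show "u \<in> carrier A" using Fb_closed[OF l] E0(1) by auto
  qed
  have span: "k_span A E = carrier A"
  proof
    show "k_span A E \<subseteq> carrier A" by (rule A.k_span_closed[OF Ec])
    show "carrier A \<subseteq> k_span A E"
    proof
      fix u assume "u \<in> carrier A"
      then show "u \<in> k_span A E"
      proof (induction u rule: A_induct)
        case (word s)
        obtain d k where d: "d \<in> carrier D0" "Fb s = Fb (Coef d # pw k)" using normal_form[OF word] by blast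
        have "Fb [Coef d] \<otimes>\<^bsub>A\<^esub> Fb (pw k) \<in> k_span A E"
        proof (rule D0.k_span_map[where f = "\<lambda>d. Fb [Coef d] \<otimes>\<^bsub>A\<^esub> Fb (pw k)", OF _ E0(1) A.k_span_subspace[OF Ec]])
          show "d \<in> k_span D0 E0" using d(1) E0(2) by simp
          fix e assume e: "e \<in> E0"
          then have "e \<in> carrier D0" using E0(1) by blast
          then have "Fb [Coef e] \<otimes>\<^bsub>A\<^esub> Fb (pw k) = N (e, k)"
            using Fb_append[of "[Coef e]" "pw k"] pw_letters by (simp add: N_def)
          then show "Fb [Coef e] \<otimes>\<^bsub>A\<^esub> Fb (pw k) \<in> k_span A E"
            using e by (intro k_span_base) (auto simp: E_def)
        next
          show "Fb [Coef \<zero>\<^bsub>D0\<^esub>] \<otimes>\<^bsub>A\<^esub> Fb (pw k) = \<zero>\<^bsub>A\<^esub>" using Fb_closed[OF pw_letters] by (simp add: Fb_Coef_hom)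
        qed (use Fb_closed[OF pw_letters] Fb_closed[of "[Coef _]"] in \<open>auto simp: Fb_Coef_hom A.l_distr A.smult_mult_l\<close>)
        then show ?case using d Fb_append[of "[Coef d]" "pw k"] pw_letters by simp
      qed (use Ec in \<open>auto intro: A.k_span_add A.k_span_smult\<close>)
    qed
  qed
  have indep: "\<forall>u\<in>F. c u = 0" if F: "finite F" "F \<subseteq> E" and zero: "\<forall>n b. (\<Sum>e\<in>F. c e * m e n b) = 0" for F c
  proof
    fix u assume u: "u \<in> F"
    \<comment> \<open>Each member of \<open>F\<close> receives one preimage (e, k). The
      parametrisation \<open>N\<close> is not known to be injective, but the chosen preimages of
      distinct members are distinct.\<close>
    define J where "J = inv_into (E0 \<times> UNIV) N ` F"
    have inj: "inj_on (inv_into (E0 \<times> UNIV) N) F" using F(2) by (intro inj_on_inv_into) (simp add: E_def)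
    have NJ: "N (inv_into (E0 \<times> UNIV) N v) = v" if "v \<in> F" for v
      using that F(2) unfolding E_def by (intro f_inv_into_f) blast
    have "inv_into (E0 \<times> UNIV) N v \<in> E0 \<times> UNIV" if "v \<in> F" for v
      using that F(2) unfolding E_def by (intro inv_into_into) blast
    then have JE: "J \<subseteq> E0 \<times> UNIV" unfolding J_def by (rule image_subsetI)
    have finJ: "finite J" using F(1) by (simp add: J_def)
    obtain d k where dk: "inv_into (E0 \<times> UNIV) N u = (d, k)" by fastforce
    define Jk where "Jk = (\<lambda>e. (e, k)) -` J"
    have finJk: "finite Jk" "Jk \<subseteq> E0"
      unfolding Jk_def by (intro finite_vimageI finJ inj_onI) (use JE in auto)
    obtain w where w: "finite {b. w b = 0}"
      "\<forall>d\<in>carrier D0. \<forall>n b. m (Fb (Coef d # pw k)) n b = (if n = k then ev d b * w b else 0)"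
      using pw_coefficient by blast
    have sum: "(\<Sum>e\<in>Jk. c (N (e, k)) * ev e b) * w b = 0" for b
    proof -
      have "0 = (\<Sum>v\<in>F. c v * m v k b)" using zero by simp
      also have "\<dots> = (\<Sum>q\<in>J. c (N q) * m (N q) k b)"
        unfolding J_def by (subst sum.reindex[OF inj]) (simp add: NJ)
      also have "\<dots> = (\<Sum>q\<in>(\<lambda>e. (e, k)) ` Jk. c (N q) * m (N q) k b)"
      proof (rule sum.mono_neutral_right[OF finJ])
        show "(\<lambda>e. (e, k)) ` Jk \<subseteq> J" by (auto simp: Jk_def)
        show "\<forall>q\<in>J - (\<lambda>e. (e, k)) ` Jk. c (N q) * m (N q) k b = 0"
        proof
          fix q assume q: "q \<in> J - (\<lambda>e. (e, k)) ` Jk"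
          obtain e k' where q': "q = (e, k')" by (cases q)
          have "k' \<noteq> k" "e \<in> carrier D0" using q q' JE E0(1) by (auto simp: Jk_def)
          moreover obtain w' where "\<forall>d\<in>carrier D0. \<forall>n b. m (Fb (Coef d # pw k')) n b = (if n = k' then ev d b * w' b else 0)"
            using pw_coefficient by blast
          ultimately show "c (N q) * m (N q) k b = 0" using q' by (simp add: N_def)
        qed
      qed
      also have "\<dots> = (\<Sum>e\<in>Jk. c (N (e, k)) * m (N (e, k)) k b)"
        by (subst sum.reindex) (auto simp: inj_on_def)
      also have "\<dots> = (\<Sum>e\<in>Jk. c (N (e, k)) * (ev e b * w b))"
        by (rule sum.cong[OF refl]) (use w(2) finJk(2) E0(1) in \<open>auto simp: N_def\<close>)
      finally show ?thesis by (simp add: sum_distrib_right mult.assoc)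
    qed
    have "finite {b. (\<Sum>e\<in>Jk. c (N (e, k)) * ev e b) \<noteq> 0}"
      by (rule finite_subset[OF _ w(1)]) (use sum in auto)
    from E0(3)[rule_format, OF finJk this] have "\<forall>e\<in>Jk. c (N (e, k)) = 0" by blast
    moreover have "(d, k) \<in> J" unfolding J_def dk[symmetric] by (rule imageI[OF u])
    then have "d \<in> Jk" by (simp add: Jk_def)
    ultimately have "c (N (d, k)) = 0" by blast
    then show "c u = 0" using NJ[OF u] dk by simp
  qed
  show ?thesis
  proof (intro exI[of _ E] conjI allI impI)
    fix F c assume "finite F" "F \<subseteq> E" "\<forall>n b. (\<Sum>e\<in>F. c e * m e n b) = 0"
    then show "\<forall>e\<in>F. c e = 0" by (rule indep)
  qed (rule Ec span)+
qed

text \<open>The coefficients whose images lie in a given subalgebra of \<open>A\<close> form a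
  subalgebra of \<open>D0\<close> that contains its generators.\<close>

lemma generate: "generates_alg A {Fb [Coef h0], Fb [Coef g0], Fb [Coef g0'], Fb [GenX], Fb [GenY]}"
  unfolding generates_alg_def
proof (intro conjI allI impI)
  show "{Fb [Coef h0], Fb [Coef g0], Fb [Coef g0'], Fb [GenX], Fb [GenY]} \<subseteq> carrier A"
    using D0_gens_closed by (auto intro!: Fb_closed)
  fix S assume "subring S A \<and> k_subspace A S \<and> {Fb [Coef h0], Fb [Coef g0], Fb [Coef g0'], Fb [GenX], Fb [GenY]} \<subseteq> S"
  then have S: "subring S A" "k_subspace A S" "Fb [Coef h0] \<in> S" "Fb [Coef g0] \<in> S" "Fb [Coef g0'] \<in> S"
    "Fb [GenX] \<in> S" "Fb [GenY] \<in> S" by auto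
  let ?C = "{d \<in> carrier D0. Fb [Coef d] \<in> S}"
  have smult: "c \<odot>\<^bsub>A\<^esub> u \<in> S" if "u \<in> S" for c u using S(2) that by (simp add: k_subspace_def)
  have sub: "k_subspace D0 ?C"
    unfolding k_subspace_def using S(2) smult
    by (auto simp: Fb_Coef_hom k_subspace_def)
  have ring: "subring ?C D0"
  proof (rule D0.subringI)
    fix d d' assume d: "d \<in> ?C" "d' \<in> ?C"
    show "\<ominus>\<^bsub>D0\<^esub> d \<in> ?C" using d smult by (simp add: D0.uminus_smult Fb_Coef_hom)
    show "d \<otimes>\<^bsub>D0\<^esub> d' \<in> ?C" "d \<oplus>\<^bsub>D0\<^esub> d' \<in> ?C"
      using d subringE(6,7)[OF S(1)] by (simp_all add: Fb_Coef_hom)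
  qed (use subringE(3)[OF S(1)] Fb_Coef_hom(4) in auto)
  have "?C = carrier D0"
  proof (rule conjunct2[OF D0_generate[unfolded generates_alg_def], rule_format], intro conjI ring sub)
    show "{h0, g0, g0'} \<subseteq> ?C" using S(3-5) D0_gens_closed by simp
  qed
  then have C: "Fb [Coef d] \<in> S" if "d \<in> carrier D0" for d using that by blast
  have W: "Fb s \<in> S" if "s \<in> lists letters" for s
    using that
  proof (induction s)
    case Nil
    then show ?case using subringE(3)[OF S(1)] by (simp add: Fb_Nil)
  next
    case (Cons q s)
    have "Fb [q] \<in> S" using Cons(1) C S(6,7) by auto
    moreover have "Fb (q # s) = Fb [q] \<otimes>\<^bsub>A\<^esub> Fb s" using Fb_append[of "[q]" s] Cons by simp
    ultimately show ?case using subringE(6)[OF S(1)] Cons by simp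
  qed
  have "u \<in> S" if "u \<in> carrier A" for u
    using that
  proof (induction u rule: A_induct)
    case (word s)
    then show ?case by (rule W)
  next
    case (add u v)
    then show ?case using subringE(7)[OF S(1)] by simp
  qed (rule smult)
  then show "S = carrier A" using subringE(1)[OF S(1)] by blast
qed

lemma rank_one: "rank_one A (Fb [Coef h0]) (Fb [Coef g0]) (Fb [Coef g0']) (Fb [GenX]) (Fb [GenY]) \<theta> a l W da m"
proof (intro rank_one.intro rank_one_axioms.intro A.k_alg_axioms coefficient_functions_axioms m_add m_smult m_one basis generate)
  show "Fb [Coef h0] \<in> carrier A" "Fb [Coef g0] \<in> carrier A" "Fb [Coef g0'] \<in> carrier A"
    "Fb [GenX] \<in> carrier A" "Fb [GenY] \<in> carrier A"
    using D0_gens_closed by (auto intro!: Fb_closed)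
  fix u n b assume u: "u \<in> carrier A"
  show "m (Fb [Coef h0] \<otimes>\<^bsub>A\<^esub> u) n b = \<theta> b * m u n b" "m (u \<otimes>\<^bsub>A\<^esub> Fb [Coef h0]) n b = \<theta> (b - n) * m u n b"
    "m (Fb [Coef g0] \<otimes>\<^bsub>A\<^esub> u) n b = l powi (- b) * m u n b"
    "m (u \<otimes>\<^bsub>A\<^esub> Fb [Coef g0]) n b = l powi (- (b - n)) * m u n b"
    "m (Fb [Coef g0'] \<otimes>\<^bsub>A\<^esub> u) n b = l powi b * m u n b"
    "m (u \<otimes>\<^bsub>A\<^esub> Fb [Coef g0']) n b = l powi (b - n) * m u n b"
    using u by (simp_all add: m_Coef D0_gens_closed ev_gens)
  show "m (Fb [GenX] \<otimes>\<^bsub>A\<^esub> u) n b = m u (n - 1) (b - 1)"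
    using m_left[OF _ u, of GenX b 1 "- 1" n] by simp
  show "m (u \<otimes>\<^bsub>A\<^esub> Fb [GenX]) n b = m u (n - 1) b"
    using m_right[OF _ u, of GenX b n 1 "- 1"] by (simp add: fun_eq_iff algebra_simps)
  show "m (Fb [GenY] \<otimes>\<^bsub>A\<^esub> u) n b = a b * m u (n + 1) (b + 1)"
    using m_left[OF _ u, of GenY b "a b" 1 n] by simp
  have "act GenY (delta (b - n)) = (\<lambda>t. a (b - n - 1) * delta (b - (n + 1)) t)"
    by (rule ext) (auto simp: algebra_simps)
  from m_right[OF _ u this]
  show "m (u \<otimes>\<^bsub>A\<^esub> Fb [GenY]) n b = a (b - n - 1) * m u (n + 1) b" by simp
qed

end

section \<open>Algebras of simple classical and quantum type\<close>

text \<open>Euclid's algorithm; algebraic closedness enters at the bottom, where a polynomial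
  without roots must be a constant.\<close>

lemma bezout_no_common_root:
  fixes p q :: "'k::alg_closed_field poly"
  assumes "\<And>z. \<not> (poly p z = 0 \<and> poly q z = 0)"
  shows "\<exists>u v. u * p + v * q = 1"
  using assms
proof (induction "if q = 0 then 0 else Suc (degree q)" arbitrary: p q rule: less_induct)
  case less
  show ?case
  proof (cases "q = 0")
    case True
    then have "\<nexists>z. poly p z = 0" using less.prems by auto
    then have "degree p = 0" using alg_closed_imp_poly_has_root by blast
    then obtain c where c: "p = [:c:]" by (elim degree_eq_zeroE)
    then have "c \<noteq> 0" using \<open>\<nexists>z. poly p z = 0\<close> by auto
    then have "[:inverse c:] * p + 0 * q = 1" by (simp add: c one_pCons)
    then show ?thesis by blast
  next
    case False
    have "(if p mod q = 0 then 0 else Suc (degree (p mod q))) < (if q = 0 then 0 else Suc (degree q))"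
      using False degree_mod_less'[OF False] by simp
    moreover have "\<not> (poly q z = 0 \<and> poly (p mod q) z = 0)" for z
    proof
      assume z: "poly q z = 0 \<and> poly (p mod q) z = 0"
      have "poly p z = poly (p div q) z * poly q z + poly (p mod q) z"
        by (metis div_mult_mod_eq poly_add poly_mult)
      then show False using z less.prems[of z] by simp
    qed
    ultimately obtain u v where uv: "u * q + v * (p mod q) = 1" using less.hyps by blast
    have "v * p + (u - v * (p div q)) * q = u * q + v * (p - p div q * q)" by (simp add: algebra_simps)
    also have "p - p div q * q = p mod q" by (rule minus_div_mult_eq_mod)
    finally show ?thesis using uv by metis
  qed
qed

text \<open>Reducing u modulo q bounds its degree, and then v q = 1 - u p bounds the degree of
  v.\<close>

lemma bezout_degree_bound:
  fixes p q :: "'k::alg_closed_field poly"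
  assumes "\<And>z. \<not> (poly p z = 0 \<and> poly q z = 0)" and "q \<noteq> 0" "degree p \<le> N" "degree q \<le> N"
  shows "\<exists>u v. degree u \<le> N \<and> degree v \<le> N \<and> u * p + v * q = 1"
proof -
  obtain u v where uv: "u * p + v * q = 1" using bezout_no_common_root[OF assms(1)] by blast
  define u' where "u' = u mod q"
  define v' where "v' = v + (u div q) * p"
  have "u' * p + v' * q = (u mod q + u div q * q) * p + v * q" 
    by (simp only: u'_def v'_def distrib_right distrib_left ac_simps)
  then have eq: "u' * p + v' * q = 1" using uv by (simp only: mod_div_mult_eq)
  have du: "degree u' \<le> degree q" using degree_mod_less[OF assms(2), of u] by (auto simp: u'_def)
  have "degree v' \<le> N"
  proof (cases "v' = 0")
    case False
    have "degree v' + degree q = degree (v' * q)" using False assms(2) by (simp add: degree_mult_eq)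
    also have "v' * q = 1 - u' * p" using eq by (simp add: eq_diff_eq add.commute)
    also have "degree (1 - u' * p) \<le> max (degree (1 :: 'k poly)) (degree (u' * p))" by (rule degree_diff_le_max)
    also have "\<dots> \<le> degree q + degree p" using degree_mult_le[of u' p] du by simp
    finally show ?thesis using assms(3) by simp
  qed simp
  then show ?thesis using eq du assms(4) by (intro exI[of _ u'] exI[of _ v'] conjI) simp_all
qed

text \<open>The zero polynomial is divisible by the irreducible X and by its image under
  \<sigma>.\<close>

lemma simple_condition_nonzero:
  assumes "simple_condition \<sigma> (a :: 'k::field poly)" shows "a \<noteq> 0"
proof
  assume "a = 0"
  moreover have "Factorial_Ring.irreducible ([:0, 1:] :: 'k poly)" by (rule irreducible_linear_field_poly) simp
  ultimately show False using assms unfolding simple_condition_def by (meson dvd_0_right order_refl)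
qed

lemma shift_aut_power: "(shift_aut ^^ n) q = pcompose q [:- of_nat n, 1:]"
proof (induction n)
  case (Suc n)
  have "pcompose (pcompose q [:- of_nat n, 1:]) [:- 1, 1:] = pcompose q [:- of_nat (Suc n), 1:]"
    unfolding pcompose_assoc[symmetric] by (rule arg_cong[of _ _ "pcompose q"]) (simp add: pcompose_pCons)
  then show ?case using Suc by (simp add: shift_aut_def)
qed simp

lemma scale_aut_power: "(scale_aut c ^^ n) q = pcompose q [:0, c ^ n:]"
proof (induction n)
  case (Suc n)
  have "pcompose (pcompose q [:0, c ^ n:]) [:0, c:] = pcompose q [:0, c ^ Suc n:]"
    unfolding pcompose_assoc[symmetric] by (rule arg_cong[of _ _ "pcompose q"]) (simp add: pcompose_pCons mult.commute)
  then show ?case using Suc by (simp add: scale_aut_def)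
qed simp

text \<open>If z is a root of a and of \<sigma>^d(a), then X - (s + t z) divides a, and so does its
  image under \<sigma>^d, a multiple of X - z. Linear factors thus turn the simplicity condition
  into coprimality of a and its translates.\<close>

lemma simple_no_common_root:
  fixes a :: "'k::field poly"
  assumes simple: "simple_condition \<sigma> a" and d: "0 < d" and pow: "\<And>q. (\<sigma> ^^ d) q = pcompose q [:s, t:]" and t: "t \<noteq> 0"
  shows "\<not> (poly a z = 0 \<and> poly ((\<sigma> ^^ d) a) z = 0)"
proof
  assume z: "poly a z = 0 \<and> poly ((\<sigma> ^^ d) a) z = 0"
  let ?q = "[:- (s + t * z), 1:]"
  have "poly a (s + t * z) = 0" using z by (simp add: pow poly_pcompose mult.commute)
  then have "?q dvd a" by (simp only: poly_eq_0_iff_dvd)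
  moreover have q: "(\<sigma> ^^ d) ?q = smult t [:- z, 1:]" by (simp add: pow pcompose_pCons algebra_simps)
  have "[:- z, 1:] dvd a" using z by (simp only: poly_eq_0_iff_dvd)
  then have "(\<sigma> ^^ d) ?q dvd a" unfolding q by (rule smult_dvd[OF _ t])
  moreover have "Factorial_Ring.irreducible ?q" by (rule irreducible_linear_field_poly) simp
  ultimately show False using simple d unfolding simple_condition_def
    by (metis One_nat_def Suc_leI)
qed

text \<open>A translate has degree at most that of a, so the bound does not depend on d; this
  uniformity keeps each lowering of an exponent at constant cost.\<close>

lemma simple_bezout:
  fixes a :: "'k::alg_closed_field poly"
  assumes simple: "simple_condition \<sigma> a" and d: "0 < d" and pow: "\<And>q. (\<sigma> ^^ d) q = pcompose q [:s, t:]" and t: "t \<noteq> 0"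
  shows "\<exists>p q. degree p \<le> degree a \<and> degree q \<le> degree a \<and> p * a + q * pcompose a [:s, t:] = 1"
proof (rule bezout_degree_bound)
  show "\<not> (poly a z = 0 \<and> poly (pcompose a [:s, t:]) z = 0)" for z
    using simple_no_common_root[OF simple d pow t, of z] unfolding pow .
  show "pcompose a [:s, t:] \<noteq> 0"
    using simple_condition_nonzero[OF simple] t pcompose_eq_0[of a "[:s, t:]"] by auto
  show "degree (pcompose a [:s, t:]) \<le> degree a" using degree_pcompose_le[of a "[:s, t:]"] t by simp
qed simp

section \<open>Polynomial functions on the integers and the classical type\<close>

lemma polynomial_multiples:
  fixes \<theta> :: "int \<Rightarrow> 'k::field" and W :: "nat \<Rightarrow> (int \<Rightarrow> 'k) set"
  assumes mono: "\<And>N N' f. N \<le> N' \<Longrightarrow> f \<in> W N \<Longrightarrow> f \<in> W N'"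
    and add: "\<And>N f f'. f \<in> W N \<Longrightarrow> f' \<in> W N \<Longrightarrow> (\<lambda>b. f b + f' b) \<in> W N"
    and scale: "\<And>N f c. f \<in> W N \<Longrightarrow> (\<lambda>b. c * f b) \<in> W N"
    and theta: "\<And>N f. f \<in> W N \<Longrightarrow> (\<lambda>b. \<theta> b * f b) \<in> W (Suc N)"
    and f: "f \<in> W N"
  shows "(\<lambda>b. poly q (\<theta> b) * f b) \<in> W (N + degree q)"
proof (induction q)
  case 0
  show ?case using scale[OF f, of 0] by simp
next
  case (pCons c q)
  show ?case
  proof (cases "q = 0")
    case True
    then show ?thesis using scale[OF f, of c] by simp
  next
    case False
    have "(\<lambda>b. \<theta> b * (poly q (\<theta> b) * f b)) \<in> W (N + degree (pCons c q))"
      using theta[OF pCons.IH] False by simp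
    moreover have "(\<lambda>b. c * f b) \<in> W (N + degree (pCons c q))" by (rule mono[OF _ scale[OF f]]) simp
    ultimately show ?thesis using add by (fastforce simp: algebra_simps)
  qed
qed

lemma poly_finite_support_eq_0:
  fixes p :: "'k::field poly"
  assumes "finite {b. poly p (\<theta> b) \<noteq> 0}" "inj (\<theta> :: int \<Rightarrow> 'k)" shows "p = 0"
proof (rule ccontr)
  assume "p \<noteq> 0"
  then have "finite (\<theta> -` {z. poly p z = 0})" using assms(2) poly_roots_finite by (intro finite_vimageI)
  then have "finite ({b. poly p (\<theta> b) \<noteq> 0} \<union> \<theta> -` {z. poly p z = 0})" using assms(1) by simp
  moreover have "{b. poly p (\<theta> b) \<noteq> 0} \<union> \<theta> -` {z. poly p z = 0} = UNIV" by auto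
  ultimately have "finite (UNIV :: int set)" by (simp only:)
  then show False using infinite_UNIV_int by contradiction
qed

definition poly_functions :: "nat \<Rightarrow> (int \<Rightarrow> 'k::field) set" where
  "poly_functions N = {\<lambda>b. poly p (of_int b) | p. degree p \<le> N}"

lemma poly_functionsI: "degree p \<le> N \<Longrightarrow> (\<And>b. f b = poly p (of_int b)) \<Longrightarrow> f \<in> poly_functions N"
  unfolding poly_functions_def by blast

lemma poly_functionsE: "f \<in> poly_functions N \<Longrightarrow> \<exists>p. degree p \<le> N \<and> (\<forall>b. f b = poly p (of_int b))"
  unfolding poly_functions_def by blast

lemma poly_functions_closed:
  "N \<le> N' \<Longrightarrow> f \<in> poly_functions N \<Longrightarrow> f \<in> poly_functions N'"
  "f \<in> poly_functions N \<Longrightarrow> f' \<in> poly_functions N \<Longrightarrow> (\<lambda>b. f b + f' b) \<in> poly_functions N"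
  "f \<in> poly_functions N \<Longrightarrow> (\<lambda>b. c * f b) \<in> poly_functions N"
  "f \<in> poly_functions N \<Longrightarrow> (\<lambda>b. of_int b * f b) \<in> poly_functions (Suc N)"
  "f \<in> poly_functions N \<Longrightarrow> (\<lambda>b. f (b + j)) \<in> poly_functions N"
  "(\<lambda>b. c) \<in> poly_functions N"
proof -
  assume f: "f \<in> poly_functions N"
  obtain p where p: "degree p \<le> N" "\<forall>b. f b = poly p (of_int b)" using poly_functionsE[OF f] by (elim exE conjE)
  show "f \<in> poly_functions N'" if "N \<le> N'" by (rule poly_functionsI[of p]) (use p that in auto)
  show "(\<lambda>b. c * f b) \<in> poly_functions N" by (rule poly_functionsI[of "smult c p"]) (use p in auto)
  show "(\<lambda>b. of_int b * f b) \<in> poly_functions (Suc N)"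
    by (rule poly_functionsI[of "pCons 0 p"]) (use p in auto)
  show "(\<lambda>b. f (b + j)) \<in> poly_functions N"
    by (rule poly_functionsI[of "pcompose p [:of_int j, 1:]"])
      (use p degree_pcompose_le[of p "[:of_int j, 1:]"] in \<open>auto simp: poly_pcompose add.commute\<close>)
  show "(\<lambda>b. f b + f' b) \<in> poly_functions N" if f': "f' \<in> poly_functions N"
  proof -
    obtain p' where p': "degree p' \<le> N" "\<forall>b. f' b = poly p' (of_int b)" using poly_functionsE[OF f'] by (elim exE conjE)
    show ?thesis by (rule poly_functionsI[of "p + p'"]) (use p p' in \<open>auto intro: degree_add_le\<close>)
  qed
next
  show "(\<lambda>b. c) \<in> poly_functions N" by (rule poly_functionsI[of "[:c:]"]) auto
qed

text \<open>With p = c + X q and g the function of q, f(b - 1) - f(b) = b (g(b - 1) - g(b)) - g(b -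
  1), so the degree drops by induction.\<close>

lemma poly_functions_difference:
  fixes f :: "int \<Rightarrow> 'k::field"
  shows "f \<in> poly_functions 0 \<Longrightarrow> (\<lambda>b. f (b - 1) - f b) = (\<lambda>_. 0)"
    "f \<in> poly_functions (Suc N) \<Longrightarrow> (\<lambda>b. f (b - 1) - f b) \<in> poly_functions N"
proof -
  have const: "(\<lambda>b. f (b - 1) - f b) = (\<lambda>_. 0)" if f: "f \<in> poly_functions 0" for f :: "int \<Rightarrow> 'k"
  proof -
    obtain p where p: "degree p \<le> 0" "\<forall>b. f b = poly p (of_int b)" using poly_functionsE[OF f] by (elim exE conjE)
    then obtain c where "p = [:c:]" using degree_eq_zeroE by blast
    then show ?thesis using p by simp
  qed
  then show "f \<in> poly_functions 0 \<Longrightarrow> (\<lambda>b. f (b - 1) - f b) = (\<lambda>_. 0)" .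
  show "(\<lambda>b. f (b - 1) - f b) \<in> poly_functions N" if "f \<in> poly_functions (Suc N)"
    using that
  proof (induction N arbitrary: f)
    case (0 f)
    obtain p where p: "degree p \<le> Suc 0" "\<forall>b. f b = poly p (of_int b)" using poly_functionsE[OF 0] by (elim exE conjE)
    obtain c q where q: "p = pCons c q" by (cases p) auto
    have "degree q = 0" using p(1) q by (auto split: if_splits)
    then obtain d where "q = [:d:]" using degree_eq_zeroE by blast
    then have "f (b - 1) - f b = - d" for b using p(2) q by (simp add: algebra_simps)
    then show ?case using poly_functions_closed(6)[of "- d" 0] by simp
  next
    case (Suc N f)
    obtain p where p: "degree p \<le> Suc (Suc N)" "\<forall>b. f b = poly p (of_int b)" using poly_functionsE[OF Suc.prems] by (elim exE conjE)
    obtain c q where q: "p = pCons c q" by (cases p) auto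
    define g where "g = (\<lambda>b. poly q (of_int b :: 'k))"
    have "degree q \<le> Suc N" using p(1) q by (auto split: if_splits)
    then have g: "g \<in> poly_functions (Suc N)" by (rule poly_functionsI) (simp add: g_def)
    have 1: "(\<lambda>b. of_int b * (g (b - 1) - g b)) \<in> poly_functions (Suc N)"
      by (rule poly_functions_closed(4)[OF Suc.IH[OF g]])
    have 2: "(\<lambda>b. (- 1) * g (b + (- 1))) \<in> poly_functions (Suc N)"
      by (rule poly_functions_closed(3)[OF poly_functions_closed(5)[OF g]])
    have "f (b - 1) - f b = of_int b * (g (b - 1) - g b) + (- 1) * g (b + (- 1))" for b
      using p(2) q by (simp add: g_def algebra_simps)
    then show ?case using poly_functions_closed(2)[OF 1 2] by simp
  qed
qed

text \<open>For l = 1 all factors are the same difference, and more than N of them kill degree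
  N.\<close>

lemma poly_functions_annihilated:
  assumes "f \<in> poly_functions N" "N < length xs"
  shows "fold (\<lambda>\<kappa> f b. f (b - 1) - f b) xs f = (\<lambda>_. 0 :: 'k::field)"
  using assms
proof (induction xs arbitrary: N f)
  case (Cons x xs)
  have zero: "fold (\<lambda>\<kappa> f b. f (b - 1) - f b) xs (\<lambda>_. 0) = (\<lambda>_. 0 :: 'k)"
    by (induction xs) simp_all
  show ?case
  proof (cases N)
    case 0
    then show ?thesis using poly_functions_difference(1)[of f] Cons.prems zero by simp
  next
    case (Suc N')
    then have "(\<lambda>b. f (b - 1) - f b) \<in> poly_functions N'" using poly_functions_difference(2) Cons.prems by blast
    from Cons.IH[OF this] show ?thesis using Cons.prems Suc by simp
  qed
qed simp

text \<open>The equation makes f periodic with period k, hence constant: in characteristic 0 its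
  polynomial takes the value f(0) infinitely often. Then f(0) = \<zeta> f(0).\<close>

lemma poly_functions_twist:
  fixes f :: "int \<Rightarrow> 'k::field_char_0"
  assumes f: "f \<in> poly_functions N" and z: "\<zeta> ^ k = 1" "0 < k" "\<zeta> \<noteq> 1" and tw: "\<And>b. f (b - 1) = \<zeta> * f b"
  shows "f = (\<lambda>_. 0)"
proof -
  obtain p where p: "\<forall>b. f b = poly p (of_int b)" using poly_functionsE[OF f] by (elim exE conjE)
  have pow: "f (b - int j) = \<zeta> ^ j * f b" for b j
  proof (induction j)
    case (Suc j)
    have "f (b - int (Suc j)) = f ((b - int j) - 1)" by (simp add: algebra_simps)
    then show ?case using Suc tw by (simp add: mult.assoc)
  qed simp
  have per: "f (- int (k * j)) = f 0" for j
    using pow[of 0 "k * j"] z(1) by (simp add: power_mult)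
  have "p - [:f 0:] = 0"
  proof (rule ccontr)
    assume "p - [:f 0:] \<noteq> 0"
    then have "finite {z. poly (p - [:f 0:]) z = 0}" by (rule poly_roots_finite)
    moreover have "range (\<lambda>j. of_int (- int (k * j))) \<subseteq> {z. poly (p - [:f 0:]) z = 0}"
      using per p by auto
    ultimately have "finite (range (\<lambda>j. of_int (- int (k * j)) :: 'k))" by (rule rev_finite_subset)
    moreover have "inj (\<lambda>j. of_int (- int (k * j)) :: 'k)"
    proof (rule injI)
      fix i j assume "of_int (- int (k * i)) = (of_int (- int (k * j)) :: 'k)"
      then have "k * i = k * j" by (simp only: of_int_eq_iff neg_equal_iff_equal of_nat_eq_iff)
      then show "i = j" using z(2) by simp
    qed
    ultimately show False using finite_imageD infinite_UNIV_nat by blast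
  qed
  then have p0: "p = [:f 0:]" by simp
  have "poly p z = f 0" for z by (subst p0) simp
  then have c: "f b = f 0" for b using p by simp
  then have "f 0 = \<zeta> * f 0" using tw[of 0] by metis
  then have "f 0 = 0" using z(3) by simp
  then show ?thesis using c by auto
qed

text \<open>\<theta>(b) = b, so that the shift of b by -1 is \<sigma>(h) = h - 1. The increment 1 +
  deg a covers multiplication by h as well as by a.\<close>

lemma classical_coefficients:
  fixes a :: "'k::{alg_closed_field, field_char_0} poly"
  assumes simple: "simple_condition shift_aut a"
  shows "coefficient_functions of_int (\<lambda>b. poly a (of_int b)) (1::'k) poly_functions (Suc (degree a))"
proof
  note a0 = simple_condition_nonzero[OF simple]
  show inj: "inj (of_int :: int \<Rightarrow> 'k)" by (simp add: inj_def)
  show "\<exists>p q. \<forall>b. (of_int (b + j) :: 'k) = p * of_int b + q" for j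
    by (intro exI[of _ 1] exI[of _ "of_int j"]) simp
  note closed = poly_functions_closed
  show "poly_functions N \<subseteq> (poly_functions N' :: (int \<Rightarrow> 'k) set)" if "N \<le> N'" for N N'
    using closed(1)[OF that] by blast
  show "(\<lambda>_. 0 :: 'k) \<in> poly_functions N" "(\<lambda>_. c :: 'k) \<in> poly_functions N" for N c by (rule closed(6))+
  fix f :: "int \<Rightarrow> 'k" and N assume f: "f \<in> poly_functions N"
  show "(\<lambda>b. f b + f' b) \<in> poly_functions N" if "f' \<in> poly_functions N" for f' by (rule closed(2)[OF f that])
  show "(\<lambda>b. c * f b) \<in> poly_functions N" for c by (rule closed(3)[OF f])
  show "(\<lambda>b. f (b + j)) \<in> poly_functions N" for j by (rule closed(5)[OF f])
  show "(\<lambda>b. of_int b * f b) \<in> poly_functions (N + Suc (degree a))"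
    by (rule closed(1)[OF _ closed(4)[OF f]]) simp
  have "(\<lambda>b. poly a (of_int b) * f b) \<in> poly_functions (N + degree a)"
    by (rule polynomial_multiples[OF closed(1) closed(2) closed(3) closed(4) f])
  then show "(\<lambda>b. poly a (of_int b) * f b) \<in> poly_functions (N + Suc (degree a))"
    by (rule closed(1)[rotated]) simp
  have "(\<lambda>b. 1 * f b) \<in> poly_functions (N + Suc (degree a))"
    by (rule closed(1)[OF _ closed(3)[OF f]]) simp
  then show "(\<lambda>b. 1 powi (- b) * f b) \<in> poly_functions (N + Suc (degree a))"
    "(\<lambda>b. 1 powi b * f b) \<in> poly_functions (N + Suc (degree a))" by simp_all
  show "f = (\<lambda>_. 0)" if "finite {b. f b \<noteq> 0}"
  proof -
    obtain p where p: "\<forall>b. f b = poly p (of_int b)" using poly_functionsE[OF f] by (elim exE conjE)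
    then have "p = 0" using that poly_finite_support_eq_0[OF _ inj, of p] by simp
    then show ?thesis using p by auto
  qed
  show "fold (\<lambda>\<kappa> f b. f (b - 1) - 1 powi \<kappa> * f b) [- int N..int N] f = (\<lambda>_. 0)"
    using poly_functions_annihilated[OF f, of "[- int N..int N]"] by simp
  show "f = (\<lambda>_. 0)" if "\<zeta> ^ k = 1" "0 < k" "\<zeta> \<noteq> 1" "\<And>b. f (b - 1) = \<zeta> * 1 powi \<kappa> * f b" for \<zeta> k \<kappa>
    by (rule poly_functions_twist[OF f that(1-3)]) (use that(4) in simp)
next
  have "finite ((of_int :: int \<Rightarrow> 'k) -` {z. poly a z = 0})"
    using poly_roots_finite[OF simple_condition_nonzero[OF simple]] by (intro finite_vimageI) (simp_all add: inj_def)
  then show "finite {b. poly a (of_int b :: 'k) = 0}" by (simp add: vimage_def)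
  show "\<exists>K. \<forall>d>0. \<exists>p q. degree p \<le> K \<and> degree q \<le> K \<and>
      (\<forall>b. poly p (of_int b) * poly a (of_int b) + poly q (of_int b) * poly a (of_int (b - int d)) = 1)"
  proof (intro exI[of _ "degree a"] allI impI)
    fix d :: nat assume d: "0 < d"
    from simple_bezout[OF simple d shift_aut_power] obtain p q where
      pq: "degree p \<le> degree a" "degree q \<le> degree a" "p * a + q * pcompose a [:- of_nat d, 1:] = 1" by auto
    have "poly p z * poly a z + poly q z * poly a (z - of_nat d) = 1" for z
      using arg_cong[OF pq(3), of "\<lambda>p. poly p z"] by (simp add: poly_pcompose)
    then show "\<exists>p q. degree p \<le> degree a \<and> degree q \<le> degree a \<and>
        (\<forall>b. poly p (of_int b) * poly a (of_int b) + poly q (of_int b) * poly a (of_int (b - int d)) = 1)"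
      using pq(1,2) by (intro exI[of _ p] exI[of _ q]) simp
  qed
qed simp

lemma polynomial_alg_simps:
  "carrier (polynomial_alg :: ('k::field, 'k poly) module) = UNIV"
  "p \<otimes>\<^bsub>polynomial_alg\<^esub> q = p * q" "p \<oplus>\<^bsub>polynomial_alg\<^esub> q = p + q"
  "\<one>\<^bsub>polynomial_alg\<^esub> = 1" "\<zero>\<^bsub>polynomial_alg\<^esub> = 0" "c \<odot>\<^bsub>polynomial_alg\<^esub> p = smult c p"
  by (simp_all add: polynomial_alg_def ring_of_type_algebra_def ring.defs module.defs)

lemma polynomial_k_alg: "k_alg (polynomial_alg :: ('k::field, 'k poly) module)"
proof (intro k_alg.intro k_alg_axioms.intro ringI abelian_groupI monoidI)
  fix p :: "'k poly"
  show "\<exists>q\<in>carrier polynomial_alg. q \<oplus>\<^bsub>polynomial_alg\<^esub> p = \<zero>\<^bsub>polynomial_alg\<^esub>"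
    by (intro bexI[of _ "- p"]) (simp_all add: polynomial_alg_simps)
qed (simp_all add: polynomial_alg_simps algebra_simps smult_add_left smult_add_right)

text \<open>Both units \<open>g\<close> and \<open>g'\<close> are 1 here, in accordance with l =
  1.\<close>

lemma classical_rank_one:
  fixes A :: "('k::{alg_closed_field, field_char_0}, 'b) module"
  assumes "simple_classical_gwa A h x y"
  shows "\<exists>g g' \<theta> a l W da m. rank_one A h g g' x y \<theta> a l W da m"
proof -
  from assms obtain a f where simple: "simple_condition shift_aut a" and A: "k_algebra A"
    and f: "f \<in> alg_iso (gwa polynomial_alg shift_aut a) A"
    and gens: "h = f (gwa_gen polynomial_alg shift_aut a (Coef [:0, 1:]))"
      "x = f (gwa_gen polynomial_alg shift_aut a GenX)" "y = f (gwa_gen polynomial_alg shift_aut a GenY)"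
    unfolding simple_classical_gwa_def is_gwa_def by blast
  interpret P: k_alg "polynomial_alg :: ('k, 'k poly) module" by (rule polynomial_k_alg)
  have shift: "poly (shift_aut q) z = poly q (z - 1)" for q and z :: 'k
    by (simp add: shift_aut_def poly_pcompose)
  have "gwa_coefficients polynomial_alg A of_int (\<lambda>b. poly a (of_int b)) 1 poly_functions (Suc (degree a))
      shift_aut (\<lambda>p b. poly p (of_int b)) a [:0, 1:] 1 1 f"
  proof (intro gwa_coefficients.intro gwa_coefficients_axioms.intro polynomial_k_alg classical_coefficients simple f)
    show "k_alg A" using A by (simp only: k_algebra_iff)
    show "bij_betw shift_aut (carrier polynomial_alg) (carrier (polynomial_alg :: ('k, 'k poly) module))"
      unfolding polynomial_alg_simps
    proof (rule bij_betw_byWitness[where f' = "\<lambda>q. pcompose q [:1, 1:]"])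
      show "\<forall>q\<in>UNIV. pcompose (shift_aut q) [:1, 1:] = (q :: 'k poly)"
        by (simp add: shift_aut_def pcompose_assoc[symmetric] pcompose_pCons)
      show "\<forall>q\<in>UNIV. shift_aut (pcompose q [:1, 1:]) = (q :: 'k poly)"
        by (simp add: shift_aut_def pcompose_assoc[symmetric] pcompose_pCons)
    qed simp_all
    show "generates_alg (polynomial_alg :: ('k, 'k poly) module) {[:0, 1:], 1, 1}"
      unfolding generates_alg_def
    proof (intro conjI allI impI)
      fix T assume T: "subring T (polynomial_alg :: ('k, 'k poly) module) \<and> k_subspace polynomial_alg T \<and> {[:0, 1:], 1, 1} \<subseteq> T"
      have "p \<in> T" for p :: "'k poly"
      proof (induction p)
        case 0
        then show ?case using T by (simp add: k_subspace_def polynomial_alg_simps)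
      next
        case (pCons c p)
        have "[:0, 1:] * p \<in> T" using T pCons subringE(6)[of T polynomial_alg "[:0, 1:]" p] by (simp add: polynomial_alg_simps)
        moreover have "\<forall>c. \<forall>q\<in>T. smult c q \<in> T" using T by (simp add: k_subspace_def polynomial_alg_simps)
        then have "smult c 1 \<in> T" using T by blast
        moreover have "\<forall>q\<in>T. \<forall>q'\<in>T. q + q' \<in> T" using T by (simp add: k_subspace_def polynomial_alg_simps)
        ultimately have "smult c 1 + [:0, 1:] * p \<in> T" by blast
        then show ?case by simp
      qed
      then show "T = carrier polynomial_alg" by (auto simp: polynomial_alg_simps)
    qed (simp add: polynomial_alg_simps)
    show "\<exists>E\<subseteq>carrier polynomial_alg. k_span polynomial_alg E = carrier (polynomial_alg :: ('k, 'k poly) module) \<and>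
        (\<forall>F c. finite F \<longrightarrow> F \<subseteq> E \<longrightarrow> finite {b. (\<Sum>e\<in>F. c e * poly e (of_int b)) \<noteq> 0} \<longrightarrow> (\<forall>e\<in>F. c e = 0))"
    proof (intro exI[of _ "range (monom 1)"] conjI allI impI)
      let ?S = "k_span polynomial_alg (range (monom (1::'k)))"
      have E: "range (monom 1) \<subseteq> carrier (polynomial_alg :: ('k, 'k poly) module)" by (simp add: polynomial_alg_simps)
      have "p \<in> ?S" for p
      proof (induction p)
        case 0
        then show ?case using P.k_span_zero[OF E] by (simp add: polynomial_alg_simps)
      next
        case (pCons c p)
        have "[:0, 1:] \<otimes>\<^bsub>polynomial_alg\<^esub> p \<in> ?S"
        proof (rule P.k_span_mult_l[OF pCons(2) E _ P.k_span_subspace[OF E]])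
          fix q :: "'k poly" assume "q \<in> range (monom 1)"
          then obtain n where "q = monom 1 n" by auto
          then have "[:0, 1:] \<otimes>\<^bsub>polynomial_alg\<^esub> q = monom 1 (Suc n)" by (simp add: polynomial_alg_simps monom_Suc)
          then show "[:0, 1:] \<otimes>\<^bsub>polynomial_alg\<^esub> q \<in> ?S" by (simp add: k_span_base)
        qed (simp add: polynomial_alg_simps)
        moreover have "c \<odot>\<^bsub>polynomial_alg\<^esub> monom 1 0 \<in> ?S" by (rule P.k_span_smult[OF E k_span_base[OF rangeI]])
        ultimately have "c \<odot>\<^bsub>polynomial_alg\<^esub> monom 1 0 \<oplus>\<^bsub>polynomial_alg\<^esub> [:0, 1:] \<otimes>\<^bsub>polynomial_alg\<^esub> p \<in> ?S"
          by (intro P.k_span_add[OF E])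
        then show ?case by (simp add: polynomial_alg_simps)
      qed
      then show "?S = carrier polynomial_alg" by (auto simp: polynomial_alg_simps)
    next
      fix F and c :: "'k poly \<Rightarrow> 'k"
      assume F: "finite F" "F \<subseteq> range (monom 1)" "finite {b. (\<Sum>e\<in>F. c e * poly e (of_int b)) \<noteq> 0}"
      have "(\<Sum>e\<in>F. smult (c e) e) = 0"
        by (rule poly_finite_support_eq_0[where \<theta> = of_int]) (use F(3) in \<open>simp_all add: poly_sum inj_def\<close>)
      show "\<forall>e\<in>F. c e = 0"
      proof
        fix e assume e: "e \<in> F"
        then obtain n where n: "e = monom 1 n" using F(2) by auto
        have "0 = coeff (\<Sum>e\<in>F. smult (c e) e) n" using \<open>(\<Sum>e\<in>F. smult (c e) e) = 0\<close> by simp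
        also have "\<dots> = (\<Sum>e'\<in>F. if e' = e then c e else 0)"
          unfolding coeff_sum
        proof (rule sum.cong[OF refl])
          fix e' assume "e' \<in> F"
          then obtain n' where "e' = monom 1 n'" using F(2) by auto
          then show "coeff (smult (c e') e') n = (if e' = e then c e else 0)"
            using n by (auto simp: monom_eq_iff')
        qed
        finally show "c e = 0" using e F(1) by simp
      qed
    qed (simp add: polynomial_alg_simps)
  qed (simp_all add: polynomial_alg_simps shift)
  from gwa_coefficients.rank_one[OF this]
  have "rank_one A h (f (gwa_gen polynomial_alg shift_aut a (Coef 1))) (f (gwa_gen polynomial_alg shift_aut a (Coef 1)))
      x y of_int (\<lambda>b. poly a (of_int b)) 1 poly_functions (Suc (degree a))
      (gwa_coefficients.m polynomial_alg (\<lambda>b. poly a (of_int b)) shift_aut (\<lambda>p b. poly p (of_int b)) a f)"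
    unfolding gens gwa_gen_def gwa_coefficients.F_def[OF \<open>gwa_coefficients _ _ _ _ _ _ _ _ _ _ _ _ _ _\<close>] .
  then show ?thesis by (intro exI)
qed

section \<open>Laurent polynomial functions and the quantum type\<close>

locale not_root_of_unity =
  fixes c :: "'k::field_char_0"
  assumes c_nonzero: "c \<noteq> 0" and not_root: "\<And>n. 1 \<le> n \<Longrightarrow> c ^ n \<noteq> 1"
begin

lemma powi_add: "c powi (i + j) = c powi i * c powi j"
  using c_nonzero by (simp add: power_int_add)

lemma powi_power: "(c powi i) ^ n = c powi (i * int n)"
  by (simp add: power_int_mult)

lemma powi_nonzero: "c powi i \<noteq> 0"
  using c_nonzero by simp

lemma powi_eq_one: assumes "c powi i = 1" shows "i = 0"
proof (rule ccontr)
  assume "i \<noteq> 0"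
  have "c ^ nat \<bar>i\<bar> = 1"
  proof (cases "0 \<le> i")
    case True
    then show ?thesis using assms by (simp add: power_int_def)
  next
    case False
    then have "inverse c ^ nat (- i) = 1" using assms by (simp add: power_int_def)
    then show ?thesis using False by (simp add: power_inverse)
  qed
  then show False using not_root[of "nat \<bar>i\<bar>"] \<open>i \<noteq> 0\<close> by simp
qed

lemma powi_inj: assumes "c powi i = c powi j" shows "i = j"
proof -
  have "c powi (i - j) * c powi j = c powi j" using assms powi_add[of "i - j" j] by simp
  then have "c powi (i - j) = 1" using c_nonzero by simp
  then show ?thesis using powi_eq_one by fastforce
qed

text \<open>A Laurent polynomial in c^b with exponents from -N to N, multiplied by c^(N b) to become
  an ordinary polynomial; its coefficient of index i belongs to the exponent i - N.\<close>

definition rep :: "nat \<Rightarrow> (int \<Rightarrow> 'k) \<Rightarrow> 'k poly \<Rightarrow> bool" where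
  "rep N f p \<longleftrightarrow> degree p \<le> 2 * N \<and> (\<forall>b. f b = c powi (- int N * b) * poly p (c powi b))"

definition laurent_functions :: "nat \<Rightarrow> (int \<Rightarrow> 'k) set" where
  "laurent_functions N = {f. \<exists>p. rep N f p}"

lemma laurent_functionsI: "rep N f p \<Longrightarrow> f \<in> laurent_functions N"
  unfolding laurent_functions_def by blast

lemma laurent_functions_closed:
  assumes "f \<in> laurent_functions N"
  shows "N \<le> N' \<Longrightarrow> f \<in> laurent_functions N'"
    "f' \<in> laurent_functions N \<Longrightarrow> (\<lambda>b. f b + f' b) \<in> laurent_functions N"
    "(\<lambda>b. d * f b) \<in> laurent_functions N"
    "(\<lambda>b. c powi (- b) * f b) \<in> laurent_functions (Suc N)"
    "(\<lambda>b. c powi b * f b) \<in> laurent_functions (Suc N)"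
    "(\<lambda>b. f (b + j)) \<in> laurent_functions N"
proof -
  obtain p where p: "degree p \<le> 2 * N" "\<forall>b. f b = c powi (- int N * b) * poly p (c powi b)"
    using assms unfolding laurent_functions_def rep_def by blast
  show "f \<in> laurent_functions N'" if N: "N \<le> N'"
  proof (rule laurent_functionsI[of _ _ "monom 1 (N' - N) * p"], unfold rep_def, intro conjI allI)
    show "degree (monom 1 (N' - N) * p) \<le> 2 * N'"
      using degree_mult_le[of "monom 1 (N' - N)" p] degree_monom_le[of "1 :: 'k" "N' - N"] p(1) N by linarith
    fix b
    have "c powi (- int N * b) = c powi (- int N' * b + b * int (N' - N))"
      using N by (intro arg_cong[of _ _ "\<lambda>i. c powi i"]) (simp add: of_nat_diff algebra_simps)
    then show "f b = c powi (- int N' * b) * poly (monom 1 (N' - N) * p) (c powi b)"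
      using p(2) by (simp only: powi_add poly_mult poly_monom powi_power mult_1_left mult.assoc)
  qed
  show "(\<lambda>b. f b + f' b) \<in> laurent_functions N" if f': "f' \<in> laurent_functions N"
  proof -
    obtain p' where p': "degree p' \<le> 2 * N" "\<forall>b. f' b = c powi (- int N * b) * poly p' (c powi b)"
      using f' unfolding laurent_functions_def rep_def by blast
    show ?thesis
      by (rule laurent_functionsI[of _ _ "p + p'"]) (use p p' in \<open>simp add: rep_def degree_add_le distrib_left\<close>)
  qed
  show "(\<lambda>b. d * f b) \<in> laurent_functions N"
    by (rule laurent_functionsI[of _ _ "smult d p"]) (use p in \<open>simp add: rep_def\<close>)
  show "(\<lambda>b. c powi (- b) * f b) \<in> laurent_functions (Suc N)"
  proof (rule laurent_functionsI[of _ _ p], unfold rep_def, intro conjI allI)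
    show "degree p \<le> 2 * Suc N" using p(1) by simp
    fix b
    have "c powi (- int (Suc N) * b) = c powi (- b + - int N * b)"
      by (intro arg_cong[of _ _ "\<lambda>i. c powi i"]) (simp add: algebra_simps)
    then show "c powi (- b) * f b = c powi (- int (Suc N) * b) * poly p (c powi b)"
      using p(2) by (simp only: powi_add mult.assoc)
  qed
  show "(\<lambda>b. c powi b * f b) \<in> laurent_functions (Suc N)"
  \<comment> \<open>Passing to N + 1 lowers the normalising exponent by one while the function gains
    one, hence the factor X^2.\<close>
  proof (rule laurent_functionsI[of _ _ "monom 1 2 * p"], unfold rep_def, intro conjI allI)
    show "degree (monom 1 2 * p) \<le> 2 * Suc N"
      using order_trans[OF degree_mult_le add_mono[OF degree_monom_le[of "1 :: 'k" 2] p(1)]] by simp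
    fix b
    have "c powi (b + - int N * b) = c powi (- int (Suc N) * b + b * int 2)"
      by (intro arg_cong[of _ _ "\<lambda>i. c powi i"]) (simp add: algebra_simps)
    then show "c powi b * f b = c powi (- int (Suc N) * b) * poly (monom 1 2 * p) (c powi b)"
      using p(2) by (simp only: powi_add poly_mult poly_monom powi_power mult_1_left mult.assoc)
        (simp only: mult.assoc[symmetric])
  qed
  show "(\<lambda>b. f (b + j)) \<in> laurent_functions N"
  proof (rule laurent_functionsI[of _ _ "smult (c powi (- int N * j)) (pcompose p [:0, c powi j:])"],
      unfold rep_def, intro conjI allI)
    show "degree (smult (c powi (- int N * j)) (pcompose p [:0, c powi j:])) \<le> 2 * N"
      using degree_smult_le[of "c powi (- int N * j)" "pcompose p [:0, c powi j:]"]
        degree_pcompose_le[of p "[:0, c powi j:]"] p(1) c_nonzero by simp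
    fix b
    have "c powi (- int N * (b + j)) = c powi (- int N * b) * c powi (- int N * j)"
      by (simp only: distrib_left powi_add)
    then show "f (b + j) = c powi (- int N * b) *
        poly (smult (c powi (- int N * j)) (pcompose p [:0, c powi j:])) (c powi b)"
      using p(2) by (simp add: poly_pcompose powi_add mult.assoc)
  qed
qed

lemma laurent_functions_const: "(\<lambda>_. d) \<in> laurent_functions N"
proof (rule laurent_functionsI[of _ _ "monom d N"], unfold rep_def, intro conjI allI)
  show "degree (monom d N) \<le> 2 * N" using degree_monom_le[of d N] by simp
  fix b
  have "c powi (- int N * b + b * int N) = 1" by (simp add: mult.commute)
  then have "c powi (- int N * b) * c powi (b * int N) = 1" by (simp only: powi_add)
  then show "d = c powi (- int N * b) * poly (monom d N) (c powi b)"
    by (simp add: poly_monom powi_power mult.left_commute[of d])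
qed

lemma rep_unique: assumes "rep N f p" "finite {b. f b \<noteq> 0}" shows "p = 0"
proof (rule poly_finite_support_eq_0)
  have "{b. poly p (c powi b) \<noteq> 0} = {b. f b \<noteq> 0}" using assms(1) powi_nonzero by (auto simp: rep_def)
  then show "finite {b. poly p (c powi b) \<noteq> 0}" using assms(2) by (simp only:)
  show "inj (\<lambda>b. c powi b)" using powi_inj by (rule injI)
qed

lemma rep_zero: "rep N f 0 \<Longrightarrow> f = (\<lambda>_. 0)"
  by (auto simp: rep_def)

text \<open>The function c^((i - N) b) is an eigenfunction of the shift with eigenvalue c^(N - i),
  so the difference acts diagonally on coefficients.\<close>

lemma rep_difference:
  assumes "rep N f p"
  shows "\<exists>p'. rep N (\<lambda>b. f (b - 1) - d * f b) p' \<and> (\<forall>i. coeff p' i = (c powi (int N - int i) - d) * coeff p i)"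
proof -
  have p: "degree p \<le> 2 * N" "\<forall>b. f b = c powi (- int N * b) * poly p (c powi b)" using assms by (auto simp: rep_def)
  let ?p = "smult (c powi int N) (pcompose p [:0, c powi (- 1):]) - smult d p"
  have co: "coeff ?p i = (c powi (int N - int i) - d) * coeff p i" for i
  proof -
    have "c powi (int N - int i) = c powi int N * c powi (- 1 * int i)" using powi_add[of "int N" "- int i"] by simp
    then show ?thesis by (simp add: coeff_pcompose_linear powi_power left_diff_distrib mult.assoc del: power_int_minus1_right)
  qed
  moreover have "rep N (\<lambda>b. f (b - 1) - d * f b) ?p"
    unfolding rep_def
  proof (intro conjI allI)
    show "degree ?p \<le> 2 * N"
    proof (rule degree_le, intro allI impI)
      fix i assume "2 * N < i"
      then have "coeff p i = 0" using p(1) by (intro coeff_eq_0) simp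
      then show "coeff ?p i = 0" unfolding co by simp
    qed
    fix b
    have 1: "c powi (- int N * (b - 1)) = c powi (- int N * b) * c powi int N"
      using powi_add[of "- int N * b" "int N"] by (simp add: algebra_simps)
    have 2: "c powi (b - 1) = c powi b * c powi (- 1)" using powi_add[of b "- 1"] by simp
    show "f (b - 1) - d * f b = c powi (- int N * b) * poly ?p (c powi b)"
      unfolding p(2)[rule_format] 1 2 by (simp add: poly_pcompose right_diff_distrib mult.assoc mult.left_commute[of d] del: power_int_minus1_right)
  qed
  ultimately show ?thesis by blast
qed

text \<open>The eigenvalues c^(N - i) for i from 0 to 2 N are exactly the c^\<kappa> with |\<kappa>|
  \<le> N, so each coefficient is killed by one factor.\<close>

lemma laurent_functions_annihilated:
  assumes f: "f \<in> laurent_functions N"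
  shows "fold (\<lambda>\<kappa> f b. f (b - 1) - c powi \<kappa> * f b) [- int N..int N] f = (\<lambda>_. 0)"
proof -
  have "\<exists>p'. rep N (fold (\<lambda>\<kappa> f b. f (b - 1) - c powi \<kappa> * f b) xs f) p' \<and>
      (\<forall>i. coeff p i = 0 \<or> int N - int i \<in> set xs \<longrightarrow> coeff p' i = 0)" if "rep N f p" for xs f p
    using that
  proof (induction xs arbitrary: f p)
    case Nil
    then show ?case by auto
  next
    case (Cons \<kappa> xs)
    from rep_difference[OF Cons.prems, of "c powi \<kappa>"] obtain p1 where p1: "rep N (\<lambda>b. f (b - 1) - c powi \<kappa> * f b) p1"
      "\<forall>i. coeff p1 i = (c powi (int N - int i) - c powi \<kappa>) * coeff p i" by (elim exE conjE)
    from Cons.IH[OF p1(1)] obtain p2 where p2: "rep N (fold (\<lambda>\<kappa> f b. f (b - 1) - c powi \<kappa> * f b) xs (\<lambda>b. f (b - 1) - c powi \<kappa> * f b)) p2"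
      "\<forall>i. coeff p1 i = 0 \<or> int N - int i \<in> set xs \<longrightarrow> coeff p2 i = 0" by (elim exE conjE)
    have "\<forall>i. coeff p i = 0 \<or> int N - int i \<in> set (\<kappa> # xs) \<longrightarrow> coeff p2 i = 0" using p1(2) p2(2) by auto
    then show ?case using p2(1) by (intro exI[of _ p2]) simp
  qed
  moreover obtain p where p: "rep N f p" using f unfolding laurent_functions_def by blast
  ultimately obtain p' where p': "rep N (fold (\<lambda>\<kappa> f b. f (b - 1) - c powi \<kappa> * f b) [- int N..int N] f) p'"
    "\<forall>i. coeff p i = 0 \<or> int N - int i \<in> set [- int N..int N] \<longrightarrow> coeff p' i = 0" by blast
  have "coeff p' i = 0" for i
  proof (cases "i \<le> 2 * N")
    case True
    then show ?thesis using p'(2) by auto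
  next
    case False
    then show ?thesis using p'(1) by (intro coeff_eq_0) (simp add: rep_def)
  qed
  then have "p' = 0" by (simp add: poly_eq_iff)
  then show ?thesis using rep_zero p'(1) by blast
qed

text \<open>A nonzero coefficient would give c^(N - i) = \<zeta> c^\<kappa>. Taking k-th powers
  forces N - i = \<kappa>, as c is not a root of unity, and then \<zeta> = 1.\<close>

lemma laurent_functions_twist:
  assumes f: "f \<in> laurent_functions N" and z: "\<zeta> ^ k = 1" "0 < k" "\<zeta> \<noteq> 1"
    and tw: "\<And>b. f (b - 1) = \<zeta> * c powi \<kappa> * f b"
  shows "f = (\<lambda>_. 0)"
proof -
  obtain p where p: "rep N f p" using f unfolding laurent_functions_def by blast
  from rep_difference[OF p, of "\<zeta> * c powi \<kappa>"] obtain p' where p': "rep N (\<lambda>b. f (b - 1) - \<zeta> * c powi \<kappa> * f b) p'"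
    "\<forall>i. coeff p' i = (c powi (int N - int i) - \<zeta> * c powi \<kappa>) * coeff p i" by (elim exE conjE)
  have "p' = 0" by (rule rep_unique[OF p'(1)]) (simp add: tw)
  have "coeff p i = 0" for i
  proof -
    have "c powi (int N - int i) \<noteq> \<zeta> * c powi \<kappa>"
    proof
      assume e: "c powi (int N - int i) = \<zeta> * c powi \<kappa>"
      then have "(c powi (int N - int i)) ^ k = (c powi \<kappa>) ^ k" using z(1) by (simp add: power_mult_distrib)
      then have "(int N - int i) * int k = \<kappa> * int k" unfolding powi_power by (rule powi_inj)
      then have "int N - int i = \<kappa>" using z(2) by simp
      then have "c powi \<kappa> = \<zeta> * c powi \<kappa>" using e by simp
      then show False using z(3) powi_nonzero[of \<kappa>] by simp
    qed
    moreover have "(c powi (int N - int i) - \<zeta> * c powi \<kappa>) * coeff p i = 0" using p'(2) \<open>p' = 0\<close> by (metis coeff_0)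
    ultimately show ?thesis by simp
  qed
  then have "p = 0" by (simp add: poly_eq_iff)
  then show ?thesis using rep_zero p by blast
qed

end

text \<open>\<theta>(b) = c^(-b), so that the shift of b by -1 multiplies h by c, as \<sigma> does;
  \<theta> is injective because c is not a root of unity.\<close>

lemma quantum_coefficients:
  fixes a :: "'k::{alg_closed_field, field_char_0} poly"
  assumes c: "not_root_of_unity c" and simple: "simple_condition (scale_aut c) a"
  shows "coefficient_functions (\<lambda>b. c powi (- b)) (\<lambda>b. poly a (c powi (- b))) c
    (not_root_of_unity.laurent_functions c) (Suc (degree a))"
proof -
  interpret not_root_of_unity c by (rule c)
  note closed = laurent_functions_closed
  have inj: "inj (\<lambda>b. c powi (- b))" using powi_inj by (intro injI) fastforce
  show ?thesis
  proof
    show "inj (\<lambda>b. c powi (- b))" by (rule inj)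
    show "c \<noteq> 0" by (rule c_nonzero)
    show "\<exists>p q. \<forall>b. c powi (- (b + j)) = p * c powi (- b) + q" for j
      using powi_add[of "- j"] by (intro exI[of _ "c powi (- j)"] exI[of _ 0]) simp
    show "laurent_functions N \<subseteq> laurent_functions N'" if "N \<le> N'" for N N'
      using closed(1)[OF _ that] by blast
    show "(\<lambda>_. 0) \<in> laurent_functions N" "(\<lambda>_. d) \<in> laurent_functions N" for N d by (rule laurent_functions_const)+
    fix f N assume f: "f \<in> laurent_functions N"
    show "(\<lambda>b. f b + f' b) \<in> laurent_functions N" if "f' \<in> laurent_functions N" for f' by (rule closed(2)[OF f that])
    show "(\<lambda>b. d * f b) \<in> laurent_functions N" for d by (rule closed(3)[OF f])
    show "(\<lambda>b. f (b + j)) \<in> laurent_functions N" for j by (rule closed(6)[OF f])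
    show "(\<lambda>b. c powi (- b) * f b) \<in> laurent_functions (N + Suc (degree a))"
      by (rule closed(1)[OF closed(4)[OF f]]) simp
    show "(\<lambda>b. c powi b * f b) \<in> laurent_functions (N + Suc (degree a))"
      by (rule closed(1)[OF closed(5)[OF f]]) simp
    have "(\<lambda>b. poly a (c powi (- b)) * f b) \<in> laurent_functions (N + degree a)"
      by (rule polynomial_multiples[OF closed(1)[rotated] closed(2) closed(3) closed(4) f])
    then show "(\<lambda>b. poly a (c powi (- b)) * f b) \<in> laurent_functions (N + Suc (degree a))"
      by (rule closed(1)) simp
    show "f = (\<lambda>_. 0)" if "finite {b. f b \<noteq> 0}"
    proof -
      obtain p where p: "rep N f p" using f unfolding laurent_functions_def by blast
      then show ?thesis using rep_unique[OF p that] rep_zero by blast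
    qed
    show "fold (\<lambda>\<kappa> f b. f (b - 1) - c powi \<kappa> * f b) [- int N..int N] f = (\<lambda>_. 0)"
      by (rule laurent_functions_annihilated[OF f])
    show "f = (\<lambda>_. 0)" if "\<zeta> ^ k = 1" "0 < k" "\<zeta> \<noteq> 1" "\<And>b. f (b - 1) = \<zeta> * c powi \<kappa> * f b" for \<zeta> k \<kappa>
      by (rule laurent_functions_twist[OF f that])
  next
    have "finite ((\<lambda>b. c powi (- b)) -` {z. poly a z = 0})"
      using poly_roots_finite[OF simple_condition_nonzero[OF simple]] inj by (intro finite_vimageI)
    then show "finite {b. poly a (c powi (- b)) = 0}" by (simp add: vimage_def)
    show "\<exists>K. \<forall>d>0. \<exists>p q. degree p \<le> K \<and> degree q \<le> K \<and>
        (\<forall>b. poly p (c powi (- b)) * poly a (c powi (- b)) + poly q (c powi (- b)) * poly a (c powi (- (b - int d))) = 1)"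
    proof (intro exI[of _ "degree a"] allI impI)
      fix d :: nat assume d: "0 < d"
      from simple_bezout[OF simple d scale_aut_power] c_nonzero obtain p q where
        pq: "degree p \<le> degree a" "degree q \<le> degree a" "p * a + q * pcompose a [:0, c ^ d:] = 1" by auto
      have "poly p z * poly a z + poly q z * poly a (c ^ d * z) = 1" for z
        using arg_cong[OF pq(3), of "\<lambda>p. poly p z"] by (simp add: poly_pcompose mult.commute)
      moreover have "c powi (- (b - int d)) = c ^ d * c powi (- b)" for b using powi_add[of "int d" "- b"] by simp
      ultimately show "\<exists>p q. degree p \<le> degree a \<and> degree q \<le> degree a \<and>
          (\<forall>b. poly p (c powi (- b)) * poly a (c powi (- b)) + poly q (c powi (- b)) * poly a (c powi (- (b - int d))) = 1)"
        using pq(1,2) by (intro exI[of _ p] exI[of _ q]) (simp only: simp_thms)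
    qed
  qed
qed

lemma lin_ext_sum: "finite I \<Longrightarrow> lin_ext \<mu> (\<Sum>i\<in>I. f i) = (\<Sum>i\<in>I. lin_ext \<mu> (f i))"
  by (induction I rule: finite_induct) simp_all

lemma lin_ext_mult:
  assumes "\<And>s t. \<mu> (s \<otimes>\<^bsub>M\<^esub> t) = \<mu> s * \<mu> t"
  shows "lin_ext \<mu> (f \<otimes>\<^bsub>monoid_alg M\<^esub> g) = lin_ext \<mu> f * lin_ext \<mu> g"
proof -
  have "Poly_Mapping.keys f \<subseteq> UNIV" "Poly_Mapping.keys g \<subseteq> UNIV" by simp_all
  from this(1) show ?thesis
  proof (induction f rule: poly_mapping_single_induct)
    case (single s c)
    from \<open>Poly_Mapping.keys g \<subseteq> UNIV\<close> show ?case
      by (induction g rule: poly_mapping_single_induct) (simp_all add: assms monoid_alg_distrib distrib_left)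
  qed (simp_all add: monoid_alg_distrib distrib_right)
qed

lemma lookup_scale_aut_laurent: "Poly_Mapping.lookup (scale_aut_laurent c f) n = c powi n * Poly_Mapping.lookup f n"
  by (simp add: scale_aut_laurent_def lookup_mapp when_def in_keys_iff)

lemma laurent_alg_simps:
  "carrier (laurent_alg :: ('k::field, int \<Rightarrow>\<^sub>0 'k) module) = UNIV"
  "f \<oplus>\<^bsub>laurent_alg\<^esub> g = f + g" "\<one>\<^bsub>laurent_alg\<^esub> = basis 0" "\<zero>\<^bsub>laurent_alg\<^esub> = 0"
  "c \<odot>\<^bsub>laurent_alg\<^esub> f = Poly_Mapping.map (\<lambda>x. c * x) f"
  "basis n \<otimes>\<^bsub>laurent_alg\<^esub> basis n' = basis (n + n')"
  by (simp_all add: laurent_alg_def monoid_alg_simps)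

lemma laurent_k_alg: "k_alg (laurent_alg :: ('k::field, int \<Rightarrow>\<^sub>0 'k) module)"
  unfolding laurent_alg_def by (rule monoid.monoid_alg_k_alg[OF group.is_monoid[OF group_integer_group]])

lemma laurent_scale_basis: "c \<odot>\<^bsub>laurent_alg\<^esub> basis n = Poly_Mapping.single n (c::'k::field)"
  by (rule poly_mapping_eqI) (simp add: laurent_alg_simps basis_def lookup_single when_def)

lemma laurent_subspace_UNIV:
  assumes T: "k_subspace laurent_alg T" and b: "\<And>n. basis n \<in> T" shows "f \<in> T"
proof -
  have "Poly_Mapping.keys f \<subseteq> UNIV" by simp
  then show ?thesis
  proof (induction f rule: poly_mapping_single_induct)
    case (single n c)
    then show ?case using T b unfolding laurent_scale_basis[symmetric] by (simp add: k_subspace_def)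
  qed (use T in \<open>simp_all add: k_subspace_def laurent_alg_simps\<close>)
qed

lemma laurent_generated: "generates_alg (laurent_alg :: ('k::field, int \<Rightarrow>\<^sub>0 'k) module) {basis 1, basis 1, basis (- 1)}"
  unfolding generates_alg_def
proof (intro conjI allI impI)
  fix T assume T: "subring T (laurent_alg :: ('k, int \<Rightarrow>\<^sub>0 'k) module) \<and> k_subspace laurent_alg T \<and>
    {basis 1, basis 1, basis (- 1)} \<subseteq> T"
  then have step: "basis n \<in> T \<Longrightarrow> basis (n + 1) \<in> T" "basis n \<in> T \<Longrightarrow> basis (n - 1) \<in> T" for n
    using subringE(6)[of T laurent_alg "basis n" "basis 1"] subringE(6)[of T laurent_alg "basis n" "basis (- 1)"]
    by (simp_all add: laurent_alg_simps)
  have "basis n \<in> T" for n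
  proof (induction n rule: int_induct[where k = 0])
    case base
    show ?case using subringE(3)[of T laurent_alg] T by (simp add: laurent_alg_simps)
  qed (use step in blast)+
  then have "f \<in> T" for f using laurent_subspace_UNIV T by blast
  then show "T = carrier laurent_alg" by (auto simp: laurent_alg_simps)
qed (simp add: laurent_alg_simps)

context not_root_of_unity begin

definition ev :: "(int \<Rightarrow>\<^sub>0 'k) \<Rightarrow> int \<Rightarrow> 'k" where "ev f b = lin_ext (\<lambda>n. c powi (- b * n)) f"

lemma ev_basis: "ev (basis n) b = c powi (- b * n)"
  by (simp add: ev_def basis_def)

lemma ev_mult: "ev (f \<otimes>\<^bsub>laurent_alg\<^esub> g) b = ev f b * ev g b"
  unfolding ev_def laurent_alg_def
proof (rule lin_ext_mult)
  fix s t
  show "c powi (- b * (s \<otimes>\<^bsub>integer_group\<^esub> t)) = c powi (- b * s) * c powi (- b * t)"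
    by (simp only: mult_integer_group distrib_left powi_add)
qed

lemma ev_scale: "ev (scale_aut_laurent c f) b = ev f (b - 1)"
proof -
  have "Poly_Mapping.keys (scale_aut_laurent c f) \<subseteq> Poly_Mapping.keys f"
    by (auto simp: in_keys_iff lookup_scale_aut_laurent)
  then have "ev (scale_aut_laurent c f) b =
      (\<Sum>n\<in>Poly_Mapping.keys f. c powi n * Poly_Mapping.lookup f n * c powi (- b * n))"
    by (simp add: ev_def lin_ext_superset[of "Poly_Mapping.keys f"] lookup_scale_aut_laurent)
  also have "\<dots> = ev f (b - 1)"
    unfolding ev_def lin_ext_def
  proof (rule sum.cong[OF refl])
    fix n
    have "c powi (- (b - 1) * n) = c powi n * c powi (- b * n)"
      unfolding powi_add[symmetric] by (rule arg_cong[of _ _ "\<lambda>i. c powi i"]) (simp add: algebra_simps)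
    then show "c powi n * Poly_Mapping.lookup f n * c powi (- b * n) = Poly_Mapping.lookup f n * c powi (- (b - 1) * n)"
      by simp
  qed
  finally show ?thesis .
qed

lemma ev_poly: "ev (poly_to_laurent a) b = poly a (c powi (- b))"
  unfolding poly_to_laurent_def ev_def poly_altdef
  by (simp add: lin_ext_sum powi_power)

lemma scale_bij: "bij_betw (scale_aut_laurent c) (carrier laurent_alg) (carrier laurent_alg)"
  unfolding laurent_alg_simps
proof (rule bij_betw_byWitness[where f' = "scale_aut_laurent (inverse c)"])
  have "inverse c powi n * c powi n = 1" for n
    using c_nonzero by (simp add: power_int_inverse[symmetric] power_int_mult_distrib[symmetric])
  then have "inverse c powi n * (c powi n * z) = z" "c powi n * (inverse c powi n * z) = z" for n z
    by (metis mult.assoc mult.commute mult_1_left)+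
  then show "\<forall>f\<in>UNIV. scale_aut_laurent (inverse c) (scale_aut_laurent c f) = f"
    "\<forall>f\<in>UNIV. scale_aut_laurent c (scale_aut_laurent (inverse c) f) = f"
    by (auto intro!: poly_mapping_eqI simp: lookup_scale_aut_laurent)
qed simp_all

text \<open>After division by c^(b M) with M large, a combination of Laurent monomials is a
  polynomial in c^(-b), which can have finite support only if it is zero.\<close>

lemma laurent_basis: "\<exists>E\<subseteq>carrier laurent_alg. k_span laurent_alg E = carrier (laurent_alg :: ('k, int \<Rightarrow>\<^sub>0 'k) module) \<and>
    (\<forall>F d. finite F \<longrightarrow> F \<subseteq> E \<longrightarrow> finite {b. (\<Sum>e\<in>F. d e * ev e b) \<noteq> 0} \<longrightarrow> (\<forall>e\<in>F. d e = 0))"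
proof (intro exI[of _ "range basis"] conjI allI impI)
  interpret L: k_alg "laurent_alg :: ('k, int \<Rightarrow>\<^sub>0 'k) module" by (rule laurent_k_alg)
  have E: "range basis \<subseteq> carrier (laurent_alg :: ('k, int \<Rightarrow>\<^sub>0 'k) module)" by (simp add: laurent_alg_simps)
  have "f \<in> k_span laurent_alg (range basis)" for f :: "int \<Rightarrow>\<^sub>0 'k"
    by (rule laurent_subspace_UNIV[OF L.k_span_subspace[OF E] k_span_base[OF rangeI]])
  then show "k_span laurent_alg (range basis) = carrier (laurent_alg :: ('k, int \<Rightarrow>\<^sub>0 'k) module)"
    by (auto simp: laurent_alg_simps)
next
  fix F and d :: "(int \<Rightarrow>\<^sub>0 'k) \<Rightarrow> 'k"
  assume F: "finite F" "F \<subseteq> range basis" "finite {b. (\<Sum>e\<in>F. d e * ev e b) \<noteq> 0}"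
  have inj: "inj (basis :: int \<Rightarrow> (int \<Rightarrow>\<^sub>0 'k))"
  proof (rule injI)
    fix i j assume "basis i = (basis j :: int \<Rightarrow>\<^sub>0 'k)"
    then have "Poly_Mapping.keys (basis i :: int \<Rightarrow>\<^sub>0 'k) = Poly_Mapping.keys (basis j :: int \<Rightarrow>\<^sub>0 'k)" by simp
    then show "i = j" by (simp add: basis_def)
  qed
  define J where "J = (basis :: int \<Rightarrow> (int \<Rightarrow>\<^sub>0 'k)) -` F"
  have J: "finite J" "F = basis ` J" unfolding J_def using F inj by (auto intro: finite_vimageI)
  \<comment> \<open>Makes all exponents j + M nonnegative, so that distinct ones stay distinct under
    \<open>nat\<close>.\<close>
  define M where "M = (\<Sum>j\<in>J. nat \<bar>j\<bar>)"
  have M: "0 \<le> j + int M" if "j \<in> J" for j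
  proof -
    have "nat \<bar>j\<bar> \<le> M" unfolding M_def using J(1) that by (intro member_le_sum) auto
    then show ?thesis by linarith
  qed
  define p where "p = (\<Sum>j\<in>J. monom (d (basis j)) (nat (j + int M)))"
  have sum: "(\<Sum>e\<in>F. d e * ev e b) = c powi (b * int M) * poly p (c powi (- b))" for b
  proof -
    have "(\<Sum>e\<in>F. d e * ev e b) = (\<Sum>j\<in>J. d (basis j) * c powi (- b * j))"
      unfolding J(2) by (subst sum.reindex) (use inj in \<open>auto simp: ev_basis inj_on_def dest: injD\<close>)
    also have "\<dots> = (\<Sum>j\<in>J. c powi (b * int M) * (d (basis j) * (c powi (- b)) ^ nat (j + int M)))"
    proof (rule sum.cong[OF refl])
      fix j assume j: "j \<in> J"
      have "c powi (- b * j) = c powi (b * int M) * c powi (- b * int (nat (j + int M)))"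
        unfolding powi_add[symmetric] using M[OF j]
        by (intro arg_cong[of _ _ "\<lambda>i. c powi i"]) (simp add: algebra_simps)
      then show "d (basis j) * c powi (- b * j) = c powi (b * int M) * (d (basis j) * (c powi (- b)) ^ nat (j + int M))"
        by (simp only: powi_power mult.left_commute)
    qed
    finally show ?thesis by (simp add: p_def poly_sum poly_monom sum_distrib_left)
  qed
  have "p = 0"
  proof (rule poly_finite_support_eq_0)
    show "finite {b. poly p (c powi (- b)) \<noteq> 0}" using F(3) powi_nonzero unfolding sum by simp
    show "inj (\<lambda>b. c powi (- b))" using powi_inj by (intro injI) fastforce
  qed
  show "\<forall>e\<in>F. d e = 0"
  proof
    fix e assume "e \<in> F"
    then obtain j where j: "j \<in> J" "e = basis j" using J(2) by blast
    have "0 = coeff p (nat (j + int M))" using \<open>p = 0\<close> by simp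
    also have "\<dots> = (\<Sum>i\<in>J. if i = j then d e else 0)"
      unfolding p_def coeff_sum
    proof (rule sum.cong[OF refl])
      fix i assume i: "i \<in> J"
      have "nat (i + int M) = nat (j + int M) \<longleftrightarrow> i = j" using M[OF i] M[OF j(1)] by auto
      then show "coeff (monom (d (basis i)) (nat (i + int M))) (nat (j + int M)) = (if i = j then d e else 0)"
        using j(2) by auto
    qed
    finally show "d e = 0" using J(1) j(1) by simp
  qed
qed (simp add: laurent_alg_simps)

end

text \<open>Here l = c and the units are h and its inverse, so h also serves as
  \<open>g\<close>.\<close>

lemma quantum_rank_one:
  fixes A :: "('k::{alg_closed_field, field_char_0}, 'b) module"
  assumes "simple_quantum_gwa A h x y"
  shows "\<exists>g g' \<theta> a l W da m. rank_one A h g g' x y \<theta> a l W da m"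
proof -
  from assms obtain c a f where c0: "c \<notin> {0, 1}" "\<forall>n\<ge>1. c ^ n \<noteq> 1" and simple: "simple_condition (scale_aut c) a"
    and A: "k_algebra A" and f: "f \<in> alg_iso (gwa laurent_alg (scale_aut_laurent c) (poly_to_laurent a)) A"
    and gens: "h = f (gwa_gen laurent_alg (scale_aut_laurent c) (poly_to_laurent a) (Coef (basis 1)))"
      "x = f (gwa_gen laurent_alg (scale_aut_laurent c) (poly_to_laurent a) GenX)"
      "y = f (gwa_gen laurent_alg (scale_aut_laurent c) (poly_to_laurent a) GenY)"
    unfolding simple_quantum_gwa_def is_gwa_def by blast
  have c: "not_root_of_unity c" by (rule not_root_of_unity.intro) (use c0 in auto)
  interpret c: not_root_of_unity c by (rule c)
  have "gwa_coefficients laurent_alg A (\<lambda>b. c powi (- b)) (\<lambda>b. poly a (c powi (- b))) c c.laurent_functions (Suc (degree a))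
      (scale_aut_laurent c) c.ev (poly_to_laurent a) (basis 1) (basis 1) (basis (- 1)) f"
  proof (intro gwa_coefficients.intro gwa_coefficients_axioms.intro laurent_k_alg quantum_coefficients c simple f
      c.scale_bij c.laurent_basis laurent_generated)
    show "k_alg A" using A by (simp only: k_algebra_iff)
  qed (simp_all add: laurent_alg_simps c.ev_mult[unfolded laurent_alg_simps] c.ev_scale c.ev_poly c.ev_basis, simp_all add: c.ev_def)
  from gwa_coefficients.rank_one[OF this]
  have "rank_one A h (f (gwa_gen laurent_alg (scale_aut_laurent c) (poly_to_laurent a) (Coef (basis 1))))
      (f (gwa_gen laurent_alg (scale_aut_laurent c) (poly_to_laurent a) (Coef (basis (- 1))))) x y
      (\<lambda>b. c powi (- b)) (\<lambda>b. poly a (c powi (- b))) c c.laurent_functions (Suc (degree a))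
      (gwa_coefficients.m laurent_alg (\<lambda>b. poly a (c powi (- b))) (scale_aut_laurent c) c.ev (poly_to_laurent a) f)"
    unfolding gens gwa_gen_def gwa_coefficients.F_def[OF \<open>gwa_coefficients _ _ _ _ _ _ _ _ _ _ _ _ _ _\<close>] .
  then show ?thesis by (intro exI)
qed

theorem theorem1p2:
  fixes A :: "nat \<Rightarrow> ('k::{alg_closed_field, field_char_0}, 'b) module"
    and h x y :: "nat \<Rightarrow> 'b"
    and m p r :: nat
    and D :: "('k, ((nat \<Rightarrow> 'b) \<Rightarrow>\<^sub>0 'k) set) module"
    and \<rho> :: "(nat \<Rightarrow> 'k) \<times> (nat \<Rightarrow> nat)
                 \<Rightarrow> ((nat \<Rightarrow> 'b) \<Rightarrow>\<^sub>0 'k) set \<Rightarrow> ((nat \<Rightarrow> 'b) \<Rightarrow>\<^sub>0 'k) set"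
    and B :: "('k, ((nat \<Rightarrow> 'b) \<Rightarrow>\<^sub>0 'k) set) module"
  assumes "r \<ge> 1" and "m \<ge> 1" and "p dvd m"
    and pure_type:
      "(\<forall>i<r. simple_classical_gwa (A i) (h i) (x i) (y i)) \<or>
       (\<forall>i<r. simple_quantum_gwa (A i) (h i) (x i) (y i))"
    and D: "D = big_tensor {..<r} A"
    and action: "natural_action m p r D
                   (\<lambda>i. tensor_incl {..<r} A i (h i))
                   (\<lambda>i. tensor_incl {..<r} A i (x i))
                   (\<lambda>i. tensor_incl {..<r} A i (y i)) \<rho>"
    and B: "B = invariant_alg D (G_mpr m p r) \<rho>"
  shows "fin_gen_alg (enveloping_alg B) \<and>
         \<not> fin_dim_subspace (enveloping_alg B) (carrier (enveloping_alg B)) \<and>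
         fdim B = 1"
proof -
  \<comment> \<open>From here on the two types are no longer distinguished; rank one data are chosen
    for each index separately.\<close>
  have "\<forall>i. \<exists>g g' \<theta> a l W da \<mu>. i < r \<longrightarrow> rank_one (A i) (h i) g g' (x i) (y i) \<theta> a l W da \<mu>"
    using pure_type classical_rank_one quantum_rank_one by metis
  then obtain g g' \<theta> a l W da \<mu> where
    rank_one: "\<And>i. i < r \<Longrightarrow> rank_one (A i) (h i) (g i) (g' i) (x i) (y i) (\<theta> i) (a i) (l i) (W i) (da i) (\<mu> i)"
    by metis
  have "tensor_action r A h g g' x y \<theta> a l W da \<mu> m p \<rho>"
  proof (intro tensor_action.intro tensor_gwa.intro tensor_action_axioms.intro rank_one)
    show "0 < r" "0 < m" using assms(1,2) by simp_all
    show "natural_action m p r (big_tensor {..<r} A) (\<lambda>i. tensor_incl {..<r} A i (h i))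
        (\<lambda>i. tensor_incl {..<r} A i (x i)) (\<lambda>i. tensor_incl {..<r} A i (y i)) \<rho>"
      using action unfolding D .
  qed
  note simple = tensor_action.simple_action[OF this]
  show ?thesis
    unfolding B D
    by (intro conjI effectively_simple_action.Env_fin_gen[OF simple]
        effectively_simple_action.Env_infinite_dim[OF simple] effectively_simple_action.fdim_invariants_eq_one[OF simple])
qed

end
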